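(* Let $n\ge2$, $m\ge2$ be integers, let $x_0\in\mathbb R^n$, $r=|x-x_0|$, $\phi(r)=\log r+\log(\log r)^2$, and for a multi-index $\alpha$ let $\beta_\alpha=\frac{3m-2|\alpha|}{2}$. (I) If $n>4m-2$ and $2\le p\le\frac{2n}{n-4m+2}$, there exist a constant $C$ and a sufficiently small $R_0$ such that for any $u\in C_0^\infty(\mathbb B_{R_0}(x_0)\setminus\{x_0\})$ and any $\tau>1$, $$\tau^{\beta_0}\|e^{-\tau\phi(r)}(\log r)^{-m}u\|_{L^p(r^{-n}dx)}+\sum_{|\alpha|=1}^{2m-1}\tau^{\beta_\alpha}\|e^{-\tau\phi(r)}(\log r)^{-m}r^{|\alpha|}D^\alpha u\|_{L^2(r^{-n}dx)}\le C\|e^{-\tau\phi(r)}r^{2m}\triangle^m u\|_{L^2(r^{-n}dx)},$$ where in this case $\beta_0=\frac{3mp-n(p-2)}{2p}$. (II) If $n=4m-2$, $2\le p<\infty$, and $0<\varepsilon<1$ is sufficiently small, there exist a constant $C$ and a sufficiently small $R_0$ such that for any $u\in C_0^\infty(\mathbb B_{R_0}(x_0)\setminus\{x_0\})$ and any $\tau>1$, $$\tau^{\tilde\beta_0}\|e^{-\tau\phi(r)}(\log r)^{-m}u\|_{L^p}+\sum_{|\alpha|=0}^{2m-1}\tau^{\beta_\alpha}\|e^{-\tau\phi(r)}(\log r)^{-m}r^{|\alpha|}D^\alpha u\|_{L^2(r^{-n}dx)}\le C\|e^{-\tau\phi(r)}r^{2m}\triangle^m u\|_{L^2(r^{-n}dx)},$$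 where $\tilde\beta_0=\frac{4m-2}{p}(1-\varepsilon)-\frac{m-2}{2}$. (III) If $2\le n<4m-2$ and $2\le p\le\infty$, there exist a constant $C$ and a sufficiently small $R_0$ such that for any $u\in C_0^\infty(\mathbb B_{R_0}(x_0)\setminus\{x_0\})$ and any $\tau>1$, $$\tau^{\bar\beta_0}\|e^{-\tau\phi(r)}(\log r)^{-m}u\|_{L^p}+\sum_{|\alpha|=0}^{2m-1}\tau^{\beta_\alpha}\|e^{-\tau\phi(r)}(\log r)^{-m}r^{|\alpha|}D^\alpha u\|_{L^2(r^{-n}dx)}\le C\|e^{-\tau\phi(r)}r^{2m}\triangle^m u\|_{L^2(r^{-n}dx)},$$ where $\bar\beta_0=\frac{4m-2}{p}-\frac{m-2}{2}$.
   Context: $\mathbb B_r(x_0)$ is the ball in $\mathbb R^n$ of radius $r$ centered at $x_0$. $\|u\|_{L^p(r^{-n}dx)}=\left(\int|u|^p r^{-n}\,dx\right)^{1/p}$ denotes the $L^p$ norm with weight $r^{-n}$, while $\|\cdot\|_{L^p}$ is the ordinary unweighted $L^p$ norm. $\sum_{|\alpha|=a}^{b}$ is the sum over all multi-indices $\alpha$ with $a\le|\alpha|\le b$. In (I), $\beta_0$ denotes only the exponent given there, not $\beta_\alpha$ at $\alpha=0$; in (II) and (III) the $|\alpha|=0$ term of the sum has exponent $\frac{3m}{2}$. *)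

theory Defs
  imports "HOL-Probability.Essential_Supremum"
begin

section \<open>Partial derivatives, smooth functions and test functions\<close>

definition partial_deriv :: "'n \<Rightarrow> (real ^ 'n \<Rightarrow> 'b) \<Rightarrow> real ^ 'n \<Rightarrow> 'b::real_normed_vector"
  where "partial_deriv i f x = vector_derivative (\<lambda>t. f (x + t *\<^sub>R axis i 1)) (at 0)"

fun C_k :: "nat \<Rightarrow> (real ^ 'n \<Rightarrow> 'b::real_normed_vector) \<Rightarrow> bool" where
  "C_k 0 f \<longleftrightarrow> continuous_on UNIV f"
| "C_k (Suc k) f \<longleftrightarrow> (\<forall>x. f differentiable at x) \<and> (\<forall>i. C_k k (partial_deriv i f))"

definition test_functions :: "(real ^ 'n) set \<Rightarrow> (real ^ 'n \<Rightarrow> 'b::real_normed_vector) set"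
  where "test_functions S =
    {f. (\<forall>k. C_k k f) \<and> compact (closure (support_on UNIV f)) \<and> closure (support_on UNIV f) \<subseteq> S}"

text \<open>Multi-indices are functions \<open>'n \<Rightarrow> nat\<close>.\<close>

definition multi_deg :: "('n::finite \<Rightarrow> nat) \<Rightarrow> nat"
  where "multi_deg \<alpha> = (\<Sum>i\<in>UNIV. \<alpha> i)"

text \<open>The index type carries no order, so an arbitrary enumeration of the coordinates is chosen.
  By symmetry of mixed partial derivatives the choice is immaterial for smooth functions.\<close>

definition coordinates :: "'n::finite list"
  where "coordinates = (SOME is. distinct is \<and> set is = UNIV)"

lemma coordinates: "distinct (coordinates :: 'n::finite list)"
    "set (coordinates :: 'n::finite list) = UNIV"
proof -
  have "\<exists>is :: 'n list. distinct is \<and> set is = UNIV"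
    using finite_distinct_list[OF finite_class.finite_UNIV] by blast
  from someI_ex[OF this] show "distinct (coordinates :: 'n list)"
    "set (coordinates :: 'n list) = UNIV"
    unfolding coordinates_def by auto
qed

definition multi_deriv ::
    "('n::finite \<Rightarrow> nat) \<Rightarrow> (real ^ 'n \<Rightarrow> 'b) \<Rightarrow> real ^ 'n \<Rightarrow> 'b::real_normed_vector"
  where "multi_deriv \<alpha> f = fold (\<lambda>i. partial_deriv i ^^ \<alpha> i) coordinates f"

definition laplacian :: "(real ^ 'n \<Rightarrow> 'b) \<Rightarrow> real ^ 'n::finite \<Rightarrow> 'b::real_normed_vector"
  where "laplacian f x = (\<Sum>i\<in>UNIV. partial_deriv i (partial_deriv i f) x)"

text \<open>Sums over multi-indices of bounded degree range over finite sets.\<close>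

lemma finite_multi_deg_le: "finite {\<alpha> :: 'n::finite \<Rightarrow> nat. a \<le> multi_deg \<alpha> \<and> multi_deg \<alpha> \<le> b}"
proof (rule finite_subset)
  show "{\<alpha> :: 'n \<Rightarrow> nat. a \<le> multi_deg \<alpha> \<and> multi_deg \<alpha> \<le> b} \<subseteq> UNIV \<rightarrow>\<^sub>E {..b}"
  proof (clarsimp simp: PiE_def Pi_def)
    fix \<alpha> :: "'n \<Rightarrow> nat" and i assume "multi_deg \<alpha> \<le> b"
    moreover have "\<alpha> i \<le> multi_deg \<alpha>"
      unfolding multi_deg_def by (rule member_le_sum) auto
    ultimately show "\<alpha> i \<le> b" by simp
  qed
  show "finite (UNIV \<rightarrow>\<^sub>E {..b} :: ('n \<Rightarrow> nat) set)"
    by (intro finite_PiE) auto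
qed

section \<open>Lebesgue norms\<close>

text \<open>The norm takes values in \<open>[0, \<infinity>]\<close>; it is meant for exponents \<open>p \<ge> 1\<close>, including
  \<open>p = \<infinity>\<close>.\<close>

definition Lp_norm :: "'a measure \<Rightarrow> ennreal \<Rightarrow> ('a \<Rightarrow> 'b::real_normed_vector) \<Rightarrow> ennreal"
  where "Lp_norm M p f =
    (if p = \<infinity> then esssup M (\<lambda>x. ennreal (norm (f x)))
     else let I = \<integral>\<^sup>+ x. ennreal (norm (f x) powr enn2real p) \<partial>M
          in if I = \<infinity> then \<infinity> else ennreal (enn2real I powr (1 / enn2real p)))"

text \<open>The measure \<open>r\<^sup>-\<^sup>n dx\<close> on \<open>real ^ 'n\<close>, where \<open>r\<close> is the distance to \<open>x\<^sub>0\<close>.\<close>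

definition radial_lborel :: "real ^ 'n \<Rightarrow> (real ^ 'n) measure"
  where "radial_lborel x0 = density lborel (\<lambda>x. ennreal (dist x x0 powi (- int CARD('n))))"

section \<open>The Carleman weight\<close>

text \<open>For \<open>0 < r < 1\<close> the number \<open>ln r\<close> is negative, so that the square in
  \<open>log r + log (log r)\<^sup>2\<close> is inside the outer logarithm.\<close>

definition carleman_phi :: "real \<Rightarrow> real"
  where "carleman_phi r = ln r + ln ((ln r)\<^sup>2)"

definition beta :: "nat \<Rightarrow> nat \<Rightarrow> real"
  where "beta m k = (3 * real m - 2 * real k) / 2"

end

theory Submission
  imports Defs
begin

section \<open>Carleman estimates for the polyharmonic operator\<close>

text \<open>
  Up to a conjugation with powers of \<open>r\<close>, the operator \<open>r\<^bsup>2m\<^esup> \<Delta>\<^sup>m\<close> is a product of \<open>m\<close> commuting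
  operators of the form \<open>r\<^sup>2\<Delta> - 2c rad + c\<^sup>2 - c(n - 2)\<close>. Conjugating one factor with the weight \<open>e\<^bsup>-\<tau>\<phi>\<^esup>\<close> and
  splitting it into a symmetric and an antisymmetric part with respect to \<open>r\<^sup>-\<^sup>n dx\<close>, the positive commutator
  gives an \<open>L\<^sup>2\<close> bound with the gain \<open>\<tau>\<^bsup>3/2\<^esup>\<close> and the loss \<open>(log r)\<^sup>-\<^sup>1\<close>; iterating over the factors
  gives \<open>\<tau>\<^bsup>3m/2\<^esup>\<close> and \<open>(log r)\<^bsup>-m\<^esup>\<close>. Interior elliptic estimates at scale \<open>r\<close> add the derivatives of order
  at most \<open>2m\<close>, each costing a factor \<open>\<tau>\<close>. The \<open>L\<^sup>p\<close> bounds follow by applying the Sobolev inequality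
  \<open>2m - 1\<close> times (with a Morrey-type bound in the last step if \<open>n < 4m - 2\<close>) and interpolating with \<open>L\<^sup>2\<close>,
  where the power of \<open>\<tau>\<close> is optimised by the level at which the function is split.
\<close>

subsection \<open>Smooth functions\<close>

text \<open>For \<phi> = log r alone the conjugated factors have constant coefficients in log r and
  the commutator vanishes; the summand log (log r)^2 makes the coefficient of the antisymmetric part
  vary at rate about 2 \<tau> (log r)^-2. The commutator is this rate times the square of a
  coefficient comparable to \<tau>, and its square root is the stated gain and loss. The obstacle is
  that the coefficient, roughly \<tau> - c + (n - 2)/2 for the factor with shift c, can be small for
  bounded \<tau>, while the claim is for all \<tau> > 1. The shifts are 2 apart, so at most one
  factor is resonant, and it is estimated jointly with a neighbour. The measure r^-n dx is invariant
  under dilations about x0. Derivatives therefore carry matching powers of r, local estimates are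
  uniform in the scale, and differentiating a weight costs 1/r times a constant multiple of \<tau>.
  One radius exp(-100 m) serves every p and \<epsilon>.\<close>

lemma partial_deriv_eq:
  assumes "(f has_derivative f') (at x)"
  shows "partial_deriv i f x = f' (axis i 1)"
proof -
  have "(f has_derivative f') (at (x + 0 *\<^sub>R axis i 1))" using assms by simp
  moreover have "((\<lambda>t. x + t *\<^sub>R axis i 1) has_derivative (\<lambda>t. t *\<^sub>R axis i 1)) (at 0)"
    by (auto intro!: derivative_eq_intros)
  ultimately have "((f \<circ> (\<lambda>t. x + t *\<^sub>R axis i 1)) has_derivative (f' \<circ> (\<lambda>t. t *\<^sub>R axis i 1))) (at 0)"
    by (intro diff_chain_at) auto
  moreover have "bounded_linear f'" using assms has_derivative_bounded_linear by blast
  ultimately have "((\<lambda>t. f (x + t *\<^sub>R axis i 1)) has_vector_derivative f' (axis i 1)) (at 0)"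
    unfolding has_vector_derivative_def o_def by (simp add: linear_simps)
  thus ?thesis unfolding partial_deriv_def by (rule vector_derivative_at)
qed

lemma has_derivative_partial_deriv:
  fixes f :: "real ^ 'n \<Rightarrow> 'b::real_normed_vector"
  assumes "f differentiable (at x)"
  shows "(f has_derivative (\<lambda>v. \<Sum>i\<in>UNIV. (v $ i) *\<^sub>R partial_deriv i f x)) (at x)"
proof -
  from assms obtain f' where f': "(f has_derivative f') (at x)" unfolding differentiable_def by blast
  have "bounded_linear f'" using f' has_derivative_bounded_linear by blast
  then interpret bounded_linear f' .
  have "f' v = (\<Sum>i\<in>UNIV. (v $ i) *\<^sub>R partial_deriv i f x)" for v
  proof -
    have "f' v = f' (\<Sum>i\<in>UNIV. (v $ i) *\<^sub>R axis i 1)" by (simp add: basis_expansion scalar_mult_eq_scaleR[symmetric])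
    also have "\<dots> = (\<Sum>i\<in>UNIV. (v $ i) *\<^sub>R f' (axis i 1))" by (simp add: sum scale)
    finally show ?thesis by (simp add: partial_deriv_eq[OF f'])
  qed
  hence "f' = (\<lambda>v. \<Sum>i\<in>UNIV. (v $ i) *\<^sub>R partial_deriv i f x)" by blast
  with f' show ?thesis by simp
qed

lemma partial_deriv_cong:
  assumes "open A" "x \<in> A" "\<And>y. y \<in> A \<Longrightarrow> f y = g y"
  shows "partial_deriv i f x = partial_deriv i g x"
proof -
  have "\<forall>\<^sub>F t in nhds 0. x + t *\<^sub>R axis i 1 \<in> A"
  proof -
    have "((\<lambda>t. x + t *\<^sub>R axis i 1) \<longlongrightarrow> x + 0 *\<^sub>R axis i 1) (nhds (0::real))"
      by (intro tendsto_intros filterlim_ident)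
    thus ?thesis using topological_tendstoD[OF _ assms(1)] assms(2) by simp
  qed
  hence "\<forall>\<^sub>F t in nhds 0. t \<in> UNIV \<longrightarrow> f (x + t *\<^sub>R axis i 1) = g (x + t *\<^sub>R axis i 1)"
    by (rule eventually_mono) (auto simp: assms(3))
  thus ?thesis unfolding partial_deriv_def by (intro vector_derivative_cong_eq) auto
qed

lemma differentiable_at_cong:
  assumes "open A" "x \<in> A" "\<And>y. y \<in> A \<Longrightarrow> f y = g y" "f differentiable (at x)"
  shows "g differentiable (at x)"
  using assms has_derivative_transform_within_open[of f _ x UNIV A g]
  unfolding differentiable_def by blast

lemma partial_deriv_const [simp]: "partial_deriv i (\<lambda>x. c) = (\<lambda>x. 0)"
  by (simp add: fun_eq_iff partial_deriv_def)

lemma partial_deriv_add: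
  assumes "f differentiable (at x)" "g differentiable (at x)"
  shows "partial_deriv i (\<lambda>x. f x + g x) x = partial_deriv i f x + partial_deriv i g x"
proof -
  from assms obtain f' g' where *: "(f has_derivative f') (at x)" "(g has_derivative g') (at x)"
    unfolding differentiable_def by blast
  show ?thesis using partial_deriv_eq[OF has_derivative_add[OF *]]
      partial_deriv_eq[OF *(1)] partial_deriv_eq[OF *(2)] by simp
qed

lemma partial_deriv_mult:
  fixes f g :: "real ^ 'n \<Rightarrow> real"
  assumes "f differentiable (at x)" "g differentiable (at x)"
  shows "partial_deriv i (\<lambda>x. f x * g x) x = f x * partial_deriv i g x + partial_deriv i f x * g x"
proof -
  from assms obtain f' g' where *: "(f has_derivative f') (at x)" "(g has_derivative g') (at x)"
    unfolding differentiable_def by blast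
  show ?thesis using partial_deriv_eq[OF has_derivative_mult[OF *]] 
      partial_deriv_eq[OF *(1)] partial_deriv_eq[OF *(2)] by simp
qed

lemma partial_deriv_cmult:
  fixes f :: "real ^ 'n \<Rightarrow> real"
  assumes "f differentiable (at x)"
  shows "partial_deriv i (\<lambda>x. c * f x) x = c * partial_deriv i f x"
  using partial_deriv_mult[OF _ assms, of "\<lambda>x. c"] by simp

lemma partial_deriv_minus:
  fixes f :: "real ^ 'n \<Rightarrow> real"
  assumes "f differentiable (at x)"
  shows "partial_deriv i (\<lambda>x. - f x) x = - partial_deriv i f x"
  using partial_deriv_cmult[OF assms, where c="-1"] by simp

lemma partial_deriv_diff:
  fixes f g :: "real ^ 'n \<Rightarrow> real"
  assumes "f differentiable (at x)" "g differentiable (at x)"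
  shows "partial_deriv i (\<lambda>x. f x - g x) x = partial_deriv i f x - partial_deriv i g x"
  using partial_deriv_add[of f x "\<lambda>x. - g x"] partial_deriv_minus[OF assms(2)] assms by simp

lemma partial_deriv_sum:
  assumes "\<And>k. k \<in> I \<Longrightarrow> f k differentiable (at x)"
  shows "partial_deriv i (\<lambda>x. \<Sum>k\<in>I. f k x) x = (\<Sum>k\<in>I. partial_deriv i (f k) x)"
  using assms
proof (induction I rule: infinite_finite_induct)
  case (insert k I)
  have "(\<lambda>x. \<Sum>k\<in>I. f k x) differentiable (at x)"
    using insert by (intro differentiable_sum) auto
  thus ?case using insert partial_deriv_add[of "f k" x "\<lambda>x. \<Sum>k\<in>I. f k x"] by simp
qed auto

lemma has_derivative_coordinate:
  "((\<lambda>x::real^'n. x $ k - c) has_derivative (\<lambda>v. v $ k)) (at x)"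
  by (rule has_derivative_eq_rhs, rule has_derivative_diff[OF bounded_linear_imp_has_derivative[OF bounded_linear_vec_nth] has_derivative_const]) simp

lemma differentiable_coordinate: "(\<lambda>x::real^'n. x $ k - c) differentiable (at x)"
  using has_derivative_coordinate unfolding differentiable_def by blast

lemma partial_deriv_coordinate:
  "partial_deriv i (\<lambda>x. x $ k - c) = (\<lambda>x::real^'n. if i = k then 1 else 0)"
proof
  fix x :: "real^'n"
  from partial_deriv_eq[OF has_derivative_coordinate, of i k c x] show "partial_deriv i (\<lambda>x. x $ k - c) x = (if i = k then 1 else 0)"
    by (auto simp: axis_def)
qed

text \<open>The weights are smooth only away from x0, so \<open>C_k\<close> has to be relativised to
  a set. Differentiability is taken at points of A within the whole space, and it is required
  already at level 0; level k thus follows from \<open>C_k (Suc k)\<close>.\<close>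

primrec diff_k :: "nat \<Rightarrow> (real ^ 'n) set \<Rightarrow> (real ^ 'n \<Rightarrow> 'b::real_normed_vector) \<Rightarrow> bool" where
  "diff_k 0 A f \<longleftrightarrow> (\<forall>x\<in>A. f differentiable (at x))"
| "diff_k (Suc k) A f \<longleftrightarrow> (\<forall>x\<in>A. f differentiable (at x)) \<and> (\<forall>i. diff_k k A (partial_deriv i f))"

definition smooth_on :: "(real ^ 'n) set \<Rightarrow> (real ^ 'n \<Rightarrow> 'b::real_normed_vector) \<Rightarrow> bool"
  where "smooth_on A f \<longleftrightarrow> (\<forall>k. diff_k k A f)"

lemma diff_k_0: "diff_k k A f \<Longrightarrow> x \<in> A \<Longrightarrow> f differentiable (at x)"
  by (cases k) auto

lemma diff_k_Suc_imp: "diff_k (Suc k) A f \<Longrightarrow> diff_k k A f"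
  by (induction k arbitrary: f) auto

lemma diff_k_cong:
  assumes "open A" "\<And>y. y \<in> A \<Longrightarrow> f y = g y" "diff_k k A f"
  shows "diff_k k A g"
  using assms(2,3)
proof (induction k arbitrary: f g)
  case 0 thus ?case using differentiable_at_cong[OF assms(1)] by (metis diff_k.simps(1))
next
  case (Suc k)
  have "partial_deriv i f y = partial_deriv i g y" if "y \<in> A" for i y
    by (rule partial_deriv_cong[OF assms(1) that Suc.prems(1)])
  hence "diff_k k A (partial_deriv i g)" for i
    using Suc.IH[of "partial_deriv i f"] Suc.prems(2) by simp
  thus ?case using Suc.prems differentiable_at_cong[OF assms(1)] by (metis diff_k.simps(2))
qed

lemma diff_k_Un: "diff_k k A f \<Longrightarrow> diff_k k B f \<Longrightarrow> diff_k k (A \<union> B) f"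
  by (induction k arbitrary: f) auto

lemma diff_k_subset: "diff_k k A f \<Longrightarrow> B \<subseteq> A \<Longrightarrow> diff_k k B f"
  by (induction k arbitrary: f) auto

lemma diff_k_const: "diff_k k A (\<lambda>x. c)"
  by (induction k arbitrary: c) auto

lemma diff_k_add:
  assumes "open A"
  shows "diff_k k A f \<Longrightarrow> diff_k k A g \<Longrightarrow> diff_k k A (\<lambda>x. f x + g x)"
proof (induction k arbitrary: f g)
  case 0 thus ?case by auto
next
  case (Suc k)
  have "diff_k k A (partial_deriv i (\<lambda>x. f x + g x))" for i
    by (rule diff_k_cong[OF assms _ Suc.IH[of "partial_deriv i f" "partial_deriv i g"]])
      (use Suc.prems in \<open>auto simp: partial_deriv_add\<close>)
  thus ?case using Suc.prems by auto
qed

lemma diff_k_mult: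
  fixes f g :: "real ^ 'n \<Rightarrow> real"
  assumes "open A"
  shows "diff_k k A f \<Longrightarrow> diff_k k A g \<Longrightarrow> diff_k k A (\<lambda>x. f x * g x)"
proof (induction k arbitrary: f g)
  case 0 thus ?case by auto
next
  case (Suc k)
  have "diff_k k A (\<lambda>x. f x * partial_deriv i g x + partial_deriv i f x * g x)" for i
    using Suc.prems diff_k_Suc_imp by (intro diff_k_add[OF assms] Suc.IH) auto
  hence "diff_k k A (partial_deriv i (\<lambda>x. f x * g x))" for i
    by (rule diff_k_cong[OF assms, rotated]) (use Suc.prems in \<open>auto simp: partial_deriv_mult\<close>)
  thus ?case using Suc.prems by auto
qed

lemma smooth_on_differentiable: "smooth_on A f \<Longrightarrow> x \<in> A \<Longrightarrow> f differentiable (at x)"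
  unfolding smooth_on_def using diff_k_0 by blast

lemma smooth_on_partial_deriv [intro]: "smooth_on A f \<Longrightarrow> smooth_on A (partial_deriv i f)"
  unfolding smooth_on_def by (metis diff_k.simps(2))

lemma smooth_on_cong:
  "open A \<Longrightarrow> (\<And>y. y \<in> A \<Longrightarrow> f y = g y) \<Longrightarrow> smooth_on A f \<Longrightarrow> smooth_on A g"
  unfolding smooth_on_def using diff_k_cong by blast

lemma smooth_on_Un: "smooth_on A f \<Longrightarrow> smooth_on B f \<Longrightarrow> smooth_on (A \<union> B) f"
  unfolding smooth_on_def using diff_k_Un by blast

lemma smooth_on_subset: "smooth_on A f \<Longrightarrow> B \<subseteq> A \<Longrightarrow> smooth_on B f"
  unfolding smooth_on_def using diff_k_subset by blast

lemma smooth_on_const [intro]: "smooth_on A (\<lambda>x. c)"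
  unfolding smooth_on_def using diff_k_const by blast

lemma smooth_on_add [intro]:
  "open A \<Longrightarrow> smooth_on A f \<Longrightarrow> smooth_on A g \<Longrightarrow> smooth_on A (\<lambda>x. f x + g x)"
  unfolding smooth_on_def using diff_k_add by blast

lemma smooth_on_mult [intro]:
  fixes f g :: "real ^ 'n \<Rightarrow> real"
  shows "open A \<Longrightarrow> smooth_on A f \<Longrightarrow> smooth_on A g \<Longrightarrow> smooth_on A (\<lambda>x. f x * g x)"
  unfolding smooth_on_def using diff_k_mult by blast

lemma smooth_on_minus [intro]:
  fixes f :: "real ^ 'n \<Rightarrow> real"
  shows "open A \<Longrightarrow> smooth_on A f \<Longrightarrow> smooth_on A (\<lambda>x. - f x)"
  using smooth_on_mult[OF _ smooth_on_const, of A f "-1"] by simp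

lemma smooth_on_diff [intro]:
  fixes f g :: "real ^ 'n \<Rightarrow> real"
  shows "open A \<Longrightarrow> smooth_on A f \<Longrightarrow> smooth_on A g \<Longrightarrow> smooth_on A (\<lambda>x. f x - g x)"
  using smooth_on_add[OF _ _ smooth_on_minus, of A f g] by simp

lemma smooth_on_sum [intro]:
  fixes f :: "'k \<Rightarrow> real ^ 'n \<Rightarrow> 'b::real_normed_vector"
  assumes "open A"
  shows "(\<And>k. k \<in> I \<Longrightarrow> smooth_on A (f k)) \<Longrightarrow> smooth_on A (\<lambda>x. \<Sum>k\<in>I. f k x)"
  by (induction I rule: infinite_finite_induct) (auto intro: smooth_on_const smooth_on_add[OF assms])

lemma smooth_on_power [intro]:
  fixes f :: "real ^ 'n \<Rightarrow> real"
  assumes "open A" "smooth_on A f"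
  shows "smooth_on A (\<lambda>x. f x ^ k)"
  by (induction k) (auto intro: assms smooth_on_mult)

lemma smooth_on_coordinate [intro]: "smooth_on A (\<lambda>x::real^'n. x $ k - c)"
proof -
  have "diff_k j A (\<lambda>x::real^'n. x $ k - c)" for j
    by (cases j) (auto simp: partial_deriv_coordinate diff_k_const differentiable_coordinate)
  thus ?thesis unfolding smooth_on_def by blast
qed

lemma smooth_on_continuous:
  assumes "smooth_on A f"
  shows "continuous_on A f"
proof -
  have "isCont f x" if "x \<in> A" for x
    using smooth_on_differentiable[OF assms that] differentiable_imp_continuous_within by blast
  thus ?thesis by (simp add: continuous_at_imp_continuous_on)
qed

lemma test_functions_smooth:
  assumes "f \<in> test_functions S"
  shows "smooth_on UNIV f"
proof -
  have "C_k (Suc k) f \<Longrightarrow> diff_k k UNIV f" for k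
    by (induction k arbitrary: f) auto
  thus ?thesis using assms unfolding test_functions_def smooth_on_def by blast
qed

text \<open>Needed with L the real or the imaginary part, to reduce complex-valued test functions to
  pairs of real ones.\<close>

lemma smooth_on_bounded_linear:
  fixes f :: "real ^ 'n \<Rightarrow> 'b::real_normed_vector" and L :: "'b \<Rightarrow> 'c::real_normed_vector"
  assumes "bounded_linear L" "open A" "smooth_on A f"
  shows "smooth_on A (\<lambda>x. L (f x))" "x \<in> A \<Longrightarrow> partial_deriv i (\<lambda>x. L (f x)) x = L (partial_deriv i f x)"
proof -
  interpret bounded_linear L by fact
  have d: "(\<lambda>x. L (f x)) differentiable (at x)" if "f differentiable (at x)" for f :: "real^'n \<Rightarrow> 'b" and x
    using that differentiable_chain_at[of f x L] bounded_linear_imp_differentiable[OF assms(1)] by (simp add: o_def)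
  have p: "partial_deriv i (\<lambda>x. L (f x)) x = L (partial_deriv i f x)" if "f differentiable (at x)" for f :: "real^'n \<Rightarrow> 'b" and x i
  proof -
    from that obtain f' where f': "(f has_derivative f') (at x)" unfolding differentiable_def by blast
    have "((\<lambda>x. L (f x)) has_derivative (\<lambda>x. L (f' x))) (at x)"
      by (rule has_derivative[OF f'])
    thus ?thesis using partial_deriv_eq f' by metis
  qed
  have "diff_k k A (\<lambda>x. L (f x))" if "diff_k k A f" for k f using that
  proof (induction k arbitrary: f)
    case 0 thus ?case using d by auto
  next
    case (Suc k)
    have "diff_k k A (partial_deriv i (\<lambda>x. L (f x)))" for i
      by (rule diff_k_cong[OF assms(2) _ Suc.IH[of "partial_deriv i f"]]) (use Suc.prems p in auto)
    thus ?case using Suc.prems d by auto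
  qed
  thus "smooth_on A (\<lambda>x. L (f x))" using assms(3) unfolding smooth_on_def by blast
  show "x \<in> A \<Longrightarrow> partial_deriv i (\<lambda>x. L (f x)) x = L (partial_deriv i f x)"
    using p assms(3) smooth_on_differentiable by blast
qed

section \<open>Symmetry of mixed derivatives and integrals of derivatives\<close>

lemma smooth_line_deriv:
  fixes f :: "real ^ 'n \<Rightarrow> real"
  assumes "f differentiable (at (x + t *\<^sub>R v))"
  shows "((\<lambda>t. f (x + t *\<^sub>R v)) has_real_derivative (\<Sum>i\<in>UNIV. v $ i * partial_deriv i f (x + t *\<^sub>R v))) (at t)"
proof -
  have "((\<lambda>t. x + t *\<^sub>R v) has_derivative (\<lambda>t. t *\<^sub>R v)) (at t)"
    by (auto intro!: derivative_eq_intros)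
  from diff_chain_at[OF this has_derivative_partial_deriv[OF assms]]
  show ?thesis unfolding has_field_derivative_def o_def
    by (rule has_derivative_eq_rhs) (auto simp: fun_eq_iff sum_distrib_right sum_distrib_left mult_ac)
qed

text \<open>The second difference of f over a square of side h is symmetric in the two directions,
  and by two mean value theorems it equals h^2 times a mixed derivative at an intermediate point, in
  either order. With h = 1/(n + 1) both intermediate points tend to x, and the mixed derivatives are
  continuous.\<close>

lemma partial_deriv_commute:
  fixes f :: "real ^ 'n \<Rightarrow> real"
  assumes "smooth_on UNIV f"
  shows "partial_deriv i (partial_deriv j f) x = partial_deriv j (partial_deriv i f) x"
proof -
  have df: "g differentiable (at y)" if "smooth_on UNIV g" for g :: "real^'n\<Rightarrow>real" and y
    using smooth_on_differentiable that by blast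
  have ax: "((\<lambda>t. g (y + t *\<^sub>R axis k 1)) has_real_derivative partial_deriv k g (y + t *\<^sub>R axis k 1)) (at t)"
    if "smooth_on UNIV g" for g and y :: "real^'n" and k and t :: real
  proof -
    have "(\<Sum>i\<in>UNIV. axis k (1::real) $ i * partial_deriv i g (y + t *\<^sub>R axis k 1)) = partial_deriv k g (y + t *\<^sub>R axis k 1)"
      by (simp add: axis_def if_distrib[of "\<lambda>x. x * _"] cong: if_cong)
    thus ?thesis using smooth_line_deriv[of g y t "axis k 1"] df[OF that] by simp
  qed
  have key: "\<exists>s t. 0 < s \<and> s < h \<and> 0 < t \<and> t < h \<and>
     f (x + h *\<^sub>R axis i 1 + h *\<^sub>R axis j 1) - f (x + h *\<^sub>R axis i 1) - f (x + h *\<^sub>R axis j 1) + f x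
     = h * h * partial_deriv j (partial_deriv i f) (x + s *\<^sub>R axis i 1 + t *\<^sub>R axis j 1)"
    if h: "h > 0" for h i j
  proof -
    define g where "g = (\<lambda>s. f ((x + h *\<^sub>R axis j 1) + s *\<^sub>R axis i 1) - f (x + s *\<^sub>R axis i 1))"
    have "\<exists>s>0. s < h \<and> g h - g 0 = (h - 0) * (partial_deriv i f ((x + h *\<^sub>R axis j 1) + s *\<^sub>R axis i 1) - partial_deriv i f (x + s *\<^sub>R axis i 1))"
      unfolding g_def by (rule MVT2[OF h]) (intro DERIV_diff ax assms)
    then obtain s where s: "s > 0" "s < h" "g h - g 0 = h * (partial_deriv i f ((x + h *\<^sub>R axis j 1) + s *\<^sub>R axis i 1) - partial_deriv i f (x + s *\<^sub>R axis i 1))" by auto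
    define k where "k = (\<lambda>t. partial_deriv i f ((x + s *\<^sub>R axis i 1) + t *\<^sub>R axis j 1))"
    have "\<exists>t>0. t < h \<and> k h - k 0 = (h - 0) * partial_deriv j (partial_deriv i f) ((x + s *\<^sub>R axis i 1) + t *\<^sub>R axis j 1)"
      unfolding k_def by (rule MVT2[OF h]) (intro ax smooth_on_partial_deriv assms)
    then obtain t where t: "t > 0" "t < h" "k h - k 0 = h * partial_deriv j (partial_deriv i f) ((x + s *\<^sub>R axis i 1) + t *\<^sub>R axis j 1)" by auto
    have "g h - g 0 = h * (k h - k 0)" unfolding s(3) k_def by (simp add: add_ac)
    show ?thesis
    proof (intro exI conjI)
      show "f (x + h *\<^sub>R axis i 1 + h *\<^sub>R axis j 1) - f (x + h *\<^sub>R axis i 1) - f (x + h *\<^sub>R axis j 1) + f x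
        = h * h * partial_deriv j (partial_deriv i f) (x + s *\<^sub>R axis i 1 + t *\<^sub>R axis j 1)"
        using \<open>g h - g 0 = h * (k h - k 0)\<close> unfolding t(3) by (simp add: g_def add_ac)
    qed (use s t in auto)
  qed
  have lim: "(\<lambda>n. partial_deriv j (partial_deriv i f) (x + s n *\<^sub>R axis i 1 + t n *\<^sub>R axis j 1)) \<longlonglongrightarrow> partial_deriv j (partial_deriv i f) x"
    if "s \<longlonglongrightarrow> 0" "t \<longlonglongrightarrow> 0" for s t i j
  proof -
    have "isCont (partial_deriv j (partial_deriv i f)) x"
      using df[of "partial_deriv j (partial_deriv i f)" x] assms differentiable_imp_continuous_within by blast
    moreover have "(\<lambda>n. x + s n *\<^sub>R axis i 1 + t n *\<^sub>R axis j 1) \<longlonglongrightarrow> x + 0 *\<^sub>R axis i 1 + 0 *\<^sub>R axis j 1"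
      using that by (intro tendsto_intros)
    ultimately show ?thesis using isCont_tendsto_compose by fastforce
  qed
  have inv: "(\<lambda>n. 1 / real (Suc n)) \<longlonglongrightarrow> 0" by (rule LIMSEQ_Suc[OF lim_1_over_n])
  have z: "s \<longlonglongrightarrow> 0" if "\<forall>n. 0 < s n \<and> s n < 1 / real (Suc n)" for s
    by (rule real_tendsto_sandwich[OF _ _ tendsto_const inv]) (use that in \<open>auto intro!: always_eventually less_imp_le simp del: of_nat_Suc\<close>)
  have "\<forall>n. \<exists>s t. 0 < s \<and> s < 1 / real (Suc n) \<and> 0 < t \<and> t < 1 / real (Suc n) \<and>
     (let h = 1 / real (Suc n) in f (x + h *\<^sub>R axis i 1 + h *\<^sub>R axis j 1) - f (x + h *\<^sub>R axis i 1) - f (x + h *\<^sub>R axis j 1) + f x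
     = h * h * partial_deriv j (partial_deriv i f) (x + s *\<^sub>R axis i 1 + t *\<^sub>R axis j 1))"
    unfolding Let_def by (intro allI key) simp
  then obtain s t where st: "\<And>n. 0 < s n \<and> s n < 1 / real (Suc n) \<and> 0 < t n \<and> t n < 1 / real (Suc n) \<and>
     (let h = 1 / real (Suc n) in f (x + h *\<^sub>R axis i 1 + h *\<^sub>R axis j 1) - f (x + h *\<^sub>R axis i 1) - f (x + h *\<^sub>R axis j 1) + f x
     = h * h * partial_deriv j (partial_deriv i f) (x + s n *\<^sub>R axis i 1 + t n *\<^sub>R axis j 1))" by metis
  have "\<forall>n. \<exists>s t. 0 < s \<and> s < 1 / real (Suc n) \<and> 0 < t \<and> t < 1 / real (Suc n) \<and>
     (let h = 1 / real (Suc n) in f (x + h *\<^sub>R axis j 1 + h *\<^sub>R axis i 1) - f (x + h *\<^sub>R axis j 1) - f (x + h *\<^sub>R axis i 1) + f x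
     = h * h * partial_deriv i (partial_deriv j f) (x + s *\<^sub>R axis j 1 + t *\<^sub>R axis i 1))"
    unfolding Let_def by (intro allI key) simp
  then obtain s' t' where st': "\<And>n. 0 < s' n \<and> s' n < 1 / real (Suc n) \<and> 0 < t' n \<and> t' n < 1 / real (Suc n) \<and>
     (let h = 1 / real (Suc n) in f (x + h *\<^sub>R axis j 1 + h *\<^sub>R axis i 1) - f (x + h *\<^sub>R axis j 1) - f (x + h *\<^sub>R axis i 1) + f x
     = h * h * partial_deriv i (partial_deriv j f) (x + s' n *\<^sub>R axis j 1 + t' n *\<^sub>R axis i 1))" by metis
  have eq: "partial_deriv j (partial_deriv i f) (x + s n *\<^sub>R axis i 1 + t n *\<^sub>R axis j 1)
      = partial_deriv i (partial_deriv j f) (x + s' n *\<^sub>R axis j 1 + t' n *\<^sub>R axis i 1)" for n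
  proof -
    define h where "h = 1 / real (Suc n)"
    have h: "h > 0" unfolding h_def by simp
    have sw: "x + h *\<^sub>R axis j 1 + h *\<^sub>R axis i 1 = x + h *\<^sub>R axis i 1 + h *\<^sub>R axis j 1" by (simp add: add_ac)
    have "h * h * partial_deriv j (partial_deriv i f) (x + s n *\<^sub>R axis i 1 + t n *\<^sub>R axis j 1)
      = h * h * partial_deriv i (partial_deriv j f) (x + s' n *\<^sub>R axis j 1 + t' n *\<^sub>R axis i 1)"
      using st[of n] st'[of n] unfolding Let_def h_def[symmetric] sw by linarith
    thus ?thesis using h by simp
  qed
  have "(\<lambda>n. partial_deriv j (partial_deriv i f) (x + s n *\<^sub>R axis i 1 + t n *\<^sub>R axis j 1)) \<longlonglongrightarrow> partial_deriv j (partial_deriv i f) x"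
    using st by (intro lim z) auto
  moreover have "(\<lambda>n. partial_deriv j (partial_deriv i f) (x + s n *\<^sub>R axis i 1 + t n *\<^sub>R axis j 1)) \<longlonglongrightarrow> partial_deriv i (partial_deriv j f) x"
    unfolding eq using st' by (intro lim z) auto
  ultimately show ?thesis by (rule LIMSEQ_unique[symmetric])
qed

text \<open>By translation invariance every difference quotient of f has integral zero, and
  dominated convergence carries this over to the derivative. All later integrations by parts rest on
  this lemma.\<close>

lemma integral_partial_deriv:
  fixes f :: "real ^ 'n \<Rightarrow> real"
  assumes f: "smooth_on UNIV f" and K: "compact K" "\<And>x. x \<notin> K \<Longrightarrow> f x = 0"
  shows "(\<integral>x. partial_deriv i f x \<partial>lborel) = 0"
proof -
  define g where "g = partial_deriv i f"
  have cf: "continuous_on UNIV f" and cg: "continuous_on UNIV g"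
    unfolding g_def using f smooth_on_continuous smooth_on_partial_deriv by blast+
  \<comment> \<open>A difference quotient with step at most 1 vanishes outside the closed unit
    neighbourhood of K, which therefore carries the dominating function.\<close>
  define K' where "K' = {x + y |x y. x \<in> K \<and> y \<in> cball 0 1}"
  have K': "compact K'" unfolding K'_def by (rule compact_sums[OF K(1) compact_cball])
  have "K \<subseteq> K'" unfolding K'_def by (force intro: exI[of _ 0])
  have "bounded (g ` K)" using compact_continuous_image[OF continuous_on_subset[OF cg]] K(1) compact_imp_bounded by blast
  then obtain B where B: "\<And>x. x \<in> K \<Longrightarrow> \<bar>g x\<bar> \<le> B" unfolding bounded_iff by auto
  have g0: "g x = 0" if "x \<notin> K" for x
  proof -
    have "partial_deriv i f x = partial_deriv i (\<lambda>x. 0) x"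
      by (rule partial_deriv_cong[of "- K"]) (use K that compact_imp_closed in auto)
    thus ?thesis unfolding g_def by simp
  qed
  define B' where "B' = max B 0"
  have B': "\<bar>g x\<bar> \<le> B'" for x using B[of x] g0[of x] unfolding B'_def by (cases "x \<in> K") auto
  define e :: "real^'n" where "e = axis i 1"
  define h where "h = (\<lambda>n::nat. 1 / real (Suc n))"
  have h: "h n > 0" "h n \<le> 1" for n unfolding h_def by auto
  have h0: "h \<longlonglongrightarrow> 0" unfolding h_def by (rule LIMSEQ_Suc[OF lim_1_over_n])
  have der: "((\<lambda>t. f (x + t *\<^sub>R e)) has_real_derivative g (x + t *\<^sub>R e)) (at t)" for x t
  proof -
    have "(\<Sum>k\<in>UNIV. e $ k * partial_deriv k f (x + t *\<^sub>R e)) = g (x + t *\<^sub>R e)"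
      by (simp add: e_def g_def axis_def if_distrib[of "\<lambda>x. x * _"] cong: if_cong)
    thus ?thesis using smooth_line_deriv[of f x t e] smooth_on_differentiable[OF f] by simp
  qed
  define s where "s = (\<lambda>n x. (f (x + h n *\<^sub>R e) - f x) / h n)"
  have bf: "f \<in> borel_measurable borel" using cf borel_measurable_continuous_onI by blast
  have intf: "integrable lborel f"
  proof -
    have "integrable lborel (\<lambda>x. indicator K x *\<^sub>R f x)"
      by (rule borel_integrable_compact[OF K(1) continuous_on_subset[OF cf]]) simp
    moreover have "(\<lambda>x. indicator K x *\<^sub>R f x) = f" using K(2) by (auto simp: indicator_def fun_eq_iff)
    ultimately show ?thesis by simp
  qed
  have trans: "integrable lborel (\<lambda>x. f (x + c))" "(\<integral>x. f (x + c) \<partial>lborel) = (\<integral>x. f x \<partial>lborel)" for c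
  proof -
    have eq: "lborel = distr lborel borel ((+) c)" by (rule lborel_distr_plus[symmetric])
    have "integrable (distr lborel borel ((+) c)) f" using intf eq by simp
    thus "integrable lborel (\<lambda>x. f (x + c))" using bf by (subst (asm) integrable_distr_eq) (auto simp: add.commute)
    have "(\<integral>x. f x \<partial>lborel) = (\<integral>x. f x \<partial>distr lborel borel ((+) c))" using eq by simp
    also have "\<dots> = (\<integral>x. f (x + c) \<partial>lborel)" using bf by (subst integral_distr) (auto simp: add.commute)
    finally show "(\<integral>x. f (x + c) \<partial>lborel) = (\<integral>x. f x \<partial>lborel)" by simp
  qed
  have s0: "(\<integral>x. s n x \<partial>lborel) = 0" for n
    unfolding s_def using trans intf by (simp add: Bochner_Integration.integral_diff)
  have "(\<lambda>n. \<integral>x. s n x \<partial>lborel) \<longlonglongrightarrow> (\<integral>x. g x \<partial>lborel)"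
  proof (rule integral_dominated_convergence[where w="\<lambda>x. B' * indicator K' x"])
    show "g \<in> borel_measurable lborel" using cg borel_measurable_continuous_onI by simp
    show "s n \<in> borel_measurable lborel" for n unfolding s_def using bf by simp
    show "integrable lborel (\<lambda>x. B' * indicator K' x)"
      using K' by (intro integrable_mult_right integrable_real_indicator) (auto intro: borel_compact simp: emeasure_compact_finite[unfolded infinity_ennreal_def])
    show "AE x in lborel. (\<lambda>n. s n x) \<longlonglongrightarrow> g x"
    proof (rule AE_I2)
      fix x
      have "((\<lambda>k. (f (x + k *\<^sub>R e) - f (x + 0 *\<^sub>R e)) / (k - 0)) \<longlongrightarrow> g (x + 0 *\<^sub>R e)) (at 0)"
        using der[of x 0] unfolding has_field_derivative_iff .
      hence "(\<lambda>n. (f (x + h n *\<^sub>R e) - f (x + 0 *\<^sub>R e)) / (h n - 0)) \<longlonglongrightarrow> g (x + 0 *\<^sub>R e)"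
        by (rule filterlim_compose) (use h0 h(1) in \<open>auto simp: filterlim_at intro!: always_eventually less_imp_neq[THEN not_sym]\<close>)
      thus "(\<lambda>n. s n x) \<longlonglongrightarrow> g x" unfolding s_def by simp
    qed
    show "AE x in lborel. norm (s n x) \<le> B' * indicator K' x" for n
    proof (rule AE_I2)
      fix x
      have "\<exists>z>0. z < h n \<and> f (x + h n *\<^sub>R e) - f (x + 0 *\<^sub>R e) = (h n - 0) * g (x + z *\<^sub>R e)"
        by (rule MVT2[OF h(1)]) (use der in auto)
      then obtain z where z: "f (x + h n *\<^sub>R e) - f x = h n * g (x + z *\<^sub>R e)" by auto
      show "norm (s n x) \<le> B' * indicator K' x"
      proof (cases "x \<in> K'")
        case True
        have "s n x = g (x + z *\<^sub>R e)" unfolding s_def z using h(1)[of n] by simp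
        thus ?thesis using True B' by simp
      next
        case False
        have "x + h n *\<^sub>R e \<notin> K"
        proof
          assume "x + h n *\<^sub>R e \<in> K"
          moreover have "- (h n *\<^sub>R e) \<in> cball 0 1" using h[of n] by (simp add: e_def)
          ultimately have "(x + h n *\<^sub>R e) + - (h n *\<^sub>R e) \<in> K'" unfolding K'_def by blast
          thus False using False by simp
        qed
        hence "s n x = 0" using False \<open>K \<subseteq> K'\<close> K(2) unfolding s_def by auto
        thus ?thesis using False by simp
      qed
    qed
  qed
  thus ?thesis unfolding s0 g_def using LIMSEQ_unique tendsto_const by blast
qed

subsection \<open>Test functions and radial weights on a punctured ball\<close>

locale punctured_space =
  fixes x0 :: "real ^ 'n"
begin

definition pball :: "(real ^ 'n) set" where "pball = ball x0 1 - {x0}"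

text \<open>Compact support inside the punctured unit ball keeps clear of both places where a weight
  degenerates: r = 0, and r = 1, where log r vanishes. The class is thus closed under multiplication
  by weights.\<close>

definition tf :: "real \<Rightarrow> (real ^ 'n \<Rightarrow> real) \<Rightarrow> bool"
  where "tf R f \<longleftrightarrow> smooth_on UNIV f \<and>
    (\<exists>K. compact K \<and> K \<subseteq> pball \<inter> ball x0 R \<and> (\<forall>x. x \<notin> K \<longrightarrow> f x = 0))"

text \<open>On \<open>pball\<close> the number \<open>- ln (norm (x - x0))\<close> is positive.\<close>

definition wt :: "real \<Rightarrow> real \<Rightarrow> real ^ 'n \<Rightarrow> real"
  where "wt a b x = norm (x - x0) powr a * (- ln (norm (x - x0))) powr b"

text \<open>The Euler field, that is, the derivative with respect to log r; it generates the
  dilations about x0.\<close>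

definition rad :: "(real ^ 'n \<Rightarrow> real) \<Rightarrow> real ^ 'n \<Rightarrow> real"
  where "rad f x = (\<Sum>i\<in>UNIV. (x $ i - x0 $ i) * partial_deriv i f x)"

lemma open_pball [simp]: "open pball"
  unfolding pball_def by (rule open_Diff) auto

lemma pball_norm: "x \<in> pball \<Longrightarrow> 0 < norm (x - x0) \<and> norm (x - x0) < 1 \<and> ln (norm (x - x0)) < 0"
  unfolding pball_def by (auto simp: dist_norm norm_minus_commute)

lemma wt_pos: "x \<in> pball \<Longrightarrow> wt a b x > 0"
  unfolding wt_def using pball_norm[of x] by simp

lemma wt_mult: "x \<in> pball \<Longrightarrow> wt a b x * wt c d x = wt (a + c) (b + d) x"
  unfolding wt_def by (simp add: powr_add mult_ac)

lemma wt_0: "x \<in> pball \<Longrightarrow> wt 0 0 x = 1"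
  unfolding wt_def using pball_norm[of x] by simp

lemma wt_power: "x \<in> pball \<Longrightarrow> wt a b x ^ k = wt (real k * a) (real k * b) x"
  by (induction k) (auto simp: wt_0 wt_mult algebra_simps)

lemma wt_2: "wt 2 0 x * c = (norm (x - x0))\<^sup>2 * c" if "x \<in> pball"
  unfolding wt_def using pball_norm[OF that] by (simp add: powr_numeral)

lemma norm_sq_coordinates: "(\<Sum>i\<in>UNIV. (x $ i - x0 $ i)\<^sup>2) = (norm (x - x0))\<^sup>2"
  unfolding norm_vec_def L2_set_def by (simp add: sum_nonneg)

lemma wt_has_derivative:
  assumes "x \<in> pball"
  shows "(wt a b has_derivative (\<lambda>v. (a * wt (a - 2) b x - b * wt (a - 2) (b - 1) x) * ((x - x0) \<bullet> v))) (at x)"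
proof -
  define \<rho> where "\<rho> = norm (x - x0)"
  have \<rho>: "\<rho> > 0" "\<rho> < 1" "ln \<rho> < 0" using pball_norm[OF assms] unfolding \<rho>_def by auto
  have 1: "((\<lambda>\<rho>. \<rho> powr a * (- ln \<rho>) powr b) has_derivative (\<lambda>t. (a * \<rho> powr (a - 1) * (- ln \<rho>) powr b
     - b * \<rho> powr (a - 1) * (- ln \<rho>) powr (b - 1)) * t)) (at (norm (x - x0)))"
    unfolding \<rho>_def[symmetric] has_field_derivative_def[symmetric]
    using \<rho> by (auto intro!: derivative_eq_intros simp: powr_diff field_simps)
  have "((\<lambda>x. x - x0) has_derivative (\<lambda>v. v)) (at x)" by (auto intro!: derivative_eq_intros)
  moreover have "(norm has_derivative (\<lambda>h. h \<bullet> sgn (x - x0))) (at (x - x0))"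
    by (rule has_derivative_norm) (use \<rho>(1) in \<open>auto simp: \<rho>_def\<close>)
  ultimately have "((\<lambda>x. norm (x - x0)) has_derivative (\<lambda>v. v \<bullet> sgn (x - x0))) (at x)"
    using has_derivative_compose by fastforce
  note der = has_derivative_compose[OF this 1]
  have sg: "v \<bullet> sgn (x - x0) = ((x - x0) \<bullet> v) / \<rho>" for v
    by (simp add: sgn_div_norm \<rho>_def inner_commute divide_inverse mult.commute)
  have alg: "(a * \<rho> powr (a - 1) * (- ln \<rho>) powr b - b * \<rho> powr (a - 1) * (- ln \<rho>) powr (b - 1)) * (c / \<rho>)
    = (a * (\<rho> powr (a - 2) * (- ln \<rho>) powr b) - b * (\<rho> powr (a - 2) * (- ln \<rho>) powr (b - 1))) * c" for c
  proof -
    have "\<rho> powr (a - 1) = \<rho> powr (a - 2) * \<rho>" using \<rho> powr_add[of \<rho> "a - 2" 1] by simp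
    thus ?thesis using \<rho> by (simp add: field_simps)
  qed
  show ?thesis using der unfolding wt_def \<rho>_def[symmetric] sg alg by simp
qed

lemma wt_differentiable: "x \<in> pball \<Longrightarrow> wt a b differentiable (at x)"
  using wt_has_derivative unfolding differentiable_def by blast

lemma partial_deriv_wt:
  assumes "x \<in> pball"
  shows "partial_deriv i (wt a b) x = (x $ i - x0 $ i) * (a * wt (a - 2) b x - b * wt (a - 2) (b - 1) x)"
  using partial_deriv_eq[OF wt_has_derivative[OF assms], of i a b] by (simp add: inner_axis)

lemma smooth_on_wt: "smooth_on pball (wt a b)"
proof -
  have "diff_k k pball (wt a b)" for k
  proof (induction k arbitrary: a b)
    case 0 thus ?case using wt_differentiable by auto
  next
    case (Suc k)
    have *: "diff_k k pball (\<lambda>x. (x $ i - x0 $ i) * (a * wt (a - 2) b x + (- b) * wt (a - 2) (b - 1) x))" for i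
      using smooth_on_coordinate[unfolded smooth_on_def]
      by (intro diff_k_mult diff_k_add diff_k_const Suc) auto
    have "diff_k k pball (partial_deriv i (wt a b))" for i
      by (rule diff_k_cong[OF open_pball _ *[of i]]) (simp add: partial_deriv_wt)
    thus ?case using wt_differentiable by auto
  qed
  thus ?thesis unfolding smooth_on_def by blast
qed

lemma smooth_on_wt' [intro]: "smooth_on pball (\<lambda>x. wt a b x)"
  using smooth_on_wt .

lemma smooth_on_rad [intro]:
  assumes "open A" "smooth_on A f"
  shows "smooth_on A (rad f)"
  unfolding rad_def[abs_def] using assms by (auto intro!: smooth_on_sum smooth_on_mult smooth_on_coordinate)

lemma smooth_on_laplacian [intro]:
  fixes f :: "real ^ 'n \<Rightarrow> real"
  assumes "open A" "smooth_on A f"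
  shows "smooth_on A (laplacian f)"
  unfolding laplacian_def[abs_def] using assms by (auto intro!: smooth_on_sum)

lemma tf_smooth: "tf R f \<Longrightarrow> smooth_on A f"
  unfolding tf_def using smooth_on_subset by blast

lemma tf_continuous: "tf R f \<Longrightarrow> continuous_on A f"
  using tf_smooth smooth_on_continuous by blast

lemma tf_differentiable: "tf R f \<Longrightarrow> f differentiable (at x)"
  using tf_smooth[of R f UNIV] smooth_on_differentiable by blast

lemma tf_measurable [measurable_dest]: "tf R f \<Longrightarrow> f \<in> borel_measurable borel"
  using tf_continuous borel_measurable_continuous_onI by blast

lemma tf_eq_0: "tf R f \<Longrightarrow> x \<notin> pball \<Longrightarrow> f x = 0"
  unfolding tf_def by blast

lemma tf_eq_0': "tf R f \<Longrightarrow> x \<notin> ball x0 R \<Longrightarrow> f x = 0"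
  unfolding tf_def by blast

lemma tf_partial_deriv [intro]:
  assumes "tf R f"
  shows "tf R (partial_deriv i f)"
proof -
  obtain K where K: "compact K" "K \<subseteq> pball \<inter> ball x0 R" "\<forall>x. x \<notin> K \<longrightarrow> f x = 0"
    using assms unfolding tf_def by blast
  have "partial_deriv i f x = 0" if "x \<notin> K" for x
  proof -
    have "partial_deriv i f x = partial_deriv i (\<lambda>x. 0) x"
      by (rule partial_deriv_cong[of "- K"]) (use K that compact_imp_closed in auto)
    thus ?thesis by simp
  qed
  thus ?thesis using K assms unfolding tf_def by blast
qed

text \<open>The punctured ball, where h is smooth, and the complement of the support of f, where the
  product is zero, are open sets that cover the space.\<close>

lemma tf_smooth_mult [intro]:
  assumes h: "smooth_on pball h" and f: "tf R f"
  shows "tf R (\<lambda>x. h x * f x)"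
proof -
  obtain K where K: "compact K" "K \<subseteq> pball \<inter> ball x0 R" "\<forall>x. x \<notin> K \<longrightarrow> f x = 0"
    using f unfolding tf_def by blast
  have o: "open (- K)" using K(1) compact_imp_closed by blast
  have "smooth_on pball (\<lambda>x. h x * f x)" using h tf_smooth[OF f] by auto
  moreover have "smooth_on (- K) (\<lambda>x. h x * f x)"
    by (rule smooth_on_cong[OF o _ smooth_on_const[of _ 0]]) (use K in auto)
  ultimately have "smooth_on (pball \<union> - K) (\<lambda>x. h x * f x)" by (rule smooth_on_Un)
  moreover have "pball \<union> - K = UNIV" using K(2) by blast
  ultimately show ?thesis using K unfolding tf_def by auto
qed

lemma tf_mult_smooth [intro]: "tf R f \<Longrightarrow> smooth_on pball h \<Longrightarrow> tf R (\<lambda>x. f x * h x)"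
  using tf_smooth_mult[of h R f] by (simp add: mult.commute)

lemma tf_cmult [intro]: "tf R f \<Longrightarrow> tf R (\<lambda>x. c * f x)"
  by (rule tf_smooth_mult[OF smooth_on_const])

lemma tf_zero: "tf R (\<lambda>x. 0)"
  unfolding tf_def using smooth_on_const by (auto intro!: exI[of _ "{}"])

lemma tf_add [intro]:
  assumes "tf R f" "tf R g"
  shows "tf R (\<lambda>x. f x + g x)"
proof -
  obtain K where K: "compact K" "K \<subseteq> pball \<inter> ball x0 R" "\<forall>x. x \<notin> K \<longrightarrow> f x = 0"
    using assms unfolding tf_def by blast
  obtain L where L: "compact L" "L \<subseteq> pball \<inter> ball x0 R" "\<forall>x. x \<notin> L \<longrightarrow> g x = 0"
    using assms unfolding tf_def by blast
  have "smooth_on UNIV (\<lambda>x. f x + g x)" using assms tf_smooth by auto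
  thus ?thesis unfolding tf_def using K L by (intro conjI exI[of _ "K \<union> L"]) auto
qed

lemma tf_diff [intro]: "tf R f \<Longrightarrow> tf R g \<Longrightarrow> tf R (\<lambda>x. f x - g x)"
  using tf_add[of R f "\<lambda>x. (- 1) * g x"] tf_cmult[of R g "-1"] by simp

lemma tf_sum [intro]: "(\<And>k. k \<in> I \<Longrightarrow> tf R (f k)) \<Longrightarrow> tf R (\<lambda>x. \<Sum>k\<in>I. f k x)"
  by (induction I rule: infinite_finite_induct) (auto intro: tf_zero)

lemma tf_power [intro]: "tf R f \<Longrightarrow> k > 0 \<Longrightarrow> tf R (\<lambda>x. f x ^ k)"
proof (induction k)
  case (Suc k) thus ?case by (cases "k = 0") (auto intro!: tf_mult_smooth tf_smooth)
qed auto

lemma tf_rad [intro]: "tf R f \<Longrightarrow> tf R (rad f)"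
  unfolding rad_def[abs_def] by (auto intro!: tf_sum tf_smooth_mult smooth_on_coordinate)

lemma tf_laplacian [intro]: "tf R f \<Longrightarrow> tf R (laplacian f)"
  unfolding laplacian_def[abs_def] by (intro tf_sum tf_partial_deriv)

lemma tf_integrable:
  assumes "tf R f"
  shows "integrable lborel f"
proof -
  obtain K where K: "compact K" "\<forall>x. x \<notin> K \<longrightarrow> f x = 0" using assms unfolding tf_def by blast
  have "integrable lborel (\<lambda>x. indicator K x *\<^sub>R f x)"
    by (rule borel_integrable_compact[OF K(1) tf_continuous[OF assms]])
  moreover have "(\<lambda>x. indicator K x *\<^sub>R f x) = f" using K(2) by (auto simp: indicator_def fun_eq_iff)
  ultimately show ?thesis by simp
qed

lemma tf_integral_partial_deriv:
  assumes "tf R f"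
  shows "(\<integral>x. partial_deriv i f x \<partial>lborel) = 0"
proof -
  obtain K where "compact K" "\<forall>x. x \<notin> K \<longrightarrow> f x = 0" using assms unfolding tf_def by blast
  thus ?thesis using integral_partial_deriv[OF tf_smooth[OF assms]] by blast
qed

lemma tf_cong: "tf R f \<Longrightarrow> (\<And>x. x \<in> pball \<Longrightarrow> f x = g x) \<Longrightarrow> (\<And>x. x \<notin> pball \<Longrightarrow> g x = 0) \<Longrightarrow> tf R g"
proof -
  assume "tf R f" "\<And>x. x \<in> pball \<Longrightarrow> f x = g x" "\<And>x. x \<notin> pball \<Longrightarrow> g x = 0"
  moreover from this have "f = g" using tf_eq_0 by fastforce
  ultimately show "tf R g" by simp
qed

end

section \<open>Sum and product rules for the Laplacian\<close>

lemma laplacian_add: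
  fixes f g :: "real ^ 'n \<Rightarrow> real"
  assumes "open A" "x \<in> A" "smooth_on A f" "smooth_on A g"
  shows "laplacian (\<lambda>x. f x + g x) x = laplacian f x + laplacian g x"
proof -
  have "partial_deriv i (partial_deriv i (\<lambda>x. f x + g x)) x
      = partial_deriv i (\<lambda>x. partial_deriv i f x + partial_deriv i g x) x" for i
    by (rule partial_deriv_cong[OF assms(1,2)])
      (use assms smooth_on_differentiable in \<open>blast intro: partial_deriv_add\<close>)
  also have "\<dots> i = partial_deriv i (partial_deriv i f) x + partial_deriv i (partial_deriv i g) x" for i
    by (rule partial_deriv_add) (use assms smooth_on_differentiable smooth_on_partial_deriv in blast)+
  finally show ?thesis unfolding laplacian_def by (simp add: sum.distrib)
qed

lemma laplacian_mult:
  fixes f g :: "real ^ 'n \<Rightarrow> real"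
  assumes "open A" "x \<in> A" "smooth_on A f" "smooth_on A g"
  shows "laplacian (\<lambda>x. f x * g x) x = f x * laplacian g x
    + 2 * (\<Sum>i\<in>UNIV. partial_deriv i f x * partial_deriv i g x) + laplacian f x * g x"
proof -
  have d: "h differentiable (at x)" if "smooth_on A h" for h :: "real^'n \<Rightarrow> real"
    using assms that smooth_on_differentiable by blast
  have "partial_deriv i (partial_deriv i (\<lambda>x. f x * g x)) x
      = partial_deriv i (\<lambda>x. f x * partial_deriv i g x + partial_deriv i f x * g x) x" for i
    by (rule partial_deriv_cong[OF assms(1,2)])
      (use assms smooth_on_differentiable in \<open>blast intro: partial_deriv_mult\<close>)
  also have "\<dots> i = f x * partial_deriv i (partial_deriv i g) x + 2 * (partial_deriv i f x * partial_deriv i g x)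
     + partial_deriv i (partial_deriv i f) x * g x" for i
  proof -
    have "partial_deriv i (\<lambda>x. f x * partial_deriv i g x + partial_deriv i f x * g x) x
      = partial_deriv i (\<lambda>x. f x * partial_deriv i g x) x + partial_deriv i (\<lambda>x. partial_deriv i f x * g x) x"
      by (rule partial_deriv_add) (auto intro!: d smooth_on_mult smooth_on_partial_deriv simp: assms)
    also have "partial_deriv i (\<lambda>x. f x * partial_deriv i g x) x
       = f x * partial_deriv i (partial_deriv i g) x + partial_deriv i f x * partial_deriv i g x"
      by (rule partial_deriv_mult) (auto intro!: d smooth_on_partial_deriv simp: assms)
    also have "partial_deriv i (\<lambda>x. partial_deriv i f x * g x) x
       = partial_deriv i f x * partial_deriv i g x + partial_deriv i (partial_deriv i f) x * g x"
      by (rule partial_deriv_mult) (auto intro!: d smooth_on_partial_deriv simp: assms)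
    finally show ?thesis by simp
  qed
  finally show ?thesis unfolding laplacian_def
    by (simp add: sum.distrib sum_distrib_left sum_distrib_right)
qed

lemma laplacian_cmult:
  fixes f :: "real ^ 'n \<Rightarrow> real"
  assumes "open A" "x \<in> A" "smooth_on A f"
  shows "laplacian (\<lambda>x. c * f x) x = c * laplacian f x"
proof -
  have "laplacian (\<lambda>x. c) x = (0::real)" by (simp add: laplacian_def)
  thus ?thesis using laplacian_mult[OF assms(1,2) smooth_on_const assms(3), of c] by simp
qed

lemma laplacian_cong:
  assumes "open A" "x \<in> A" "\<And>y. y \<in> A \<Longrightarrow> f y = g y"
  shows "laplacian f x = laplacian g x"
proof -
  have "partial_deriv i (partial_deriv i f) x = partial_deriv i (partial_deriv i g) x" for i
    by (rule partial_deriv_cong[OF assms(1,2)]) (rule partial_deriv_cong[OF assms(1) _ assms(3)])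
  thus ?thesis unfolding laplacian_def by simp
qed

section \<open>The radial derivative and radial weights\<close>

context punctured_space
begin

lemma rad_add: "f differentiable (at x) \<Longrightarrow> g differentiable (at x) \<Longrightarrow> rad (\<lambda>x. f x + g x) x = rad f x + rad g x"
  unfolding rad_def by (simp add: partial_deriv_add sum.distrib distrib_left)

lemma rad_mult: "f differentiable (at x) \<Longrightarrow> g differentiable (at x) \<Longrightarrow> rad (\<lambda>x. f x * g x) x = f x * rad g x + rad f x * g x"
  unfolding rad_def by (simp add: partial_deriv_mult sum.distrib sum_distrib_left sum_distrib_right distrib_left mult_ac)

lemma rad_const: "rad (\<lambda>x. c) x = 0"
  unfolding rad_def by simp

lemma rad_cmult: "f differentiable (at x) \<Longrightarrow> rad (\<lambda>x. c * f x) x = c * rad f x"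
  using rad_mult[of "\<lambda>x. c" x f] by (simp add: rad_const)

lemma rad_minus: "f differentiable (at x) \<Longrightarrow> rad (\<lambda>x. - f x) x = - rad f x"
  using rad_cmult[of f x "-1"] by simp

lemma rad_diff: "f differentiable (at x) \<Longrightarrow> g differentiable (at x) \<Longrightarrow> rad (\<lambda>x. f x - g x) x = rad f x - rad g x"
  using rad_add[of f x "\<lambda>x. - g x"] rad_minus[of g x] by simp

lemma rad_power: "f differentiable (at x) \<Longrightarrow> rad (\<lambda>x. f x ^ k) x = real k * f x ^ (k - 1) * rad f x"
proof (induction k)
  case 0 thus ?case by (simp add: rad_const)
next
  case (Suc k)
  have "rad (\<lambda>x. f x * f x ^ k) x = f x * rad (\<lambda>x. f x ^ k) x + rad f x * f x ^ k"
    using Suc.prems by (intro rad_mult) auto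
  thus ?case using Suc by (cases k) (auto simp: algebra_simps)
qed

lemma rad_sum: "(\<And>k. k \<in> I \<Longrightarrow> f k differentiable (at x)) \<Longrightarrow> rad (\<lambda>x. \<Sum>k\<in>I. f k x) x = (\<Sum>k\<in>I. rad (f k) x)"
proof (induction I rule: infinite_finite_induct)
  case (insert k I)
  have "(\<lambda>x. \<Sum>k\<in>I. f k x) differentiable (at x)" using insert by (intro differentiable_sum) auto
  thus ?case using insert by (simp add: rad_add)
qed (auto simp: rad_const)

text \<open>The small parameter 1/(-log r). Lowering the second exponent of a weight by one is
  multiplication by \<open>li\<close>, and the radial derivative of \<open>li\<close> is its square,
  so the calculus of weights stays polynomial in \<open>li\<close>.\<close>

abbreviation li :: "real ^ 'n \<Rightarrow> real" where "li \<equiv> wt 0 (- 1)"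

lemma wt_shift: "x \<in> pball \<Longrightarrow> wt a (b - 1) x = wt a b x * li x"
  by (simp add: wt_mult)

lemma wt_norm: "x \<in> pball \<Longrightarrow> wt (a - 2) b x * (norm (x - x0))\<^sup>2 = wt a b x"
  using wt_mult[of x "a - 2" b 2 0] wt_2[of x 1] by simp

lemma li_pos: "x \<in> pball \<Longrightarrow> li x > 0" by (rule wt_pos)

lemma rad_wt:
  assumes "x \<in> pball"
  shows "rad (wt a b) x = wt a b x * (a - b * li x)"
proof -
  have "rad (wt a b) x = (\<Sum>i\<in>UNIV. (x $ i - x0 $ i)\<^sup>2) * (a * wt (a - 2) b x - b * wt (a - 2) (b - 1) x)"
    unfolding rad_def by (simp add: partial_deriv_wt[OF assms] sum_distrib_right power2_eq_square mult_ac)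
  also have "\<dots> = a * (wt (a - 2) b x * (norm (x - x0))\<^sup>2) - b * (wt (a - 2) (b - 1) x * (norm (x - x0))\<^sup>2)"
    by (simp add: norm_sq_coordinates algebra_simps)
  also have "\<dots> = wt a b x * (a - b * li x)"
    unfolding wt_norm[OF assms] unfolding wt_shift[OF assms] by (simp add: algebra_simps)
  finally show ?thesis .
qed

lemma rad_li: "x \<in> pball \<Longrightarrow> rad li x = (li x)\<^sup>2"
  by (simp add: rad_wt power2_eq_square)

text \<open>The gradient of a radial weight is parallel to x - x0, so its product with another
  gradient sees only the radial derivative.\<close>

lemma sum_partial_wt:
  assumes "x \<in> pball"
  shows "(norm (x - x0))\<^sup>2 * (\<Sum>i\<in>UNIV. partial_deriv i (wt a b) x * partial_deriv i f x)
    = wt a b x * (a - b * li x) * rad f x"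
proof -
  have "(\<Sum>i\<in>UNIV. partial_deriv i (wt a b) x * partial_deriv i f x) = (a * wt (a - 2) b x - b * wt (a - 2) (b - 1) x) * rad f x"
    unfolding rad_def sum_distrib_left by (intro sum.cong) (auto simp: partial_deriv_wt[OF assms])
  also have "(norm (x - x0))\<^sup>2 * \<dots> = (a * (wt (a - 2) b x * (norm (x - x0))\<^sup>2) - b * (wt (a - 2) (b - 1) x * (norm (x - x0))\<^sup>2)) * rad f x"
    by (simp add: algebra_simps)
  finally show ?thesis unfolding wt_norm[OF assms] unfolding wt_shift[OF assms] by (simp add: algebra_simps)
qed

lemma smooth_on_norm_sq: "smooth_on A (\<lambda>x. (norm (x - x0))\<^sup>2)" if "open A"
proof -
  have "smooth_on A (\<lambda>x. \<Sum>i\<in>UNIV. (x $ i - x0 $ i) ^ 2)"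
    by (intro smooth_on_sum smooth_on_power smooth_on_coordinate that)
  thus ?thesis by (simp add: norm_sq_coordinates)
qed

text \<open>On radial functions r^2 times the Laplacian is rad^2 + (n - 2) rad. Applying
  \<open>rad_wt\<close> twice gives the square of a - b li together with -b li^2 from
  differentiating \<open>li\<close>.\<close>

lemma laplacian_wt:
  assumes "x \<in> pball"
  shows "(norm (x - x0))\<^sup>2 * laplacian (wt a b) x
    = wt a b x * ((a - b * li x)\<^sup>2 - b * (li x)\<^sup>2 + (real CARD('n) - 2) * (a - b * li x))"
proof -
  define g where "g = (\<lambda>x. a * wt (a - 2) b x - b * wt (a - 2) (b - 1) x)"
  have wd: "wt a b differentiable (at x)" "(\<lambda>x. wt a b x) differentiable (at x)" for a b
    using wt_differentiable[OF assms] by auto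
  have gd: "g differentiable (at x)" unfolding g_def by (intro differentiable_diff differentiable_mult wd differentiable_const)
  have "partial_deriv i (partial_deriv i (wt a b)) x = (x $ i - x0 $ i) * partial_deriv i g x + g x" for i
  proof -
    have "partial_deriv i (partial_deriv i (wt a b)) x = partial_deriv i (\<lambda>x. (x $ i - x0 $ i) * g x) x"
      by (rule partial_deriv_cong[OF open_pball assms]) (simp add: partial_deriv_wt g_def)
    also have "\<dots> = (x $ i - x0 $ i) * partial_deriv i g x + g x"
      using partial_deriv_mult[OF differentiable_coordinate gd, of i i "x0 $ i"] by (simp add: partial_deriv_coordinate)
    finally show ?thesis .
  qed
  hence "laplacian (wt a b) x = rad g x + real CARD('n) * g x"
    unfolding laplacian_def rad_def by (simp add: sum.distrib)
  also have "rad g x = a * rad (wt (a - 2) b) x - b * rad (wt (a - 2) (b - 1)) x"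
    unfolding g_def by (simp add: rad_diff rad_cmult wd)
  also have "\<dots> = wt (a - 2) b x * (a * (a - 2 - b * li x) - b * li x * (a - 2 - (b - 1) * li x))"
    unfolding rad_wt[OF assms] wt_shift[OF assms] by (simp add: algebra_simps)
  also have "g x = wt (a - 2) b x * (a - b * li x)"
    unfolding g_def wt_shift[OF assms] by (simp add: algebra_simps)
  finally have "laplacian (wt a b) x = wt (a - 2) b x
     * (a * (a - 2 - b * li x) - b * li x * (a - 2 - (b - 1) * li x) + real CARD('n) * (a - b * li x))"
    by (simp add: algebra_simps)
  hence "(norm (x - x0))\<^sup>2 * laplacian (wt a b) x = (wt (a - 2) b x * (norm (x - x0))\<^sup>2)
     * (a * (a - 2 - b * li x) - b * li x * (a - 2 - (b - 1) * li x) + real CARD('n) * (a - b * li x))"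
    by (simp only: mult_ac)
  thus ?thesis unfolding wt_norm[OF assms] by (simp add: algebra_simps power2_eq_square)
qed

lemma laplacian_wt_mult:
  assumes "x \<in> pball" "smooth_on pball v"
  shows "(norm (x - x0))\<^sup>2 * laplacian (\<lambda>x. wt a b x * v x) x
    = wt a b x * ((norm (x - x0))\<^sup>2 * laplacian v x + 2 * (a - b * li x) * rad v x
      + ((a - b * li x)\<^sup>2 - b * (li x)\<^sup>2 + (real CARD('n) - 2) * (a - b * li x)) * v x)"
proof -
  have "(norm (x - x0))\<^sup>2 * laplacian (\<lambda>x. wt a b x * v x) x
     = wt a b x * ((norm (x - x0))\<^sup>2 * laplacian v x)
     + 2 * ((norm (x - x0))\<^sup>2 * (\<Sum>i\<in>UNIV. partial_deriv i (wt a b) x * partial_deriv i v x))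
     + ((norm (x - x0))\<^sup>2 * laplacian (wt a b) x) * v x"
    using laplacian_mult[OF open_pball assms(1) smooth_on_wt assms(2), of a b]
    by (simp add: algebra_simps)
  thus ?thesis unfolding sum_partial_wt[OF assms(1)] laplacian_wt[OF assms(1)]
    by (simp add: algebra_simps)
qed

subsection \<open>The factors of the polyharmonic operator\<close>

text \<open>Integration against the invariant measure \<open>r\<^sup>-\<^sup>n dx\<close>, for which the radial derivative is
  antisymmetric.\<close>

definition J :: "(real ^ 'n \<Rightarrow> real) \<Rightarrow> real"
  where "J f = (\<integral>x. wt (- real CARD('n)) 0 x * f x \<partial>lborel)"

lemma J_integrable: "tf R f \<Longrightarrow> integrable lborel (\<lambda>x. wt (- real CARD('n)) 0 x * f x)"
  by (rule tf_integrable[OF tf_smooth_mult[OF smooth_on_wt']])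

lemma J_add: "tf R f \<Longrightarrow> tf R g \<Longrightarrow> J (\<lambda>x. f x + g x) = J f + J g"
  unfolding J_def by (simp add: distrib_left J_integrable)

lemma J_cmult: "J (\<lambda>x. c * f x) = c * J f"
  unfolding J_def by (simp add: mult.left_commute)

lemma J_diff: "tf R f \<Longrightarrow> tf R g \<Longrightarrow> J (\<lambda>x. f x - g x) = J f - J g"
  unfolding J_def by (simp add: right_diff_distrib J_integrable)

lemma J_mono:
  assumes "tf R f" "tf R g" "\<And>x. x \<in> pball \<Longrightarrow> f x \<le> g x"
  shows "J f \<le> J g"
  unfolding J_def
proof (rule integral_mono)
  fix x
  show "wt (- real CARD('n)) 0 x * f x \<le> wt (- real CARD('n)) 0 x * g x"
    using assms tf_eq_0[of R f x] tf_eq_0[of R g x] wt_pos[of x]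
    by (cases "x \<in> pball") (auto intro: mult_left_mono)
qed (use J_integrable assms in auto)

lemma J_nonneg: "(\<And>x. 0 \<le> f x) \<Longrightarrow> 0 \<le> J f"
  unfolding J_def by (intro Bochner_Integration.integral_nonneg) (auto simp: wt_def)

text \<open>The field (x - x0) r^-n is divergence free away from x0, so r^-n times
  \<open>rad f\<close> is the divergence of a compactly supported smooth field.\<close>

lemma J_rad:
  assumes "tf R f"
  shows "J (rad f) = 0"
proof -
  let ?w = "wt (- real CARD('n)) 0"
  define g where "g = (\<lambda>i x. ((x $ i - x0 $ i) * ?w x) * f x)"
  have g: "tf R (g i)" for i unfolding g_def by (intro tf_smooth_mult smooth_on_mult smooth_on_coordinate smooth_on_wt' open_pball assms)
  have "?w x * rad f x = (\<Sum>i\<in>UNIV. partial_deriv i (g i) x)" for x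
  proof (cases "x \<in> pball")
    case True
    note wd = wt_differentiable[OF True]
    note fd = tf_differentiable[OF assms]
    have "partial_deriv i (g i) x = ((x $ i - x0 $ i) * ?w x) * partial_deriv i f x + partial_deriv i (\<lambda>x. (x $ i - x0 $ i) * ?w x) x * f x" for i
      unfolding g_def by (rule partial_deriv_mult) (auto intro: differentiable_mult differentiable_coordinate wd fd)
    moreover have "partial_deriv i (\<lambda>x. (x $ i - x0 $ i) * ?w x) x = (x $ i - x0 $ i) * partial_deriv i ?w x + ?w x" for i
      using partial_deriv_mult[OF differentiable_coordinate wd, of i i "x0 $ i"] by (simp add: partial_deriv_coordinate)
    ultimately have "(\<Sum>i\<in>UNIV. partial_deriv i (g i) x) = ?w x * rad f x + (rad ?w x + real CARD('n) * ?w x) * f x"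
      unfolding rad_def by (simp add: sum.distrib sum_distrib_left sum_distrib_right distrib_right distrib_left mult_ac)
    thus ?thesis by (simp add: rad_wt[OF True])
  next
    case False
    show ?thesis using tf_eq_0[OF tf_rad[OF assms] False] tf_eq_0[OF tf_partial_deriv[OF g] False] by simp
  qed
  hence "J (rad f) = (\<integral>x. (\<Sum>i\<in>UNIV. partial_deriv i (g i) x) \<partial>lborel)" unfolding J_def by simp
  also have "\<dots> = (\<Sum>i\<in>UNIV. \<integral>x. partial_deriv i (g i) x \<partial>lborel)"
    by (rule Bochner_Integration.integral_sum) (rule tf_integrable[OF tf_partial_deriv[OF g]])
  also have "\<dots> = 0" using tf_integral_partial_deriv[OF g] by simp
  finally show ?thesis .
qed

lemma partial_deriv_rad:
  assumes "smooth_on UNIV f"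
  shows "partial_deriv k (rad f) x = partial_deriv k f x + rad (partial_deriv k f) x"
proof -
  have d: "partial_deriv i f differentiable (at x)" for i
    using assms smooth_on_differentiable smooth_on_partial_deriv by blast
  have "partial_deriv k (rad f) x = (\<Sum>i\<in>UNIV. partial_deriv k (\<lambda>x. (x $ i - x0 $ i) * partial_deriv i f x) x)"
    unfolding rad_def[abs_def]
    by (rule partial_deriv_sum) (intro differentiable_mult differentiable_coordinate d)
  also have "\<dots> = (\<Sum>i\<in>UNIV. (x $ i - x0 $ i) * partial_deriv k (partial_deriv i f) x + (if k = i then 1 else 0) * partial_deriv i f x)"
    by (intro sum.cong refl, subst partial_deriv_mult[OF differentiable_coordinate d])
       (simp add: partial_deriv_coordinate)
  also have "\<dots> = rad (partial_deriv k f) x + partial_deriv k f x"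
    unfolding rad_def sum.distrib partial_deriv_commute[OF assms, of k]
    by (simp add: if_distrib[of "\<lambda>x. x * _"] cong: if_cong)
  finally show ?thesis by simp
qed

text \<open>The Laplacian is homogeneous of degree -2 under the dilations generated by
  \<open>rad\<close>, which fixes the commutator. Consequently r^2 times the Laplacian commutes with
  \<open>rad\<close>.\<close>

lemma laplacian_rad:
  assumes "smooth_on UNIV f"
  shows "laplacian (rad f) x = rad (laplacian f) x + 2 * laplacian f x"
proof -
  have "partial_deriv k (partial_deriv k (rad f)) x = 2 * partial_deriv k (partial_deriv k f) x + rad (partial_deriv k (partial_deriv k f)) x" for k
  proof -
    have "partial_deriv k (rad f) = (\<lambda>x. partial_deriv k f x + rad (partial_deriv k f) x)"
      using partial_deriv_rad[OF assms] by blast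
    hence "partial_deriv k (partial_deriv k (rad f)) x
        = partial_deriv k (partial_deriv k f) x + partial_deriv k (rad (partial_deriv k f)) x"
      using smooth_on_differentiable[of UNIV] assms
      by (simp only:, intro partial_deriv_add) (auto intro!: smooth_on_partial_deriv smooth_on_rad)
    thus ?thesis using partial_deriv_rad[OF smooth_on_partial_deriv[OF assms]] by simp
  qed
  hence "laplacian (rad f) x = 2 * laplacian f x + (\<Sum>k\<in>UNIV. rad (partial_deriv k (partial_deriv k f)) x)"
    unfolding laplacian_def by (simp add: sum.distrib sum_distrib_left)
  also have "(\<Sum>k\<in>UNIV. rad (partial_deriv k (partial_deriv k f)) x) = rad (laplacian f) x"
    unfolding laplacian_def[abs_def]
    by (rule rad_sum[symmetric]) (use assms smooth_on_differentiable smooth_on_partial_deriv in blast)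
  finally show ?thesis by simp
qed

text \<open>\<open>Lop c\<close> is \<open>r\<^sup>2\<Delta>\<close> conjugated by \<open>r\<^sup>c\<close>: it maps \<open>r\<^sup>c w\<close> to \<open>r\<^bsup>c+2\<^esup> \<Delta>w\<close>. Hence \<open>r\<^bsup>2m\<^esup> \<Delta>\<^sup>m\<close> is a product of
  commuting second-order operators.\<close>

definition Lop :: "real \<Rightarrow> (real ^ 'n \<Rightarrow> real) \<Rightarrow> real ^ 'n \<Rightarrow> real"
  where "Lop c u x = (norm (x - x0))\<^sup>2 * laplacian u x - 2 * c * rad u x + (c\<^sup>2 - c * (real CARD('n) - 2)) * u x"

lemma tf_Lop [intro]: "tf R u \<Longrightarrow> tf R (Lop c u)"
  unfolding Lop_def[abs_def]
  by (intro tf_add tf_diff tf_cmult tf_smooth_mult[OF smooth_on_norm_sq] tf_laplacian tf_rad open_pball)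

text \<open>Every \<open>Lop c\<close> is a combination, with constant coefficients, of r^2 times
  the Laplacian, of \<open>rad\<close> and of the identity, and these commute pairwise
  (\<open>comm\<close>).\<close>

lemma Lop_commute:
  assumes u: "smooth_on UNIV u"
  shows "Lop c (Lop d u) x = Lop d (Lop c u) x"
proof -
  define M where "M = (\<lambda>u x. (norm (x - x0))\<^sup>2 * laplacian u x)"
  have M: "smooth_on UNIV (M f)" if "smooth_on UNIV f" for f
    unfolding M_def using that by (intro smooth_on_mult smooth_on_norm_sq smooth_on_laplacian) auto
  have df: "f differentiable (at x)" if "smooth_on UNIV f" for f and x
    using that smooth_on_differentiable by blast
  define k where "k = (\<lambda>c. c\<^sup>2 - c * (real CARD('n) - 2))"
  have L: "Lop c f = (\<lambda>x. M f x + ((- 2 * c) * rad f x + k c * f x))" for c f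
    unfolding Lop_def M_def k_def by (auto simp: fun_eq_iff)
  have comm: "rad (M f) x = M (rad f) x" if f: "smooth_on UNIV f" for f x
  proof -
    have "rad (\<lambda>x. (norm (x - x0))\<^sup>2) x = 2 * (norm (x - x0))\<^sup>2"
    proof -
      have "(\<lambda>x. (norm (x - x0))\<^sup>2) = (\<lambda>x. \<Sum>i\<in>UNIV. (x $ i - x0 $ i) ^ 2)" by (simp add: norm_sq_coordinates)
      hence "rad (\<lambda>x. (norm (x - x0))\<^sup>2) x = (\<Sum>i\<in>UNIV. rad (\<lambda>x. (x $ i - x0 $ i) ^ 2) x)"
        by (simp add: rad_sum differentiable_coordinate)
      also have "\<dots> = (\<Sum>i\<in>UNIV. 2 * (x $ i - x0 $ i) * (x $ i - x0 $ i))"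
      proof (intro sum.cong refl)
        fix i
        have "rad (\<lambda>x. x $ i - x0 $ i) x = x $ i - x0 $ i"
          unfolding rad_def partial_deriv_coordinate by (simp add: if_distrib cong: if_cong)
        thus "rad (\<lambda>x. (x $ i - x0 $ i) ^ 2) x = 2 * (x $ i - x0 $ i) * (x $ i - x0 $ i)"
          using rad_power[OF differentiable_coordinate, of i "x0 $ i" 2 x] by simp
      qed
      also have "\<dots> = 2 * (norm (x - x0))\<^sup>2"
        unfolding norm_sq_coordinates[symmetric] sum_distrib_left by (simp only: power2_eq_square mult.assoc)
      finally show ?thesis .
    qed
    hence "rad (M f) x = (norm (x - x0))\<^sup>2 * rad (laplacian f) x + 2 * (norm (x - x0))\<^sup>2 * laplacian f x"
      unfolding M_def using f by (subst rad_mult) (auto intro!: df smooth_on_norm_sq smooth_on_laplacian)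
    thus ?thesis unfolding M_def laplacian_rad[OF f] by (simp add: algebra_simps)
  qed
  have exp: "Lop c (Lop d f) x = M (M f) x + (- 2 * d) * M (rad f) x + k d * M f x
      + (- 2 * c) * (M (rad f) x + (- 2 * d) * rad (rad f) x + k d * rad f x) + k c * (M f x + ((- 2 * d) * rad f x + k d * f x))"
    if f: "smooth_on UNIV f" for c d f
  proof -
    have 1: "M (\<lambda>x. M f x + ((- 2 * d) * rad f x + k d * f x)) x = M (M f) x + (- 2 * d) * M (rad f) x + k d * M f x"
    proof -
      have "laplacian (\<lambda>x. M f x + ((- 2 * d) * rad f x + k d * f x)) x = laplacian (M f) x + laplacian (\<lambda>x. (- 2 * d) * rad f x + k d * f x) x"
        by (rule laplacian_add[of UNIV]) (auto intro!: M f smooth_on_add smooth_on_mult smooth_on_const smooth_on_rad simp del: mult_minus_left)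
      also have "laplacian (\<lambda>x. (- 2 * d) * rad f x + k d * f x) x = laplacian (\<lambda>x. (- 2 * d) * rad f x) x + laplacian (\<lambda>x. k d * f x) x"
        by (rule laplacian_add[of UNIV]) (auto intro!: f smooth_on_mult smooth_on_const smooth_on_rad simp del: mult_minus_left)
      also have "laplacian (\<lambda>x. (- 2 * d) * rad f x) x = (- 2 * d) * laplacian (rad f) x"
        by (rule laplacian_cmult[of UNIV]) (auto intro: f)
      also have "laplacian (\<lambda>x. k d * f x) x = k d * laplacian f x"
        by (rule laplacian_cmult[of UNIV]) (auto intro: f)
      finally have E: "laplacian (\<lambda>x. M f x + ((- 2 * d) * rad f x + k d * f x)) x
        = laplacian (M f) x + ((- 2 * d) * laplacian (rad f) x + k d * laplacian f x)" .
      have Mx: "M h x = (norm (x - x0))\<^sup>2 * laplacian h x" for h by (simp add: M_def)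
      show ?thesis unfolding Mx E by (simp add: algebra_simps)
    qed
    have 2: "rad (\<lambda>x. M f x + ((- 2 * d) * rad f x + k d * f x)) x = M (rad f) x + (- 2 * d) * rad (rad f) x + k d * rad f x"
      using df[OF M[OF f]] df[OF f] df[OF smooth_on_rad[OF _ f]] comm[OF f]
      by (simp add: rad_add rad_diff rad_cmult rad_minus del: mult_minus_left)
    show ?thesis unfolding L 1 2 by (simp add: algebra_simps)
  qed
  show ?thesis unfolding exp[OF u] by (simp add: algebra_simps)
qed

text \<open>The second-order parts cancel. What remains is purely radial, which allows u to be
  recovered from the images under two different factors.\<close>

lemma Lop_diff:
  "Lop c u x - Lop d u x = - 2 * (c - d) * (rad u x - (c + d - (real CARD('n) - 2)) / 2 * u x)"
  unfolding Lop_def by (simp add: field_simps power2_eq_square)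

lemma Lop_wt:
  assumes "x \<in> pball" "smooth_on pball w"
  shows "Lop c (\<lambda>x. wt c 0 x * w x) x = wt c 0 x * ((norm (x - x0))\<^sup>2 * laplacian w x)"
proof -
  have "rad (\<lambda>x. wt c 0 x * w x) x = wt c 0 x * rad w x + c * wt c 0 x * w x"
    using rad_mult[OF wt_differentiable[OF assms(1)] smooth_on_differentiable[OF assms(2,1)], of c 0]
    by (simp add: rad_wt[OF assms(1)])
  thus ?thesis unfolding Lop_def laplacian_wt_mult[OF assms]
    by (simp add: algebra_simps power2_eq_square)
qed

lemma J_cong: "(\<And>x. x \<in> pball \<Longrightarrow> f x = g x) \<Longrightarrow> tf R f \<Longrightarrow> tf R g \<Longrightarrow> J f = J g"
  using J_mono[of R f g] J_mono[of R g f] by fastforce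

text \<open>Hardy's inequality in the variable -log r: the square of 3 li^2 v + 2 li rad v is
  nonnegative, and its mixed term is completed to the radial derivative of li^3 v^2, whose integral
  vanishes. It pays for the only negative term of the commutator.\<close>

lemma hardy:
  assumes v: "tf R v"
  shows "9 * J (\<lambda>x. li x ^ 4 * (v x)\<^sup>2) \<le> 4 * J (\<lambda>x. li x ^ 2 * (rad v x)\<^sup>2)"
proof -
  have t1: "tf R (\<lambda>x. li x ^ 4 * (v x)\<^sup>2)" and t2: "tf R (\<lambda>x. li x ^ 2 * (rad v x)\<^sup>2)"
    and t3: "tf R (\<lambda>x. li x ^ 3 * (v x)\<^sup>2)"
    using v by (auto intro!: tf_smooth_mult smooth_on_power smooth_on_wt')
  have r: "rad (\<lambda>x. li x ^ 3 * (v x)\<^sup>2) x = 3 * li x ^ 4 * (v x)\<^sup>2 + 2 * li x ^ 3 * v x * rad v x" if "x \<in> pball" for x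
    using wt_differentiable[OF that] tf_differentiable[OF v] rad_li[OF that]
    by (simp add: rad_mult rad_power algebra_simps power_numeral_reduce)
  have "J (\<lambda>x. (9/6) * (li x ^ 4 * (v x)\<^sup>2) - (4/6) * (li x ^ 2 * (rad v x)\<^sup>2)) \<le> J (rad (\<lambda>x. li x ^ 3 * (v x)\<^sup>2))"
  proof (rule J_mono[of R])
    fix x assume x: "x \<in> pball"
    have "0 \<le> (3 * (li x ^ 2 * v x) + 2 * (li x * rad v x))\<^sup>2" by simp
    thus "(9/6) * (li x ^ 4 * (v x)\<^sup>2) - (4/6) * (li x ^ 2 * (rad v x)\<^sup>2) \<le> rad (\<lambda>x. li x ^ 3 * (v x)\<^sup>2) x"
      unfolding r[OF x] by (simp add: power2_eq_square power_numeral_reduce algebra_simps)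
  qed (intro tf_diff tf_cmult tf_rad t1 t2 t3)+
  also have "J (rad (\<lambda>x. li x ^ 3 * (v x)\<^sup>2)) = 0" using J_rad[OF t3] .
  finally show ?thesis using J_diff[OF tf_cmult[OF t1] tf_cmult[OF t2], of "9/6" "4/6"]
    unfolding J_cmult by linarith
qed

text \<open>Green's formula for the measure r^-n dx. The density in front of the Laplacian is
  r^(2-n), and its gradient produces the first-order term.\<close>

lemma J_laplacian:
  assumes v: "tf R v" and A: "tf R A"
  shows "J (\<lambda>x. (norm (x - x0))\<^sup>2 * laplacian v x * A x)
    = J (\<lambda>x. (real CARD('n) - 2) * (A x * rad v x)
        - (norm (x - x0))\<^sup>2 * (\<Sum>i\<in>UNIV. partial_deriv i A x * partial_deriv i v x))"
proof -
  let ?n = "real CARD('n)"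
  define w where "w = wt (2 - ?n) 0"
  have wn: "wt (- ?n) 0 x * (norm (x - x0))\<^sup>2 = w x" if "x \<in> pball" for x
    using wt_norm[OF that, of "2 - ?n" 0] unfolding w_def by simp
  define g where "g = (\<lambda>i x. w x * (A x * partial_deriv i v x))"
  have g: "tf R (g i)" for i unfolding g_def w_def
    using v by (intro tf_smooth_mult smooth_on_wt' tf_smooth[OF A] tf_partial_deriv)
  have eq: "wt (- ?n) 0 x * ((norm (x - x0))\<^sup>2 * laplacian v x * A x)
     = (\<Sum>i\<in>UNIV. partial_deriv i (g i) x) + wt (- ?n) 0 x * ((?n - 2) * (A x * rad v x)
        - (norm (x - x0))\<^sup>2 * (\<Sum>i\<in>UNIV. partial_deriv i A x * partial_deriv i v x))" for x
  proof (cases "x \<in> pball")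
    case True
    have wd: "w differentiable (at x)" unfolding w_def by (rule wt_differentiable[OF True])
    have d: "A differentiable (at x)" "partial_deriv i v differentiable (at x)" for i
      using A v tf_differentiable tf_partial_deriv by blast+
    have "partial_deriv i (g i) x = w x * (A x * partial_deriv i (partial_deriv i v) x + partial_deriv i A x * partial_deriv i v x)
        + A x * (partial_deriv i w x * partial_deriv i v x)" for i
      unfolding g_def using wd d by (simp add: partial_deriv_mult algebra_simps)
    hence "(\<Sum>i\<in>UNIV. partial_deriv i (g i) x) = w x * (A x * laplacian v x + (\<Sum>i\<in>UNIV. partial_deriv i A x * partial_deriv i v x))
      + A x * (\<Sum>i\<in>UNIV. partial_deriv i w x * partial_deriv i v x)"
      unfolding laplacian_def by (simp add: sum.distrib sum_distrib_left distrib_left)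
    also have "(\<Sum>i\<in>UNIV. partial_deriv i w x * partial_deriv i v x) = (2 - ?n) * (wt (- ?n) 0 x * rad v x)"
    proof -
      have "(norm (x - x0))\<^sup>2 * (\<Sum>i\<in>UNIV. partial_deriv i w x * partial_deriv i v x) = (norm (x - x0))\<^sup>2 * ((2 - ?n) * (wt (- ?n) 0 x * rad v x))"
        unfolding w_def sum_partial_wt[OF True] wn[OF True, unfolded w_def, symmetric] by simp
      moreover have "norm (x - x0) \<noteq> 0" using pball_norm[OF True] by simp
      ultimately show ?thesis by simp
    qed
    finally have E: "(\<Sum>i\<in>UNIV. partial_deriv i (g i) x) = w x * (A x * laplacian v x + (\<Sum>i\<in>UNIV. partial_deriv i A x * partial_deriv i v x))
      + A x * ((2 - ?n) * (wt (- ?n) 0 x * rad v x))" .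
    show ?thesis unfolding E wn[OF True, symmetric] by algebra
  next
    case False
    show ?thesis using tf_eq_0[OF tf_rad[OF v] False] tf_eq_0[OF tf_partial_deriv[OF g] False]
       tf_eq_0[OF A False] tf_eq_0[OF tf_partial_deriv[OF v] False] by simp
  qed
  have "J (\<lambda>x. (norm (x - x0))\<^sup>2 * laplacian v x * A x) = (\<integral>x. (\<Sum>i\<in>UNIV. partial_deriv i (g i) x) \<partial>lborel)
     + J (\<lambda>x. (?n - 2) * (A x * rad v x) - (norm (x - x0))\<^sup>2 * (\<Sum>i\<in>UNIV. partial_deriv i A x * partial_deriv i v x))"
    unfolding J_def eq
  proof (rule Bochner_Integration.integral_add)
    show "integrable lborel (\<lambda>x. \<Sum>i\<in>UNIV. partial_deriv i (g i) x)"
      by (intro Bochner_Integration.integrable_sum tf_integrable[OF tf_partial_deriv[OF g]])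
    have "tf R (\<lambda>x. (?n - 2) * (A x * rad v x) - (norm (x - x0))\<^sup>2 * (\<Sum>i\<in>UNIV. partial_deriv i A x * partial_deriv i v x))"
      using v A by (intro tf_diff tf_cmult tf_smooth_mult[OF smooth_on_norm_sq] open_pball tf_sum tf_smooth_mult[OF tf_smooth[OF A]]
         tf_smooth_mult[OF tf_smooth[OF tf_partial_deriv[OF A]]] tf_rad tf_partial_deriv)
    from J_integrable[OF this] show "integrable lborel (\<lambda>x. wt (- ?n) 0 x * ((?n - 2) * (A x * rad v x) - (norm (x - x0))\<^sup>2 * (\<Sum>i\<in>UNIV. partial_deriv i A x * partial_deriv i v x)))" .
  qed
  moreover have "(\<integral>x. (\<Sum>i\<in>UNIV. partial_deriv i (g i) x) \<partial>lborel) = 0"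
    using tf_integral_partial_deriv[OF g] by (subst Bochner_Integration.integral_sum) (auto intro: tf_integrable[OF tf_partial_deriv[OF g]])
  ultimately show ?thesis by simp
qed

lemma rad_norm_sq:
  assumes "x \<in> pball"
  shows "rad (\<lambda>x. (norm (x - x0))\<^sup>2) x = 2 * (norm (x - x0))\<^sup>2"
proof -
  have "rad (\<lambda>x. (norm (x - x0))\<^sup>2) x = rad (wt 2 0) x"
    unfolding rad_def by (intro sum.cong refl arg_cong2[of _ _ _ _ "(*)"] partial_deriv_cong[OF open_pball assms])
      (use wt_2[where c=1] in auto)
  thus ?thesis using rad_wt[OF assms, of 2 0] wt_2[OF assms, of 1] by simp
qed

subsection \<open>The Carleman estimate for the function itself\<close>

text \<open>The conjugated operator splits as \<open>S + A\<close> with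
  \<open>S = r\<^sup>2\<Delta> - (n - 2) rad + (\<sigma>\<^sup>2 - \<kappa>\<^sup>2)\<close> and \<open>A = 2 \<sigma> rad + rad \<sigma>\<close>, where
  \<open>\<sigma> = \<tau> - c + \<kappa> - q li\<close> and \<open>\<kappa> = (n - 2)/2\<close>; the commutator of the two parts is positive because
  \<open>\<sigma>\<close> is decreasing in \<open>li\<close>.\<close>

lemma carleman_conjugated:
  fixes q k0 \<kappa> :: real
  assumes v: "tf R v" and q: "q > 0"
  defines "\<sigma> \<equiv> \<lambda>x. k0 - q * li x"
  defines "\<kappa> \<equiv> (real CARD('n) - 2) / 2"
  defines "P \<equiv> \<lambda>x. (norm (x - x0))\<^sup>2 * laplacian v x - (real CARD('n) - 2) * rad v x
     + ((\<sigma> x)\<^sup>2 - \<kappa>\<^sup>2) * v x + (2 * \<sigma> x * rad v x - q * (li x)\<^sup>2 * v x)"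
  shows "J (\<lambda>x. (P x)\<^sup>2) \<ge> 8 * q * J (\<lambda>x. (\<sigma> x)\<^sup>2 * (li x)\<^sup>2 * (v x)\<^sup>2) + 6 * q * J (\<lambda>x. li x ^ 4 * (v x)\<^sup>2)"
proof -
  let ?n = "real CARD('n)"
  let ?r2 = "\<lambda>x. (norm (x - x0))\<^sup>2"
  have s: "smooth_on pball \<sigma>" unfolding \<sigma>_def by (intro smooth_on_diff smooth_on_const smooth_on_mult smooth_on_wt' open_pball)
  have sli: "smooth_on pball li" by (rule smooth_on_wt')
  note sr = smooth_on_norm_sq[OF open_pball]
  have sv: "smooth_on pball v" "smooth_on pball (rad v)" using tf_smooth[OF v] tf_smooth[OF tf_rad[OF v]] by auto
  note tfI = tf_add tf_diff tf_cmult tf_smooth_mult tf_laplacian tf_rad v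
    smooth_on_const smooth_on_mult smooth_on_add smooth_on_diff smooth_on_power s sli sr sv open_pball
  define A where "A = (\<lambda>x. 2 * \<sigma> x * rad v x - q * (li x)\<^sup>2 * v x)"
  define S where "S = (\<lambda>x. ?r2 x * laplacian v x - (?n - 2) * rad v x + ((\<sigma> x)\<^sup>2 - \<kappa>\<^sup>2) * v x)"
  have A: "tf R A" unfolding A_def by (intro tfI)
  have S: "tf R S" unfolding S_def by (intro tfI)
  have sA: "smooth_on pball A" using tf_smooth[OF A] .
  have PA: "P = (\<lambda>x. S x + A x)" unfolding P_def S_def A_def by auto
  define D where "D = (\<lambda>x. \<Sum>i\<in>UNIV. partial_deriv i A x * partial_deriv i v x)"
  have D: "tf R D" unfolding D_def using v A by (intro tf_sum tf_smooth_mult tf_smooth[OF tf_partial_deriv[OF A]] tf_partial_deriv)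
  define N where "N = (\<lambda>x. ?r2 x * (\<Sum>i\<in>UNIV. (partial_deriv i v x)\<^sup>2))"
  have N: "tf R N" unfolding N_def using v by (intro tf_smooth_mult sr tf_sum tf_power tf_partial_deriv) auto
  have SA: "J (\<lambda>x. S x * A x) = J (\<lambda>x. ((\<sigma> x)\<^sup>2 - \<kappa>\<^sup>2) * v x * A x - ?r2 x * D x)"
  proof -
    have t: "tf R (\<lambda>x. ?r2 x * laplacian v x * A x)" "tf R (\<lambda>x. - (?n - 2) * rad v x * A x + ((\<sigma> x)\<^sup>2 - \<kappa>\<^sup>2) * v x * A x)"
      "tf R (\<lambda>x. (?n - 2) * (A x * rad v x) - ?r2 x * D x)"
      by (intro tfI A D sA smooth_on_laplacian)+
    have "J (\<lambda>x. S x * A x) = J (\<lambda>x. ?r2 x * laplacian v x * A x + (- (?n - 2) * rad v x * A x + ((\<sigma> x)\<^sup>2 - \<kappa>\<^sup>2) * v x * A x))"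
      by (rule arg_cong[of _ _ J]) (auto simp: S_def fun_eq_iff algebra_simps)
    also have "\<dots> = J (\<lambda>x. ?r2 x * laplacian v x * A x) + J (\<lambda>x. - (?n - 2) * rad v x * A x + ((\<sigma> x)\<^sup>2 - \<kappa>\<^sup>2) * v x * A x)"
      by (rule J_add[OF t(1,2)])
    also have "J (\<lambda>x. ?r2 x * laplacian v x * A x) = J (\<lambda>x. (?n - 2) * (A x * rad v x) - ?r2 x * D x)"
      unfolding D_def by (rule J_laplacian[OF v A])
    also have "\<dots> + J (\<lambda>x. - (?n - 2) * rad v x * A x + ((\<sigma> x)\<^sup>2 - \<kappa>\<^sup>2) * v x * A x)
      = J (\<lambda>x. ((?n - 2) * (A x * rad v x) - ?r2 x * D x) + (- (?n - 2) * rad v x * A x + ((\<sigma> x)\<^sup>2 - \<kappa>\<^sup>2) * v x * A x))"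
      by (rule J_add[OF t(3,2), symmetric])
    also have "\<dots> = J (\<lambda>x. ((\<sigma> x)\<^sup>2 - \<kappa>\<^sup>2) * v x * A x - ?r2 x * D x)"
      by (rule arg_cong[of _ _ J]) (auto simp: fun_eq_iff algebra_simps)
    finally show ?thesis .
  qed
  \<comment> \<open>G collects what is an exact radial derivative in the product of S and A. The
    summand with N, the full gradient squared, accounts for all second derivatives of v and for the
    tangential gradient, so F contains the radial derivative only.\<close>
  define G where "G = (\<lambda>x. ((\<sigma> x) ^ 3 - \<kappa>\<^sup>2 * \<sigma> x) * (v x)\<^sup>2 - \<sigma> x * N x + q * (li x) ^ 3 * (v x)\<^sup>2)"
  have v2: "tf R (\<lambda>x. (v x)\<^sup>2)" using v by (auto intro: tf_power)
  have G: "tf R G" unfolding G_def by (intro tfI N v2)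
  define F where "F = (\<lambda>x. 2 * q * ((li x)\<^sup>2 * (rad v x)\<^sup>2) + 2 * q * ((\<sigma> x)\<^sup>2 * (li x)\<^sup>2 * (v x)\<^sup>2) - 3 * q * (li x ^ 4 * (v x)\<^sup>2))"
  have t: "tf R (\<lambda>x. (li x)\<^sup>2 * (rad v x)\<^sup>2)" "tf R (\<lambda>x. (\<sigma> x)\<^sup>2 * (li x)\<^sup>2 * (v x)\<^sup>2)" "tf R (\<lambda>x. li x ^ 4 * (v x)\<^sup>2)"
    using v by (intro tfI tf_power; simp)+
  have F: "tf R F" unfolding F_def by (intro tf_add tf_diff tf_cmult t)
  have eq: "((\<sigma> x)\<^sup>2 - \<kappa>\<^sup>2) * v x * A x - ?r2 x * D x = F x + rad G x" if x: "x \<in> pball" for x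
  proof -
    have ld: "li differentiable (at x)" "\<And>f. tf R f \<Longrightarrow> f differentiable (at x)"
      using wt_differentiable[OF x] tf_differentiable by auto
    have sd: "\<sigma> differentiable (at x)" using smooth_on_differentiable[OF s x] .
    have rs: "rad \<sigma> x = - q * (li x)\<^sup>2" unfolding \<sigma>_def using ld by (simp add: rad_diff rad_const rad_cmult rad_li[OF x])
    note vd = ld(2)[OF v] and rvd = ld(2)[OF tf_rad[OF v]]
    have pd: "partial_deriv i \<sigma> x = - q * partial_deriv i li x" for i
      unfolding \<sigma>_def using ld by (simp add: partial_deriv_diff partial_deriv_cmult)
    have gli: "?r2 x * (\<Sum>i\<in>UNIV. partial_deriv i li x * partial_deriv i v x) = (li x)\<^sup>2 * rad v x"
      using sum_partial_wt[OF x, of 0 "-1" v] by (simp add: power2_eq_square)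
    have dA: "partial_deriv i A x = 2 * \<sigma> x * (partial_deriv i v x + rad (partial_deriv i v) x)
       - 2 * q * partial_deriv i li x * rad v x - q * (li x)\<^sup>2 * partial_deriv i v x
       - 2 * q * li x * partial_deriv i li x * v x" for i
    proof -
      have "partial_deriv i A x = 2 * \<sigma> x * partial_deriv i (rad v) x + partial_deriv i (\<lambda>x. 2 * \<sigma> x) x * rad v x
         - (q * (li x)\<^sup>2 * partial_deriv i v x + partial_deriv i (\<lambda>x. q * (li x)\<^sup>2) x * v x)"
        unfolding A_def using ld sd vd rvd by (simp add: partial_deriv_diff partial_deriv_mult)
      moreover have "partial_deriv i (\<lambda>x. q * (li x)\<^sup>2) x = 2 * q * li x * partial_deriv i li x"
        using ld by (simp add: power2_eq_square partial_deriv_mult)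
      moreover have "partial_deriv i (\<lambda>x. 2 * \<sigma> x) x = - 2 * q * partial_deriv i li x"
        using sd pd by (simp add: partial_deriv_cmult)
      ultimately show ?thesis unfolding partial_deriv_rad[OF tf_smooth[OF v]] by (simp add: algebra_simps)
    qed
    define T where "T = (\<Sum>i\<in>UNIV. (partial_deriv i v x)\<^sup>2)"
    define T' where "T' = (\<Sum>i\<in>UNIV. partial_deriv i v x * rad (partial_deriv i v) x)"
    define L where "L = (\<Sum>i\<in>UNIV. partial_deriv i li x * partial_deriv i v x)"
    have DE: "D x = 2 * \<sigma> x * (T + T') - 2 * q * rad v x * L - q * (li x)\<^sup>2 * T - 2 * q * li x * v x * L"
      unfolding D_def dA T_def T'_def L_def
      by (simp add: sum.distrib sum_subtractf sum_distrib_left sum_distrib_right algebra_simps power2_eq_square)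
    have "?r2 x * D x = 2 * \<sigma> x * (?r2 x * (T + T')) - (2 * q * rad v x + 2 * q * li x * v x) * (?r2 x * L) - q * (li x)\<^sup>2 * (?r2 x * T)"
      unfolding DE by algebra
    hence e1: "?r2 x * D x = 2 * \<sigma> x * (?r2 x * (T + T')) - (2 * q * rad v x + 2 * q * li x * v x) * ((li x)\<^sup>2 * rad v x) - q * (li x)\<^sup>2 * N x"
      unfolding L_def gli N_def T_def by simp
    have rN: "rad N x = 2 * (?r2 x * (T + T'))"
    proof -
      have "rad (\<lambda>x. \<Sum>i\<in>UNIV. (partial_deriv i v x)\<^sup>2) x = (\<Sum>i\<in>UNIV. rad (\<lambda>x. (partial_deriv i v x)\<^sup>2) x)"
        by (rule rad_sum) (simp add: ld(2)[OF tf_partial_deriv[OF v]])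
      also have "\<dots> = 2 * T'" unfolding T'_def sum_distrib_left
        by (intro sum.cong refl, subst rad_power) (auto intro!: ld tf_partial_deriv v)
      finally have "rad (\<lambda>x. \<Sum>i\<in>UNIV. (partial_deriv i v x)\<^sup>2) x = 2 * T'" .
      moreover have "?r2 differentiable (at x)" using smooth_on_differentiable[OF sr x] .
      moreover have "(\<lambda>x. \<Sum>i\<in>UNIV. (partial_deriv i v x)\<^sup>2) differentiable (at x)"
        by (auto intro!: differentiable_sum simp: ld(2)[OF tf_partial_deriv[OF v]])
      ultimately show ?thesis unfolding N_def using rad_norm_sq[OF x]
        by (simp add: rad_mult T_def[symmetric] algebra_simps)
    qed
    have rG: "rad G x = ((\<sigma> x) ^ 3 - \<kappa>\<^sup>2 * \<sigma> x) * (2 * v x * rad v x) + (3 * (\<sigma> x)\<^sup>2 * rad \<sigma> x - \<kappa>\<^sup>2 * rad \<sigma> x) * (v x)\<^sup>2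
       - (\<sigma> x * rad N x + rad \<sigma> x * N x) + (q * (li x) ^ 3 * (2 * v x * rad v x) + 3 * q * (li x) ^ 4 * (v x)\<^sup>2)"
    proof -
      have Nd: "N differentiable (at x)" using ld(2)[OF N] .
      have 1: "rad (\<lambda>x. \<sigma> x ^ 3 - \<kappa>\<^sup>2 * \<sigma> x) x = 3 * (\<sigma> x)\<^sup>2 * rad \<sigma> x - \<kappa>\<^sup>2 * rad \<sigma> x"
        using sd by (simp add: rad_diff rad_power rad_cmult)
      have 2: "rad (\<lambda>x. q * (li x) ^ 3) x = 3 * q * (li x) ^ 4"
        using ld by (simp add: rad_cmult rad_power rad_li[OF x] flip: power_add)
      have 3: "rad (\<lambda>x. (v x)\<^sup>2) x = 2 * v x * rad v x" using vd by (simp add: rad_power)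
      have d: "(\<lambda>x. \<sigma> x ^ 3 - \<kappa>\<^sup>2 * \<sigma> x) differentiable (at x)" "(\<lambda>x. (v x)\<^sup>2) differentiable (at x)"
        "(\<lambda>x. q * (li x) ^ 3) differentiable (at x)" using sd vd ld(1) by auto
      have "rad G x = rad (\<lambda>x. (\<sigma> x ^ 3 - \<kappa>\<^sup>2 * \<sigma> x) * (v x)\<^sup>2 - \<sigma> x * N x) x + rad (\<lambda>x. (q * (li x) ^ 3) * (v x)\<^sup>2) x"
        unfolding G_def using d sd Nd ld(1) by (intro rad_add differentiable_diff differentiable_mult) auto
      also have "rad (\<lambda>x. (\<sigma> x ^ 3 - \<kappa>\<^sup>2 * \<sigma> x) * (v x)\<^sup>2 - \<sigma> x * N x) x
         = rad (\<lambda>x. (\<sigma> x ^ 3 - \<kappa>\<^sup>2 * \<sigma> x) * (v x)\<^sup>2) x - rad (\<lambda>x. \<sigma> x * N x) x"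
        using d sd Nd ld(1) by (intro rad_diff differentiable_mult) auto
      finally show ?thesis unfolding rad_mult[OF d(1,2)] rad_mult[OF d(3,2)] rad_mult[OF sd Nd] 1 2 3 by simp
    qed
    show ?thesis unfolding e1 rG rN rs F_def A_def
      by (simp add: algebra_simps power2_eq_square power_numeral_reduce)
  qed
  have "J (\<lambda>x. S x * A x) = J F"
  proof -
    have "J (\<lambda>x. S x * A x) = J (\<lambda>x. F x + rad G x)"
      unfolding SA by (rule J_cong[OF eq, where R=R]) (auto intro!: tfI A D F G sA smooth_on_laplacian)
    also have "\<dots> = J F" using J_add[OF F tf_rad[OF G]] J_rad[OF G] by simp
    finally show ?thesis .
  qed
  \<comment> \<open>The square of S - A is discarded; the mixed term alone carries the
    estimate.\<close>
  moreover have "J (\<lambda>x. 4 * (S x * A x)) \<le> J (\<lambda>x. (P x)\<^sup>2)"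
  proof (rule J_mono)
    show "tf R (\<lambda>x. 4 * (S x * A x))" using S sA tf_mult_smooth by (intro tf_cmult) blast
    show "tf R (\<lambda>x. (P x)\<^sup>2)" unfolding PA using S A by (intro tf_power tf_add) auto
    fix x
    have "0 \<le> (S x - A x)\<^sup>2" by simp
    thus "4 * (S x * A x) \<le> (P x)\<^sup>2" unfolding PA by (simp add: power2_eq_square algebra_simps)
  qed
  moreover have "J F = 2 * q * J (\<lambda>x. (li x)\<^sup>2 * (rad v x)\<^sup>2) + 2 * q * J (\<lambda>x. (\<sigma> x)\<^sup>2 * (li x)\<^sup>2 * (v x)\<^sup>2) - 3 * q * J (\<lambda>x. li x ^ 4 * (v x)\<^sup>2)"
    by (simp only: F_def J_diff[OF tf_add[OF tf_cmult[OF t(1)] tf_cmult[OF t(2)]] tf_cmult[OF t(3)]]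
      J_add[OF tf_cmult[OF t(1)] tf_cmult[OF t(2)]] J_cmult)
  ultimately have "4 * (2 * q * J (\<lambda>x. (li x)\<^sup>2 * (rad v x)\<^sup>2) + 2 * q * J (\<lambda>x. (\<sigma> x)\<^sup>2 * (li x)\<^sup>2 * (v x)\<^sup>2) - 3 * q * J (\<lambda>x. li x ^ 4 * (v x)\<^sup>2)) \<le> J (\<lambda>x. (P x)\<^sup>2)"
    by (simp add: J_cmult)
  \<comment> \<open>Hardy's inequality turns the radial term with coefficient 8 q into 18 q times
    the integral of li^4 v^2. This outweighs the -12 q already present and leaves the 6 q of the
    claim.\<close>
  moreover have "q * (9 * J (\<lambda>x. li x ^ 4 * (v x)\<^sup>2)) \<le> q * (4 * J (\<lambda>x. (li x)\<^sup>2 * (rad v x)\<^sup>2))"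
    using hardy[OF v] q by (intro mult_left_mono) auto
  ultimately show ?thesis by (simp add: algebra_simps)
qed

section \<open>Weighted norms and estimates for one or two factors\<close>

lemma rad_cong:
  assumes "open A" "x \<in> A" "\<And>y. y \<in> A \<Longrightarrow> f y = g y"
  shows "rad f x = rad g x"
  unfolding rad_def using partial_deriv_cong[OF assms] by simp

lemma Lop_cong:
  assumes "open A" "x \<in> A" "\<And>y. y \<in> A \<Longrightarrow> f y = g y"
  shows "Lop c f x = Lop c g x"
  unfolding Lop_def using laplacian_cong[OF assms] rad_cong[OF assms] assms by simp

lemma wt_inverse: "x \<in> pball \<Longrightarrow> wt a b x * wt (- a) (- b) x = 1"
  by (simp add: wt_mult wt_0)

lemma li_le:
  assumes "x \<in> pball" "x \<in> ball x0 (exp (- K))" "K > 0"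
  shows "li x \<le> 1 / K"
proof -
  have p: "0 < norm (x - x0)" "ln (norm (x - x0)) < 0" using pball_norm[OF assms(1)] by auto
  have "ln (norm (x - x0)) < ln (exp (- K))"
    using assms(2) p(1) by (subst ln_less_cancel_iff) (auto simp: dist_norm norm_minus_commute)
  hence "K < - ln (norm (x - x0))" by simp
  thus ?thesis unfolding wt_def using assms(3) p by (simp add: powr_minus_divide field_simps)
qed

text \<open>The squared norm of \<open>e\<^bsup>-\<tau>\<phi>\<^esup> (- log r)\<^bsup>-j\<^esup> u\<close> in \<open>L\<^sup>2(r\<^sup>-\<^sup>n dx)\<close>.\<close>

definition NN :: "real \<Rightarrow> real \<Rightarrow> (real ^ 'n \<Rightarrow> real) \<Rightarrow> real"
  where "NN \<tau> j u = J (\<lambda>x. (wt (- \<tau>) (- (2 * \<tau> + j)) x * u x)\<^sup>2)"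

lemma tf_NN: "tf R u \<Longrightarrow> tf R (\<lambda>x. (wt a b x * u x)\<^sup>2)"
  by (intro tf_power tf_smooth_mult smooth_on_wt') auto

lemma NN_nonneg: "0 \<le> NN \<tau> j u"
  unfolding NN_def by (rule J_nonneg) simp

lemma NN_shift: "x \<in> pball \<Longrightarrow> wt (- \<tau>) (- (2 * \<tau> + (j + 1))) x = wt (- \<tau>) (- (2 * \<tau> + j)) x * li x"
  by (simp add: wt_mult algebra_simps)

lemma NN_shift2: "x \<in> pball \<Longrightarrow> wt (- \<tau>) (- (2 * \<tau> + (j + 2))) x = wt (- \<tau>) (- (2 * \<tau> + j)) x * (li x)\<^sup>2"
  by (simp add: wt_mult power2_eq_square algebra_simps)

lemma NN_shift_le:
  assumes u: "tf R u" and R: "\<And>x. x \<in> pball \<Longrightarrow> x \<in> ball x0 R \<Longrightarrow> li x \<le> 1"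
  shows "NN \<tau> (j + 1) u \<le> NN \<tau> j u"
  unfolding NN_def
proof (rule J_mono[OF tf_NN[OF u] tf_NN[OF u]])
  fix x assume x: "x \<in> pball"
  show "(wt (- \<tau>) (- (2 * \<tau> + (j + 1))) x * u x)\<^sup>2 \<le> (wt (- \<tau>) (- (2 * \<tau> + j)) x * u x)\<^sup>2"
  proof (cases "x \<in> ball x0 R")
    case True
    have "(li x)\<^sup>2 \<le> 1" using R[OF x True] li_pos[OF x] by (simp add: power_le_one)
    hence "(li x)\<^sup>2 * (wt (- \<tau>) (- (2 * \<tau> + j)) x * u x)\<^sup>2 \<le> 1 * (wt (- \<tau>) (- (2 * \<tau> + j)) x * u x)\<^sup>2"
      by (rule mult_right_mono) simp
    thus ?thesis unfolding NN_shift[OF x] by (simp add: power_mult_distrib mult_ac)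
  qed (use tf_eq_0'[OF u] in simp)
qed

text \<open>Substituting u = r^\<tau> (-log r)^q v replaces \<open>rad\<close> by rad + \<tau> - q
  li. The shift by \<kappa> - c in \<open>\<sigma>\<close> completes the square in the zeroth-order
  coefficient, up to the constant \<kappa>^2 and the derivative of \<open>li\<close>.\<close>

lemma conjugation:
  fixes \<tau> q c e :: real
  assumes u: "tf R u" and x: "x \<in> pball"
  defines "v \<equiv> \<lambda>x. wt (- \<tau>) (- q) x * u x"
  defines "\<kappa> \<equiv> (real CARD('n) - 2) / 2"
  defines "\<sigma> \<equiv> \<lambda>x. \<tau> - c + \<kappa> - q * li x"
  shows "wt (- \<tau>) (- q) x * Lop c u x = (norm (x - x0))\<^sup>2 * laplacian v x - (real CARD('n) - 2) * rad v x
     + ((\<sigma> x)\<^sup>2 - \<kappa>\<^sup>2) * v x + (2 * \<sigma> x * rad v x - q * (li x)\<^sup>2 * v x)"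
    and "wt (- \<tau>) (- q) x * (rad u x - e * u x) = rad v x + (\<tau> - e - q * li x) * v x"
proof -
  let ?E = "wt (- \<tau>) (- q) x" and ?F = "wt \<tau> q x" and ?n = "real CARD('n)"
  have EF: "?E * ?F = 1" using wt_inverse[OF x, of \<tau> q] by (simp add: mult.commute)
  have v: "tf R v" unfolding v_def using u by (intro tf_smooth_mult smooth_on_wt')
  have sv: "smooth_on pball v" using tf_smooth[OF v] .
  have uv: "u y = wt \<tau> q y * v y" if "y \<in> pball" for y
    unfolding v_def using wt_inverse[OF that, of \<tau> q] by (simp flip: mult.assoc)
  have r: "rad u x = ?F * (rad v x + (\<tau> - q * li x) * v x)"
  proof -
    have "rad u x = rad (\<lambda>x. wt \<tau> q x * v x) x" by (rule rad_cong[OF open_pball x uv])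
    thus ?thesis using rad_mult[OF wt_differentiable[OF x] tf_differentiable[OF v], of \<tau> q]
      by (simp add: rad_wt[OF x] algebra_simps)
  qed
  have l: "(norm (x - x0))\<^sup>2 * laplacian u x = ?F * ((norm (x - x0))\<^sup>2 * laplacian v x + 2 * (\<tau> - q * li x) * rad v x
      + ((\<tau> - q * li x)\<^sup>2 - q * (li x)\<^sup>2 + (?n - 2) * (\<tau> - q * li x)) * v x)"
  proof -
    have "laplacian u x = laplacian (\<lambda>x. wt \<tau> q x * v x) x" by (rule laplacian_cong[OF open_pball x uv])
    thus ?thesis using laplacian_wt_mult[OF x sv, of \<tau> q] by simp
  qed
  have "Lop c u x = ?F * ((norm (x - x0))\<^sup>2 * laplacian v x - (?n - 2) * rad v x
     + ((\<sigma> x)\<^sup>2 - \<kappa>\<^sup>2) * v x + (2 * \<sigma> x * rad v x - q * (li x)\<^sup>2 * v x))"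
    unfolding Lop_def l r uv[OF x] \<sigma>_def \<kappa>_def by (simp add: field_simps power2_eq_square)
  thus "?E * Lop c u x = (norm (x - x0))\<^sup>2 * laplacian v x - (?n - 2) * rad v x
     + ((\<sigma> x)\<^sup>2 - \<kappa>\<^sup>2) * v x + (2 * \<sigma> x * rad v x - q * (li x)\<^sup>2 * v x)"
    using EF by (simp flip: mult.assoc)
  have "rad u x - e * u x = ?F * (rad v x + (\<tau> - e - q * li x) * v x)"
    unfolding r uv[OF x] by (simp add: algebra_simps)
  thus "?E * (rad u x - e * u x) = rad v x + (\<tau> - e - q * li x) * v x"
    using EF by (simp flip: mult.assoc)
qed

text \<open>Two uses of \<open>carleman_conjugated\<close>. Off resonance its first term yields s^2
  with the loss of one \<open>li\<close>. With no lower bound on \<sigma> the remainder from Hardy's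
  inequality still controls u, at the price of \<open>li\<close> squared.\<close>

lemma carleman_single:
  assumes u: "tf R u" and \<tau>: "2 * \<tau> + j > 0"
  shows "(\<And>x. x \<in> pball \<Longrightarrow> x \<in> ball x0 R \<Longrightarrow> s \<le> \<bar>\<tau> - c + (real CARD('n) - 2) / 2 - (2 * \<tau> + j) * li x\<bar>) \<Longrightarrow> s \<ge> 0
      \<Longrightarrow> 8 * (2 * \<tau> + j) * s\<^sup>2 * NN \<tau> (j + 1) u \<le> NN \<tau> j (Lop c u)"
    and "6 * (2 * \<tau> + j) * NN \<tau> (j + 2) u \<le> NN \<tau> j (Lop c u)"
proof -
  define q where "q = 2 * \<tau> + j"
  define v where "v = (\<lambda>x. wt (- \<tau>) (- q) x * u x)"
  define \<sigma> where "\<sigma> = (\<lambda>x. \<tau> - c + (real CARD('n) - 2) / 2 - q * li x)"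
  have q: "q > 0" using \<tau> unfolding q_def by simp
  have v: "tf R v" unfolding v_def using u by (intro tf_smooth_mult smooth_on_wt')
  define P where "P = (\<lambda>x. (norm (x - x0))\<^sup>2 * laplacian v x - (real CARD('n) - 2) * rad v x
     + ((\<sigma> x)\<^sup>2 - ((real CARD('n) - 2) / 2)\<^sup>2) * v x + (2 * \<sigma> x * rad v x - q * (li x)\<^sup>2 * v x))"
  have s\<sigma>: "smooth_on pball \<sigma>" unfolding \<sigma>_def by (intro smooth_on_diff smooth_on_const smooth_on_mult smooth_on_wt' open_pball)
  have tP: "tf R P" unfolding P_def
    by (intro tf_add tf_diff tf_cmult tf_smooth_mult tf_laplacian tf_rad v
    smooth_on_const smooth_on_mult smooth_on_add smooth_on_diff smooth_on_power s\<sigma> smooth_on_wt' smooth_on_norm_sq open_pball)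
  have "NN \<tau> j (Lop c u) = J (\<lambda>x. (P x)\<^sup>2)"
    unfolding NN_def
  proof (rule J_cong[OF _ tf_NN[OF tf_Lop[OF u]]])
    show "tf R (\<lambda>x. (P x)\<^sup>2)" using tP by (auto intro: tf_power)
    fix x assume "x \<in> pball"
    from conjugation(1)[OF u this, of \<tau> q c]
    show "(wt (- \<tau>) (- (2 * \<tau> + j)) x * Lop c u x)\<^sup>2 = (P x)\<^sup>2"
      unfolding q_def[symmetric] P_def v_def \<sigma>_def by simp
  qed
  also have "J (\<lambda>x. (P x)\<^sup>2) \<ge> 8 * q * J (\<lambda>x. (\<sigma> x)\<^sup>2 * (li x)\<^sup>2 * (v x)\<^sup>2) + 6 * q * J (\<lambda>x. li x ^ 4 * (v x)\<^sup>2)"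
    unfolding P_def \<sigma>_def by (rule carleman_conjugated[OF v q])
  finally have main: "8 * q * J (\<lambda>x. (\<sigma> x)\<^sup>2 * (li x)\<^sup>2 * (v x)\<^sup>2) + 6 * q * J (\<lambda>x. li x ^ 4 * (v x)\<^sup>2) \<le> NN \<tau> j (Lop c u)" .
  have t1: "tf R (\<lambda>x. (\<sigma> x)\<^sup>2 * (li x)\<^sup>2 * (v x)\<^sup>2)" and t2: "tf R (\<lambda>x. li x ^ 4 * (v x)\<^sup>2)"
    using v by (auto intro!: tf_smooth_mult smooth_on_mult smooth_on_power s\<sigma> smooth_on_wt' tf_power)
  have n1: "0 \<le> q * J (\<lambda>x. (\<sigma> x)\<^sup>2 * (li x)\<^sup>2 * (v x)\<^sup>2)" and n2: "0 \<le> q * J (\<lambda>x. li x ^ 4 * (v x)\<^sup>2)"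
    using q by (auto intro!: mult_nonneg_nonneg J_nonneg)
  have "NN \<tau> (j + 2) u = J (\<lambda>x. li x ^ 4 * (v x)\<^sup>2)"
    unfolding NN_def
    by (rule J_cong[OF _ tf_NN[OF u] t2], subst NN_shift2, assumption)
      (simp add: v_def q_def power_mult_distrib flip: power_mult)
  thus "6 * (2 * \<tau> + j) * NN \<tau> (j + 2) u \<le> NN \<tau> j (Lop c u)"
    using main n1 unfolding q_def[symmetric] by simp
  assume s: "s \<ge> 0" "\<And>x. x \<in> pball \<Longrightarrow> x \<in> ball x0 R \<Longrightarrow> s \<le> \<bar>\<tau> - c + (real CARD('n) - 2) / 2 - (2 * \<tau> + j) * li x\<bar>"
  have "J (\<lambda>x. s\<^sup>2 * (wt (- \<tau>) (- (2 * \<tau> + (j + 1))) x * u x)\<^sup>2) \<le> J (\<lambda>x. (\<sigma> x)\<^sup>2 * (li x)\<^sup>2 * (v x)\<^sup>2)"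
  proof (rule J_mono[OF tf_cmult[OF tf_NN[OF u]] t1])
    fix x assume x: "x \<in> pball"
    show "s\<^sup>2 * (wt (- \<tau>) (- (2 * \<tau> + (j + 1))) x * u x)\<^sup>2 \<le> (\<sigma> x)\<^sup>2 * (li x)\<^sup>2 * (v x)\<^sup>2"
    proof (cases "x \<in> ball x0 R")
      case True
      have "\<bar>s\<bar> \<le> \<bar>\<sigma> x\<bar>" using s(2)[OF x True] s(1) unfolding \<sigma>_def q_def by simp
      hence "s\<^sup>2 \<le> (\<sigma> x)\<^sup>2" by (simp only: abs_le_square_iff)
      hence "s\<^sup>2 * ((li x)\<^sup>2 * (v x)\<^sup>2) \<le> (\<sigma> x)\<^sup>2 * ((li x)\<^sup>2 * (v x)\<^sup>2)" by (rule mult_right_mono) simp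
      thus ?thesis unfolding NN_shift[OF x] by (simp add: v_def q_def power_mult_distrib mult_ac)
    qed (use tf_eq_0'[OF u] in \<open>simp add: v_def\<close>)
  qed
  hence "s\<^sup>2 * NN \<tau> (j + 1) u \<le> J (\<lambda>x. (\<sigma> x)\<^sup>2 * (li x)\<^sup>2 * (v x)\<^sup>2)" unfolding J_cmult NN_def .
  hence "q * (s\<^sup>2 * NN \<tau> (j + 1) u) \<le> q * J (\<lambda>x. (\<sigma> x)\<^sup>2 * (li x)\<^sup>2 * (v x)\<^sup>2)" using q by (intro mult_left_mono) auto
  thus "8 * (2 * \<tau> + j) * s\<^sup>2 * NN \<tau> (j + 1) u \<le> NN \<tau> j (Lop c u)"
    using main n2 unfolding q_def[symmetric] by simp
qed

text \<open>In the square of rad v + \<sigma> v the mixed term is the radial derivative of \<sigma>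
  v^2 plus q li^2 v^2, which is nonnegative because \<sigma> decreases along \<open>rad\<close>. So
  nothing is lost in powers of \<open>li\<close>.\<close>

lemma elliptic_first_order:
  assumes u: "tf R u" and \<tau>: "2 * \<tau> + j > 0" and s: "s \<ge> 0"
    and R: "\<And>x. x \<in> pball \<Longrightarrow> x \<in> ball x0 R \<Longrightarrow> s \<le> \<bar>\<tau> - e - (2 * \<tau> + j) * li x\<bar>"
  shows "s\<^sup>2 * NN \<tau> j u \<le> NN \<tau> j (\<lambda>x. rad u x - e * u x)"
proof -
  define q where "q = 2 * \<tau> + j"
  define v where "v = (\<lambda>x. wt (- \<tau>) (- q) x * u x)"
  define \<sigma> where "\<sigma> = (\<lambda>x. \<tau> - e - q * li x)"
  have q: "q > 0" using \<tau> unfolding q_def by simp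
  have v: "tf R v" unfolding v_def using u by (intro tf_smooth_mult smooth_on_wt')
  have s\<sigma>: "smooth_on pball \<sigma>" unfolding \<sigma>_def by (intro smooth_on_diff smooth_on_const smooth_on_mult smooth_on_wt' open_pball)
  have tP: "tf R (\<lambda>x. rad v x + \<sigma> x * v x)" using v s\<sigma> by auto
  have tG: "tf R (\<lambda>x. \<sigma> x * (v x)\<^sup>2)" using v s\<sigma> by (auto intro!: tf_smooth_mult tf_power)
  have tu: "tf R (\<lambda>x. rad u x - e * u x)" using u by auto
  have "NN \<tau> j (\<lambda>x. rad u x - e * u x) = J (\<lambda>x. (rad v x + \<sigma> x * v x)\<^sup>2)"
    unfolding NN_def
  proof (rule J_cong[OF _ tf_NN[OF tu]])
    show "tf R (\<lambda>x. (rad v x + \<sigma> x * v x)\<^sup>2)" using tP by (auto intro: tf_power)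
    fix x assume "x \<in> pball"
    from conjugation(2)[OF u this, of \<tau> q e]
    show "(wt (- \<tau>) (- (2 * \<tau> + j)) x * (rad u x - e * u x))\<^sup>2 = (rad v x + \<sigma> x * v x)\<^sup>2"
      unfolding q_def[symmetric] v_def \<sigma>_def by simp
  qed
  also have "\<dots> \<ge> J (\<lambda>x. s\<^sup>2 * (wt (- \<tau>) (- (2 * \<tau> + j)) x * u x)\<^sup>2 + rad (\<lambda>x. \<sigma> x * (v x)\<^sup>2) x)"
  proof (rule J_mono)
    show "tf R (\<lambda>x. (rad v x + \<sigma> x * v x)\<^sup>2)" using tP by (auto intro: tf_power)
    show "tf R (\<lambda>x. s\<^sup>2 * (wt (- \<tau>) (- (2 * \<tau> + j)) x * u x)\<^sup>2 + rad (\<lambda>x. \<sigma> x * (v x)\<^sup>2) x)"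
      using u tG by (intro tf_add tf_cmult tf_NN tf_rad)
    fix x assume x: "x \<in> pball"
    have sd: "\<sigma> differentiable (at x)" using smooth_on_differentiable[OF s\<sigma> x] .
    have rs: "rad \<sigma> x = - q * (li x)\<^sup>2" unfolding \<sigma>_def using wt_differentiable[OF x]
      by (simp add: rad_diff rad_const rad_cmult rad_li[OF x])
    have r: "rad (\<lambda>x. \<sigma> x * (v x)\<^sup>2) x = 2 * \<sigma> x * v x * rad v x - q * (li x)\<^sup>2 * (v x)\<^sup>2"
      using rad_mult[OF sd, of "\<lambda>x. (v x)\<^sup>2"] tf_differentiable[OF v] by (simp add: rad_power rs)
    have "s\<^sup>2 * (v x)\<^sup>2 \<le> (\<sigma> x)\<^sup>2 * (v x)\<^sup>2"
    proof (cases "x \<in> ball x0 R")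
      case True
      have "\<bar>s\<bar> \<le> \<bar>\<sigma> x\<bar>" using R[OF x True] s unfolding \<sigma>_def q_def by simp
      hence "s\<^sup>2 \<le> (\<sigma> x)\<^sup>2" by (simp only: abs_le_square_iff)
      thus ?thesis by (rule mult_right_mono) simp
    qed (use tf_eq_0'[OF v] in simp)
    moreover have "0 \<le> (rad v x)\<^sup>2" "0 \<le> q * (li x)\<^sup>2 * (v x)\<^sup>2" using q by auto
    moreover have "(rad v x + \<sigma> x * v x)\<^sup>2 = (rad v x)\<^sup>2 + (\<sigma> x)\<^sup>2 * (v x)\<^sup>2 + 2 * \<sigma> x * v x * rad v x"
      by (simp add: power2_eq_square algebra_simps)
    moreover have e1: "wt (- \<tau>) (- (2 * \<tau> + j)) x * u x = v x" unfolding v_def q_def ..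
    ultimately show "s\<^sup>2 * (wt (- \<tau>) (- (2 * \<tau> + j)) x * u x)\<^sup>2 + rad (\<lambda>x. \<sigma> x * (v x)\<^sup>2) x \<le> (rad v x + \<sigma> x * v x)\<^sup>2"
      unfolding r e1 by linarith
  qed
  also have "J (\<lambda>x. s\<^sup>2 * (wt (- \<tau>) (- (2 * \<tau> + j)) x * u x)\<^sup>2 + rad (\<lambda>x. \<sigma> x * (v x)\<^sup>2) x) = s\<^sup>2 * NN \<tau> j u"
    using J_add[OF tf_cmult[OF tf_NN[OF u]] tf_rad[OF tG]] J_rad[OF tG] by (simp add: J_cmult NN_def)
  finally show ?thesis .
qed

text \<open>For bounded \<open>\<tau>\<close> one factor \<open>Lop b\<close> may be resonant and lose \<open>li\<^sup>2\<close>. Because \<open>Lop b - Lop c\<close> is a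
  multiple of the first-order operator \<open>rad - e\<close>, which is then elliptic, a resonant and a
  non-resonant factor together still lose only \<open>li\<^sup>2\<close>.\<close>

lemma carleman_pair:
  assumes u: "tf R u" and \<tau>: "\<tau> > 1" and j: "j \<ge> 0"
    and li: "\<And>x. x \<in> pball \<Longrightarrow> x \<in> ball x0 R \<Longrightarrow> li x \<le> 1"
    and li': "\<And>x. x \<in> pball \<Longrightarrow> x \<in> ball x0 R \<Longrightarrow> (2 * \<tau> + (j + 2)) * li x \<le> 1 / 4"
    and bc: "\<bar>b - c\<bar> = 2" and b: "\<bar>\<tau> - b + (real CARD('n) - 2) / 2\<bar> < 1 / 2"
  shows "NN \<tau> (j + 2) u \<le> 4 * NN \<tau> j (Lop b (Lop c u))"
proof -
  let ?k = "(real CARD('n) - 2) / 2"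
  define F where "F = NN \<tau> j (Lop b (Lop c u))"
  have F': "F = NN \<tau> j (Lop c (Lop b u))"
    unfolding F_def using Lop_commute[OF tf_smooth[OF u], of b c] by presburger
  have lip: "(2 * \<tau> + j) * li x \<le> 1/4" "(2 * \<tau> + j) * li x \<ge> 0" "(2 * \<tau> + (j + 2)) * li x \<ge> 0"
    if "x \<in> pball" "x \<in> ball x0 R" for x
  proof -
    show "(2 * \<tau> + j) * li x \<ge> 0" "(2 * \<tau> + (j + 2)) * li x \<ge> 0"
      using li_pos[OF that(1)] \<tau> j by (auto intro!: mult_nonneg_nonneg)
    show "(2 * \<tau> + j) * li x \<le> 1/4" using li'[OF that] li_pos[OF that(1)] by (simp add: algebra_simps)
  qed
  \<comment> \<open>\<open>Lop c\<close> acts off resonance: \<tau> - c + k has modulus at least 1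
    and the term with \<open>li\<close> is at most 1/4. The bound with s = 1/4 is generous, and 8 (2
    \<tau> + j)/16 >= 1 because \<tau> > 1.\<close>
  have "NN \<tau> (j + 2) (Lop b u) \<le> F"
  proof -
    have "8 * (2 * \<tau> + j) * (1/4)\<^sup>2 * NN \<tau> (j + 1) (Lop b u) \<le> F" unfolding F'
    proof (rule carleman_single(1)[OF tf_Lop[OF u]])
      show "2 * \<tau> + j > 0" using \<tau> j by simp
      show "1 / 4 \<le> \<bar>\<tau> - c + ?k - (2 * \<tau> + j) * li x\<bar>" if "x \<in> pball" "x \<in> ball x0 R" for x
      proof -
        have "\<bar>\<tau> - c + ?k\<bar> \<ge> 1" using bc b by linarith
        thus ?thesis using lip[OF that] by linarith
      qed
    qed simp
    moreover have "1 * NN \<tau> (j + 1) (Lop b u) \<le> 8 * (2 * \<tau> + j) * (1/4)\<^sup>2 * NN \<tau> (j + 1) (Lop b u)"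
      using \<tau> j NN_nonneg by (intro mult_right_mono) (auto simp: power2_eq_square)
    moreover have "NN \<tau> (j + 1 + 1) (Lop b u) \<le> NN \<tau> (j + 1) (Lop b u)"
      by (rule NN_shift_le[OF tf_Lop[OF u] li])
    ultimately show ?thesis by (simp add: add.assoc)
  qed
  moreover have "NN \<tau> (j + 2) (Lop c u) \<le> F"
  proof -
    have "6 * (2 * \<tau> + j) * NN \<tau> (j + 2) (Lop c u) \<le> F" unfolding F_def
      by (rule carleman_single(2)[OF tf_Lop[OF u]]) (use \<tau> j in simp)
    moreover have "1 * NN \<tau> (j + 2) (Lop c u) \<le> 6 * (2 * \<tau> + j) * NN \<tau> (j + 2) (Lop c u)"
      using \<tau> j NN_nonneg by (intro mult_right_mono) auto
    ultimately show ?thesis by simp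
  qed
  \<comment> \<open>The constant of \<open>Lop_diff\<close>. It is the midpoint of the resonances b
    - k and c - k, hence at distance 1 from each, and \<tau> lies within 1/2 of the first.\<close>
  moreover define e where "e = (b + c - (real CARD('n) - 2)) / 2"
  define w where "w = (\<lambda>x. rad u x - e * u x)"
  have w: "tf R w" unfolding w_def using u by auto
  have "(1/4)\<^sup>2 * NN \<tau> (j + 2) u \<le> NN \<tau> (j + 2) w"
    unfolding w_def
  proof (rule elliptic_first_order[OF u])
    show "2 * \<tau> + (j + 2) > 0" using \<tau> j by simp
    show "1/4 \<le> \<bar>\<tau> - e - (2 * \<tau> + (j + 2)) * li x\<bar>" if "x \<in> pball" "x \<in> ball x0 R" for x
    proof -
      have "e = b - ?k + (c - b) / 2" unfolding e_def by (simp add: field_simps)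
      moreover have "(c - b) / 2 = 1 \<or> (c - b) / 2 = - 1" using bc by (cases "b - c \<ge> 0") auto
      ultimately have "\<bar>\<tau> - e\<bar> \<ge> 1/2" using b by linarith
      thus ?thesis using li'[OF that] lip[OF that] by linarith
    qed
  qed simp
  \<comment> \<open>Since |b - c| = 2, the difference of the two images of u is w with a coefficient
    of modulus 4.\<close>
  moreover have "16 * NN \<tau> (j + 2) w \<le> 2 * NN \<tau> (j + 2) (Lop b u) + 2 * NN \<tau> (j + 2) (Lop c u)"
  proof -
    let ?W = "wt (- \<tau>) (- (2 * \<tau> + (j + 2)))"
    note t = tf_NN[OF w] tf_NN[OF tf_Lop[OF u]]
    have "J (\<lambda>x. 16 * (?W x * w x)\<^sup>2) \<le> J (\<lambda>x. 2 * (?W x * Lop b u x)\<^sup>2 + 2 * (?W x * Lop c u x)\<^sup>2)"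
    proof (rule J_mono[of R])
      fix x
      have "Lop b u x - Lop c u x = - 2 * (b - c) * w x"
        unfolding w_def e_def by (rule Lop_diff)
      hence "(Lop b u x - Lop c u x)\<^sup>2 = (- 2)\<^sup>2 * (b - c)\<^sup>2 * (w x)\<^sup>2" by (simp only: power_mult_distrib)
      hence "(Lop b u x - Lop c u x)\<^sup>2 = 4 * \<bar>b - c\<bar>\<^sup>2 * (w x)\<^sup>2" by simp
      hence "16 * (w x)\<^sup>2 = (Lop b u x - Lop c u x)\<^sup>2" unfolding bc by simp
      also have "\<dots> \<le> 2 * (Lop b u x)\<^sup>2 + 2 * (Lop c u x)\<^sup>2"
        using zero_le_power2[of "Lop b u x + Lop c u x"] by (simp add: power2_eq_square algebra_simps)
      finally have "(?W x)\<^sup>2 * (16 * (w x)\<^sup>2) \<le> (?W x)\<^sup>2 * (2 * (Lop b u x)\<^sup>2 + 2 * (Lop c u x)\<^sup>2)"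
        by (rule mult_left_mono) simp
      thus "16 * (?W x * w x)\<^sup>2 \<le> 2 * (?W x * Lop b u x)\<^sup>2 + 2 * (?W x * Lop c u x)\<^sup>2"
        by (simp add: power_mult_distrib algebra_simps)
    qed (intro tf_add tf_cmult t)+
    also have "\<dots> = 2 * NN \<tau> (j + 2) (Lop b u) + 2 * NN \<tau> (j + 2) (Lop c u)"
      unfolding NN_def by (subst J_add[OF tf_cmult[OF t(2)] tf_cmult[OF t(2)]]) (simp add: J_cmult)
    finally show ?thesis unfolding J_cmult NN_def .
  qed
  ultimately show ?thesis unfolding F_def[symmetric] by (simp add: power2_eq_square)
qed

text \<open>With w 0 = u and w m = r^(2m) times the m-th power of the Laplacian, this factorises the
  right-hand operator into \<open>Lop 0\<close>, \<open>Lop 2\<close>, up to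
  \<open>Lop (2 (m - 1))\<close>, each of them one step along w.\<close>

lemma iterated_laplacian_Lop:
  assumes u: "tf R u"
  defines "w \<equiv> \<lambda>i x. norm (x - x0) ^ (2 * i) * (laplacian ^^ i) u x"
  shows "tf R (w i)" and "Lop (2 * real i) (w i) = w (Suc i)"
proof -
  have tl: "tf R ((laplacian ^^ i) u)" for i by (induction i) (auto simp: u)
  have "smooth_on pball (\<lambda>x. norm (x - x0) ^ (2 * i))" for i
    using smooth_on_power[OF open_pball smooth_on_norm_sq[OF open_pball], of i] by (simp add: power_mult)
  hence tw: "tf R (w i)" for i unfolding w_def using tl by (intro tf_smooth_mult)
  show "tf R (w i)" by (rule tw)
  have wt: "wt (2 * real i) 0 x = norm (x - x0) ^ (2 * i)" if "x \<in> pball" for x i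
    unfolding wt_def using pball_norm[OF that] powr_realpow[of "norm (x - x0)" "2 * i"] by simp
  show "Lop (2 * real i) (w i) = w (Suc i)"
  proof
    fix x
    show "Lop (2 * real i) (w i) x = w (Suc i) x"
    proof (cases "x \<in> pball")
      case True
      have "Lop (2 * real i) (w i) x = Lop (2 * real i) (\<lambda>x. wt (2 * real i) 0 x * (laplacian ^^ i) u x) x"
        by (rule Lop_cong[OF open_pball True]) (simp add: w_def wt)
      also have "\<dots> = wt (2 * real i) 0 x * ((norm (x - x0))\<^sup>2 * (laplacian ^^ Suc i) u x)"
        using Lop_wt[OF True tf_smooth[OF tl]] by simp
      also have "\<dots> = w (Suc i) x" unfolding wt[OF True] w_def by (simp add: power2_eq_square)
      finally show ?thesis .
    next
      case False
      thus ?thesis using tf_eq_0[OF tw] tf_eq_0[OF tf_Lop[OF tw]] by metis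
    qed
  qed
qed

text \<open>For \<tau> >= 9 m the \<sigma> of every factor is at least \<tau>/2, and each factor
  contributes \<tau>^3 and one \<open>li\<close>. For smaller \<tau> the power \<tau>^(3m) is
  bounded, and only the total loss has to stay at \<open>li\<close> to the power m; the resonant
  pair spends exactly the two powers that two ordinary factors would.\<close>

theorem carleman_polyharmonic:
  fixes m :: nat
  assumes m: "m \<ge> 2"
  shows "\<exists>C>0. \<forall>\<tau>>1. \<forall>u. tf (exp (- 100 * real m)) u \<longrightarrow>
    \<tau> ^ (3 * m) * NN \<tau> (real m) u \<le> C * NN \<tau> 0 (\<lambda>x. norm (x - x0) ^ (2 * m) * (laplacian ^^ m) u x)"
proof (intro exI[of _ "4 * (9 * real m) ^ (3 * m)"] conjI allI impI)
  show "0 < 4 * (9 * real m) ^ (3 * m)" using m by simp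
  fix \<tau> :: real and u assume \<tau>: "\<tau> > 1" and u: "tf (exp (- 100 * real m)) u"
  \<comment> \<open>On this ball \<open>li\<close> is at most 1/(100 m). For \<tau> < 9 m and j <= m
    it follows that (2 \<tau> + j + 2) li <= 20 m li <= 1/5, within the margin 1/4 used off
    resonance.\<close>
  define R where "R = exp (- 100 * real m)"
  define k where "k = (real CARD('n) - 2) / 2"
  have k: "k \<ge> - 1/2"
  proof -
    have "CARD('n) \<ge> 1" using zero_less_card_finite[where 'a='n] by linarith
    thus ?thesis unfolding k_def by simp
  qed
  have li: "100 * real m * li x \<le> 1" if "x \<in> pball" "x \<in> ball x0 R" for x
    using li_le[OF that(1), of "100 * real m"] that(2) m unfolding R_def by (simp add: field_simps)
  have li1: "li x \<le> 1 / 200" if "x \<in> pball" "x \<in> ball x0 R" for x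
  proof -
    have "2 * li x \<le> real m * li x" using m li_pos[OF that(1)] by (intro mult_right_mono) auto
    thus ?thesis using li[OF that] by simp
  qed
  define w where "w = (\<lambda>i x. norm (x - x0) ^ (2 * i) * (laplacian ^^ i) u x)"
  have w: "tf R (w i)" "Lop (2 * real i) (w i) = w (Suc i)" for i
    unfolding R_def w_def by (rule iterated_laplacian_Lop[OF u])+
  have w0: "w 0 = u" unfolding w_def by auto
  have step: "8 * (2 * \<tau> + real j) * s\<^sup>2 * NN \<tau> (real (Suc j)) (w i) \<le> NN \<tau> (real j) (w (Suc i))"
    if "\<And>x. x \<in> pball \<Longrightarrow> x \<in> ball x0 R \<Longrightarrow> s \<le> \<bar>\<tau> - 2 * real i + k - (2 * \<tau> + real j) * li x\<bar>" "s \<ge> 0" for s i j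
    using carleman_single(1)[OF w(1), of \<tau> "real j" s "2 * real i" i] that \<tau> unfolding w(2) k_def[symmetric]
    by (simp add: add.commute)
  show "\<tau> ^ (3 * m) * NN \<tau> (real m) u \<le> 4 * (9 * real m) ^ (3 * m) * NN \<tau> 0 (\<lambda>x. norm (x - x0) ^ (2 * m) * (laplacian ^^ m) u x)"
  proof (cases "\<tau> \<ge> 9 * real m")
    case True
    have st: "\<tau> ^ 3 * NN \<tau> (real (Suc j)) (w i) \<le> NN \<tau> (real j) (w (Suc i))" if "i < m" "j \<le> m" for i j
    proof -
      have "8 * (2 * \<tau> + real j) * (\<tau> / 2)\<^sup>2 * NN \<tau> (real (Suc j)) (w i) \<le> NN \<tau> (real j) (w (Suc i))"
      proof (rule step)
        fix x assume x: "x \<in> pball" "x \<in> ball x0 R"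
        have "(2 * \<tau> + real j) * li x \<le> (2 * \<tau> + real m) * (1 / 200)"
          using li1[OF x] li_pos[OF x(1)] \<tau> that by (intro mult_mono) auto
        moreover have "real i + 1 \<le> real m" using that by simp
        moreover have "0 \<le> real m" by simp
        ultimately have "\<tau> / 2 \<le> \<tau> - 2 * real i + k - (2 * \<tau> + real j) * li x"
          using True k by (simp add: field_simps)
        thus "\<tau> / 2 \<le> \<bar>\<tau> - 2 * real i + k - (2 * \<tau> + real j) * li x\<bar>" by linarith
      qed (use \<tau> in simp)
      moreover have "\<tau> ^ 3 * NN \<tau> (real (Suc j)) (w i) \<le> 8 * (2 * \<tau> + real j) * (\<tau> / 2)\<^sup>2 * NN \<tau> (real (Suc j)) (w i)"
      proof (rule mult_right_mono[OF _ NN_nonneg])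
        have "\<tau> * \<tau>\<^sup>2 \<le> (2 * (2 * \<tau> + real j)) * \<tau>\<^sup>2" using \<tau> by (intro mult_right_mono) auto
        thus "\<tau> ^ 3 \<le> 8 * (2 * \<tau> + real j) * (\<tau> / 2)\<^sup>2" by (simp add: power2_eq_square power3_eq_cube algebra_simps)
      qed
      ultimately show ?thesis by linarith
    qed
    have "\<tau> ^ (3 * j) * NN \<tau> (real j) (w (m - j)) \<le> NN \<tau> 0 (w m)" if "j \<le> m" for j
      using that
    proof (induction j)
      case (Suc j)
      have "\<tau> ^ (3 * j) * (\<tau> ^ 3 * NN \<tau> (real (Suc j)) (w (m - Suc j))) \<le> \<tau> ^ (3 * j) * NN \<tau> (real j) (w (m - j))"
        using st[of "m - Suc j" j] Suc.prems \<tau> by (intro mult_left_mono) (auto simp: Suc_diff_Suc)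
      also have "\<dots> \<le> NN \<tau> 0 (w m)" using Suc by simp
      finally show ?case by (simp add: power_add mult_ac flip: power_mult)
    qed simp
    from this[of m] have "\<tau> ^ (3 * m) * NN \<tau> (real m) u \<le> NN \<tau> 0 (w m)" using w0 by simp
    also have "\<dots> \<le> 4 * (9 * real m) ^ (3 * m) * NN \<tau> 0 (w m)"
    proof -
      have "1 \<le> (9 * real m) ^ (3 * m)" using m by (intro one_le_power) auto
      hence "1 * NN \<tau> 0 (w m) \<le> 4 * (9 * real m) ^ (3 * m) * NN \<tau> 0 (w m)"
        by (intro mult_right_mono NN_nonneg) auto
      thus ?thesis by simp
    qed
    finally show ?thesis unfolding w_def .
  next
    case False
    have lip: "(2 * \<tau> + (real j + 2)) * li x \<le> 1/4" "(2 * \<tau> + real j) * li x \<le> 1/4" "(2 * \<tau> + real j) * li x \<ge> 0"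
      if "x \<in> pball" "x \<in> ball x0 R" "j \<le> m" for x j
    proof -
      have "(2 * \<tau> + (real j + 2)) * li x \<le> (20 * real m) * li x"
        using False that li_pos[OF that(1)] m by (intro mult_right_mono) auto
      thus *: "(2 * \<tau> + (real j + 2)) * li x \<le> 1/4" using li[OF that(1,2)] by simp
      show "(2 * \<tau> + real j) * li x \<ge> 0" using \<tau> li_pos[OF that(1)] by (intro mult_nonneg_nonneg) auto
      show "(2 * \<tau> + real j) * li x \<le> 1/4"
        using * li_pos[OF that(1)] by (simp add: algebra_simps)
    qed
    have good: "NN \<tau> (real (Suc j)) (w i) \<le> NN \<tau> (real j) (w (Suc i))"
      if "j \<le> m" "\<bar>\<tau> - 2 * real i + k\<bar> \<ge> 1/2" for i j
    proof -
      have "8 * (2 * \<tau> + real j) * (1/4)\<^sup>2 * NN \<tau> (real (Suc j)) (w i) \<le> NN \<tau> (real j) (w (Suc i))"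
      proof (rule step)
        fix x assume x: "x \<in> pball" "x \<in> ball x0 R"
        show "1/4 \<le> \<bar>\<tau> - 2 * real i + k - (2 * \<tau> + real j) * li x\<bar>"
          using lip(2,3)[OF x that(1)] that(2) by linarith
      qed simp
      moreover have "1 * NN \<tau> (real (Suc j)) (w i) \<le> 8 * (2 * \<tau> + real j) * (1/4)\<^sup>2 * NN \<tau> (real (Suc j)) (w i)"
        using \<tau> by (intro mult_right_mono NN_nonneg) (auto simp: power2_eq_square)
      ultimately show ?thesis by simp
    qed
    \<comment> \<open>A run of consecutive factors, all off resonance, costs one power of
      \<open>li\<close> each.\<close>
    have chain: "NN \<tau> (real (j + l)) (w a) \<le> NN \<tau> (real j) (w (a + l))"
      if "j + l \<le> m" "\<And>i. a \<le> i \<Longrightarrow> i < a + l \<Longrightarrow> \<bar>\<tau> - 2 * real i + k\<bar> \<ge> 1/2" for a j l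
      using that
    proof (induction l arbitrary: j)
      case (Suc l)
      have "NN \<tau> (real (Suc j + l)) (w a) \<le> NN \<tau> (real (Suc j)) (w (a + l))"
        by (rule Suc.IH) (use Suc.prems in auto)
      also have "\<dots> \<le> NN \<tau> (real j) (w (Suc (a + l)))"
        by (rule good) (use Suc.prems(1) Suc.prems(2)[of "a + l"] in auto)
      finally show ?case by simp
    qed simp
    have "NN \<tau> (real m) (w 0) \<le> 4 * NN \<tau> 0 (w m)"
    proof (cases "\<exists>b<m. \<bar>\<tau> - 2 * real b + k\<bar> < 1/2")
      case False
      have "1 / 2 \<le> \<bar>\<tau> - 2 * real i + k\<bar>" if "i < m" for i using False that leI by blast
      hence "NN \<tau> (real (0 + m)) (w 0) \<le> NN \<tau> (real 0) (w (0 + m))"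
        by (intro chain) auto
      thus ?thesis using NN_nonneg[of \<tau> 0 "w m"] by simp
    next
      case True
      then obtain b where b: "b < m" "\<bar>\<tau> - 2 * real b + k\<bar> < 1/2" by blast
      have other: "\<bar>\<tau> - 2 * real i + k\<bar> \<ge> 1/2" if "i \<noteq> b" for i
      proof -
        have "\<bar>real i - real b\<bar> \<ge> 1" using that by linarith
        thus ?thesis using b(2) by linarith
      qed
      \<comment> \<open>The pair l, l + 1 contains the resonant index b. The partner is b + 1 unless
        b is the last factor; in that case it is b - 1, which exists because m >= 2.\<close>
      define l where "l = (if Suc b < m then b else b - 1)"
      have l: "Suc l < m" "l = b \<or> Suc l = b" using b m unfolding l_def by auto
      define j where "j = m - l - 2"
      have j: "j + 2 + l = m" "l + 2 + j = m" using l(1) unfolding j_def by auto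
      have Lw: "w (l + 2) = Lop (2 * real (Suc l)) (Lop (2 * real l) (w l))" unfolding w(2) by simp
      have comm: "Lop (2 * real (Suc l)) (Lop (2 * real l) (w l)) = Lop (2 * real l) (Lop (2 * real (Suc l)) (w l))"
        using Lop_commute[OF tf_smooth[OF w(1)]] by blast
      define c where "c = (if l = b then Suc l else l)"
      have Lw': "w (l + 2) = Lop (2 * real b) (Lop (2 * real c) (w l))"
        using l(2) comm Lw unfolding c_def by auto
      have pair: "NN \<tau> (real j + 2) (w l) \<le> 4 * NN \<tau> (real j) (w (l + 2))"
        unfolding Lw'
      proof (rule carleman_pair[OF w(1) \<tau>])
        show "li x \<le> 1" if "x \<in> pball" "x \<in> ball x0 R" for x using li1[OF that] by simp
        show "(2 * \<tau> + (real j + 2)) * li x \<le> 1 / 4" if "x \<in> pball" "x \<in> ball x0 R" for x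
          using lip(1)[OF that] j by simp
        show "\<bar>2 * real b - 2 * real c\<bar> = 2" using l(2) unfolding c_def by auto
        show "\<bar>\<tau> - 2 * real b + (real CARD('n) - 2) / 2\<bar> < 1 / 2" using b(2) unfolding k_def .
      qed simp
      have "NN \<tau> (real m) (w 0) \<le> NN \<tau> (real (j + 2)) (w (0 + l))"
        unfolding j(1)[symmetric] by (rule chain) (use j l other in auto)
      also have "\<dots> \<le> 4 * NN \<tau> (real (0 + j)) (w (l + 2))" using pair by (simp add: add.commute)
      also have "NN \<tau> (real (0 + j)) (w (l + 2)) \<le> NN \<tau> (real 0) (w (l + 2 + j))"
        by (rule chain) (use j l other in auto)
      finally show ?thesis unfolding j(2) by simp
    qed
    moreover have "\<tau> ^ (3 * m) \<le> (9 * real m) ^ (3 * m)" using False \<tau> by (intro power_mono) auto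
    ultimately have "\<tau> ^ (3 * m) * NN \<tau> (real m) (w 0) \<le> (9 * real m) ^ (3 * m) * (4 * NN \<tau> 0 (w m))"
      using NN_nonneg \<tau> by (intro mult_mono) auto
    thus ?thesis unfolding w0 unfolding w_def by (simp add: mult_ac)
  qed
qed

end

subsection \<open>Interior elliptic estimates\<close>

lemma young_ineq: "c > 0 \<Longrightarrow> a * b \<le> c * a\<^sup>2 + b\<^sup>2 / (4 * c)" for a b c :: real
proof -
  assume c: "c > 0"
  have "0 \<le> (2 * c * a - b)\<^sup>2 / (4 * c)" using c by simp
  also have "\<dots> = c * a\<^sup>2 + b\<^sup>2 / (4 * c) - a * b" using c by (simp add: power2_eq_square field_simps)
  finally show ?thesis by simp
qed

context punctured_space
begin

definition I :: "(real ^ 'n \<Rightarrow> real) \<Rightarrow> real"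
  where "I f = (\<integral>x. f x \<partial>lborel)"

lemma I_add: "tf R f \<Longrightarrow> tf R g \<Longrightarrow> I (\<lambda>x. f x + g x) = I f + I g"
  unfolding I_def by (simp add: tf_integrable)

lemma I_diff: "tf R f \<Longrightarrow> tf R g \<Longrightarrow> I (\<lambda>x. f x - g x) = I f - I g"
  unfolding I_def by (simp add: tf_integrable)

lemma I_cmult: "I (\<lambda>x. c * f x) = c * I f"
  unfolding I_def by simp

lemma I_sum: "(\<And>k. k \<in> A \<Longrightarrow> tf R (f k)) \<Longrightarrow> I (\<lambda>x. \<Sum>k\<in>A. f k x) = (\<Sum>k\<in>A. I (f k))"
  unfolding I_def by (rule Bochner_Integration.integral_sum) (blast intro: tf_integrable)

lemma I_mono:
  assumes "tf R f" "tf R g" "\<And>x. x \<in> pball \<Longrightarrow> x \<in> ball x0 R \<Longrightarrow> f x \<le> g x"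
  shows "I f \<le> I g"
  unfolding I_def
proof (rule integral_mono)
  fix x
  show "f x \<le> g x"
    using assms(3)[of x] tf_eq_0[OF assms(1), of x] tf_eq_0[OF assms(2), of x] tf_eq_0'[OF assms(1), of x] tf_eq_0'[OF assms(2), of x]
    by fastforce
qed (use tf_integrable assms in auto)

lemma I_nonneg: "(\<And>x. 0 \<le> f x) \<Longrightarrow> 0 \<le> I f"
  unfolding I_def by (rule Bochner_Integration.integral_nonneg)

lemma I_partial_deriv: "tf R f \<Longrightarrow> I (partial_deriv i f) = 0"
  unfolding I_def by (rule tf_integral_partial_deriv)

lemma I_div:
  assumes "\<And>k. k \<in> A \<Longrightarrow> tf R (g k)"
  shows "I (\<lambda>x. \<Sum>k\<in>A. partial_deriv (i k) (g k) x) = 0"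
proof -
  have "I (\<lambda>x. \<Sum>k\<in>A. partial_deriv (i k) (g k) x) = (\<Sum>k\<in>A. I (partial_deriv (i k) (g k)))"
    using assms by (intro I_sum[where R=R] tf_partial_deriv)
  thus ?thesis using I_partial_deriv[OF assms] by simp
qed

lemma I_sum2:
  assumes "\<And>i j. tf R (f i j)"
  shows "I (\<lambda>x. \<Sum>i\<in>A. \<Sum>j\<in>B. f i j x) = (\<Sum>i\<in>A. \<Sum>j\<in>B. I (f i j))"
proof -
  have "I (\<lambda>x. \<Sum>i\<in>A. \<Sum>j\<in>B. f i j x) = (\<Sum>i\<in>A. I (\<lambda>x. \<Sum>j\<in>B. f i j x))"
    using assms by (intro I_sum[where R=R] tf_sum)
  also have "\<dots> = (\<Sum>i\<in>A. \<Sum>j\<in>B. I (f i j))" using assms by (intro sum.cong refl I_sum[where R=R])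
  finally show ?thesis .
qed

text \<open>Lebesgue measure is used here and the density r^-n is hidden in the exponent a, so that
  divergences integrate to zero without correction terms.\<close>

definition Sq :: "real \<Rightarrow> real \<Rightarrow> (real ^ 'n \<Rightarrow> real) \<Rightarrow> real"
  where "Sq a b f = I (\<lambda>x. (wt a b x * f x)\<^sup>2)"

lemma Sq_nonneg: "0 \<le> Sq a b f"
  unfolding Sq_def by (rule I_nonneg) simp

lemma rad_sq_le: "(rad u x)\<^sup>2 \<le> (norm (x - x0))\<^sup>2 * (\<Sum>i\<in>UNIV. (partial_deriv i u x)\<^sup>2)"
proof -
  have "(rad u x)\<^sup>2 \<le> (\<Sum>i\<in>UNIV. (x $ i - x0 $ i)\<^sup>2) * (\<Sum>i\<in>UNIV. (partial_deriv i u x)\<^sup>2)"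
    unfolding rad_def by (rule Cauchy_Schwarz_ineq_sum)
  thus ?thesis by (simp add: norm_sq_coordinates)
qed

lemma wt_sq: "x \<in> pball \<Longrightarrow> (wt a b x)\<^sup>2 = wt (2 * a) (2 * b) x"
  using wt_power[of x a b 2] by simp

lemma wt_norm1: "x \<in> pball \<Longrightarrow> wt (a + 1) b x = wt a b x * norm (x - x0)"
  using wt_mult[of x a b 1 0] pball_norm[of x] by (simp add: wt_def)

lemma wt_norm2: "x \<in> pball \<Longrightarrow> wt (a + 2) b x = wt a b x * (norm (x - x0))\<^sup>2"
  using wt_norm[of x "a + 2" b] by simp

lemma sum_partial_wt':
  assumes "x \<in> pball"
  shows "(\<Sum>i\<in>UNIV. partial_deriv i (wt (2 * a + 2) (2 * b)) x * partial_deriv i f x)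
    = (wt a b x)\<^sup>2 * (2 * a + 2 - 2 * b * li x) * rad f x"
proof -
  have "(norm (x - x0))\<^sup>2 * (\<Sum>i\<in>UNIV. partial_deriv i (wt (2 * a + 2) (2 * b)) x * partial_deriv i f x)
    = (norm (x - x0))\<^sup>2 * ((wt a b x)\<^sup>2 * (2 * a + 2 - 2 * b * li x) * rad f x)"
    unfolding sum_partial_wt[OF assms] wt_sq[OF assms] by (subst wt_norm2[OF assms]) simp
  moreover have "norm (x - x0) \<noteq> 0" using pball_norm[OF assms] by simp
  ultimately show ?thesis by simp
qed

context
  fixes R :: real
  assumes R: "R \<le> exp (- 1)"
begin

lemma li_le_1: "x \<in> pball \<Longrightarrow> x \<in> ball x0 R \<Longrightarrow> li x \<le> 1"
  using li_le[of x 1] R by (force simp: mem_ball)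

lemma coeff_bound:
  assumes "x \<in> pball" "x \<in> ball x0 R" "\<bar>a\<bar> \<le> \<Lambda>" "\<bar>b\<bar> \<le> \<Lambda>" "\<Lambda> \<ge> 1" "0 \<le> s" "s \<le> 4"
  shows "\<bar>2 * a + s - 2 * b * li x\<bar> \<le> 8 * \<Lambda>"
proof -
  have "\<bar>2 * b * li x\<bar> \<le> 2 * \<Lambda> * 1"
    unfolding abs_mult using assms li_le_1[OF assms(1,2)] li_pos[OF assms(1)] by (intro mult_mono) auto
  thus ?thesis using assms by linarith
qed

text \<open>Caccioppoli's inequality, from the divergence of h u grad u with h = r^(2a+2) (-log
  r)^(2b). The logarithmic gradient of h is at most 8 \<Lambda>/r, so \<Lambda>/r acts as the
  frequency to which a derivative is compared.\<close>

lemma gradient_estimate: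
  assumes u: "tf R u" and ab: "\<bar>a\<bar> \<le> \<Lambda>" "\<bar>b\<bar> \<le> \<Lambda>" "\<Lambda> \<ge> 1" and e: "\<epsilon> > 0"
  shows "(\<Sum>i\<in>UNIV. Sq (a + 1) b (partial_deriv i u))
    \<le> \<epsilon> / \<Lambda>\<^sup>2 * Sq (a + 2) b (laplacian u) + (1 / \<epsilon> + 64) * \<Lambda>\<^sup>2 * Sq a b u"
proof -
  define h where "h = wt (2 * a + 2) (2 * b)"
  have sh: "smooth_on pball h" unfolding h_def by (rule smooth_on_wt)
  define g where "g = (\<lambda>i x. h x * (u x * partial_deriv i u x))"
  have g: "tf R (g i)" for i unfolding g_def by (intro tf_smooth_mult sh tf_smooth[OF u] tf_partial_deriv u)
  define N where "N = (\<lambda>x. \<Sum>i\<in>UNIV. (wt (a + 1) b x * partial_deriv i u x)\<^sup>2)"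
  define L where "L = (\<lambda>x. (wt (a + 2) b x * laplacian u x)\<^sup>2)"
  define U where "U = (\<lambda>x. (wt a b x * u x)\<^sup>2)"
  have tN: "tf R N" unfolding N_def using u by (intro tf_sum tf_NN tf_partial_deriv)
  have tL: "tf R L" unfolding L_def using u by (intro tf_NN tf_laplacian)
  have tU: "tf R U" unfolding U_def using u by (intro tf_NN)
  have "0 = I (\<lambda>x. \<Sum>i\<in>UNIV. partial_deriv i (g i) x)"
    by (rule I_div[OF g, symmetric])
  also have "\<dots> \<ge> I (\<lambda>x. 1/2 * N x - (\<epsilon> / (2 * \<Lambda>\<^sup>2) * L x + (1 / (2 * \<epsilon>) + 32) * \<Lambda>\<^sup>2 * U x))"
  proof (rule I_mono)
    show "tf R (\<lambda>x. 1/2 * N x - (\<epsilon> / (2 * \<Lambda>\<^sup>2) * L x + (1 / (2 * \<epsilon>) + 32) * \<Lambda>\<^sup>2 * U x))"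
      by (intro tf_diff tf_add tf_cmult tN tL tU)
    show "tf R (\<lambda>x. \<Sum>i\<in>UNIV. partial_deriv i (g i) x)" by (intro tf_sum tf_partial_deriv g)
    fix x assume x: "x \<in> pball" "x \<in> ball x0 R"
    have hd: "h differentiable (at x)" using smooth_on_differentiable[OF sh x(1)] .
    have ud: "u differentiable (at x)" "partial_deriv i u differentiable (at x)" for i
      using u tf_differentiable tf_partial_deriv by blast+
    define E where "E = wt a b x"
    define r where "r = norm (x - x0)"
    define c where "c = 2 * a + 2 - 2 * b * li x"
    define T where "T = (\<Sum>i\<in>UNIV. (partial_deriv i u x)\<^sup>2)"
    have c: "\<bar>c\<bar> \<le> 8 * \<Lambda>" unfolding c_def by (rule coeff_bound[OF x ab]) auto
    have hx: "h x = (E * r)\<^sup>2"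
      unfolding h_def E_def r_def using wt_sq[OF x(1), of "a + 1" b] wt_norm1[OF x(1), of a b] by (simp add: algebra_simps)
    have "partial_deriv i (g i) x = h x * (u x * partial_deriv i (partial_deriv i u) x) + h x * (partial_deriv i u x)\<^sup>2
       + u x * (partial_deriv i h x * partial_deriv i u x)" for i
      unfolding g_def using hd ud by (simp add: partial_deriv_mult power2_eq_square algebra_simps)
    hence "(\<Sum>i\<in>UNIV. partial_deriv i (g i) x) = h x * (u x * laplacian u x) + h x * T
       + u x * (\<Sum>i\<in>UNIV. partial_deriv i h x * partial_deriv i u x)"
      unfolding laplacian_def T_def by (simp add: sum.distrib sum_distrib_left)
    moreover have "(\<Sum>i\<in>UNIV. partial_deriv i h x * partial_deriv i u x) = E\<^sup>2 * c * rad u x"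
      unfolding h_def sum_partial_wt'[OF x(1)] E_def c_def ..
    ultimately have eq: "(\<Sum>i\<in>UNIV. partial_deriv i (g i) x) = (E * r)\<^sup>2 * (u x * laplacian u x) + (E * r)\<^sup>2 * T
       + u x * (E\<^sup>2 * c * rad u x)"
      unfolding hx by simp
    have Nx: "N x = (E * r)\<^sup>2 * T"
      unfolding N_def T_def E_def r_def wt_norm1[OF x(1)] by (simp add: power_mult_distrib sum_distrib_left)
    have Lx: "L x = (E * r\<^sup>2 * laplacian u x)\<^sup>2" unfolding L_def E_def r_def wt_norm2[OF x(1)] ..
    have Ux: "U x = (E * u x)\<^sup>2" unfolding U_def E_def ..
    have "- ((E * r)\<^sup>2 * (u x * laplacian u x)) = (E * r\<^sup>2 * laplacian u x) * (- (E * u x))"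
      by (simp add: power2_eq_square)
    also have "\<dots> \<le> \<epsilon> / (2 * \<Lambda>\<^sup>2) * (E * r\<^sup>2 * laplacian u x)\<^sup>2 + (- (E * u x))\<^sup>2 / (4 * (\<epsilon> / (2 * \<Lambda>\<^sup>2)))"
      by (rule young_ineq) (use e ab in simp)
    also have "\<dots> = \<epsilon> / (2 * \<Lambda>\<^sup>2) * L x + 1 / (2 * \<epsilon>) * \<Lambda>\<^sup>2 * U x" unfolding Lx Ux by simp
    finally have 1: "- ((E * r)\<^sup>2 * (u x * laplacian u x)) \<le> \<epsilon> / (2 * \<Lambda>\<^sup>2) * L x + 1 / (2 * \<epsilon>) * \<Lambda>\<^sup>2 * U x" .
    \<comment> \<open>Half of N is spent on the term with the gradient of h; the rest of the cost is
      (8 \<Lambda>)^2/2 = 32 \<Lambda>^2 times U.\<close>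
    have "- (u x * (E\<^sup>2 * c * rad u x)) = (E * rad u x) * (- (c * (E * u x)))"
      by (simp add: power2_eq_square)
    also have "\<dots> \<le> 1/2 * (E * rad u x)\<^sup>2 + (- (c * (E * u x)))\<^sup>2 / (4 * (1/2))"
      by (rule young_ineq) simp
    also have "(- (c * (E * u x)))\<^sup>2 / (4 * (1/2)) = c\<^sup>2 * U x / 2" unfolding Ux by (simp add: power_mult_distrib)
    also have "c\<^sup>2 * U x / 2 \<le> 32 * \<Lambda>\<^sup>2 * U x"
    proof -
      have "c\<^sup>2 \<le> (8 * \<Lambda>)\<^sup>2" using c ab(3) by (intro abs_le_square_iff[THEN iffD1]) auto
      hence "c\<^sup>2 * U x \<le> (8 * \<Lambda>)\<^sup>2 * U x" by (rule mult_right_mono) (simp add: Ux)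
      thus ?thesis by (simp add: power_mult_distrib)
    qed
    also have "(E * rad u x)\<^sup>2 \<le> N x"
      unfolding Nx power_mult_distrib T_def r_def mult.assoc by (rule mult_left_mono[OF rad_sq_le]) simp
    finally have 2: "- (u x * (E\<^sup>2 * c * rad u x)) \<le> 1/2 * N x + 32 * \<Lambda>\<^sup>2 * U x" by simp
    show "1/2 * N x - (\<epsilon> / (2 * \<Lambda>\<^sup>2) * L x + (1 / (2 * \<epsilon>) + 32) * \<Lambda>\<^sup>2 * U x) \<le> (\<Sum>i\<in>UNIV. partial_deriv i (g i) x)"
    proof -
      have "(1 / (2 * \<epsilon>) + 32) * \<Lambda>\<^sup>2 * U x = 1 / (2 * \<epsilon>) * \<Lambda>\<^sup>2 * U x + 32 * \<Lambda>\<^sup>2 * U x"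
        by (simp add: algebra_simps)
      thus ?thesis unfolding eq Nx[symmetric] using 1 2 by linarith
    qed
  qed
  also have "I (\<lambda>x. 1/2 * N x - (\<epsilon> / (2 * \<Lambda>\<^sup>2) * L x + (1 / (2 * \<epsilon>) + 32) * \<Lambda>\<^sup>2 * U x))
     = 1/2 * I N - (\<epsilon> / (2 * \<Lambda>\<^sup>2) * I L + (1 / (2 * \<epsilon>) + 32) * \<Lambda>\<^sup>2 * I U)"
    unfolding I_diff[OF tf_cmult[OF tN] tf_add[OF tf_cmult[OF tL] tf_cmult[OF tU]]] I_add[OF tf_cmult[OF tL] tf_cmult[OF tU]] I_cmult ..
  finally have "I N \<le> 2 * (\<epsilon> / (2 * \<Lambda>\<^sup>2) * I L + (1 / (2 * \<epsilon>) + 32) * \<Lambda>\<^sup>2 * I U)" by simp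
  moreover have "I N = (\<Sum>i\<in>UNIV. Sq (a + 1) b (partial_deriv i u))"
    unfolding N_def Sq_def by (rule I_sum[OF tf_NN[OF tf_partial_deriv[OF u]]])
  ultimately show ?thesis unfolding Sq_def L_def U_def by (simp add: algebra_simps)
qed

text \<open>The divergences of h (d_j u)(d_i d_j u) in direction i and of h (d_j u)(d_i d_i u) in
  direction j have the same third-order terms. Their difference, summed, is h times (|D^2 u|^2 -
  (laplacian u)^2) plus terms with the gradient of h, which Young's inequality and
  \<open>gradient_estimate\<close> absorb.\<close>

lemma hessian_estimate:
  fixes \<Lambda> a b :: real
  assumes u: "tf R u" and ab: "\<bar>a\<bar> \<le> \<Lambda>" "\<bar>b\<bar> \<le> \<Lambda>" "\<Lambda> \<ge> 1"
  defines "n \<equiv> real CARD('n)"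
  shows "(\<Sum>i\<in>UNIV. \<Sum>j\<in>UNIV. Sq (a + 2) b (partial_deriv i (partial_deriv j u)))
    \<le> (2 + 256 * n\<^sup>2) * Sq (a + 2) b (laplacian u) + 65 * 256 * n\<^sup>2 * \<Lambda> ^ 4 * Sq a b u"
proof -
  have n1: "n \<ge> 1" unfolding n_def using zero_less_card_finite[where 'a='n] by linarith
  define h where "h = wt (2 * a + 4) (2 * b)"
  have sh: "smooth_on pball h" unfolding h_def by (rule smooth_on_wt)
  let ?d = "\<lambda>i j. partial_deriv i (partial_deriv j u)"
  define g1 where "g1 = (\<lambda>i j x. h x * (partial_deriv j u x * ?d i j x))"
  define g2 where "g2 = (\<lambda>i j x. h x * (partial_deriv j u x * ?d i i x))"
  have g: "tf R (g1 i j)" "tf R (g2 i j)" for i j unfolding g1_def g2_def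
    by (intro tf_smooth_mult sh tf_smooth[OF tf_partial_deriv[OF u]] tf_partial_deriv u)+
  define T where "T = (\<lambda>x. \<Sum>i\<in>UNIV. \<Sum>j\<in>UNIV. (wt (a + 2) b x * ?d i j x)\<^sup>2)"
  define L where "L = (\<lambda>x. (wt (a + 2) b x * laplacian u x)\<^sup>2)"
  define G where "G = (\<lambda>x. \<Sum>i\<in>UNIV. (wt (a + 1) b x * partial_deriv i u x)\<^sup>2)"
  have tT: "tf R T" unfolding T_def using u by (intro tf_sum tf_NN tf_partial_deriv)
  have tL: "tf R L" unfolding L_def using u by (intro tf_NN tf_laplacian)
  have tG: "tf R G" unfolding G_def using u by (intro tf_sum tf_NN tf_partial_deriv)
  have "0 = I (\<lambda>x. (\<Sum>i\<in>UNIV. \<Sum>j\<in>UNIV. partial_deriv i (g1 i j) x) - (\<Sum>i\<in>UNIV. \<Sum>j\<in>UNIV. partial_deriv j (g2 i j) x))"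
  proof -
    have "I (\<lambda>x. \<Sum>i\<in>UNIV. \<Sum>j\<in>UNIV. partial_deriv i (g1 i j) x) = 0"
      "I (\<lambda>x. \<Sum>i\<in>UNIV. \<Sum>j\<in>UNIV. partial_deriv j (g2 i j) x) = 0"
      by (subst I_sum2[where R=R], intro tf_partial_deriv g, simp add: I_partial_deriv[OF g(1)],
          subst I_sum2[where R=R], intro tf_partial_deriv g, simp add: I_partial_deriv[OF g(2)])
    thus ?thesis
      by (subst I_diff[where R=R]) (intro tf_sum tf_partial_deriv g | simp)+
  qed
  also have "\<dots> \<ge> I (\<lambda>x. 1/2 * T x - (L x + 128 * n\<^sup>2 * \<Lambda>\<^sup>2 * G x))"
  proof (rule I_mono)
    show "tf R (\<lambda>x. 1/2 * T x - (L x + 128 * n\<^sup>2 * \<Lambda>\<^sup>2 * G x))"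
      by (intro tf_diff tf_add tf_cmult tT tL tG)
    show "tf R (\<lambda>x. (\<Sum>i\<in>UNIV. \<Sum>j\<in>UNIV. partial_deriv i (g1 i j) x) - (\<Sum>i\<in>UNIV. \<Sum>j\<in>UNIV. partial_deriv j (g2 i j) x))"
      by (intro tf_diff tf_sum tf_partial_deriv g)
    fix x assume x: "x \<in> pball" "x \<in> ball x0 R"
    have hd: "h differentiable (at x)" using smooth_on_differentiable[OF sh x(1)] .
    have ud: "partial_deriv i u differentiable (at x)" "?d i j differentiable (at x)" for i j
      using u tf_differentiable tf_partial_deriv by blast+
    define E where "E = wt a b x"
    define r where "r = norm (x - x0)"
    have r: "r > 0" unfolding r_def using pball_norm[OF x(1)] by simp
    have E: "E > 0" unfolding E_def by (rule wt_pos[OF x(1)])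
    define c where "c = 2 * a + 4 - 2 * b * li x"
    have c: "\<bar>c\<bar> \<le> 8 * \<Lambda>" unfolding c_def by (rule coeff_bound[OF x ab]) auto
    have hx: "h x = (E * r\<^sup>2)\<^sup>2"
      unfolding h_def E_def r_def using wt_sq[OF x(1), of "a + 2" b] wt_norm2[OF x(1), of a b] by (simp add: algebra_simps)
    have dh: "\<bar>partial_deriv i h x\<bar> \<le> 8 * \<Lambda> * (E * r) * (E * r\<^sup>2)" for i
    proof -
      have "partial_deriv i h x = (x $ i - x0 $ i) * (c * wt (2 * a + 2) (2 * b) x)"
        unfolding h_def partial_deriv_wt[OF x(1)] wt_shift[OF x(1)] c_def by (simp add: algebra_simps)
      also have "wt (2 * a + 2) (2 * b) x = (E * r)\<^sup>2"
        unfolding E_def r_def using wt_sq[OF x(1), of "a + 1" b] wt_norm1[OF x(1), of a b] by (simp add: algebra_simps)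
      finally have "\<bar>partial_deriv i h x\<bar> = \<bar>x $ i - x0 $ i\<bar> * (\<bar>c\<bar> * (E * r)\<^sup>2)"
        by (simp add: abs_mult)
      also have "\<dots> \<le> r * (8 * \<Lambda> * (E * r)\<^sup>2)"
        using component_le_norm_cart[of "x - x0" i] c r ab by (intro mult_mono) (auto simp: r_def)
      finally show ?thesis by (simp add: power2_eq_square algebra_simps)
    qed
    define P where "P = (\<lambda>j. E * r * \<bar>partial_deriv j u x\<bar>)"
    define Q where "Q = (\<lambda>i j. E * r\<^sup>2 * \<bar>?d i j x\<bar>)"
    define Ps where "Ps = (\<Sum>j\<in>UNIV. (P j)\<^sup>2)"
    define Qs where "Qs = (\<Sum>i\<in>UNIV. \<Sum>j\<in>UNIV. (Q i j)\<^sup>2)"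
    have Gx: "G x = Ps" unfolding G_def Ps_def P_def E_def r_def wt_norm1[OF x(1)] by (simp add: power_mult_distrib)
    have Tx: "T x = Qs" unfolding T_def Qs_def Q_def E_def r_def wt_norm2[OF x(1)] by (simp add: power_mult_distrib)
    \<comment> \<open>The weight 1/(4 n) is dictated by the second family, where the diagonal square
      of Q is repeated n times. Each family then costs at most a quarter of Qs, and half of it
      survives.\<close>
    have cross: "\<bar>partial_deriv k h x * (partial_deriv j u x * ?d i l x)\<bar> \<le> 1 / (4 * n) * (Q i l)\<^sup>2 + 64 * n * \<Lambda>\<^sup>2 * (P j)\<^sup>2" for i j k l
    proof -
      have "\<bar>partial_deriv k h x * (partial_deriv j u x * ?d i l x)\<bar> \<le> (8 * \<Lambda> * (E * r) * (E * r\<^sup>2)) * (\<bar>partial_deriv j u x\<bar> * \<bar>?d i l x\<bar>)"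
        unfolding abs_mult by (intro mult_right_mono dh mult_nonneg_nonneg) auto
      also have "\<dots> = Q i l * (8 * \<Lambda> * P j)" unfolding P_def Q_def by (simp add: algebra_simps)
      also have "\<dots> \<le> 1 / (4 * n) * (Q i l)\<^sup>2 + (8 * \<Lambda> * P j)\<^sup>2 / (4 * (1 / (4 * n)))"
        by (rule young_ineq) (use n1 in simp)
      finally show ?thesis by (simp add: power_mult_distrib algebra_simps)
    qed
    have d1: "partial_deriv i (g1 i j) x = h x * (?d i j x)\<^sup>2 + h x * (partial_deriv j u x * partial_deriv i (?d i j) x)
       + partial_deriv i h x * (partial_deriv j u x * ?d i j x)" for i j
      unfolding g1_def using hd ud by (simp add: partial_deriv_mult power2_eq_square algebra_simps)
    have d2: "partial_deriv j (g2 i j) x = h x * (?d j j x * ?d i i x) + h x * (partial_deriv j u x * partial_deriv i (?d i j) x)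
       + partial_deriv j h x * (partial_deriv j u x * ?d i i x)" for i j
    proof -
      have "partial_deriv j (?d i i) x = partial_deriv i (?d i j) x"
      proof -
        have "partial_deriv j (partial_deriv i (partial_deriv i u)) x = partial_deriv i (partial_deriv j (partial_deriv i u)) x"
          by (rule partial_deriv_commute[OF tf_smooth[OF tf_partial_deriv[OF u]]])
        also have "partial_deriv j (partial_deriv i u) = partial_deriv i (partial_deriv j u)"
          using partial_deriv_commute[OF tf_smooth[OF u]] by blast
        finally show ?thesis .
      qed
      thus ?thesis unfolding g2_def using hd ud by (simp add: partial_deriv_mult algebra_simps)
    qed
    have "h x * (?d i j x)\<^sup>2 - h x * (?d j j x * ?d i i x)
        - (1 / (4 * n) * (Q i j)\<^sup>2 + 1 / (4 * n) * (Q i i)\<^sup>2 + 128 * n * \<Lambda>\<^sup>2 * (P j)\<^sup>2)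
      \<le> partial_deriv i (g1 i j) x - partial_deriv j (g2 i j) x" for i j
      using cross[of i j i j] cross[of j j i i] unfolding d1 d2 by (simp add: abs_le_iff)
    hence "(\<Sum>i\<in>UNIV. \<Sum>j\<in>UNIV. h x * (?d i j x)\<^sup>2 - h x * (?d j j x * ?d i i x)
        - (1 / (4 * n) * (Q i j)\<^sup>2 + 1 / (4 * n) * (Q i i)\<^sup>2 + 128 * n * \<Lambda>\<^sup>2 * (P j)\<^sup>2))
      \<le> (\<Sum>i\<in>UNIV. \<Sum>j\<in>UNIV. partial_deriv i (g1 i j) x - partial_deriv j (g2 i j) x)"
      by (intro sum_mono)
    also have "(\<Sum>i\<in>UNIV. \<Sum>j\<in>UNIV. h x * (?d i j x)\<^sup>2 - h x * (?d j j x * ?d i i x)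
        - (1 / (4 * n) * (Q i j)\<^sup>2 + 1 / (4 * n) * (Q i i)\<^sup>2 + 128 * n * \<Lambda>\<^sup>2 * (P j)\<^sup>2))
      = Qs - L x - (1 / (4 * n) * Qs + 1 / (4 * n) * (n * (\<Sum>i\<in>UNIV. (Q i i)\<^sup>2)) + 128 * n * \<Lambda>\<^sup>2 * (n * Ps))"
    proof -
      have "h x * (?d i j x)\<^sup>2 = (Q i j)\<^sup>2" for i j unfolding hx Q_def by (simp add: power_mult_distrib)
      moreover have "(\<Sum>i\<in>UNIV. \<Sum>j\<in>UNIV. h x * (?d j j x * ?d i i x)) = L x"
      proof -
        have "(\<Sum>i\<in>UNIV. \<Sum>j\<in>UNIV. h x * (?d j j x * ?d i i x)) = h x * (\<Sum>i\<in>UNIV. \<Sum>j\<in>UNIV. ?d i i x * ?d j j x)"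
          by (simp add: sum_distrib_left mult_ac)
        also have "(\<Sum>i\<in>UNIV. \<Sum>j\<in>UNIV. ?d i i x * ?d j j x) = (laplacian u x)\<^sup>2"
          unfolding laplacian_def power2_eq_square sum_product ..
        finally show ?thesis unfolding L_def hx E_def r_def wt_norm2[OF x(1)] by (simp add: power_mult_distrib)
      qed
      moreover have "(\<Sum>i\<in>UNIV. \<Sum>j\<in>(UNIV::'n set). 1 / (4 * n) * (Q i i)\<^sup>2) = 1 / (4 * n) * (n * (\<Sum>i\<in>UNIV. (Q i i)\<^sup>2))"
        by (simp add: n_def sum_distrib_left)
      moreover have "(\<Sum>i\<in>(UNIV::'n set). \<Sum>j\<in>UNIV. 128 * n * \<Lambda>\<^sup>2 * (P j)\<^sup>2) = 128 * n * \<Lambda>\<^sup>2 * (n * Ps)"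
        by (simp add: n_def Ps_def sum_distrib_left mult_ac)
      moreover have "(\<Sum>i\<in>UNIV. \<Sum>j\<in>UNIV. 1 / (4 * n) * (Q i j)\<^sup>2) = 1 / (4 * n) * Qs"
        unfolding Qs_def sum_distrib_left ..
      ultimately show ?thesis unfolding sum_subtractf sum.distrib Qs_def by presburger
    qed
    finally have main: "Qs - L x - (1 / (4 * n) * Qs + 1 / (4 * n) * (n * (\<Sum>i\<in>UNIV. (Q i i)\<^sup>2)) + 128 * n * \<Lambda>\<^sup>2 * (n * Ps))
       \<le> (\<Sum>i\<in>UNIV. \<Sum>j\<in>UNIV. partial_deriv i (g1 i j) x) - (\<Sum>i\<in>UNIV. \<Sum>j\<in>UNIV. partial_deriv j (g2 i j) x)"
      by (simp add: sum_subtractf)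
    have "(\<Sum>i\<in>UNIV. (Q i i)\<^sup>2) \<le> Qs"
      unfolding Qs_def by (intro sum_mono member_le_sum) auto
    hence "1 / (4 * n) * (n * (\<Sum>i\<in>UNIV. (Q i i)\<^sup>2)) \<le> 1/4 * Qs" using n1 by simp
    moreover have "1 / (4 * n) * Qs \<le> 1/4 * Qs"
    proof (rule mult_right_mono)
      show "1 / (4 * n) \<le> 1/4" using n1 by simp
      show "0 \<le> Qs" unfolding Qs_def by (intro sum_nonneg) auto
    qed
    ultimately show "1/2 * T x - (L x + 128 * n\<^sup>2 * \<Lambda>\<^sup>2 * G x)
      \<le> (\<Sum>i\<in>UNIV. \<Sum>j\<in>UNIV. partial_deriv i (g1 i j) x) - (\<Sum>i\<in>UNIV. \<Sum>j\<in>UNIV. partial_deriv j (g2 i j) x)"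
      using main unfolding Tx Gx by (simp add: power2_eq_square mult_ac)
  qed
  also have "I (\<lambda>x. 1/2 * T x - (L x + 128 * n\<^sup>2 * \<Lambda>\<^sup>2 * G x)) = 1/2 * I T - (I L + 128 * n\<^sup>2 * \<Lambda>\<^sup>2 * I G)"
    unfolding I_diff[OF tf_cmult[OF tT] tf_add[OF tL tf_cmult[OF tG]]] I_add[OF tL tf_cmult[OF tG]] I_cmult ..
  finally have 1: "I T \<le> 2 * I L + 256 * n\<^sup>2 * \<Lambda>\<^sup>2 * I G" by simp
  have "I G = (\<Sum>i\<in>UNIV. Sq (a + 1) b (partial_deriv i u))"
    unfolding G_def Sq_def by (rule I_sum[OF tf_NN[OF tf_partial_deriv[OF u]]])
  hence "I G \<le> 1 / \<Lambda>\<^sup>2 * I L + 65 * \<Lambda>\<^sup>2 * Sq a b u"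
    using gradient_estimate[OF u ab, of 1] unfolding L_def Sq_def[symmetric] by simp
  hence "256 * n\<^sup>2 * \<Lambda>\<^sup>2 * I G \<le> 256 * n\<^sup>2 * \<Lambda>\<^sup>2 * (1 / \<Lambda>\<^sup>2 * I L + 65 * \<Lambda>\<^sup>2 * Sq a b u)"
    by (rule mult_left_mono) simp
  also have "\<dots> = 256 * n\<^sup>2 * I L + 65 * 256 * n\<^sup>2 * \<Lambda> ^ 4 * Sq a b u"
    using ab(3) by (simp add: field_simps power2_eq_square power4_eq_xxxx)
  finally have "I T \<le> (2 + 256 * n\<^sup>2) * I L + 65 * 256 * n\<^sup>2 * \<Lambda> ^ 4 * Sq a b u"
    using 1 by (simp add: algebra_simps)
  moreover have "I T = (\<Sum>i\<in>UNIV. \<Sum>j\<in>UNIV. Sq (a + 2) b (?d i j))"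
    unfolding T_def Sq_def by (rule I_sum2[OF tf_NN[OF tf_partial_deriv[OF tf_partial_deriv[OF u]]]])
  ultimately show ?thesis unfolding L_def Sq_def[symmetric] by simp
qed

end

end

text \<open>Derivatives along a word of directions. A word can be shortened letter by letter in
  inductions, and \<open>multi_deriv\<close> is the case in which equal letters are
  adjacent.\<close>

definition pdw :: "'n list \<Rightarrow> (real ^ 'n \<Rightarrow> 'b) \<Rightarrow> real ^ 'n \<Rightarrow> 'b::real_normed_vector"
  where "pdw w f = foldr partial_deriv w f"

lemma pdw_simps [simp]: "pdw [] f = f" "pdw (i # w) f = partial_deriv i (pdw w f)"
  unfolding pdw_def by auto

lemma pdw_append: "pdw (v @ w) f = pdw v (pdw w f)"
  unfolding pdw_def by simp

lemma multi_deriv_eq_pdw: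
  fixes \<alpha> :: "'n::finite \<Rightarrow> nat"
  obtains w where "length w = multi_deg \<alpha>"
    "\<And>f :: real ^ 'n \<Rightarrow> 'b::real_normed_vector. multi_deriv \<alpha> f = pdw w f"
proof -
  have pow: "(partial_deriv i ^^ k) f = pdw (replicate k i) f" for i k and f :: "real ^ 'n \<Rightarrow> 'b"
    by (induction k) auto
  have "\<exists>w. length w = sum_list (map \<alpha> is) \<and>
     (\<forall>f :: real ^ 'n \<Rightarrow> 'b. fold (\<lambda>i. partial_deriv i ^^ \<alpha> i) is f = pdw w f)" for "is"
  proof (induction "is")
    case (Cons i "is")
    then obtain w where w: "length w = sum_list (map \<alpha> is)"
      "\<forall>f :: real ^ 'n \<Rightarrow> 'b. fold (\<lambda>i. partial_deriv i ^^ \<alpha> i) is f = pdw w f" by blast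
    show ?case by (rule exI[of _ "w @ replicate (\<alpha> i) i"]) (simp add: w(1) w(2)[rule_format] pdw_append flip: pow)
  qed simp
  from this[of coordinates] obtain w where w: "length w = sum_list (map \<alpha> coordinates)"
     "\<And>f :: real ^ 'n \<Rightarrow> 'b. multi_deriv \<alpha> f = pdw w f" unfolding multi_deriv_def by blast
  moreover have "sum_list (map \<alpha> coordinates) = multi_deg \<alpha>"
  proof -
    have "set (coordinates :: 'n list) = UNIV" by (rule coordinates(2))
    thus ?thesis unfolding multi_deg_def
      using sum_list_distinct_conv_sum_set[OF coordinates(1), of \<alpha>] by simp
  qed
  ultimately show ?thesis using that by metis
qed

lemma smooth_on_pdw: "smooth_on A f \<Longrightarrow> smooth_on A (pdw w f)"
  by (induction w) auto

lemma laplacian_partial_deriv: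
  fixes f :: "real ^ 'n \<Rightarrow> real"
  assumes f: "smooth_on UNIV f"
  shows "laplacian (partial_deriv i f) = partial_deriv i (laplacian f)"
proof
  fix x
  have "partial_deriv k (partial_deriv k (partial_deriv i f)) x = partial_deriv i (partial_deriv k (partial_deriv k f)) x" for k
  proof -
    have "partial_deriv k (partial_deriv i f) = partial_deriv i (partial_deriv k f)"
      using partial_deriv_commute[OF f] by blast
    thus ?thesis using partial_deriv_commute[OF smooth_on_partial_deriv[OF f]] by simp
  qed
  moreover have "partial_deriv i (laplacian f) x = (\<Sum>k\<in>UNIV. partial_deriv i (partial_deriv k (partial_deriv k f)) x)"
    unfolding laplacian_def[abs_def] 
    by (rule partial_deriv_sum) (use f smooth_on_differentiable smooth_on_partial_deriv in blast)
  ultimately show "laplacian (partial_deriv i f) x = partial_deriv i (laplacian f) x"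
    unfolding laplacian_def by simp
qed

lemma laplacian_pdw:
  fixes f :: "real ^ 'n \<Rightarrow> real"
  assumes f: "smooth_on UNIV f"
  shows "laplacian (pdw w f) = pdw w (laplacian f)"
  by (induction w) (auto simp: laplacian_partial_deriv[OF smooth_on_pdw[OF f]])

section \<open>Interpolation between powers of the Laplacian and estimates for all
  derivatives\<close>

context punctured_space
begin

lemma tf_pdw [intro]: "tf R u \<Longrightarrow> tf R (pdw w u)"
  by (induction w) auto

lemma tf_laplacian_power [intro]: "tf R u \<Longrightarrow> tf R ((laplacian ^^ i) u)"
  by (induction i) auto

context
  fixes R :: real
  assumes R: "R \<le> exp (- 1)"
begin

text \<open>With v = laplacian u, the divergence of h v grad u expresses the norm of v by the
  gradients of u and v. \<open>gradient_estimate\<close> bounds these by u, v and laplacian v, and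
  what is left over of v is absorbed.\<close>

lemma laplacian_interpolation:
  assumes e: "\<epsilon> > 0"
  obtains C where "C > 0"
    "\<And>a b \<Lambda> u. tf R u \<Longrightarrow> \<bar>a\<bar> \<le> \<Lambda> \<Longrightarrow> \<bar>b\<bar> \<le> \<Lambda> \<Longrightarrow> 1 \<le> \<Lambda> \<Longrightarrow>
      \<Lambda> ^ 4 * Sq (a + 2) b (laplacian u) \<le> \<epsilon> * Sq (a + 4) b (laplacian (laplacian u)) + C * \<Lambda> ^ 8 * Sq a b u"
proof -
  \<comment> \<open>\<open>gradient_estimate\<close> is applied to v with exponent a + 2 and hence
    with 3 \<Lambda>, which produces 65 * 9 = 585. K >= 1170 keeps 585/(4 K) below 1/8, and
    1/\<epsilon> makes the share of laplacian v at most \<epsilon>/2. With (K + 64) \<eta> = 1/8,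
    the part absorbed from 3/4 of the norm of v is 1/4.\<close>
  define K where "K = 1170 + 1 / \<epsilon>"
  define \<eta> where "\<eta> = 1 / (8 * (K + 64))"
  define C where "C = 2 * (K + 64) * (1 / \<eta> + 64)"
  have K: "K > 0" "585 / (4 * K) \<le> 1/8" "1 / (36 * K) \<le> \<epsilon> / 2" and eta: "\<eta> > 0" "(K + 64) * \<eta> = 1/8"
  proof -
    show K0: "K > 0" unfolding K_def using e by (simp add: add_pos_pos)
    have "1170 \<le> K" unfolding K_def using e by simp
    thus "585 / (4 * K) \<le> 1/8" using K0 by (simp add: field_simps)
    have "\<epsilon> * K = 1170 * \<epsilon> + 1" unfolding K_def using e by (simp add: field_simps)
    thus "1 / (36 * K) \<le> \<epsilon> / 2" using K0 e by (simp add: field_simps)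
    show "\<eta> > 0" "(K + 64) * \<eta> = 1/8" unfolding \<eta>_def using K0 by (auto simp: field_simps)
  qed
  show ?thesis
  proof (rule that[of C])
    show "C > 0" unfolding C_def using K eta by (intro mult_pos_pos) (auto simp: add_pos_pos)
    fix a b \<Lambda> :: real and u assume u: "tf R u" and ab: "\<bar>a\<bar> \<le> \<Lambda>" "\<bar>b\<bar> \<le> \<Lambda>" "1 \<le> \<Lambda>"
    define v where "v = laplacian u"
    have v: "tf R v" unfolding v_def using u by auto
    define h where "h = wt (2 * (a + 1) + 2) (2 * b)"
    have sh: "smooth_on pball h" unfolding h_def by (rule smooth_on_wt)
    define g where "g = (\<lambda>i x. h x * (v x * partial_deriv i u x))"
    have g: "tf R (g i)" for i unfolding g_def by (intro tf_smooth_mult sh tf_smooth[OF v] tf_partial_deriv u)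
    define V where "V = (\<lambda>x. (wt (a + 2) b x * v x)\<^sup>2)"
    define T where "T = (\<lambda>x. \<Sum>i\<in>UNIV. (wt (a + 2 + 1) b x * partial_deriv i v x)\<^sup>2)"
    define G where "G = (\<lambda>x. \<Sum>i\<in>UNIV. (wt (a + 1) b x * partial_deriv i u x)\<^sup>2)"
    have tV: "tf R V" unfolding V_def using v by (intro tf_NN)
    have tT: "tf R T" unfolding T_def using v by (intro tf_sum tf_NN tf_partial_deriv)
    have tG: "tf R G" unfolding G_def using u by (intro tf_sum tf_NN tf_partial_deriv)
    have "0 = I (\<lambda>x. \<Sum>i\<in>UNIV. partial_deriv i (g i) x)"
      by (rule I_div[OF g, symmetric])
    also have "\<dots> \<ge> I (\<lambda>x. 3/4 * V x - (1 / (4 * K * \<Lambda>\<^sup>2) * T x + (K + 64) * \<Lambda>\<^sup>2 * G x))"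
    proof (rule I_mono)
      show "tf R (\<lambda>x. 3/4 * V x - (1 / (4 * K * \<Lambda>\<^sup>2) * T x + (K + 64) * \<Lambda>\<^sup>2 * G x))"
        by (intro tf_diff tf_add tf_cmult tV tT tG)
      show "tf R (\<lambda>x. \<Sum>i\<in>UNIV. partial_deriv i (g i) x)" by (intro tf_sum tf_partial_deriv g)
      fix x assume x: "x \<in> pball" "x \<in> ball x0 R"
      have hd: "h differentiable (at x)" using smooth_on_differentiable[OF sh x(1)] .
      have ud: "v differentiable (at x)" "partial_deriv i u differentiable (at x)" for i
        using u v tf_differentiable tf_partial_deriv by blast+
      define E where "E = wt a b x"
      define r where "r = norm (x - x0)"
      define c where "c = 2 * (a + 1) + 2 - 2 * b * li x"
      have c: "\<bar>c\<bar> \<le> 8 * \<Lambda>" unfolding c_def using coeff_bound[OF R x ab, of 4] by simp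
      have hx: "h x = (E * r\<^sup>2)\<^sup>2"
        unfolding h_def E_def r_def using wt_sq[OF x(1), of "a + 2" b] wt_norm2[OF x(1), of a b] by (simp add: algebra_simps)
      have "partial_deriv i (g i) x = h x * (v x * partial_deriv i (partial_deriv i u) x) + h x * (partial_deriv i v x * partial_deriv i u x)
         + v x * (partial_deriv i h x * partial_deriv i u x)" for i
        unfolding g_def using hd ud by (simp add: partial_deriv_mult algebra_simps)
      hence "(\<Sum>i\<in>UNIV. partial_deriv i (g i) x) = h x * (v x * laplacian u x) + (\<Sum>i\<in>UNIV. h x * (partial_deriv i v x * partial_deriv i u x))
         + v x * (\<Sum>i\<in>UNIV. partial_deriv i h x * partial_deriv i u x)"
        unfolding laplacian_def by (simp add: sum.distrib sum_distrib_left)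
      moreover have "(\<Sum>i\<in>UNIV. partial_deriv i h x * partial_deriv i u x) = (E * r)\<^sup>2 * c * rad u x"
        unfolding h_def sum_partial_wt'[OF x(1)] E_def c_def r_def wt_norm1[OF x(1)] ..
      moreover have "h x * (v x * laplacian u x) = V x"
        unfolding hx V_def wt_norm2[OF x(1)] E_def r_def v_def by (simp add: power2_eq_square)
      ultimately have eq: "(\<Sum>i\<in>UNIV. partial_deriv i (g i) x) = V x + (\<Sum>i\<in>UNIV. h x * (partial_deriv i v x * partial_deriv i u x))
         + v x * ((E * r)\<^sup>2 * c * rad u x)" by simp
      have w1: "wt (a + 1) b x = E * r" "wt (a + 2) b x = E * r\<^sup>2" "wt (a + 2 + 1) b x = E * r ^ 3"
        unfolding E_def r_def wt_norm1[OF x(1)] wt_norm2[OF x(1)] by (auto simp: power2_eq_square power3_eq_cube)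
      have "- (h x * (partial_deriv i v x * partial_deriv i u x))
         \<le> 1 / (4 * K * \<Lambda>\<^sup>2) * (wt (a + 2 + 1) b x * partial_deriv i v x)\<^sup>2 + K * \<Lambda>\<^sup>2 * (wt (a + 1) b x * partial_deriv i u x)\<^sup>2" for i
      proof -
        have "- (h x * (partial_deriv i v x * partial_deriv i u x)) = (E * r ^ 3 * partial_deriv i v x) * (- (E * r * partial_deriv i u x))"
          unfolding hx by (simp add: power2_eq_square power3_eq_cube)
        also have "\<dots> \<le> 1 / (4 * K * \<Lambda>\<^sup>2) * (E * r ^ 3 * partial_deriv i v x)\<^sup>2 + (- (E * r * partial_deriv i u x))\<^sup>2 / (4 * (1 / (4 * K * \<Lambda>\<^sup>2)))"
          by (rule young_ineq) (use K ab in simp)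
        finally show ?thesis unfolding w1 using K ab by (simp add: field_simps)
      qed
      hence "(\<Sum>i\<in>UNIV. - (h x * (partial_deriv i v x * partial_deriv i u x)))
         \<le> (\<Sum>i\<in>UNIV. 1 / (4 * K * \<Lambda>\<^sup>2) * (wt (a + 2 + 1) b x * partial_deriv i v x)\<^sup>2 + K * \<Lambda>\<^sup>2 * (wt (a + 1) b x * partial_deriv i u x)\<^sup>2)"
        by (intro sum_mono)
      hence 1: "- (\<Sum>i\<in>UNIV. h x * (partial_deriv i v x * partial_deriv i u x)) \<le> 1 / (4 * K * \<Lambda>\<^sup>2) * T x + K * \<Lambda>\<^sup>2 * G x"
        unfolding T_def G_def by (simp only: sum.distrib sum_distrib_left sum_negf)
      have "- (v x * ((E * r)\<^sup>2 * c * rad u x)) = (E * r\<^sup>2 * v x) * (- (c * (E * rad u x)))"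
        by (simp add: power2_eq_square)
      also have "\<dots> \<le> 1/4 * (E * r\<^sup>2 * v x)\<^sup>2 + (- (c * (E * rad u x)))\<^sup>2 / (4 * (1/4))"
        by (rule young_ineq) simp
      also have "\<dots> = 1/4 * V x + c\<^sup>2 * (E * rad u x)\<^sup>2"
        unfolding V_def w1 by (simp add: power_mult_distrib)
      also have "c\<^sup>2 * (E * rad u x)\<^sup>2 \<le> (8 * \<Lambda>)\<^sup>2 * G x"
      proof (rule mult_mono)
        show "c\<^sup>2 \<le> (8 * \<Lambda>)\<^sup>2" using c ab(3) by (intro abs_le_square_iff[THEN iffD1]) auto
        have "G x = E\<^sup>2 * (r\<^sup>2 * (\<Sum>i\<in>UNIV. (partial_deriv i u x)\<^sup>2))"
          unfolding G_def w1 by (simp add: power_mult_distrib sum_distrib_left mult.assoc)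
        thus "(E * rad u x)\<^sup>2 \<le> G x"
          unfolding power_mult_distrib r_def by (simp add: mult_left_mono[OF rad_sq_le])
      qed auto
      finally have 2: "- (v x * ((E * r)\<^sup>2 * c * rad u x)) \<le> 1/4 * V x + 64 * \<Lambda>\<^sup>2 * G x"
        by (simp add: power_mult_distrib)
      show "3/4 * V x - (1 / (4 * K * \<Lambda>\<^sup>2) * T x + (K + 64) * \<Lambda>\<^sup>2 * G x) \<le> (\<Sum>i\<in>UNIV. partial_deriv i (g i) x)"
      proof -
        have "(K + 64) * \<Lambda>\<^sup>2 * G x = K * \<Lambda>\<^sup>2 * G x + 64 * \<Lambda>\<^sup>2 * G x" by (simp add: algebra_simps)
        thus ?thesis unfolding eq using 1 2 by linarith
      qed
    qed
    also have "I (\<lambda>x. 3/4 * V x - (1 / (4 * K * \<Lambda>\<^sup>2) * T x + (K + 64) * \<Lambda>\<^sup>2 * G x))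
      = 3/4 * I V - (1 / (4 * K * \<Lambda>\<^sup>2) * I T + (K + 64) * \<Lambda>\<^sup>2 * I G)"
      unfolding I_diff[OF tf_cmult[OF tV] tf_add[OF tf_cmult[OF tT] tf_cmult[OF tG]]] I_add[OF tf_cmult[OF tT] tf_cmult[OF tG]] I_cmult ..
    finally have main: "3/4 * I V \<le> 1 / (4 * K * \<Lambda>\<^sup>2) * I T + (K + 64) * \<Lambda>\<^sup>2 * I G" by simp
    define S0 where "S0 = Sq a b u"
    define S1 where "S1 = Sq (a + 2) b v"
    define S2 where "S2 = Sq (a + 4) b (laplacian v)"
    have V: "I V = S1" unfolding V_def S1_def Sq_def ..
    have "I T = (\<Sum>i\<in>UNIV. Sq (a + 2 + 1) b (partial_deriv i v))"
      unfolding T_def Sq_def by (rule I_sum[OF tf_NN[OF tf_partial_deriv[OF v]]])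
    also have "\<dots> \<le> 1 / (3 * \<Lambda>)\<^sup>2 * Sq (a + 2 + 2) b (laplacian v) + (1 / 1 + 64) * (3 * \<Lambda>)\<^sup>2 * Sq (a + 2) b v"
      by (rule gradient_estimate[OF R v]) (use ab in auto)
    finally have T: "I T \<le> 1 / (9 * \<Lambda>\<^sup>2) * S2 + 585 * \<Lambda>\<^sup>2 * S1"
      unfolding S1_def S2_def by (simp add: power_mult_distrib add_ac)
    have "I G = (\<Sum>i\<in>UNIV. Sq (a + 1) b (partial_deriv i u))"
      unfolding G_def Sq_def by (rule I_sum[OF tf_NN[OF tf_partial_deriv[OF u]]])
    also have "\<dots> \<le> \<eta> / \<Lambda>\<^sup>2 * Sq (a + 2) b v + (1 / \<eta> + 64) * \<Lambda>\<^sup>2 * Sq a b u"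
      unfolding v_def by (rule gradient_estimate[OF R u ab eta(1)])
    finally have G: "I G \<le> \<eta> / \<Lambda>\<^sup>2 * S1 + (1 / \<eta> + 64) * \<Lambda>\<^sup>2 * S0" unfolding S1_def S0_def .
    have n: "S0 \<ge> 0" "S1 \<ge> 0" "S2 \<ge> 0" unfolding S0_def S1_def S2_def by (rule Sq_nonneg)+
    have L: "\<Lambda> > 0" using ab by simp
    have "1 / (4 * K * \<Lambda>\<^sup>2) * I T \<le> 1 / (4 * K * \<Lambda>\<^sup>2) * (1 / (9 * \<Lambda>\<^sup>2) * S2 + 585 * \<Lambda>\<^sup>2 * S1)"
      using T K L by (intro mult_left_mono) auto
    also have "\<dots> = 1 / (36 * K) * (S2 / \<Lambda> ^ 4) + 585 / (4 * K) * S1"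
      using K L by (simp add: field_simps power2_eq_square power4_eq_xxxx)
    also have "\<dots> \<le> \<epsilon> / 2 * (S2 / \<Lambda> ^ 4) + 1/8 * S1"
      using K n L by (intro add_mono mult_right_mono) auto
    finally have p1: "1 / (4 * K * \<Lambda>\<^sup>2) * I T \<le> \<epsilon> / 2 * (S2 / \<Lambda> ^ 4) + 1/8 * S1" .
    have "(K + 64) * \<Lambda>\<^sup>2 * I G \<le> (K + 64) * \<Lambda>\<^sup>2 * (\<eta> / \<Lambda>\<^sup>2 * S1 + (1 / \<eta> + 64) * \<Lambda>\<^sup>2 * S0)"
      using G K by (intro mult_left_mono) auto
    also have "\<dots> = ((K + 64) * \<eta>) * S1 + (K + 64) * (1 / \<eta> + 64) * \<Lambda> ^ 4 * S0"
      using L by (simp add: distrib_left power2_eq_square power4_eq_xxxx)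
    also have "\<dots> = 1/8 * S1 + C / 2 * \<Lambda> ^ 4 * S0" unfolding eta(2) C_def by simp
    finally have p2: "(K + 64) * \<Lambda>\<^sup>2 * I G \<le> 1/8 * S1 + C / 2 * \<Lambda> ^ 4 * S0" .
    have "1/2 * S1 \<le> \<epsilon> / 2 * (S2 / \<Lambda> ^ 4) + C / 2 * \<Lambda> ^ 4 * S0"
      using main p1 p2 V n by linarith
    hence "2 * \<Lambda> ^ 4 * (1/2 * S1) \<le> 2 * \<Lambda> ^ 4 * (\<epsilon> / 2 * (S2 / \<Lambda> ^ 4) + C / 2 * \<Lambda> ^ 4 * S0)"
      using L by (intro mult_left_mono) auto
    also have "\<dots> = \<epsilon> * S2 + C * \<Lambda> ^ 8 * S0" using L by (simp add: distrib_left flip: power_add)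
    finally show "\<Lambda> ^ 4 * Sq (a + 2) b (laplacian u) \<le> \<epsilon> * Sq (a + 4) b (laplacian (laplacian u)) + C * \<Lambda> ^ 8 * Sq a b u"
      unfolding S0_def S1_def S2_def v_def by simp
  qed
qed

text \<open>The induction hypothesis for laplacian u bounds the second power of the Laplacian by the
  highest one and by laplacian u itself. Inserting it into \<open>laplacian_interpolation\<close>
  with a small coefficient lets the recurring term with laplacian u be absorbed.\<close>

lemma laplacian_power_interpolation:
  assumes "m \<ge> 1" "\<epsilon> > 0"
  shows "\<exists>C>0. \<forall>a b \<Lambda> u. tf R u \<longrightarrow> \<bar>a\<bar> \<le> \<Lambda> \<longrightarrow> \<bar>b\<bar> \<le> \<Lambda> \<longrightarrow> 1 \<le> \<Lambda> \<longrightarrow>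
      \<Lambda> ^ (4 * m) * Sq (a + 2) b (laplacian u) \<le> \<epsilon> * Sq (a + 2 * real m + 2) b ((laplacian ^^ Suc m) u) + C * \<Lambda> ^ (4 * m + 4) * Sq a b u"
  using assms
proof (induction m arbitrary: \<epsilon> rule: nat_induct_at_least)
  case base
  from laplacian_interpolation[OF base] obtain C where "C > 0"
    "\<And>a b \<Lambda> u. tf R u \<Longrightarrow> \<bar>a\<bar> \<le> \<Lambda> \<Longrightarrow> \<bar>b\<bar> \<le> \<Lambda> \<Longrightarrow> 1 \<le> \<Lambda> \<Longrightarrow>
      \<Lambda> ^ 4 * Sq (a + 2) b (laplacian u) \<le> \<epsilon> * Sq (a + 4) b (laplacian (laplacian u)) + C * \<Lambda> ^ 8 * Sq a b u" by metis
  thus ?case by (intro exI[of _ C]) (auto simp: add.assoc)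
next
  case (Suc m)
  from Suc.IH[of "\<epsilon> / 2"] Suc.prems obtain C1 where C1: "C1 > 0"
   "\<And>a b \<Lambda> u. tf R u \<Longrightarrow> \<bar>a\<bar> \<le> \<Lambda> \<Longrightarrow> \<bar>b\<bar> \<le> \<Lambda> \<Longrightarrow> 1 \<le> \<Lambda> \<Longrightarrow>
      \<Lambda> ^ (4 * m) * Sq (a + 2) b (laplacian u) \<le> \<epsilon> / 2 * Sq (a + 2 * real m + 2) b ((laplacian ^^ Suc m) u) + C1 * \<Lambda> ^ (4 * m + 4) * Sq a b u"
    by fastforce
  \<comment> \<open>For laplacian u the exponent is a + 2, bounded by 3 \<Lambda>; D collects the
    powers of 3. Then \<epsilon>2 D <= 1/2 permits the absorption and doubles C2.\<close>
  define D where "D = C1 * 3 ^ (4 * m + 4)"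
  have D: "D > 0" unfolding D_def using C1 by simp
  define \<epsilon>2 where "\<epsilon>2 = min 1 (1 / (2 * D))"
  have e2: "\<epsilon>2 > 0" "\<epsilon>2 \<le> 1" "\<epsilon>2 * D \<le> 1/2"
  proof -
    show "\<epsilon>2 > 0" "\<epsilon>2 \<le> 1" unfolding \<epsilon>2_def using D by auto
    have "\<epsilon>2 * D \<le> 1 / (2 * D) * D" unfolding \<epsilon>2_def using D by (intro mult_right_mono) auto
    thus "\<epsilon>2 * D \<le> 1/2" using D by simp
  qed
  from laplacian_interpolation[OF e2(1)] obtain C2 where C2: "C2 > 0"
    "\<And>a b \<Lambda> u. tf R u \<Longrightarrow> \<bar>a\<bar> \<le> \<Lambda> \<Longrightarrow> \<bar>b\<bar> \<le> \<Lambda> \<Longrightarrow> 1 \<le> \<Lambda> \<Longrightarrow>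
      \<Lambda> ^ 4 * Sq (a + 2) b (laplacian u) \<le> \<epsilon>2 * Sq (a + 4) b (laplacian (laplacian u)) + C2 * \<Lambda> ^ 8 * Sq a b u" by metis
  show ?case
  proof (intro exI[of _ "2 * C2"] conjI allI impI)
    show "2 * C2 > 0" using C2 by simp
    fix a b \<Lambda> :: real and u assume u: "tf R u" and ab: "\<bar>a\<bar> \<le> \<Lambda>" "\<bar>b\<bar> \<le> \<Lambda>" "1 \<le> \<Lambda>"
    define S0 where "S0 = Sq a b u"
    define S1 where "S1 = Sq (a + 2) b (laplacian u)"
    define S2 where "S2 = Sq (a + 4) b (laplacian (laplacian u))"
    define Sm where "Sm = Sq (a + 2 * real (Suc m) + 2) b ((laplacian ^^ Suc (Suc m)) u)"
    have n: "S0 \<ge> 0" "S1 \<ge> 0" "S2 \<ge> 0" "Sm \<ge> 0" unfolding S0_def S1_def S2_def Sm_def by (rule Sq_nonneg)+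
    have i1: "\<Lambda> ^ 4 * S1 \<le> \<epsilon>2 * S2 + C2 * \<Lambda> ^ 8 * S0"
      unfolding S0_def S1_def S2_def by (rule C2(2)[OF u ab])
    have "(3 * \<Lambda>) ^ (4 * m) * Sq ((a + 2) + 2) b (laplacian (laplacian u))
       \<le> \<epsilon> / 2 * Sq ((a + 2) + 2 * real m + 2) b ((laplacian ^^ Suc m) (laplacian u)) + C1 * (3 * \<Lambda>) ^ (4 * m + 4) * Sq (a + 2) b (laplacian u)"
      by (rule C1(2)) (use u ab in auto)
    also have "(laplacian ^^ Suc m) (laplacian u) = (laplacian ^^ Suc (Suc m)) u" by (simp add: funpow_swap1)
    finally have "(3 * \<Lambda>) ^ (4 * m) * S2 \<le> \<epsilon> / 2 * Sm + C1 * (3 * \<Lambda>) ^ (4 * m + 4) * S1"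
      unfolding S2_def Sm_def S1_def by (simp add: add_ac)
    moreover have "\<Lambda> ^ (4 * m) * S2 \<le> (3 * \<Lambda>) ^ (4 * m) * S2"
      using ab n by (intro mult_right_mono power_mono) auto
    ultimately have i2: "\<Lambda> ^ (4 * m) * S2 \<le> \<epsilon> / 2 * Sm + D * \<Lambda> ^ (4 * m + 4) * S1"
      unfolding D_def by (simp add: power_mult_distrib mult_ac)
    have "\<Lambda> ^ (4 * m) * (\<Lambda> ^ 4 * S1) \<le> \<Lambda> ^ (4 * m) * (\<epsilon>2 * S2 + C2 * \<Lambda> ^ 8 * S0)"
      using i1 ab by (intro mult_left_mono) auto
    also have "\<dots> = \<epsilon>2 * (\<Lambda> ^ (4 * m) * S2) + C2 * \<Lambda> ^ (4 * m + 8) * S0"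
      by (simp add: algebra_simps power_add)
    also have "\<epsilon>2 * (\<Lambda> ^ (4 * m) * S2) \<le> \<epsilon>2 * (\<epsilon> / 2 * Sm + D * \<Lambda> ^ (4 * m + 4) * S1)"
      using i2 e2 by (intro mult_left_mono) auto
    also have "\<dots> = \<epsilon>2 * (\<epsilon> / 2 * Sm) + (\<epsilon>2 * D) * (\<Lambda> ^ (4 * m + 4) * S1)" by (simp add: algebra_simps)
    also have "\<dots> \<le> 1 * (\<epsilon> / 2 * Sm) + 1/2 * (\<Lambda> ^ (4 * m + 4) * S1)"
      using e2 n ab Suc.prems by (intro add_mono mult_right_mono) auto
    finally have "\<Lambda> ^ (4 * m + 4) * S1 \<le> \<epsilon> * Sm + 2 * C2 * \<Lambda> ^ (4 * m + 8) * S0"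
      by (simp add: power_add mult_ac)
    thus "\<Lambda> ^ (4 * Suc m) * Sq (a + 2) b (laplacian u)
      \<le> \<epsilon> * Sq (a + 2 * real (Suc m) + 2) b ((laplacian ^^ Suc (Suc m)) u) + 2 * C2 * \<Lambda> ^ (4 * Suc m + 4) * Sq a b u"
      unfolding S0_def S1_def Sm_def by (simp add: add_ac)
  qed
qed

text \<open>Interior regularity with explicit frequency. The two outermost derivatives of a word are
  removed by \<open>hessian_estimate\<close>: the Laplacian commutes past the rest of the word and
  falls under the induction on m for laplacian u, while the lower-order term falls under the
  induction on the length of the word.\<close>

lemma elliptic_estimate:
  "\<exists>C>0. \<forall>a b \<Lambda> u w. tf R u \<longrightarrow> \<bar>a\<bar> \<le> \<Lambda> \<longrightarrow> \<bar>b\<bar> \<le> \<Lambda> \<longrightarrow> 1 \<le> \<Lambda> \<longrightarrow> length w \<le> 2 * m \<longrightarrow>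
    \<Lambda> ^ (4 * m - 2 * length w) * Sq (a + real (length w)) b (pdw w u)
    \<le> C * (Sq (a + 2 * real m) b ((laplacian ^^ m) u) + \<Lambda> ^ (4 * m) * Sq a b u)"
proof (induction m)
  case 0
  show ?case by (intro exI[of _ 1]) (auto simp: Sq_nonneg)
next
  case (Suc m)
  then obtain C1 where C1: "C1 > 0"
    "\<And>a b \<Lambda> u w. tf R u \<Longrightarrow> \<bar>a\<bar> \<le> \<Lambda> \<Longrightarrow> \<bar>b\<bar> \<le> \<Lambda> \<Longrightarrow> 1 \<le> \<Lambda> \<Longrightarrow> length w \<le> 2 * m \<Longrightarrow>
    \<Lambda> ^ (4 * m - 2 * length w) * Sq (a + real (length w)) b (pdw w u)
    \<le> C1 * (Sq (a + 2 * real m) b ((laplacian ^^ m) u) + \<Lambda> ^ (4 * m) * Sq a b u)"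
    by blast
  obtain C2 where C2: "C2 > 0"
    "\<And>a b \<Lambda> u. tf R u \<Longrightarrow> \<bar>a\<bar> \<le> \<Lambda> \<Longrightarrow> \<bar>b\<bar> \<le> \<Lambda> \<Longrightarrow> 1 \<le> \<Lambda> \<Longrightarrow>
      \<Lambda> ^ (4 * m) * Sq (a + 2) b (laplacian u) \<le> 1 * Sq (a + 2 * real m + 2) b ((laplacian ^^ Suc m) u) + C2 * \<Lambda> ^ (4 * m + 4) * Sq a b u"
  proof (cases "m \<ge> 1")
    case True
    show ?thesis using laplacian_power_interpolation[OF True, of 1] that by fastforce
  next
    case False
    hence "m = 0" by simp
    thus ?thesis by (intro that[of 1]) (auto simp: Sq_nonneg)
  qed
  define n where "n = real CARD('n)"
  define H1 where "H1 = 2 + 256 * n\<^sup>2"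
  define H2 where "H2 = 65 * 256 * n\<^sup>2"
  have H: "H1 > 0" "H2 \<ge> 0" unfolding H1_def H2_def by (auto simp: add_pos_nonneg)
  define C1' where "C1' = C1 * 3 ^ (4 * m)"
  have C1': "C1' > 0" unfolding C1'_def using C1 by simp
  define B where "B = 1 + C2"
  \<comment> \<open>Large enough for each of the three cases (empty word, one letter, at least two
    letters); the bound grows by a factor c0 per letter.\<close>
  define c0 where "c0 = 1 + B + 65 + H1 * (C1' * (1 + B)) + H2 * (2 * real m + 1) ^ 4"
  have B: "B > 1" unfolding B_def using C2 by simp
  have c0: "c0 \<ge> 1" "c0 \<ge> B + 65" "c0 \<ge> H1 * (C1' * (1 + B)) + H2 * (2 * real m + 1) ^ 4 + B"
    "H1 * (C1' * (1 + B)) \<ge> 0" "H2 * (2 * real m + 1) ^ 4 \<ge> 0"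
  proof -
    show p: "H1 * (C1' * (1 + B)) \<ge> 0" "H2 * (2 * real m + 1) ^ 4 \<ge> 0" using H C1' B by auto
    show "c0 \<ge> 1" "c0 \<ge> B + 65" "c0 \<ge> H1 * (C1' * (1 + B)) + H2 * (2 * real m + 1) ^ 4 + B" unfolding c0_def using p B by auto
  qed
  have claim: "\<Lambda> ^ (4 * Suc m - 2 * length w) * Sq (a + real (length w)) b (pdw w u)
    \<le> c0 ^ Suc (length w) * (Sq (a + 2 * real (Suc m)) b ((laplacian ^^ Suc m) u) + \<Lambda> ^ (4 * Suc m) * Sq a b u)"
    if u: "tf R u" and ab: "\<bar>a\<bar> \<le> \<Lambda>" "\<bar>b\<bar> \<le> \<Lambda>" "1 \<le> \<Lambda>" and w: "length w \<le> 2 * Suc m" for a b \<Lambda> u w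
    using w
  proof (induction "length w" arbitrary: w rule: less_induct)
    case less
    define F where "F = Sq (a + 2 * real (Suc m)) b ((laplacian ^^ Suc m) u)"
    define S0 where "S0 = Sq a b u"
    define S1 where "S1 = Sq (a + 2) b (laplacian u)"
    have n: "F \<ge> 0" "S0 \<ge> 0" "S1 \<ge> 0" unfolding F_def S0_def S1_def by (rule Sq_nonneg)+
    define X where "X = F + \<Lambda> ^ (4 * Suc m) * S0"
    have X: "0 \<le> X" "\<Lambda> ^ (4 * Suc m) * S0 \<le> X" "F \<le> X" unfolding X_def using n ab by auto
    have S1: "\<Lambda> ^ (4 * m) * S1 \<le> B * X"
    proof -
      have "\<Lambda> ^ (4 * m) * S1 \<le> F + C2 * (\<Lambda> ^ (4 * Suc m) * S0)"
        using C2(2)[OF u ab] unfolding S1_def F_def S0_def by (simp add: add_ac mult.assoc)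
      also have "\<dots> \<le> X + C2 * X" using X C2 by (intro add_mono mult_left_mono) auto
      finally show ?thesis unfolding B_def by (simp add: algebra_simps)
    qed
    have pow1: "c0 * X \<le> c0 ^ Suc k * X" for k
    proof -
      have "c0 ^ 1 \<le> c0 ^ Suc k" using c0 by (intro power_increasing) auto
      thus ?thesis using X by (intro mult_right_mono) auto
    qed
    consider "w = []" | i where "w = [i]" | i j w' where "w = i # j # w'"
      by (metis list.exhaust)
    hence "\<Lambda> ^ (4 * Suc m - 2 * length w) * Sq (a + real (length w)) b (pdw w u) \<le> c0 ^ Suc (length w) * X"
    proof cases
      case 1
      have "\<Lambda> ^ (4 * Suc m) * S0 \<le> c0 * X" using X c0 mult_right_mono[of 1 c0 X] by linarith
      thus ?thesis using 1 unfolding S0_def by simp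
    next
      case 2
      have "Sq (a + 1) b (partial_deriv i u) \<le> (\<Sum>i\<in>UNIV. Sq (a + 1) b (partial_deriv i u))"
        by (rule member_le_sum) (auto simp: Sq_nonneg)
      also have "\<dots> \<le> 1 / \<Lambda>\<^sup>2 * S1 + (1 / 1 + 64) * \<Lambda>\<^sup>2 * S0"
        unfolding S1_def S0_def by (rule gradient_estimate[OF R u ab]) simp
      finally have "\<Lambda> ^ (4 * m + 2) * Sq (a + 1) b (partial_deriv i u) \<le> \<Lambda> ^ (4 * m + 2) * (1 / \<Lambda>\<^sup>2 * S1 + 65 * \<Lambda>\<^sup>2 * S0)"
        using ab by (intro mult_left_mono) auto
      also have "\<dots> = \<Lambda> ^ (4 * m) * S1 + 65 * (\<Lambda> ^ (4 * Suc m) * S0)"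
        using ab by (simp add: power_add algebra_simps power2_eq_square power4_eq_xxxx)
      also have "\<dots> \<le> B * X + 65 * X" using S1 X by (intro add_mono mult_left_mono) auto
      also have "\<dots> = (B + 65) * X" by (simp add: algebra_simps)
      also have "\<dots> \<le> c0 * X" using c0 X by (intro mult_right_mono) auto
      also have "\<dots> \<le> c0 ^ Suc (length w) * X" by (rule pow1)
      finally show ?thesis using 2 by simp
    next
      case 3
      define k where "k = length w'"
      have k: "k \<le> 2 * m" using less.prems 3 unfolding k_def by simp
      have Pw: "length w = k + 2" unfolding 3 k_def by simp
      define f where "f = pdw w' u"
      have f: "tf R f" unfolding f_def using u by auto
      \<comment> \<open>After k derivatives the weight exponent is a + k with k <= 2 m, still
        bounded by this multiple of \<Lambda>.\<close>
      define M where "M = (2 * real m + 1) * \<Lambda>"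
      have Mb: "\<bar>a + real k\<bar> \<le> M" "\<bar>b\<bar> \<le> M" "1 \<le> M"
      proof -
        have "real k \<le> 2 * real m" using k by simp
        also have "\<dots> \<le> 2 * real m * \<Lambda>" using ab mult_left_mono[of 1 \<Lambda> "2 * real m"] by simp
        finally show "\<bar>a + real k\<bar> \<le> M" unfolding M_def using ab by (simp add: algebra_simps)
        have "\<Lambda> \<le> M" unfolding M_def using ab by (simp add: algebra_simps)
        thus "\<bar>b\<bar> \<le> M" "1 \<le> M" using ab by auto
      qed
      have "Sq (a + real k + 2) b (partial_deriv i (partial_deriv j f)) \<le> (\<Sum>j\<in>UNIV. Sq (a + real k + 2) b (partial_deriv i (partial_deriv j f)))"
        by (rule member_le_sum) (auto simp: Sq_nonneg)
      also have "\<dots> \<le> (\<Sum>i\<in>UNIV. \<Sum>j\<in>UNIV. Sq (a + real k + 2) b (partial_deriv i (partial_deriv j f)))"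
        by (rule member_le_sum[of i UNIV "\<lambda>i. \<Sum>j\<in>UNIV. Sq (a + real k + 2) b (partial_deriv i (partial_deriv j f))"])
          (auto intro!: sum_nonneg simp: Sq_nonneg)
      also have "\<dots> \<le> H1 * Sq (a + real k + 2) b (laplacian f) + H2 * M ^ 4 * Sq (a + real k) b f"
        unfolding H1_def H2_def n_def by (rule hessian_estimate[OF R f Mb])
      also have "laplacian f = pdw w' (laplacian u)" unfolding f_def by (rule laplacian_pdw[OF tf_smooth[OF u]])
      finally have 4: "Sq (a + real k + 2) b (pdw w u) \<le> H1 * Sq (a + real k + 2) b (pdw w' (laplacian u)) + H2 * M ^ 4 * Sq (a + real k) b f"
        unfolding 3 f_def by simp
      have 5: "\<Lambda> ^ (4 * m - 2 * k) * Sq (a + real k + 2) b (pdw w' (laplacian u)) \<le> C1' * (1 + B) * X"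
      proof -
        have "\<Lambda> ^ (4 * m - 2 * k) * Sq (a + real k + 2) b (pdw w' (laplacian u))
          \<le> (3 * \<Lambda>) ^ (4 * m - 2 * k) * Sq ((a + 2) + real (length w')) b (pdw w' (laplacian u))"
          using ab Sq_nonneg unfolding k_def by (intro mult_mono power_mono) (auto simp: add_ac)
        also have "\<dots> \<le> C1 * (Sq ((a + 2) + 2 * real m) b ((laplacian ^^ m) (laplacian u)) + (3 * \<Lambda>) ^ (4 * m) * Sq (a + 2) b (laplacian u))"
          unfolding k_def by (rule C1(2)) (use u ab k in \<open>auto simp: k_def\<close>)
        also have "\<dots> = C1 * (F + 3 ^ (4 * m) * (\<Lambda> ^ (4 * m) * S1))"
          unfolding F_def S1_def by (simp add: funpow_swap1 add_ac power_mult_distrib)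
        also have "\<dots> \<le> C1 * (3 ^ (4 * m) * F + 3 ^ (4 * m) * (\<Lambda> ^ (4 * m) * S1))"
          using C1 n mult_right_mono[of 1 "3 ^ (4 * m)" F] by (intro mult_left_mono add_right_mono) auto
        also have "\<dots> = C1' * (F + \<Lambda> ^ (4 * m) * S1)" unfolding C1'_def by (simp add: algebra_simps)
        also have "\<dots> \<le> C1' * (X + B * X)" using C1' X S1 by (intro mult_left_mono add_mono) auto
        finally show ?thesis by (simp add: algebra_simps)
      qed
      have 6: "\<Lambda> ^ (4 * Suc m - 2 * k) * Sq (a + real k) b f \<le> c0 ^ Suc k * X"
        using less.hyps[of w'] Pw k unfolding k_def f_def X_def F_def S0_def by simp
      have 7: "\<Lambda> ^ (4 * m - 2 * k) * (M ^ 4 * Sq (a + real k) b f) \<le> (2 * real m + 1) ^ 4 * (c0 ^ Suc k * X)"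
      proof -
        have e: "4 * Suc m - 2 * k = (4 * m - 2 * k) + 4" using k by simp
        have eq: "\<Lambda> ^ (4 * m - 2 * k) * (M ^ 4 * Sq (a + real k) b f) = (2 * real m + 1) ^ 4 * (\<Lambda> ^ (4 * Suc m - 2 * k) * Sq (a + real k) b f)"
          unfolding M_def e power_add by (simp add: power_mult_distrib)
        show ?thesis unfolding eq by (rule mult_left_mono[OF 6]) simp
      qed
      have ex: "4 * Suc m - 2 * length w = 4 * m - 2 * k" using Pw k by simp
      have "\<Lambda> ^ (4 * Suc m - 2 * length w) * Sq (a + real (length w)) b (pdw w u)
        \<le> \<Lambda> ^ (4 * m - 2 * k) * (H1 * Sq (a + real k + 2) b (pdw w' (laplacian u)) + H2 * M ^ 4 * Sq (a + real k) b f)"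
        unfolding ex using 4 ab Pw by (intro mult_left_mono) (auto simp: add_ac)
      also have "\<dots> = H1 * (\<Lambda> ^ (4 * m - 2 * k) * Sq (a + real k + 2) b (pdw w' (laplacian u))) + H2 * (\<Lambda> ^ (4 * m - 2 * k) * (M ^ 4 * Sq (a + real k) b f))"
        by (simp add: algebra_simps)
      also have "\<dots> \<le> H1 * (C1' * (1 + B) * X) + H2 * ((2 * real m + 1) ^ 4 * (c0 ^ Suc k * X))"
        using 5 7 H by (intro add_mono mult_left_mono) auto
      also have "H1 * (C1' * (1 + B) * X) \<le> (H1 * (C1' * (1 + B))) * (c0 ^ Suc k * X)"
      proof -
        have "1 * X \<le> c0 ^ Suc k * X" using X c0 by (intro mult_right_mono one_le_power) auto
        hence "(H1 * (C1' * (1 + B))) * X \<le> (H1 * (C1' * (1 + B))) * (c0 ^ Suc k * X)"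
          using c0 by (intro mult_left_mono) auto
        thus ?thesis by (simp add: mult.assoc)
      qed
      also have "(H1 * (C1' * (1 + B))) * (c0 ^ Suc k * X) + H2 * ((2 * real m + 1) ^ 4 * (c0 ^ Suc k * X))
        = (H1 * (C1' * (1 + B)) + H2 * (2 * real m + 1) ^ 4) * (c0 ^ Suc k * X)" by (simp add: algebra_simps)
      also have "\<dots> \<le> c0 * (c0 ^ Suc k * X)" using c0 B X by (intro mult_right_mono) auto
      also have "\<dots> \<le> c0 ^ Suc (length w) * X"
      proof -
        have "c0 * c0 ^ Suc k \<le> c0 ^ Suc (length w)"
          unfolding Pw power_Suc[symmetric] using c0 by (intro power_increasing) auto
        thus ?thesis using X mult_right_mono by (fastforce simp: mult.assoc[symmetric])
      qed
      finally show ?thesis by simp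
    qed
    thus ?case unfolding X_def F_def S0_def .
  qed
  show ?case
  proof (intro exI[of _ "c0 ^ Suc (2 * Suc m)"] conjI allI impI)
    show "0 < c0 ^ Suc (2 * Suc m)" using c0 by simp
    fix a b \<Lambda> :: real and u and w :: "'n list"
    assume A: "tf R u" "\<bar>a\<bar> \<le> \<Lambda>" "\<bar>b\<bar> \<le> \<Lambda>" "1 \<le> \<Lambda>" "length w \<le> 2 * Suc m"
    have "c0 ^ Suc (length w) \<le> c0 ^ Suc (2 * Suc m)" using c0 A by (intro power_increasing) auto
    hence "c0 ^ Suc (length w) * (Sq (a + 2 * real (Suc m)) b ((laplacian ^^ Suc m) u) + \<Lambda> ^ (4 * Suc m) * Sq a b u)
      \<le> c0 ^ Suc (2 * Suc m) * (Sq (a + 2 * real (Suc m)) b ((laplacian ^^ Suc m) u) + \<Lambda> ^ (4 * Suc m) * Sq a b u)"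
      using A by (intro mult_right_mono add_nonneg_nonneg mult_nonneg_nonneg Sq_nonneg) auto
    with claim[OF A] show "\<Lambda> ^ (4 * Suc m - 2 * length w) * Sq (a + real (length w)) b (pdw w u)
      \<le> c0 ^ Suc (2 * Suc m) * (Sq (a + 2 * real (Suc m)) b ((laplacian ^^ Suc m) u) + \<Lambda> ^ (4 * Suc m) * Sq a b u)" by linarith
  qed
qed

end

section \<open>The Carleman estimate for derivatives\<close>

lemma NN_eq_Sq: "tf R u \<Longrightarrow> NN \<tau> j u = Sq (- \<tau> - real CARD('n) / 2) (- (2 * \<tau> + j)) u"
proof -
  assume u: "tf R u"
  have "NN \<tau> j u = I (\<lambda>x. wt (- real CARD('n)) 0 x * (wt (- \<tau>) (- (2 * \<tau> + j)) x * u x)\<^sup>2)"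
    unfolding NN_def J_def I_def ..
  also have "\<dots> = I (\<lambda>x. (wt (- \<tau> - real CARD('n) / 2) (- (2 * \<tau> + j)) x * u x)\<^sup>2)"
  proof (rule arg_cong[of _ _ I], rule ext)
    fix x
    show "wt (- real CARD('n)) 0 x * (wt (- \<tau>) (- (2 * \<tau> + j)) x * u x)\<^sup>2
      = (wt (- \<tau> - real CARD('n) / 2) (- (2 * \<tau> + j)) x * u x)\<^sup>2"
    proof (cases "x \<in> pball")
      case True
      have "wt (- \<tau> - real CARD('n) / 2) (- (2 * \<tau> + j)) x = wt (- real CARD('n) / 2) 0 x * wt (- \<tau>) (- (2 * \<tau> + j)) x"
        unfolding wt_mult[OF True] by (simp add: algebra_simps)
      moreover have "(wt (- real CARD('n) / 2) 0 x)\<^sup>2 = wt (- real CARD('n)) 0 x"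
        unfolding wt_sq[OF True] by simp
      ultimately show ?thesis by (simp add: power_mult_distrib)
    qed (use tf_eq_0[OF u] in simp)
  qed
  finally show ?thesis unfolding Sq_def .
qed

text \<open>Both weight exponents are of size \<tau>, so \<open>elliptic_estimate\<close> applies
  with \<Lambda> comparable to \<tau>: a derivative is exchanged for a factor \<tau>, and u itself
  is controlled by \<open>carleman_polyharmonic\<close>.\<close>

theorem carleman_derivatives:
  fixes m :: nat
  assumes m: "m \<ge> 2"
  shows "\<exists>C>0. \<forall>\<tau>>1. \<forall>u w. tf (exp (- 100 * real m)) u \<longrightarrow> length w \<le> 2 * m \<longrightarrow>
    \<tau> ^ (3 * m) * Sq (- \<tau> - real CARD('n) / 2 + real (length w)) (- (2 * \<tau> + real m)) (pdw w u)
    \<le> C * \<tau> ^ (2 * length w) * NN \<tau> 0 (\<lambda>x. norm (x - x0) ^ (2 * m) * (laplacian ^^ m) u x)"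
proof -
  define R where "R = exp (- 100 * real m)"
  have R: "R \<le> exp (- 1)" unfolding R_def using m by simp
  obtain C1 where C1: "C1 > 0" "\<And>\<tau> u. \<tau> > 1 \<Longrightarrow> tf R u \<Longrightarrow>
    \<tau> ^ (3 * m) * NN \<tau> (real m) u \<le> C1 * NN \<tau> 0 (\<lambda>x. norm (x - x0) ^ (2 * m) * (laplacian ^^ m) u x)"
    using carleman_polyharmonic[OF m] unfolding R_def by blast
  obtain C2 where C2: "C2 > 0"
    "\<And>a b \<Lambda> u w. tf R u \<Longrightarrow> \<bar>a\<bar> \<le> \<Lambda> \<Longrightarrow> \<bar>b\<bar> \<le> \<Lambda> \<Longrightarrow> 1 \<le> \<Lambda> \<Longrightarrow> length w \<le> 2 * m \<Longrightarrow>
    \<Lambda> ^ (4 * m - 2 * length w) * Sq (a + real (length w)) b (pdw w u)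
    \<le> C2 * (Sq (a + 2 * real m) b ((laplacian ^^ m) u) + \<Lambda> ^ (4 * m) * Sq a b u)"
    using elliptic_estimate[OF R, of m] by blast
  \<comment> \<open>As \<tau> > 1, the product \<kappa> \<tau> dominates both \<tau> + n/2 and 2
    \<tau> + m.\<close>
  define \<kappa> where "\<kappa> = 2 + real m + real CARD('n)"
  have k: "\<kappa> \<ge> 1" unfolding \<kappa>_def by simp
  define C where "C = C2 * (1 + \<kappa> ^ (4 * m) * C1)"
  show ?thesis
  proof (intro exI[of _ C] conjI allI impI)
    show "C > 0" unfolding C_def using C1 C2 k by (intro mult_pos_pos add_pos_pos) auto
    fix \<tau> :: real and u and w :: "'n list"
    assume \<tau>: "\<tau> > 1" and u': "tf (exp (- 100 * real m)) u" and w: "length w \<le> 2 * m"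
    have u: "tf R u" using u' unfolding R_def .
    define F where "F = NN \<tau> 0 (\<lambda>x. norm (x - x0) ^ (2 * m) * (laplacian ^^ m) u x)"
    define a where "a = - \<tau> - real CARD('n) / 2"
    define b where "b = - (2 * \<tau> + real m)"
    define \<Lambda> where "\<Lambda> = \<kappa> * \<tau>"
    have L: "\<bar>a\<bar> \<le> \<Lambda>" "\<bar>b\<bar> \<le> \<Lambda>" "1 \<le> \<Lambda>"
    proof -
      have "real m * 1 \<le> real m * \<tau>" "real CARD('n) * 1 \<le> real CARD('n) * \<tau>"
        using \<tau> by (intro mult_left_mono; simp)+
      moreover have "\<Lambda> = 2 * \<tau> + real m * \<tau> + real CARD('n) * \<tau>" unfolding \<Lambda>_def \<kappa>_def by (simp add: algebra_simps)
      moreover have "real m \<ge> 0" "real CARD('n) \<ge> 0" by auto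
      ultimately show "\<bar>a\<bar> \<le> \<Lambda>" "\<bar>b\<bar> \<le> \<Lambda>" unfolding a_def b_def using \<tau> by linarith+
      show "1 \<le> \<Lambda>" unfolding \<Lambda>_def using k \<tau> mult_mono[of 1 \<kappa> 1 \<tau>] by simp
    qed
    have F: "F \<ge> 0" unfolding F_def by (rule NN_nonneg)
    define y where "y = (\<lambda>x. norm (x - x0) ^ (2 * m) * (laplacian ^^ m) u x)"
    have y: "tf R y" unfolding y_def by (rule iterated_laplacian_Lop(1)[OF u])
    have Sm: "Sq (a + 2 * real m) b ((laplacian ^^ m) u) \<le> F"
    proof -
      have "Sq (a + 2 * real m) b ((laplacian ^^ m) u) = Sq a b y"
        unfolding Sq_def
      proof (rule arg_cong[of _ _ I], rule ext)
        fix x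
        show "(wt (a + 2 * real m) b x * (laplacian ^^ m) u x)\<^sup>2 = (wt a b x * y x)\<^sup>2"
        proof (cases "x \<in> pball")
          case True
          have "wt (2 * real m) 0 x = norm (x - x0) ^ (2 * m)"
            unfolding wt_def using pball_norm[OF True] powr_realpow[of "norm (x - x0)" "2 * m"] by simp
          hence "wt (a + 2 * real m) b x = wt a b x * norm (x - x0) ^ (2 * m)"
            using wt_mult[OF True, of a b "2 * real m" 0] by simp
          thus ?thesis unfolding y_def by (simp add: mult_ac)
        qed (use tf_eq_0[OF tf_laplacian_power[OF u]] in \<open>simp add: y_def\<close>)
      qed
      also have "\<dots> = NN \<tau> (real m) y" unfolding NN_eq_Sq[OF y] a_def b_def ..
      also have "NN \<tau> (real j) y \<le> NN \<tau> 0 y" for j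
      proof (induction j)
        case (Suc j)
        have "NN \<tau> (real j + 1) y \<le> NN \<tau> (real j) y"
          by (rule NN_shift_le[OF y li_le_1[OF R]])
        with Suc show ?case by (simp add: add.commute)
      qed simp
      finally show ?thesis unfolding F_def y_def .
    qed
    have S0: "\<tau> ^ (3 * m) * Sq a b u \<le> C1 * F"
      using C1(2)[OF \<tau> u] unfolding NN_eq_Sq[OF u] F_def a_def b_def .
    have "\<tau> ^ (4 * m - 2 * length w) * (\<tau> ^ (3 * m) * Sq (a + real (length w)) b (pdw w u))
      = \<tau> ^ (3 * m) * (\<tau> ^ (4 * m - 2 * length w) * Sq (a + real (length w)) b (pdw w u))"
      by simp
    also have "\<dots> \<le> \<tau> ^ (3 * m) * (\<Lambda> ^ (4 * m - 2 * length w) * Sq (a + real (length w)) b (pdw w u))"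
      unfolding \<Lambda>_def using k \<tau> Sq_nonneg by (intro mult_left_mono mult_right_mono power_mono) (auto simp: mult_le_cancel_right1)
    also have "\<dots> \<le> \<tau> ^ (3 * m) * (C2 * (Sq (a + 2 * real m) b ((laplacian ^^ m) u) + \<Lambda> ^ (4 * m) * Sq a b u))"
      using C2(2)[OF u L w] \<tau> by (intro mult_left_mono) auto
    also have "\<dots> = C2 * (\<tau> ^ (3 * m) * Sq (a + 2 * real m) b ((laplacian ^^ m) u) + \<Lambda> ^ (4 * m) * (\<tau> ^ (3 * m) * Sq a b u))"
      by (simp add: algebra_simps)
    also have "\<dots> \<le> C2 * (\<tau> ^ (4 * m) * F + \<Lambda> ^ (4 * m) * (C1 * F))"
    proof (rule mult_left_mono[OF add_mono])
      \<comment> \<open>The highest power of the Laplacian comes without any gain in \<tau>. None is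
        needed, since the term with u is weighted by \<Lambda>^(4m) anyway.\<close>
      show "\<tau> ^ (3 * m) * Sq (a + 2 * real m) b ((laplacian ^^ m) u) \<le> \<tau> ^ (4 * m) * F"
        using \<tau> Sm by (intro mult_mono power_increasing) (auto simp: Sq_nonneg)
      show "\<Lambda> ^ (4 * m) * (\<tau> ^ (3 * m) * Sq a b u) \<le> \<Lambda> ^ (4 * m) * (C1 * F)"
        using L by (intro mult_left_mono S0) auto
    qed (use C2 in auto)
    also have "\<dots> = \<tau> ^ (4 * m) * (C * F)" unfolding \<Lambda>_def C_def by (simp add: power_mult_distrib algebra_simps)
    also have "\<tau> ^ (4 * m) = \<tau> ^ (4 * m - 2 * length w) * \<tau> ^ (2 * length w)"
      using w by (simp flip: power_add)
    finally have "\<tau> ^ (4 * m - 2 * length w) * (\<tau> ^ (3 * m) * Sq (a + real (length w)) b (pdw w u))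
       \<le> \<tau> ^ (4 * m - 2 * length w) * (C * \<tau> ^ (2 * length w) * F)" by (simp add: mult_ac)
    hence "\<tau> ^ (3 * m) * Sq (a + real (length w)) b (pdw w u) \<le> C * \<tau> ^ (2 * length w) * F"
      by (rule mult_left_le_imp_le) (use \<tau> in simp)
    thus "\<tau> ^ (3 * m) * Sq (- \<tau> - real CARD('n) / 2 + real (length w)) (- (2 * \<tau> + real m)) (pdw w u)
    \<le> C * \<tau> ^ (2 * length w) * NN \<tau> 0 (\<lambda>x. norm (x - x0) ^ (2 * m) * (laplacian ^^ m) u x)"
      unfolding a_def b_def F_def .
  qed
qed

end

subsection \<open>The Sobolev inequality\<close>

text \<open>An upper gradient: g dominates the derivative of h along every line. The truncations
  used below are only C^1 and hence outside \<open>smooth_on\<close>, and the proof integrates g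
  along rays, for which this form suffices.\<close>

definition grad_bound :: "(real ^ 'n \<Rightarrow> real) \<Rightarrow> (real ^ 'n \<Rightarrow> real) \<Rightarrow> bool"
  where "grad_bound h g \<longleftrightarrow> continuous_on UNIV h \<and> continuous_on UNIV g \<and> (\<forall>x. 0 \<le> g x) \<and>
    (\<forall>x v s. \<exists>d. ((\<lambda>s. h (x + s *\<^sub>R v)) has_real_derivative d) (at s) \<and> \<bar>d\<bar> \<le> g (x + s *\<^sub>R v) * norm v)"

lemma grad_bound_measurable:
  assumes "grad_bound h g"
  shows "h \<in> borel_measurable borel" "g \<in> borel_measurable borel" "0 \<le> g x"
  using assms borel_measurable_continuous_onI unfolding grad_bound_def by auto

lemma nn_integral_bound_difference:
  fixes \<phi> G :: "real \<Rightarrow> real"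
  assumes ab: "a \<le> b" and G: "continuous_on UNIV G" "\<And>s. 0 \<le> G s"
    and d: "\<And>s. (\<phi> has_real_derivative \<phi>' s) (at s)" "\<And>s. a < s \<Longrightarrow> s < b \<Longrightarrow> \<bar>\<phi>' s\<bar> \<le> G s"
  shows "ennreal \<bar>\<phi> b - \<phi> a\<bar> \<le> (\<integral>\<^sup>+s. ennreal (G s) * indicator {a..b} s \<partial>lborel)"
proof (cases "a = b")
  case False
  hence ab': "a < b" using ab by simp
  \<comment> \<open>Antidifferentiating on a larger interval makes F differentiable from both sides
    at a and b.\<close>
  obtain F where F: "\<And>x. x \<in> {a - 1..b + 1} \<Longrightarrow> (F has_vector_derivative G x) (at x within {a - 1..b + 1})"
    using antiderivative_continuous[of "a - 1" "b + 1" G] continuous_on_subset[OF G(1)] by blast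
  have F': "(F has_real_derivative G x) (at x)" if "x \<in> {a..b}" for x
  proof -
    have "x \<in> interior {a - 1..b + 1}" using that by simp
    hence "at x within {a - 1..b + 1} = at x" by (rule at_within_interior)
    thus ?thesis using F[of x] that by (simp add: has_real_derivative_iff_has_vector_derivative)
  qed
  have "norm (\<phi> b - \<phi> a) \<le> F b - F a"
  proof (rule differentiable_bound_general[OF ab'])
    show "continuous_on {a..b} \<phi>" using d(1) by (meson DERIV_isCont continuous_at_imp_continuous_on)
    show "continuous_on {a..b} F" using F' by (meson DERIV_isCont continuous_at_imp_continuous_on)
    show "(\<phi> has_vector_derivative \<phi>' s) (at s)" for s
      using d(1) by (simp add: has_real_derivative_iff_has_vector_derivative)
    show "(F has_vector_derivative G s) (at s)" if "a < s" "s < b" for s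
      using F'[of s] that by (simp add: has_real_derivative_iff_has_vector_derivative)
    show "norm (\<phi>' s) \<le> G s" if "a < s" "s < b" for s using d(2)[OF that] by simp
  qed
  hence "ennreal \<bar>\<phi> b - \<phi> a\<bar> \<le> ennreal (F b - F a)" by (intro ennreal_leI) simp
  also have "\<dots> = (\<integral>\<^sup>+s. ennreal (G s) * indicator {a..b} s \<partial>lborel)"
    by (rule nn_integral_FTC_Icc[symmetric]) (use G F' ab borel_measurable_continuous_onI in auto)
  finally show ?thesis .
qed simp

text \<open>Rays are averaged over directions in a ball \<open>ray_ball\<close> that stays away from the origin.\<close>

definition ray_ball :: "(real ^ 'n) set"
  where "ray_ball = ball (2 *\<^sub>R axis (SOME i. True) 1) 1"

lemma ray_ball_norm:
  assumes "\<omega> \<in> (ray_ball :: (real ^ 'n) set)"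
  shows "1 \<le> norm \<omega>" "norm \<omega> \<le> 3"
proof -
  define e :: "real ^ 'n" where "e = 2 *\<^sub>R axis (SOME i. True) 1"
  have e: "norm e = 2" unfolding e_def by simp
  have "norm (e - \<omega>) < 1" using assms unfolding ray_ball_def e_def[symmetric] by (simp add: dist_norm)
  moreover have "norm e \<le> norm (e - \<omega>) + norm \<omega>" using norm_triangle_ineq[of "e - \<omega>" \<omega>] by simp
  moreover have "norm \<omega> \<le> norm (e - \<omega>) + norm e" using norm_triangle_ineq4[of e "e - \<omega>"] by simp
  ultimately show "1 \<le> norm \<omega>" "norm \<omega> \<le> 3" using e by linarith+
qed

lemma ray_ball_sets [measurable]: "ray_ball \<in> sets borel"
  unfolding ray_ball_def by simp

definition ray_vol :: "'n::finite itself \<Rightarrow> real"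
  where "ray_vol _ = measure lborel (ray_ball :: (real ^ 'n) set)"

lemma ray_vol: "ray_vol TYPE('n::finite) > 0" "emeasure lborel (ray_ball :: (real ^ 'n) set) = ennreal (ray_vol TYPE('n))"
proof -
  have fin: "emeasure lborel (ray_ball :: (real ^ 'n) set) < \<infinity>"
    unfolding ray_ball_def by (rule emeasure_bounded_finite) simp
  show eq: "emeasure lborel (ray_ball :: (real ^ 'n) set) = ennreal (ray_vol TYPE('n))"
    unfolding ray_vol_def by (rule emeasure_eq_ennreal_measure) (use fin in auto)
  have "measure lborel (ball (2 *\<^sub>R axis (SOME i. True) 1 :: real ^ 'n) 1) > 0"
    by (rule content_ball_pos) simp
  thus "ray_vol TYPE('n) > 0" unfolding ray_vol_def ray_ball_def .
qed

text \<open>An integral of f over the ball of radius s about a point at distance 2 s from x,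
  rescaled to the fixed set \<open>ray_ball\<close>; it is an average up to the factor
  \<open>ray_vol\<close>.\<close>

definition ray_mean :: "(real ^ 'n \<Rightarrow> ennreal) \<Rightarrow> real \<Rightarrow> real ^ 'n \<Rightarrow> ennreal"
  where "ray_mean f s x = (\<integral>\<^sup>+\<omega>. f (x + s *\<^sub>R \<omega>) * indicator ray_ball \<omega> \<partial>lborel)"

lemma ray_mean_measurable:
  assumes [measurable]: "f \<in> borel_measurable borel"
  shows "(\<lambda>s. ray_mean f s x) \<in> borel_measurable borel"
    "(\<lambda>(x, s). ray_mean f s x) \<in> borel_measurable (borel \<Otimes>\<^sub>M borel)"
  unfolding ray_mean_def by measurable

lemma nn_integral_translate:
  fixes c :: "real ^ 'n"
  assumes [measurable]: "f \<in> borel_measurable borel"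
  shows "(\<integral>\<^sup>+x. f (x + c) \<partial>lborel) = (\<integral>\<^sup>+x. f x \<partial>lborel)"
proof -
  have "(\<integral>\<^sup>+x. f x \<partial>lborel) = (\<integral>\<^sup>+x. f x \<partial>distr lborel borel ((+) c))" by (simp add: lborel_distr_plus)
  also have "\<dots> = (\<integral>\<^sup>+x. f (x + c) \<partial>lborel)" by (subst nn_integral_distr) (auto simp: add.commute)
  finally show ?thesis by simp
qed

lemma nn_integral_scale:
  fixes x :: "real ^ 'n"
  assumes [measurable]: "f \<in> borel_measurable borel" and s: "s > 0"
  shows "(\<integral>\<^sup>+\<omega>. f (x + s *\<^sub>R \<omega>) \<partial>lborel) = ennreal (s powr (- real CARD('n))) * (\<integral>\<^sup>+x. f x \<partial>lborel)"
proof -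
  have "(\<integral>\<^sup>+y. f y \<partial>lborel) = (\<integral>\<^sup>+y. f y \<partial>density (distr lborel borel (\<lambda>\<omega>. x + s *\<^sub>R \<omega>)) (\<lambda>_. \<bar>s\<bar> ^ DIM(real ^ 'n)))"
    using lborel_affine[of s x] s by simp
  also have "\<dots> = (\<integral>\<^sup>+\<omega>. ennreal (s ^ CARD('n)) * f (x + s *\<^sub>R \<omega>) \<partial>lborel)"
    using s by (subst nn_integral_density) (auto simp: nn_integral_distr)
  also have "\<dots> = ennreal (s ^ CARD('n)) * (\<integral>\<^sup>+\<omega>. f (x + s *\<^sub>R \<omega>) \<partial>lborel)"
    by (rule nn_integral_cmult) simp
  finally have eq: "(\<integral>\<^sup>+y. f y \<partial>lborel) = ennreal (s ^ CARD('n)) * (\<integral>\<^sup>+\<omega>. f (x + s *\<^sub>R \<omega>) \<partial>lborel)" .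
  have "s powr (- real CARD('n)) * s ^ CARD('n) = 1"
    using s by (simp add: powr_minus powr_realpow)
  hence "ennreal (s powr (- real CARD('n))) * ennreal (s ^ CARD('n)) = 1"
    using s by (simp flip: ennreal_mult)
  thus ?thesis unfolding eq by (simp flip: mult.assoc)
qed

lemma ray_mean_le:
  fixes x :: "real ^ 'n"
  assumes [measurable]: "f \<in> borel_measurable borel" and s: "s > 0"
  shows "ray_mean f s x \<le> ennreal (s powr (- real CARD('n))) * (\<integral>\<^sup>+x. f x \<partial>lborel)"
proof -
  have "ray_mean f s x \<le> (\<integral>\<^sup>+\<omega>. f (x + s *\<^sub>R \<omega>) \<partial>lborel)"
    unfolding ray_mean_def by (rule nn_integral_mono) (auto simp: indicator_def)
  thus ?thesis using nn_integral_scale[OF assms] by simp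
qed

text \<open>Integrating over x first removes the translation by s \<omega>. This bound is uniform in
  s and thus the useful one for small s, where \<open>ray_mean_le\<close> blows up.\<close>

lemma nn_integral_ray_mean:
  fixes f :: "real ^ 'n \<Rightarrow> ennreal"
  assumes [measurable]: "f \<in> borel_measurable borel"
  shows "(\<integral>\<^sup>+x. ray_mean f s x \<partial>lborel) = ennreal (ray_vol TYPE('n)) * (\<integral>\<^sup>+x. f x \<partial>lborel)"
proof -
  have "(\<integral>\<^sup>+x. ray_mean f s x \<partial>lborel) = (\<integral>\<^sup>+\<omega>. (\<integral>\<^sup>+x. f (x + s *\<^sub>R \<omega>) * indicator ray_ball \<omega> \<partial>lborel) \<partial>lborel)"
    unfolding ray_mean_def by (rule lborel_pair.Fubini') measurable
  also have "\<dots> = (\<integral>\<^sup>+\<omega>. (\<integral>\<^sup>+x. f x \<partial>lborel) * indicator (ray_ball :: (real ^ 'n) set) \<omega> \<partial>lborel)"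
  proof -
    have "(\<integral>\<^sup>+x. f (x + s *\<^sub>R \<omega>) * indicator ray_ball \<omega> \<partial>lborel) = (\<integral>\<^sup>+x. f x \<partial>lborel) * indicator ray_ball \<omega>" for \<omega>
      by (subst nn_integral_multc) (auto simp: nn_integral_translate)
    thus ?thesis by simp
  qed
  also have "\<dots> = ennreal (ray_vol TYPE('n)) * (\<integral>\<^sup>+x. f x \<partial>lborel)"
    by (subst nn_integral_cmult_indicator) (auto simp: ray_vol(2) mult.commute)
  finally show ?thesis .
qed

text \<open>A form of Jensen's inequality for means: \<open>g \<le> T + T\<^bsup>1-q\<^esup> g\<^sup>q\<close> for every threshold \<open>T\<close>.\<close>

lemma threshold_ineq:
  fixes g T q :: real
  assumes "g \<ge> 0" "T > 0" "q \<ge> 1"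
  shows "g \<le> T + T powr (1 - q) * g powr q"
proof (cases "g \<le> T")
  case True thus ?thesis by (simp add: add_increasing2)
next
  case False
  have "g = g powr (1 - q) * g powr q" using False assms by (simp flip: powr_add)
  also have "\<dots> \<le> T powr (1 - q) * g powr q"
    using False assms by (intro mult_right_mono powr_mono2') auto
  finally show ?thesis using assms by linarith
qed

lemma ray_mean_threshold:
  fixes g :: "real ^ 'n \<Rightarrow> real"
  assumes [measurable]: "g \<in> borel_measurable borel" and g: "\<And>x. 0 \<le> g x" and T: "T > 0" "q \<ge> 1"
  shows "ray_mean (\<lambda>x. ennreal (g x)) s x \<le> ennreal (ray_vol TYPE('n) * T)
    + ennreal (T powr (1 - q)) * ray_mean (\<lambda>x. ennreal (g x powr q)) s x"
proof -
  have "ray_mean (\<lambda>x. ennreal (g x)) s x \<le> (\<integral>\<^sup>+\<omega>. ennreal T * indicator ray_ball \<omega>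
      + ennreal (T powr (1 - q)) * (ennreal (g (x + s *\<^sub>R \<omega>) powr q) * indicator ray_ball \<omega>) \<partial>lborel)"
    unfolding ray_mean_def
  proof (rule nn_integral_mono)
    fix \<omega>
    have "ennreal (g (x + s *\<^sub>R \<omega>)) \<le> ennreal (T + T powr (1 - q) * g (x + s *\<^sub>R \<omega>) powr q)"
      by (intro ennreal_leI threshold_ineq g T)
    also have "\<dots> = ennreal T + ennreal (T powr (1 - q)) * ennreal (g (x + s *\<^sub>R \<omega>) powr q)"
      using T by (simp add: ennreal_plus ennreal_mult)
    finally show "ennreal (g (x + s *\<^sub>R \<omega>)) * indicator ray_ball \<omega> \<le> ennreal T * indicator ray_ball \<omega>
      + ennreal (T powr (1 - q)) * (ennreal (g (x + s *\<^sub>R \<omega>) powr q) * indicator ray_ball \<omega>)"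
      by (auto simp: indicator_def)
  qed
  also have "\<dots> = ennreal (ray_vol TYPE('n) * T) + ennreal (T powr (1 - q)) * ray_mean (\<lambda>x. ennreal (g x powr q)) s x"
    unfolding ray_mean_def using ray_vol(1)[where 'n='n] T
    by (simp add: nn_integral_add nn_integral_cmult ray_vol(2) ennreal_mult mult.commute)
  finally show ?thesis .
qed

text \<open>Along each ray h vanishes from some point on, so its value at x is at most the integral
  of g along the ray times |\<omega>| <= 3. Averaging over a solid ball of directions instead of a
  sphere makes Fubini applicable without polar coordinates.\<close>

lemma ray_representation:
  fixes h g :: "real ^ 'n \<Rightarrow> real"
  assumes hg: "grad_bound h g" and supp: "\<And>x. norm x > r \<Longrightarrow> h x = 0"
  shows "ennreal (ray_vol TYPE('n) * \<bar>h x\<bar>)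
    \<le> 3 * (\<integral>\<^sup>+s. ray_mean (\<lambda>x. ennreal (g x)) s x * indicator {0..} s \<partial>lborel)"
proof -
  note [measurable] = grad_bound_measurable(1,2)[OF hg]
  have cg: "continuous_on UNIV g" and g0: "\<And>x. 0 \<le> g x" using hg unfolding grad_bound_def by auto
  have ray: "ennreal \<bar>h x\<bar> \<le> 3 * (\<integral>\<^sup>+s. ennreal (g (x + s *\<^sub>R \<omega>)) * indicator {0..} s \<partial>lborel)"
    if w: "\<omega> \<in> ray_ball" for \<omega>
  proof -
    note wn = ray_ball_norm[OF w]
    \<comment> \<open>Since |\<omega>| >= 1, the ray has left the ball of radius r at parameter
      N.\<close>
    define N where "N = norm x + \<bar>r\<bar> + 1"
    have N: "N \<ge> 0" unfolding N_def by (auto intro: add_nonneg_nonneg)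
    have "N * 1 \<le> N * norm \<omega>" using wn N by (intro mult_left_mono) auto
    moreover have "norm (N *\<^sub>R \<omega>) \<le> norm (x + N *\<^sub>R \<omega>) + norm x"
      using norm_triangle_ineq4[of "x + N *\<^sub>R \<omega>" x] by simp
    ultimately have "norm (x + N *\<^sub>R \<omega>) > r" using N unfolding N_def by (simp add: abs_mult)
    hence hN: "h (x + N *\<^sub>R \<omega>) = 0" by (rule supp)
    have "\<forall>s. \<exists>d. ((\<lambda>s. h (x + s *\<^sub>R \<omega>)) has_real_derivative d) (at s) \<and> \<bar>d\<bar> \<le> g (x + s *\<^sub>R \<omega>) * norm \<omega>"
      using hg unfolding grad_bound_def by blast
    then obtain d where d: "\<And>s. ((\<lambda>s. h (x + s *\<^sub>R \<omega>)) has_real_derivative d s) (at s)"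
      "\<And>s. \<bar>d s\<bar> \<le> g (x + s *\<^sub>R \<omega>) * norm \<omega>" by metis
    have "ennreal \<bar>h (x + N *\<^sub>R \<omega>) - h (x + 0 *\<^sub>R \<omega>)\<bar>
      \<le> (\<integral>\<^sup>+s. ennreal (g (x + s *\<^sub>R \<omega>) * norm \<omega>) * indicator {0..N} s \<partial>lborel)"
    proof (rule nn_integral_bound_difference[OF N _ _ d(1) d(2)])
      show "continuous_on UNIV (\<lambda>s. g (x + s *\<^sub>R \<omega>) * norm \<omega>)"
        by (intro continuous_intros continuous_on_compose2[OF cg]) auto
    qed (use g0 in auto)
    also have "\<dots> \<le> (\<integral>\<^sup>+s. 3 * (ennreal (g (x + s *\<^sub>R \<omega>)) * indicator {0..} s) \<partial>lborel)"
    proof (rule nn_integral_mono)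
      fix s
      have "ennreal (g (x + s *\<^sub>R \<omega>) * norm \<omega>) \<le> ennreal (3 * g (x + s *\<^sub>R \<omega>))"
        using wn g0[of "x + s *\<^sub>R \<omega>"] mult_left_mono[of "norm \<omega>" 3 "g (x + s *\<^sub>R \<omega>)"] by (intro ennreal_leI) (simp add: mult.commute)
      also have "\<dots> = 3 * ennreal (g (x + s *\<^sub>R \<omega>))" using g0 by (simp add: ennreal_mult)
      finally show "ennreal (g (x + s *\<^sub>R \<omega>) * norm \<omega>) * indicator {0..N} s \<le> 3 * (ennreal (g (x + s *\<^sub>R \<omega>)) * indicator {0..} s)"
        by (auto simp: indicator_def)
    qed
    also have "\<dots> = 3 * (\<integral>\<^sup>+s. ennreal (g (x + s *\<^sub>R \<omega>)) * indicator {0..} s \<partial>lborel)"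
      by (rule nn_integral_cmult) measurable
    finally show ?thesis using hN by simp
  qed
  have "ennreal (ray_vol TYPE('n) * \<bar>h x\<bar>) = (\<integral>\<^sup>+\<omega>. ennreal \<bar>h x\<bar> * indicator (ray_ball :: (real ^ 'n) set) \<omega> \<partial>lborel)"
    using ray_vol(1)[where 'n='n] by (subst nn_integral_cmult_indicator) (auto simp: ray_vol(2) ennreal_mult mult.commute)
  also have "\<dots> \<le> (\<integral>\<^sup>+\<omega>. 3 * (\<integral>\<^sup>+s. ennreal (g (x + s *\<^sub>R \<omega>)) * indicator {0..} s \<partial>lborel) * indicator ray_ball \<omega> \<partial>lborel)"
    using ray by (intro nn_integral_mono) (auto simp: indicator_def)
  also have "\<dots> = 3 * (\<integral>\<^sup>+\<omega>. (\<integral>\<^sup>+s. ennreal (g (x + s *\<^sub>R \<omega>)) * indicator {0..} s * indicator ray_ball \<omega> \<partial>lborel) \<partial>lborel)"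
  proof -
    have "3 * (\<integral>\<^sup>+s. ennreal (g (x + s *\<^sub>R \<omega>)) * indicator {0..} s \<partial>lborel) * indicator ray_ball \<omega>
      = 3 * (\<integral>\<^sup>+s. ennreal (g (x + s *\<^sub>R \<omega>)) * indicator {0..} s * indicator ray_ball \<omega> \<partial>lborel)" for \<omega>
      by (subst nn_integral_multc) (auto simp: mult.assoc)
    thus ?thesis by (simp only:) (rule nn_integral_cmult, measurable)
  qed
  also have "(\<integral>\<^sup>+\<omega>. (\<integral>\<^sup>+s. ennreal (g (x + s *\<^sub>R \<omega>)) * indicator {0..} s * indicator ray_ball \<omega> \<partial>lborel) \<partial>lborel)
    = (\<integral>\<^sup>+s. (\<integral>\<^sup>+\<omega>. ennreal (g (x + s *\<^sub>R \<omega>)) * indicator {0..} s * indicator ray_ball \<omega> \<partial>lborel) \<partial>lborel)"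
    by (rule lborel_pair.Fubini') measurable
  also have "\<dots> = (\<integral>\<^sup>+s. ray_mean (\<lambda>x. ennreal (g x)) s x * indicator {0..} s \<partial>lborel)"
    unfolding ray_mean_def by (rule nn_integral_cong, subst nn_integral_multc[symmetric]) (auto simp: mult_ac)
  finally show ?thesis .
qed

text \<open>The ray integral is split at a radius \<delta>. The far part is small pointwise by the
  decay of ray means; the near part, after thresholding, is a constant plus a multiple of N, whose
  integral over space is proportional to \<delta>. So {|h| > t} lies in a superlevel set of N, and
  Markov's inequality bounds its measure.\<close>

lemma weak_type_estimate:
  fixes q :: real
  assumes q: "1 \<le> q" "q < real CARD('n)"
  obtains C where "C > 0"
    "\<And>(h :: real ^ 'n \<Rightarrow> real) g r B t. grad_bound h g \<Longrightarrow> (\<And>x. norm x > r \<Longrightarrow> h x = 0) \<Longrightarrow> B > 0 \<Longrightarrow> t > 0 \<Longrightarrow>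
      (\<integral>\<^sup>+x. ennreal (g x powr q) \<partial>lborel) \<le> ennreal B \<Longrightarrow>
      emeasure lborel {x. \<bar>h x\<bar> > t} \<le> ennreal (C * (B / t powr q) powr (real CARD('n) / (real CARD('n) - q)))"
proof -
  define n where "n = real CARD('n)"
  define \<kappa> where "\<kappa> = ray_vol TYPE('n)"
  define p where "p = n / q - 1"
  have \<kappa>: "\<kappa> > 0" unfolding \<kappa>_def by (rule ray_vol(1))
  have nq: "n > 0" "n > q" "q > 0" "p > 0" using q unfolding n_def p_def by (auto simp: field_simps)
  define C where "C = 12 powr q * (12 / p) powr (q / p) * \<kappa> powr (- (1 / p))"
  show ?thesis
  proof (rule that[of C])
    show "C > 0" unfolding C_def using nq \<kappa> by simp
    fix h g :: "real ^ 'n \<Rightarrow> real" and r B t :: real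
    assume hg: "grad_bound h g" and supp: "\<And>x. norm x > r \<Longrightarrow> h x = 0" and B: "B > 0" and lam: "t > 0"
      and A: "(\<integral>\<^sup>+x. ennreal (g x powr q) \<partial>lborel) \<le> ennreal B"
    note [measurable] = grad_bound_measurable(1,2)[OF hg] ray_mean_measurable
    note g0 = grad_bound_measurable(3)[OF hg]
    define M where "M = (\<lambda>s x. ray_mean (\<lambda>x. ennreal (g x)) s x)"
    define Q where "Q = (\<lambda>s x. ray_mean (\<lambda>x. ennreal (g x powr q)) s x)"
    have [measurable]: "(\<lambda>s. M s x) \<in> borel_measurable borel" "(\<lambda>s. Q s x) \<in> borel_measurable borel"
       "(\<lambda>(x, s). Q s x) \<in> borel_measurable (borel \<Otimes>\<^sub>M borel)" for x
      unfolding M_def Q_def using ray_mean_measurable[of "\<lambda>x. ennreal (g x)"] ray_mean_measurable[of "\<lambda>x. ennreal (g x powr q)"] by auto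
    define c where "c = (B / \<kappa>) powr (1 / q)"
    have c: "c > 0" unfolding c_def using B \<kappa> by simp
    have cq: "c powr q = B / \<kappa>" unfolding c_def using B \<kappa> nq by (simp add: powr_powr)
    have Mfar: "M s x \<le> ennreal (2 * \<kappa> * c * s powr (- (n / q)))" if s: "s > 0" for s x
    proof -
      \<comment> \<open>The threshold at which the two terms of \<open>ray_mean_threshold\<close>
        balance: T^(1-q) s^-n B = \<kappa> T. Since n/q > 1, the resulting decay in s is integrable
        at infinity.\<close>
      define T where "T = c * s powr (- (n / q))"
      have T: "T > 0" unfolding T_def using c s by simp
      have "Q s x \<le> ennreal (s powr (- n)) * (\<integral>\<^sup>+x. ennreal (g x powr q) \<partial>lborel)"
        unfolding Q_def n_def by (rule ray_mean_le) (use s in auto)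
      also have "\<dots> \<le> ennreal (s powr (- n)) * ennreal B" by (rule mult_left_mono[OF A]) simp
      finally have Qb: "Q s x \<le> ennreal (s powr (- n)) * ennreal B" .
      have "M s x \<le> ennreal (\<kappa> * T) + ennreal (T powr (1 - q)) * Q s x"
        unfolding M_def Q_def \<kappa>_def by (rule ray_mean_threshold) (use g0 T q in auto)
      also have "\<dots> \<le> ennreal (\<kappa> * T) + ennreal (T powr (1 - q)) * (ennreal (s powr (- n)) * ennreal B)"
        by (intro add_left_mono mult_left_mono Qb) simp
      also have "\<dots>
        = ennreal (\<kappa> * T + T powr (1 - q) * s powr (- n) * B)"
        using T \<kappa> B by (simp add: ennreal_plus ennreal_mult mult.assoc)
      also have "T powr (1 - q) * s powr (- n) * B = \<kappa> * T"
      proof -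
        have "T powr (1 - q) = T * T powr (- q)" using T powr_add[of T 1 "- q"] by simp
        also have "T powr (- q) = inverse (c powr q) * s powr n"
        proof -
          have "(s powr (- (n / q))) powr (- q) = s powr n" using nq by (simp only: powr_powr) simp
          moreover have "T powr (- q) = c powr (- q) * (s powr (- (n / q))) powr (- q)"
            unfolding T_def using c s by (intro powr_mult)
          ultimately show ?thesis by (simp only: powr_minus)
        qed
        also have "\<dots> = \<kappa> / B * s powr n"
          unfolding cq by simp
        finally have "T powr (1 - q) * s powr (- n) * B = \<kappa> * T * (s powr n * s powr (- n))" using B by simp
        thus ?thesis using s by (simp flip: powr_add)
      qed
      finally show ?thesis unfolding T_def by (simp add: algebra_simps)
    qed
    \<comment> \<open>Chosen so that the far part is at most \<kappa> t/6.\<close>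
    define \<delta> where "\<delta> = (12 * c / (p * t)) powr (1 / p)"
    have d: "\<delta> > 0" unfolding \<delta>_def using c nq lam by simp
    have dp: "\<delta> powr (- p) = p * t / (12 * c)"
      unfolding \<delta>_def using c nq lam by (simp add: powr_powr powr_minus)
    have far: "(\<integral>\<^sup>+s. M s x * indicator {\<delta>..} s \<partial>lborel) \<le> ennreal (\<kappa> * t / 6)" for x
    proof -
      have "(\<integral>\<^sup>+s. M s x * indicator {\<delta>..} s \<partial>lborel) \<le> (\<integral>\<^sup>+s. ennreal (2 * \<kappa> * c * s powr (- (n / q))) * indicator {\<delta>..} s \<partial>lborel)"
        using Mfar d by (intro nn_integral_mono) (auto simp: indicator_def)
      also have "\<dots> = ennreal (0 - (- (2 * \<kappa> * c / p) * \<delta> powr (- p)))"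
      proof (rule nn_integral_FTC_atLeast)
        show "((\<lambda>s. - (2 * \<kappa> * c / p) * s powr (- p)) \<longlongrightarrow> 0) at_top"
          using tendsto_mult_right_zero[OF tendsto_neg_powr[of "- p", OF _ filterlim_ident], of "- (2 * \<kappa> * c / p)"] nq by simp
        fix s assume s: "\<delta> \<le> s"
        have "((\<lambda>s. - (2 * \<kappa> * c / p) * s powr (- p)) has_real_derivative - (2 * \<kappa> * c / p) * (- p * s powr (- p - 1))) (at s)"
          using s d by (auto intro!: derivative_eq_intros)
        also have "- (2 * \<kappa> * c / p) * (- p * s powr (- p - 1)) = 2 * \<kappa> * c * s powr (- (n / q))"
        proof -
          have "- p - 1 = - (n / q)" unfolding p_def by simp
          thus ?thesis using nq(4) by simp
        qed
        finally show "((\<lambda>s. - (2 * \<kappa> * c / p) * s powr (- p)) has_real_derivative 2 * \<kappa> * c * s powr (- (n / q))) (at s)" .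
        show "0 \<le> 2 * \<kappa> * c * s powr (- (n / q))" using \<kappa> c by simp
      qed measurable
      also have "0 - (- (2 * \<kappa> * c / p) * \<delta> powr (- p)) = \<kappa> * t / 6"
        unfolding dp using nq c by (simp add: field_simps)
      finally show ?thesis .
    qed
    \<comment> \<open>The constant part of the near estimate becomes \<kappa> t/12. With the factor
      3 of \<open>ray_representation\<close> the two constant parts amount to 3 (1/12 + 1/6) = 3/4
      of \<kappa> t, so N must supply the rest.\<close>
    define T where "T = t / (12 * \<delta>)"
    have T: "T > 0" unfolding T_def using lam d by simp
    define N where "N = (\<lambda>x. \<integral>\<^sup>+s. Q s x * indicator {0..\<delta>} s \<partial>lborel)"
    have [measurable]: "N \<in> borel_measurable borel" unfolding N_def by measurable
    have near: "(\<integral>\<^sup>+s. M s x * indicator {0..\<delta>} s \<partial>lborel) \<le> ennreal (\<kappa> * t / 12) + ennreal (T powr (1 - q)) * N x" for x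
    proof -
      have "(\<integral>\<^sup>+s. M s x * indicator {0..\<delta>} s \<partial>lborel)
        \<le> (\<integral>\<^sup>+s. ennreal (\<kappa> * T) * indicator {0..\<delta>} s + ennreal (T powr (1 - q)) * (Q s x * indicator {0..\<delta>} s) \<partial>lborel)"
      proof (rule nn_integral_mono)
        fix s
        have "M s x \<le> ennreal (\<kappa> * T) + ennreal (T powr (1 - q)) * Q s x"
          unfolding M_def Q_def \<kappa>_def by (rule ray_mean_threshold) (use g0 T q in auto)
        thus "M s x * indicator {0..\<delta>} s \<le> ennreal (\<kappa> * T) * indicator {0..\<delta>} s + ennreal (T powr (1 - q)) * (Q s x * indicator {0..\<delta>} s)"
          by (auto simp: indicator_def)
      qed
      also have "\<dots> = ennreal (\<kappa> * T) * ennreal \<delta> + ennreal (T powr (1 - q)) * N x"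
        unfolding N_def using d by (simp add: nn_integral_add nn_integral_cmult)
      also have "ennreal (\<kappa> * T) * ennreal \<delta> = ennreal (\<kappa> * t / 12)"
        unfolding T_def using d \<kappa> lam by (simp flip: ennreal_mult)
      finally show ?thesis .
    qed
    define e where "e = \<kappa> * t / 12 * T powr (q - 1)"
    have e: "e > 0" unfolding e_def using \<kappa> lam T by simp
    have sub: "{x. \<bar>h x\<bar> > t} \<subseteq> {x \<in> UNIV. 1 \<le> ennreal (1 / e) * N x}"
    proof safe
      fix x assume hx: "\<bar>h x\<bar> > t"
      show "1 \<le> ennreal (1 / e) * N x"
      proof (cases "N x = \<infinity>")
        case True thus ?thesis using e by (simp add: ennreal_mult_top)
      next
        case False
        then obtain y where y: "N x = ennreal y" "y \<ge> 0" by (cases "N x") auto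
        have "ennreal (\<kappa> * \<bar>h x\<bar>) \<le> 3 * (\<integral>\<^sup>+s. M s x * indicator {0..} s \<partial>lborel)"
          unfolding \<kappa>_def M_def by (rule ray_representation[OF hg supp])
        also have "(\<integral>\<^sup>+s. M s x * indicator {0..} s \<partial>lborel)
           \<le> (\<integral>\<^sup>+s. M s x * indicator {0..\<delta>} s + M s x * indicator {\<delta>..} s \<partial>lborel)"
          by (intro nn_integral_mono) (auto simp: indicator_def)
        also have "\<dots> = (\<integral>\<^sup>+s. M s x * indicator {0..\<delta>} s \<partial>lborel) + (\<integral>\<^sup>+s. M s x * indicator {\<delta>..} s \<partial>lborel)"
          by (rule nn_integral_add) measurable
        also have "\<dots> \<le> (ennreal (\<kappa> * t / 12) + ennreal (T powr (1 - q)) * N x) + ennreal (\<kappa> * t / 6)"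
          by (intro add_mono near far)
        also have "(ennreal (\<kappa> * t / 12) + ennreal (T powr (1 - q)) * N x) + ennreal (\<kappa> * t / 6)
          = ennreal (\<kappa> * t / 12 + T powr (1 - q) * y + \<kappa> * t / 6)"
        proof -
          have "ennreal (a + b + c) = ennreal a + ennreal b + ennreal c" if "a \<ge> 0" "b \<ge> 0" "c \<ge> 0" for a b c
            using that by simp
          from this[of "\<kappa> * t / 12" "T powr (1 - q) * y" "\<kappa> * t / 6"] show ?thesis
            unfolding y(1) using y(2) \<kappa> lam by (auto simp: ennreal_mult)
        qed
        also have "3 * \<dots> = ennreal (3 * (\<kappa> * t / 12 + T powr (1 - q) * y + \<kappa> * t / 6))"
          using y(2) \<kappa> lam by (subst ennreal_mult) auto
        finally have "ennreal (\<kappa> * \<bar>h x\<bar>) \<le> ennreal (3 * (\<kappa> * t / 12 + T powr (1 - q) * y + \<kappa> * t / 6))"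
          by (simp add: mult_left_mono)
        hence "\<kappa> * \<bar>h x\<bar> \<le> 3 * (\<kappa> * t / 12 + T powr (1 - q) * y + \<kappa> * t / 6)"
          using y(2) \<kappa> lam T by (subst (asm) ennreal_le_iff) auto
        moreover have "\<kappa> * t < \<kappa> * \<bar>h x\<bar>" using hx \<kappa> by simp
        ultimately have "\<kappa> * t / 12 \<le> T powr (1 - q) * y" by simp
        hence "T powr (q - 1) * (\<kappa> * t / 12) \<le> T powr (q - 1) * (T powr (1 - q) * y)"
          by (rule mult_left_mono) simp
        also have "\<dots> = y" using T by (simp flip: powr_add mult.assoc)
        finally have "e \<le> y" unfolding e_def by (simp add: mult.commute)
        hence "1 \<le> 1 / e * y" using e by (simp add: field_simps)
        hence "ennreal 1 \<le> ennreal (1 / e * y)" by (rule ennreal_leI)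
        thus ?thesis unfolding y(1) using e y(2) by (subst (asm) ennreal_mult) auto
      qed
    qed simp
    \<comment> \<open>Fubini, with the integral of each ray mean independent of s, leaves the length
      \<delta> of the interval.\<close>
    have intN: "(\<integral>\<^sup>+x. N x \<partial>lborel) \<le> ennreal (\<delta> * \<kappa> * B)"
    proof -
      have "(\<integral>\<^sup>+x. N x \<partial>lborel) = (\<integral>\<^sup>+s. (\<integral>\<^sup>+x. Q s x * indicator {0..\<delta>} s \<partial>lborel) \<partial>lborel)"
        unfolding N_def by (rule lborel_pair.Fubini') measurable
      also have "\<dots> = (\<integral>\<^sup>+s. ennreal \<kappa> * (\<integral>\<^sup>+x. ennreal (g x powr q) \<partial>lborel) * indicator {0..\<delta>} s \<partial>lborel)"
        unfolding Q_def \<kappa>_def by (rule nn_integral_cong, subst nn_integral_multc) (auto simp: nn_integral_ray_mean ray_mean_def)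
      also have "\<dots> = ennreal \<kappa> * (\<integral>\<^sup>+x. ennreal (g x powr q) \<partial>lborel) * ennreal \<delta>"
        using d by (simp add: nn_integral_cmult)
      also have "\<dots> \<le> ennreal \<kappa> * ennreal B * ennreal \<delta>" by (intro mult_right_mono mult_left_mono A) auto
      also have "\<dots> = ennreal (\<delta> * \<kappa> * B)" using d \<kappa> B by (simp add: mult_ac flip: ennreal_mult)
      finally show ?thesis .
    qed
    have "emeasure lborel {x. \<bar>h x\<bar> > t} \<le> emeasure lborel {x \<in> UNIV. 1 \<le> ennreal (1 / e) * N x}"
      by (rule emeasure_mono[OF sub]) measurable
    also have "\<dots> \<le> ennreal (1 / e) * (\<integral>\<^sup>+x. N x * indicator UNIV x \<partial>lborel)"
      by (rule nn_integral_Markov_inequality) auto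
    also have "\<dots> \<le> ennreal (1 / e) * ennreal (\<delta> * \<kappa> * B)"
      using intN by (intro mult_left_mono) auto
    also have "\<dots> = ennreal (\<delta> * \<kappa> * B / e)" using e d \<kappa> B by (simp flip: ennreal_mult)
    also have "\<delta> * \<kappa> * B / e = B * (12 * \<delta> / t) powr q"
    proof -
      have "T powr (q - 1) = T powr q / T" using T by (simp add: powr_diff)
      moreover have "T powr q = 1 / (12 * \<delta> / t) powr q"
        unfolding T_def using lam d by (simp add: powr_divide)
      ultimately have "e = \<kappa> * \<delta> / (12 * \<delta> / t) powr q"
        unfolding e_def T_def using lam d by simp
      thus ?thesis using \<kappa> d lam by simp
    qed
    also have "\<dots> = C * (B / t powr q) powr (n / (n - q))"
    proof -
      have ex: "n / (n - q) = 1 + 1 / p" unfolding p_def using nq by (simp add: field_simps)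
      have "\<delta> powr q = (12 / p) powr (q / p) * (c / t) powr (q / p)"
        unfolding \<delta>_def using c nq lam by (simp add: powr_powr flip: powr_mult)
      also have "(c / t) powr (q / p) = ((B / \<kappa>) / t powr q) powr (1 / p)"
        unfolding cq[symmetric] using c lam by (simp add: powr_powr flip: powr_divide)
      also have "\<dots> = \<kappa> powr (- (1 / p)) * (B / t powr q) powr (1 / p)"
        using B \<kappa> lam by (simp add: powr_divide powr_mult powr_minus divide_simps)
      finally have dq: "\<delta> powr q = (12 / p) powr (q / p) * (\<kappa> powr (- (1 / p)) * (B / t powr q) powr (1 / p))" .
      have "(12 * \<delta> / t) powr q = 12 powr q * \<delta> powr q / t powr q"
        using d lam by (simp add: powr_divide powr_mult)
      hence "B * (12 * \<delta> / t) powr q = C * ((B / t powr q) * (B / t powr q) powr (1 / p))"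
        unfolding dq C_def by simp
      also have "(B / t powr q) * (B / t powr q) powr (1 / p) = (B / t powr q) powr (n / (n - q))"
        unfolding ex powr_add using B lam by simp
      finally show ?thesis .
    qed
    finally show "emeasure lborel {x. \<bar>h x\<bar> > t} \<le> ennreal (C * (B / t powr q) powr (real CARD('n) / (real CARD('n) - q)))"
      unfolding n_def .
  qed
qed

section \<open>Truncation at dyadic levels and the strong Sobolev inequality\<close>

definition sq_pos :: "real \<Rightarrow> real" where "sq_pos z = (max 0 z)\<^sup>2"

lemma sq_pos_has_derivative: "(sq_pos has_real_derivative 2 * max 0 z) (at z)"
proof -
  consider "z < 0" | "z > 0" | "z = 0" by linarith
  thus ?thesis
  proof cases
    case 1
    have "((\<lambda>z. 0) has_real_derivative 2 * max 0 z) (at z)" using 1 by (auto intro!: derivative_eq_intros)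
    thus ?thesis by (rule has_field_derivative_transform_within_open[where S="{..<0}"])
      (use 1 in \<open>auto simp: sq_pos_def max_def\<close>)
  next
    case 2
    have "((\<lambda>z. z\<^sup>2) has_real_derivative 2 * max 0 z) (at z)" using 2 by (auto intro!: derivative_eq_intros)
    thus ?thesis by (rule has_field_derivative_transform_within_open[where S="{0<..}"])
      (use 2 in \<open>auto simp: sq_pos_def max_def\<close>)
  next
    case 3
    have "((\<lambda>h. (sq_pos (0 + h) - sq_pos 0) / h) \<longlongrightarrow> 0) (at 0)"
    proof (rule Lim_null_comparison[where g="\<lambda>h. \<bar>h\<bar>"])
      show "\<forall>\<^sub>F h in at 0. norm ((sq_pos (0 + h) - sq_pos 0) / h) \<le> \<bar>h\<bar>"
      proof (rule always_eventually, rule allI)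
        fix h :: real
        show "norm ((sq_pos (0 + h) - sq_pos 0) / h) \<le> \<bar>h\<bar>"
          by (cases "h > 0") (auto simp: sq_pos_def max_def power2_eq_square)
      qed
      show "((\<lambda>h. \<bar>h\<bar>) \<longlongrightarrow> 0) (at (0::real))" by (auto intro!: tendsto_eq_intros)
    qed
    thus ?thesis unfolding DERIV_def using 3 by simp
  qed
qed

text \<open>A \<open>C\<^sup>1\<close> cutoff: it vanishes for \<open>y \<le> 1\<close> and equals \<open>1/2\<close> for \<open>y \<ge> 2\<close>.\<close>

definition cutoff :: "real \<Rightarrow> real"
  where "cutoff y = sq_pos (y - 1) - 2 * sq_pos (y - 3/2) + sq_pos (y - 2)"

definition cutoff' :: "real \<Rightarrow> real"
  where "cutoff' y = 2 * max 0 (y - 1) - 4 * max 0 (y - 3/2) + 2 * max 0 (y - 2)"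

lemma cutoff_has_derivative: "(cutoff has_real_derivative cutoff' y) (at y)"
proof -
  have s: "((\<lambda>y. sq_pos (y - c)) has_real_derivative 2 * max 0 (y - c)) (at y)" for c
  proof -
    have "((\<lambda>y. y - c) has_real_derivative 1) (at y)" by (auto intro!: derivative_eq_intros)
    from DERIV_chain2[OF sq_pos_has_derivative this] show ?thesis by simp
  qed
  show ?thesis unfolding cutoff_def[abs_def] cutoff'_def
    by (rule derivative_eq_intros s refl)+ simp
qed

lemma cutoff'_bounds: "0 \<le> cutoff' y" "cutoff' y \<le> 1" "y \<le> 1 \<Longrightarrow> cutoff' y = 0" "y \<ge> 2 \<Longrightarrow> cutoff' y = 0"
  unfolding cutoff'_def by (auto simp: max_def)

lemma cutoff_values: "y \<le> 1 \<Longrightarrow> cutoff y = 0" "y \<ge> 2 \<Longrightarrow> cutoff y = 1/2"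
  unfolding cutoff_def sq_pos_def by (auto simp: max_def power2_eq_square algebra_simps)

lemma continuous_cutoff': "continuous_on UNIV cutoff'"
  unfolding cutoff'_def by (intro continuous_intros)

text \<open>The cutoff acts on f^2 rather than on |f|, which keeps the truncation differentiable
  where f changes sign; the chain rule gives the factor 2 |f|/t.\<close>

lemma grad_bound_truncation:
  fixes f g :: "real ^ 'n \<Rightarrow> real"
  assumes fg: "grad_bound f g" and t: "t > 0"
  shows "grad_bound (\<lambda>x. t * cutoff ((f x)\<^sup>2 / t\<^sup>2)) (\<lambda>x. cutoff' ((f x)\<^sup>2 / t\<^sup>2) * (2 * \<bar>f x\<bar> / t) * g x)"
  unfolding grad_bound_def
proof (intro conjI allI)
  have cf: "continuous_on UNIV f" "continuous_on UNIV g" and g0: "\<And>x. 0 \<le> g x"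
    using fg unfolding grad_bound_def by auto
  have cc: "continuous_on UNIV cutoff" using cutoff_has_derivative DERIV_isCont continuous_at_imp_continuous_on by blast
  show "continuous_on UNIV (\<lambda>x. t * cutoff ((f x)\<^sup>2 / t\<^sup>2))"
    by (intro continuous_intros continuous_on_compose2[OF cc] cf) (use t in auto)
  show "continuous_on UNIV (\<lambda>x. cutoff' ((f x)\<^sup>2 / t\<^sup>2) * (2 * \<bar>f x\<bar> / t) * g x)"
    by (intro continuous_intros continuous_on_compose2[OF continuous_cutoff'] cf) (use t in auto)
  show "0 \<le> cutoff' ((f x)\<^sup>2 / t\<^sup>2) * (2 * \<bar>f x\<bar> / t) * g x" for x
    using cutoff'_bounds t g0 by (intro mult_nonneg_nonneg) auto
  fix x v :: "real ^ 'n" and s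
  let ?y = "x + s *\<^sub>R v"
  obtain d where d: "((\<lambda>s. f (x + s *\<^sub>R v)) has_real_derivative d) (at s)" "\<bar>d\<bar> \<le> g ?y * norm v"
    using fg unfolding grad_bound_def by blast
  have "((\<lambda>s. (f (x + s *\<^sub>R v))\<^sup>2 / t\<^sup>2) has_real_derivative 2 * f ?y * d / t\<^sup>2) (at s)"
    by (rule DERIV_cdivide) (use d(1) in \<open>auto intro!: derivative_eq_intros\<close>)
  hence "((\<lambda>s. t * cutoff ((f (x + s *\<^sub>R v))\<^sup>2 / t\<^sup>2)) has_real_derivative t * (cutoff' ((f ?y)\<^sup>2 / t\<^sup>2) * (2 * f ?y * d / t\<^sup>2))) (at s)"
    by (intro DERIV_cmult DERIV_chain2[OF cutoff_has_derivative])
  moreover have "\<bar>t * (cutoff' ((f ?y)\<^sup>2 / t\<^sup>2) * (2 * f ?y * d / t\<^sup>2))\<bar> \<le> cutoff' ((f ?y)\<^sup>2 / t\<^sup>2) * (2 * \<bar>f ?y\<bar> / t) * g ?y * norm v"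
  proof -
    have "\<bar>t * (cutoff' ((f ?y)\<^sup>2 / t\<^sup>2) * (2 * f ?y * d / t\<^sup>2))\<bar> = cutoff' ((f ?y)\<^sup>2 / t\<^sup>2) * (2 * \<bar>f ?y\<bar> / t) * \<bar>d\<bar>"
      using t cutoff'_bounds(1) by (simp add: abs_mult power2_eq_square)
    also have "\<dots> \<le> cutoff' ((f ?y)\<^sup>2 / t\<^sup>2) * (2 * \<bar>f ?y\<bar> / t) * (g ?y * norm v)"
      using t cutoff'_bounds(1) by (intro mult_left_mono d(2)) auto
    finally show ?thesis by (simp add: mult.assoc)
  qed
  ultimately show "\<exists>d. ((\<lambda>s. t * cutoff ((f (x + s *\<^sub>R v))\<^sup>2 / t\<^sup>2)) has_real_derivative d) (at s) \<and>
    \<bar>d\<bar> \<le> cutoff' ((f ?y)\<^sup>2 / t\<^sup>2) * (2 * \<bar>f ?y\<bar> / t) * g ?y * norm v" by blast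
qed

text \<open>The derivative of the cutoff lives on t^2 < f^2 < 2 t^2. There |f| < 3/2 t because 2 <
  9/4, so the chain-rule factor stays below 3. The slightly larger layer in the statement is
  half-open and dyadic, hence disjoint from the layers at other levels.\<close>

lemma truncated_gradient_le:
  assumes "t > 0" "g \<ge> 0"
  shows "cutoff' (f\<^sup>2 / t\<^sup>2) * (2 * \<bar>f\<bar> / t) * g \<le> 3 * g * indicator {x. t \<le> \<bar>x\<bar> \<and> \<bar>x\<bar> < 2 * t} f"
proof (cases "1 < f\<^sup>2 / t\<^sup>2 \<and> f\<^sup>2 / t\<^sup>2 < 2")
  case True
  have "t\<^sup>2 < \<bar>f\<bar>\<^sup>2" "\<bar>f\<bar>\<^sup>2 < 2 * t\<^sup>2" using True assms by (auto simp: field_simps)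
  have 1: "t < \<bar>f\<bar>" using \<open>t\<^sup>2 < \<bar>f\<bar>\<^sup>2\<close> by (rule power_less_imp_less_base) simp
  have "(3/2 * t)\<^sup>2 = 9/4 * t\<^sup>2" by (simp add: power_mult_distrib power_divide)
  hence "\<bar>f\<bar>\<^sup>2 < (3/2 * t)\<^sup>2" using \<open>\<bar>f\<bar>\<^sup>2 < 2 * t\<^sup>2\<close> zero_le_power2[of t] by linarith
  hence 2: "\<bar>f\<bar> < 3/2 * t" by (rule power_less_imp_less_base) (use assms in simp)
  have "cutoff' (f\<^sup>2 / t\<^sup>2) * (2 * \<bar>f\<bar> / t) \<le> 1 * 3"
    using 2 assms cutoff'_bounds by (intro mult_mono) (auto simp: field_simps)
  hence "cutoff' (f\<^sup>2 / t\<^sup>2) * (2 * \<bar>f\<bar> / t) * g \<le> 3 * g" using assms by (intro mult_right_mono) auto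
  moreover have "indicator {x. t \<le> \<bar>x\<bar> \<and> \<bar>x\<bar> < 2 * t} f = (1::real)" using 1 2 assms by simp
  ultimately show ?thesis by simp
next
  case False
  hence "cutoff' (f\<^sup>2 / t\<^sup>2) = 0" using cutoff'_bounds(3,4) by force
  thus ?thesis using assms by (simp add: indicator_def)
qed

text \<open>Summing the weak-type estimate over the dyadic truncations of \<open>f\<close> upgrades it to a strong one.\<close>

theorem gagliardo_nirenberg_sobolev:
  fixes q :: real
  assumes q: "1 \<le> q" "q < real CARD('n)"
  defines "\<theta> \<equiv> real CARD('n) / (real CARD('n) - q)"
  obtains C where "C > 0"
    "\<And>(f :: real ^ 'n \<Rightarrow> real) g r B. grad_bound f g \<Longrightarrow> (\<And>x. norm x > r \<Longrightarrow> f x = 0) \<Longrightarrow> B > 0 \<Longrightarrow>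
      (\<integral>\<^sup>+x. ennreal (g x powr q) \<partial>lborel) \<le> ennreal B \<Longrightarrow>
      (\<integral>\<^sup>+x. ennreal (\<bar>f x\<bar> powr (q * \<theta>)) \<partial>lborel) \<le> ennreal (C * B powr \<theta>)"
proof -
  obtain Cw where Cw: "Cw > 0"
    "\<And>(h :: real ^ 'n \<Rightarrow> real) g r B t. grad_bound h g \<Longrightarrow> (\<And>x. norm x > r \<Longrightarrow> h x = 0) \<Longrightarrow> B > 0 \<Longrightarrow> t > 0 \<Longrightarrow>
      (\<integral>\<^sup>+x. ennreal (g x powr q) \<partial>lborel) \<le> ennreal B \<Longrightarrow>
      emeasure lborel {x. \<bar>h x\<bar> > t} \<le> ennreal (Cw * (B / t powr q) powr \<theta>)"
    using weak_type_estimate[OF q] unfolding \<theta>_def by metis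
  have th: "\<theta> \<ge> 1" using q unfolding \<theta>_def by (simp add: field_simps)
  \<comment> \<open>3^q comes from the gradient of the truncations and 1 from the geometric series
    added in b.\<close>
  define S0 where "S0 = 3 powr q + 1"
  have S0: "S0 > 0" unfolding S0_def by (simp add: add_pos_pos)
  define C where "C = 16 powr (q * \<theta>) * Cw * S0 powr \<theta>"
  show ?thesis
  proof (rule that[of C])
    show "C > 0" unfolding C_def using Cw S0 by simp
    fix f g :: "real ^ 'n \<Rightarrow> real" and r B :: real
    assume fg: "grad_bound f g" and supp: "\<And>x. norm x > r \<Longrightarrow> f x = 0" and B: "B > 0"
      and A: "(\<integral>\<^sup>+x. ennreal (g x powr q) \<partial>lborel) \<le> ennreal B"
    note [measurable] = grad_bound_measurable(1,2)[OF fg]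
    note g0 = grad_bound_measurable(3)[OF fg]
    obtain M where M: "M > 0" "\<And>x. \<bar>f x\<bar> \<le> M"
    proof -
      have cf: "continuous_on UNIV f" using fg unfolding grad_bound_def by auto
      have "bounded (f ` cball 0 \<bar>r\<bar>)"
        by (intro compact_imp_bounded compact_continuous_image continuous_on_subset[OF cf]) auto
      then obtain M where "\<And>x. x \<in> cball 0 \<bar>r\<bar> \<Longrightarrow> \<bar>f x\<bar> \<le> M" by (metis (no_types, lifting) bounded_iff imageI real_norm_def)
      moreover have "f x = 0" if "x \<notin> cball 0 \<bar>r\<bar>" for x using that by (intro supp) auto
      ultimately have "\<bar>f x\<bar> \<le> \<bar>M\<bar> + 1" for x
        by (cases "x \<in> cball 0 \<bar>r\<bar>") (auto intro: order_trans[of _ M])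
      thus ?thesis using that[of "\<bar>M\<bar> + 1"] by fastforce
    qed
    \<comment> \<open>The offset 2 gives 4 t_0 = M, the upper bound of |f|, so that the top level
      needs no separate layer.\<close>
    define t where "t = (\<lambda>j::nat. M / 2 ^ (j + 2))"
    have t: "t j > 0" for j unfolding t_def using M by simp
    define E where "E = (\<lambda>j. {x. t j \<le> \<bar>f x\<bar> \<and> \<bar>f x\<bar> < 2 * t j})"
    have E [measurable]: "E j \<in> sets borel" for j unfolding E_def by measurable
    have disj: "disjoint_family E"
    proof -
      have "E i \<inter> E j = {}" if "i < j" for i j
      proof -
        have "2 ^ (Suc i + 2) \<le> (2::real) ^ (j + 2)" using that by (intro power_increasing) auto
        hence "2 * t j \<le> t i" unfolding t_def using M by (simp add: field_simps)
        thus ?thesis unfolding E_def by fastforce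
      qed
      thus ?thesis unfolding disjoint_family_on_def by (metis inf_commute linorder_neqE_nat)
    qed
    define D where "D = density lborel (\<lambda>x. ennreal (g x powr q))"
    have Dsum: "(\<Sum>j. emeasure D (E j)) \<le> ennreal B"
    proof -
      have "(\<Sum>j. emeasure D (E j)) = emeasure D (\<Union>j. E j)"
        by (rule suminf_emeasure) (use disj in \<open>auto simp: D_def\<close>)
      also have "\<dots> \<le> emeasure D UNIV" by (rule emeasure_mono) (auto simp: D_def)
      also have "\<dots> = (\<integral>\<^sup>+x. ennreal (g x powr q) \<partial>lborel)" unfolding D_def by (simp add: emeasure_density)
      finally show ?thesis using A by (rule order_trans)
    qed
    have Dfin: "emeasure D (E j) < \<infinity>" for j
    proof -
      have "emeasure D (E j) \<le> (\<Sum>j. emeasure D (E j))" using sum_le_suminf[of "\<lambda>j. emeasure D (E j)" "{j}"] by auto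
      thus ?thesis using Dsum le_less_trans ennreal_less_top by (metis infinity_ennreal_def order.trans)
    qed
    define a where "a = (\<lambda>j. enn2real (emeasure D (E j)))"
    have a: "emeasure D (E j) = ennreal (a j)" "a j \<ge> 0" for j unfolding a_def using Dfin[of j] by auto
    \<comment> \<open>The weak-type estimate requires a positive bound, but the integral over a
      layer may vanish. The geometric summand repairs this at the total cost B.\<close>
    define b where "b = (\<lambda>j::nat. 3 powr q * a j + B * (1/2) ^ Suc j)"
    have b: "b j > 0" for j unfolding b_def using a(2) B by (intro add_nonneg_pos) auto
    have bsum: "(\<Sum>j. ennreal (b j)) \<le> ennreal (S0 * B)"
    proof -
      have "(\<Sum>j. ennreal (b j)) = (\<Sum>j. ennreal (3 powr q) * emeasure D (E j) + ennreal (B * (1/2) ^ Suc j))"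
        unfolding b_def a(1) using a(2) B by (intro suminf_cong) (simp add: ennreal_plus ennreal_mult)
      also have "\<dots> = ennreal (3 powr q) * (\<Sum>j. emeasure D (E j)) + (\<Sum>j. ennreal (B * (1/2) ^ Suc j))"
        by (simp add: suminf_add[symmetric] ennreal_suminf_cmult)
      also have "(\<Sum>j. ennreal (B * (1/2) ^ Suc j)) = ennreal B"
      proof (rule suminf_ennreal_eq)
        show "(\<lambda>j. B * (1/2) ^ Suc j) sums B" using sums_mult[OF power_half_series, of B] by simp
      qed (use B in simp)
      also have "ennreal (3 powr q) * (\<Sum>j. emeasure D (E j)) + ennreal B \<le> ennreal (3 powr q) * ennreal B + ennreal B"
        by (intro add_right_mono mult_left_mono Dsum) simp
      also have "\<dots> = ennreal (S0 * B)" unfolding S0_def using B by (simp add: distrib_right ennreal_plus ennreal_mult)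
      finally show ?thesis .
    qed
    have ble: "b j \<le> S0 * B" for j
    proof -
      have "ennreal (b j) \<le> (\<Sum>j. ennreal (b j))" using sum_le_suminf[of "\<lambda>j. ennreal (b j)" "{j}"] by auto
      hence "ennreal (b j) \<le> ennreal (S0 * B)" using bsum by (rule order_trans)
      thus ?thesis using S0 B by (simp add: ennreal_le_iff)
    qed
    have level: "emeasure lborel {x. \<bar>f x\<bar> \<ge> 2 * t j} \<le> ennreal (Cw * (b j / (t j / 4) powr q) powr \<theta>)" for j
    proof -
      define h where "h = (\<lambda>x. t j * cutoff ((f x)\<^sup>2 / (t j)\<^sup>2))"
      define k where "k = (\<lambda>x. cutoff' ((f x)\<^sup>2 / (t j)\<^sup>2) * (2 * \<bar>f x\<bar> / t j) * g x)"
      have hk: "grad_bound h k" unfolding h_def k_def by (rule grad_bound_truncation[OF fg t])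
      note [measurable] = grad_bound_measurable(1,2)[OF hk]
      have "{x. \<bar>f x\<bar> \<ge> 2 * t j} \<subseteq> {x. \<bar>h x\<bar> > t j / 4}"
      proof safe
        fix x assume "\<bar>f x\<bar> \<ge> 2 * t j"
        hence "(2 * t j)\<^sup>2 \<le> \<bar>f x\<bar>\<^sup>2" using t by (intro power_mono) (auto simp: less_imp_le)
        hence "4 * (t j)\<^sup>2 \<le> (f x)\<^sup>2" by (simp add: power_mult_distrib)
        hence "2 * (t j)\<^sup>2 \<le> (f x)\<^sup>2" using zero_le_power2[of "t j"] by linarith
        hence "(f x)\<^sup>2 / (t j)\<^sup>2 \<ge> 2" using t[of j] by (simp add: le_divide_eq)
        hence "h x = t j / 2" unfolding h_def by (simp add: cutoff_values)
        thus "t j / 4 < \<bar>h x\<bar>" using t[of j] by simp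
      qed
      hence "emeasure lborel {x. \<bar>f x\<bar> \<ge> 2 * t j} \<le> emeasure lborel {x. \<bar>h x\<bar> > t j / 4}"
        by (rule emeasure_mono) measurable
      also have "\<dots> \<le> ennreal (Cw * (b j / (t j / 4) powr q) powr \<theta>)"
      proof (rule Cw(2)[OF hk])
        show "h x = 0" if "norm x > r" for x unfolding h_def using supp[OF that] by (simp add: cutoff_values)
        show "b j > 0" "t j / 4 > 0" using b t by auto
        have "(\<integral>\<^sup>+x. ennreal (k x powr q) \<partial>lborel) \<le> (\<integral>\<^sup>+x. ennreal (3 powr q) * (ennreal (g x powr q) * indicator (E j) x) \<partial>lborel)"
        proof (rule nn_integral_mono)
          fix x
          have "k x \<le> 3 * g x * indicator (E j) x"
            using truncated_gradient_le[OF t g0, of "f x" j x] unfolding k_def E_def by (simp add: indicator_def)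
          moreover have "0 \<le> k x" unfolding k_def using g0 t[of j] cutoff'_bounds by (intro mult_nonneg_nonneg) auto
          ultimately have "k x powr q \<le> (3 * g x * indicator (E j) x) powr q" using q by (intro powr_mono2) auto
          also have "\<dots> = 3 powr q * (g x powr q * indicator (E j) x)"
            using g0 q by (simp add: indicator_def powr_mult)
          finally show "ennreal (k x powr q) \<le> ennreal (3 powr q) * (ennreal (g x powr q) * indicator (E j) x)"
            by (auto simp: indicator_def ennreal_mult[symmetric] intro: ennreal_leI)
        qed
        also have "\<dots> = ennreal (3 powr q) * emeasure D (E j)"
          unfolding D_def by (simp add: nn_integral_cmult emeasure_density)
        also have "\<dots> = ennreal (3 powr q * a j)" unfolding a(1) using a(2) by (simp add: ennreal_mult)
        also have "\<dots> \<le> ennreal (b j)" unfolding b_def using B by (intro ennreal_leI) simp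
        finally show "(\<integral>\<^sup>+x. ennreal (k x powr q) \<partial>lborel) \<le> ennreal (b j)" .
      qed
      finally show ?thesis .
    qed
    \<comment> \<open>The factor 16 is the ratio of 4 t to t/4. Since \<theta> >= 1, the power of b
      is replaced by b times a power of the common bound S0 B, and b is summable.\<close>
    have term_le: "(4 * t j) powr (q * \<theta>) * (Cw * (b j / (t j / 4) powr q) powr \<theta>) \<le> 16 powr (q * \<theta>) * Cw * (S0 * B) powr (\<theta> - 1) * b j" for j
    proof -
      have "(b j / (t j / 4) powr q) powr \<theta> = b j powr \<theta> / (t j / 4) powr (q * \<theta>)"
      proof -
        have "(b j / (t j / 4) powr q) powr \<theta> = b j powr \<theta> / ((t j / 4) powr q) powr \<theta>"
          by (rule powr_divide)
        thus ?thesis by (simp only: powr_powr)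
      qed
      moreover have "(4 * t j) powr (q * \<theta>) = 16 powr (q * \<theta>) * (t j / 4) powr (q * \<theta>)"
        using t[of j] by (simp flip: powr_mult)
      ultimately have "(4 * t j) powr (q * \<theta>) * (Cw * (b j / (t j / 4) powr q) powr \<theta>) = 16 powr (q * \<theta>) * Cw * b j powr \<theta>"
        using t[of j] by simp
      also have "b j powr \<theta> = b j powr (\<theta> - 1) * b j" using b[of j] powr_add[of "b j" "\<theta> - 1" 1] by simp
      also have "\<dots> \<le> (S0 * B) powr (\<theta> - 1) * b j"
        using b[of j] ble[of j] th by (intro mult_right_mono powr_mono2) auto
      finally show ?thesis using Cw(1) by (simp add: mult_left_mono mult.assoc)
    qed
    \<comment> \<open>The first level with 2 t_j <= |f x| also satisfies |f x| <= 4 t_j, so this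
      single summand dominates and the others are only nonnegative.\<close>
    have point: "ennreal (\<bar>f x\<bar> powr (q * \<theta>)) \<le> (\<Sum>j. ennreal ((4 * t j) powr (q * \<theta>)) * indicator {x. \<bar>f x\<bar> \<ge> 2 * t j} x)" for x
    proof (cases "f x = 0")
      case False
      have "\<exists>j. 2 * t j \<le> \<bar>f x\<bar>"
      proof -
        obtain j where "inverse ((2::real) ^ j) < \<bar>f x\<bar> / M" using False M real_arch_pow_inv[of "\<bar>f x\<bar> / M" "1/2"] 
          by (auto simp: power_one_over inverse_eq_divide)
        hence "M / 2 ^ j < \<bar>f x\<bar>" using M by (simp add: field_simps)
        moreover have "2 * t j \<le> M / 2 ^ j" unfolding t_def using M by (simp add: field_simps)
        ultimately show ?thesis by (intro exI[of _ j]) linarith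
      qed
      define j where "j = (LEAST j. 2 * t j \<le> \<bar>f x\<bar>)"
      have j: "2 * t j \<le> \<bar>f x\<bar>" unfolding j_def using \<open>\<exists>j. 2 * t j \<le> \<bar>f x\<bar>\<close> by (rule LeastI_ex)
      have j4: "\<bar>f x\<bar> \<le> 4 * t j"
      proof (cases j)
        case 0 thus ?thesis using M(2)[of x] unfolding t_def by simp
      next
        case (Suc i)
        have "\<not> 2 * t i \<le> \<bar>f x\<bar>" using Suc unfolding j_def by (metis lessI not_less_Least)
        moreover have "4 * t j = 2 * t i" unfolding t_def Suc by (simp add: field_simps)
        ultimately show ?thesis by linarith
      qed
      have "ennreal (\<bar>f x\<bar> powr (q * \<theta>)) \<le> ennreal ((4 * t j) powr (q * \<theta>)) * indicator {x. \<bar>f x\<bar> \<ge> 2 * t j} x"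
        using j j4 q th by (auto intro!: ennreal_leI powr_mono2)
      also have "\<dots> \<le> (\<Sum>j. ennreal ((4 * t j) powr (q * \<theta>)) * indicator {x. \<bar>f x\<bar> \<ge> 2 * t j} x)"
      proof -
        define F where "F = (\<lambda>j. ennreal ((4 * t j) powr (q * \<theta>)) * indicator {x. \<bar>f x\<bar> \<ge> 2 * t j} x)"
        have "sum F {j} \<le> suminf F" by (rule sum_le_suminf) auto
        hence "F j \<le> suminf F" by simp
        thus ?thesis unfolding F_def .
      qed
      finally show ?thesis .
    qed (use q th in simp)
    have "(\<integral>\<^sup>+x. ennreal (\<bar>f x\<bar> powr (q * \<theta>)) \<partial>lborel)
      \<le> (\<integral>\<^sup>+x. (\<Sum>j. ennreal ((4 * t j) powr (q * \<theta>)) * indicator {x. \<bar>f x\<bar> \<ge> 2 * t j} x) \<partial>lborel)"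
      by (rule nn_integral_mono) (rule point)
    also have "\<dots> = (\<Sum>j. \<integral>\<^sup>+x. ennreal ((4 * t j) powr (q * \<theta>)) * indicator {x. \<bar>f x\<bar> \<ge> 2 * t j} x \<partial>lborel)"
      by (rule nn_integral_suminf) measurable
    also have "\<dots> = (\<Sum>j. ennreal ((4 * t j) powr (q * \<theta>)) * emeasure lborel {x. \<bar>f x\<bar> \<ge> 2 * t j})"
      by (intro suminf_cong nn_integral_cmult_indicator) measurable
    also have "\<dots> \<le> (\<Sum>j. ennreal (16 powr (q * \<theta>) * Cw * (S0 * B) powr (\<theta> - 1)) * ennreal (b j))"
    proof (rule suminf_le)
      fix j
      have "ennreal ((4 * t j) powr (q * \<theta>)) * emeasure lborel {x. \<bar>f x\<bar> \<ge> 2 * t j}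
        \<le> ennreal ((4 * t j) powr (q * \<theta>)) * ennreal (Cw * (b j / (t j / 4) powr q) powr \<theta>)"
        by (intro mult_left_mono level) simp
      also have "\<dots> = ennreal ((4 * t j) powr (q * \<theta>) * (Cw * (b j / (t j / 4) powr q) powr \<theta>))"
        using Cw by (simp add: ennreal_mult)
      also have "\<dots> \<le> ennreal (16 powr (q * \<theta>) * Cw * (S0 * B) powr (\<theta> - 1) * b j)"
        by (rule ennreal_leI) (rule term_le)
      also have "\<dots> = ennreal (16 powr (q * \<theta>) * Cw * (S0 * B) powr (\<theta> - 1)) * ennreal (b j)"
        using Cw b[of j] by (intro ennreal_mult) (auto simp: less_imp_le)
      finally show "ennreal ((4 * t j) powr (q * \<theta>)) * emeasure lborel {x. \<bar>f x\<bar> \<ge> 2 * t j}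
        \<le> ennreal (16 powr (q * \<theta>) * Cw * (S0 * B) powr (\<theta> - 1)) * ennreal (b j)" .
    qed auto
    also have "\<dots> = ennreal (16 powr (q * \<theta>) * Cw * (S0 * B) powr (\<theta> - 1)) * (\<Sum>j. ennreal (b j))"
      by (rule ennreal_suminf_cmult)
    also have "\<dots> \<le> ennreal (16 powr (q * \<theta>) * Cw * (S0 * B) powr (\<theta> - 1)) * ennreal (S0 * B)"
      by (intro mult_left_mono bsum) simp
    also have "\<dots> = ennreal (16 powr (q * \<theta>) * Cw * (S0 * B) powr (\<theta> - 1) * (S0 * B))"
      using Cw S0 B by (simp add: ennreal_mult)
    also have "16 powr (q * \<theta>) * Cw * (S0 * B) powr (\<theta> - 1) * (S0 * B) = C * B powr \<theta>"
    proof -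
      have "(S0 * B) powr (\<theta> - 1) * (S0 * B) = (S0 * B) powr \<theta>"
        using S0 B powr_add[of "S0 * B" "\<theta> - 1" 1] by simp
      also have "\<dots> = S0 powr \<theta> * B powr \<theta>" using S0 B by (simp add: powr_mult)
      finally show ?thesis unfolding C_def by (simp add: mult.assoc)
    qed
    finally show "(\<integral>\<^sup>+x. ennreal (\<bar>f x\<bar> powr (q * \<theta>)) \<partial>lborel) \<le> ennreal (C * B powr \<theta>)" .
  qed
qed

subsection \<open>Sobolev chains for the weighted norms\<close>

lemma powr_add_le:
  fixes a b q :: real
  assumes "a \<ge> 0" "b \<ge> 0" "q \<ge> 0"
  shows "(a + b) powr q \<le> 2 powr q * (a powr q + b powr q)"
proof -
  have "(a + b) powr q \<le> (2 * max a b) powr q" using assms by (intro powr_mono2) auto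
  also have "\<dots> = 2 powr q * max a b powr q" using assms by (simp add: powr_mult)
  also have "\<dots> \<le> 2 powr q * (a powr q + b powr q)"
    by (intro mult_left_mono) (auto simp: max_def)
  finally show ?thesis .
qed

lemma sum_powr_le:
  fixes a :: "'i::finite \<Rightarrow> real"
  assumes "\<And>i. a i \<ge> 0" "q \<ge> 0"
  shows "(\<Sum>i\<in>UNIV. a i) powr q \<le> real CARD('i) powr q * (\<Sum>i\<in>UNIV. a i powr q)"
proof -
  define M where "M = Max (range a)"
  have M: "a i \<le> M" for i unfolding M_def by (rule Max_ge) auto
  have "M \<in> range a" unfolding M_def by (rule Max_in) auto
  then obtain j where j: "M = a j" by blast
  have "(\<Sum>i\<in>UNIV. a i) \<le> real CARD('i) * M"
    using sum_mono[of UNIV a "\<lambda>_. M"] M by simp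
  hence "(\<Sum>i\<in>UNIV. a i) powr q \<le> (real CARD('i) * M) powr q"
    using assms by (intro powr_mono2 sum_nonneg) auto
  also have "\<dots> = real CARD('i) powr q * a j powr q" using assms j by (simp add: powr_mult)
  also have "\<dots> \<le> real CARD('i) powr q * (\<Sum>i\<in>UNIV. a i powr q)"
    by (intro mult_left_mono member_le_sum) auto
  finally show ?thesis .
qed

context punctured_space
begin

lemma wt_measurable [measurable]: "wt a b \<in> borel_measurable borel"
  unfolding wt_def[abs_def] by measurable

lemma wt_nonneg: "0 \<le> wt a b x"
  unfolding wt_def by simp

lemma grad_bound_tf:
  assumes f: "tf R f"
  shows "grad_bound f (\<lambda>x. \<Sum>i\<in>UNIV. \<bar>partial_deriv i f x\<bar>)"
  unfolding grad_bound_def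
proof (intro conjI allI)
  show "continuous_on UNIV f" using tf_continuous[OF f] .
  show "continuous_on UNIV (\<lambda>x. \<Sum>i\<in>UNIV. \<bar>partial_deriv i f x\<bar>)"
    by (intro continuous_intros tf_continuous[OF tf_partial_deriv[OF f]])
  show "0 \<le> (\<Sum>i\<in>UNIV. \<bar>partial_deriv i f x\<bar>)" for x by (intro sum_nonneg) auto
  fix x v :: "real ^ 'n" and s
  have "\<bar>\<Sum>i\<in>UNIV. v $ i * partial_deriv i f (x + s *\<^sub>R v)\<bar> \<le> (\<Sum>i\<in>UNIV. \<bar>v $ i\<bar> * \<bar>partial_deriv i f (x + s *\<^sub>R v)\<bar>)"
    unfolding abs_mult[symmetric] by (rule sum_abs)
  also have "\<dots> \<le> (\<Sum>i\<in>UNIV. norm v * \<bar>partial_deriv i f (x + s *\<^sub>R v)\<bar>)"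
    by (intro sum_mono mult_right_mono component_le_norm_cart) auto
  also have "\<dots> = (\<Sum>i\<in>UNIV. \<bar>partial_deriv i f (x + s *\<^sub>R v)\<bar>) * norm v"
    by (simp add: sum_distrib_left mult.commute)
  finally show "\<exists>d. ((\<lambda>s. f (x + s *\<^sub>R v)) has_real_derivative d) (at s) \<and> \<bar>d\<bar> \<le> (\<Sum>i\<in>UNIV. \<bar>partial_deriv i f (x + s *\<^sub>R v)\<bar>) * norm v"
    using smooth_line_deriv[OF tf_differentiable[OF f]] by blast
qed

lemma tf_bounded_support: "tf R f \<Longrightarrow> norm x > norm x0 + 1 \<Longrightarrow> f x = 0"
proof (rule tf_eq_0)
  assume "norm x > norm x0 + 1"
  moreover have "norm x \<le> norm (x - x0) + norm x0" using norm_triangle_ineq[of "x - x0" x0] by simp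
  ultimately show "x \<notin> pball" using pball_norm[of x] by force
qed

text \<open>Differentiating the weight yields r^-1 times a - b li, and on the small ball
  \<open>li\<close> is at most 1, so |a| + |b| bounds the coefficient.\<close>

lemma partial_deriv_wt_mult_le:
  assumes R: "R \<le> exp (- 1)" and f: "tf R f" and L: "\<bar>a\<bar> + \<bar>b\<bar> \<le> \<Lambda>"
  shows "\<bar>partial_deriv i (\<lambda>x. wt a b x * f x) x\<bar> \<le> \<bar>wt a b x * partial_deriv i f x\<bar> + \<Lambda> * \<bar>wt (a - 1) b x * f x\<bar>"
proof (cases "x \<in> pball \<and> x \<in> ball x0 R")
  case True
  hence x: "x \<in> pball" "x \<in> ball x0 R" by auto
  have "\<bar>partial_deriv i (wt a b) x\<bar> \<le> \<Lambda> * wt (a - 1) b x"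
  proof -
    have "partial_deriv i (wt a b) x = (x $ i - x0 $ i) * (wt (a - 2) b x * (a - b * li x))"
      unfolding partial_deriv_wt[OF x(1)] wt_shift[OF x(1)] by (simp add: algebra_simps)
    hence "\<bar>partial_deriv i (wt a b) x\<bar> = \<bar>x $ i - x0 $ i\<bar> * (wt (a - 2) b x * \<bar>a - b * li x\<bar>)"
      by (simp add: abs_mult wt_nonneg)
    also have "\<dots> \<le> norm (x - x0) * (wt (a - 2) b x * \<Lambda>)"
    proof (intro mult_mono mult_left_mono)
      show "\<bar>x $ i - x0 $ i\<bar> \<le> norm (x - x0)" using component_le_norm_cart[of "x - x0" i] by simp
      have "\<bar>b * li x\<bar> \<le> \<bar>b\<bar> * 1" unfolding abs_mult using li_le_1[OF R x] li_pos[OF x(1)] by (intro mult_left_mono) auto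
      thus "\<bar>a - b * li x\<bar> \<le> \<Lambda>" using L by linarith
    qed (auto simp: wt_nonneg)
    also have "\<dots> = \<Lambda> * (wt (a - 2) b x * norm (x - x0))" by simp
    also have "wt (a - 2) b x * norm (x - x0) = wt (a - 1) b x" using wt_norm1[OF x(1), of "a - 2" b] by simp
    finally show ?thesis .
  qed
  hence "\<bar>partial_deriv i (wt a b) x * f x\<bar> \<le> \<Lambda> * \<bar>wt (a - 1) b x * f x\<bar>"
    unfolding abs_mult using wt_nonneg[of "a - 1" b x] by (simp add: mult_right_mono mult.assoc[symmetric])
  moreover have "partial_deriv i (\<lambda>x. wt a b x * f x) x = wt a b x * partial_deriv i f x + partial_deriv i (wt a b) x * f x"
    by (rule partial_deriv_mult[OF wt_differentiable[OF x(1)] tf_differentiable[OF f]])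
  ultimately show ?thesis by linarith
next
  case False
  have t: "tf R (\<lambda>x. wt a b x * f x)" using f by (intro tf_smooth_mult smooth_on_wt')
  have "partial_deriv i (\<lambda>x. wt a b x * f x) x = 0"
    using False tf_eq_0[OF tf_partial_deriv[OF t]] tf_eq_0'[OF tf_partial_deriv[OF t]] by blast
  thus ?thesis using L by (intro order_trans[OF _ add_nonneg_nonneg]) auto
qed

text \<open>\<open>rbd q f A\<close> bounds the norm of \<open>f\<close> in \<open>L\<^sup>q(r\<^sup>-\<^sup>n dx)\<close> by \<open>A\<close>.\<close>

definition rbd :: "real \<Rightarrow> (real ^ 'n \<Rightarrow> real) \<Rightarrow> real \<Rightarrow> bool"
  where "rbd q f A \<longleftrightarrow> (\<integral>\<^sup>+x. ennreal (wt (- real CARD('n)) 0 x * \<bar>f x\<bar> powr q) \<partial>lborel) \<le> ennreal (A powr q)"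

lemma rbd_mono: "rbd q f A \<Longrightarrow> 0 \<le> A \<Longrightarrow> A \<le> B \<Longrightarrow> 0 \<le> q \<Longrightarrow> rbd q f B"
  unfolding rbd_def by (meson ennreal_leI order_trans powr_mono2)

text \<open>The density r^-n is the q-th power of r^(-n/q), so passing to Lebesgue measure lowers
  the first weight exponent by n/q.\<close>

lemma wt_powr_shift:
  assumes f: "tf R f" and q: "q > 0"
  shows "wt (- real CARD('n)) 0 x * \<bar>wt c b x * f x\<bar> powr q = \<bar>wt (c - real CARD('n) / q) b x * f x\<bar> powr q"
proof (cases "x \<in> pball")
  case True
  have p: "norm (x - x0) > 0" "- ln (norm (x - x0)) > 0" using pball_norm[OF True] by auto
  have "wt a b x powr q = wt (a * q) (b * q) x" for a b
    unfolding wt_def using p by (simp add: powr_mult powr_powr)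
  hence "wt (c - real CARD('n) / q) b x powr q = wt (c * q + - real CARD('n)) (b * q + 0) x"
    using q by (simp add: algebra_simps)
  also have "\<dots> = wt c b x powr q * wt (- real CARD('n)) 0 x"
    using \<open>\<And>a b. wt a b x powr q = wt (a * q) (b * q) x\<close> by (simp add: wt_mult[OF True])
  finally show ?thesis by (simp add: abs_mult wt_nonneg powr_mult)
qed (use tf_eq_0[OF f] in simp)

lemma rbd_iff:
  assumes f: "tf R f" and q: "q > 0"
  shows "rbd q (\<lambda>x. wt c b x * f x) A \<longleftrightarrow>
    (\<integral>\<^sup>+x. ennreal (\<bar>wt (c - real CARD('n) / q) b x * f x\<bar> powr q) \<partial>lborel) \<le> ennreal (A powr q)"
  unfolding rbd_def wt_powr_shift[OF assms] ..

lemma rbd_2: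
  assumes f: "tf R f" and A: "A \<ge> 0" "Sq (c - real CARD('n) / 2) b f \<le> A\<^sup>2"
  shows "rbd 2 (\<lambda>x. wt c b x * f x) A"
proof -
  have "(\<integral>\<^sup>+x. ennreal (\<bar>wt (c - real CARD('n) / 2) b x * f x\<bar> powr 2) \<partial>lborel)
    = (\<integral>\<^sup>+x. ennreal ((wt (c - real CARD('n) / 2) b x * f x)\<^sup>2) \<partial>lborel)"
    by (intro nn_integral_cong) (simp add: powr_numeral)
  also have "\<dots> = ennreal (Sq (c - real CARD('n) / 2) b f)"
    unfolding Sq_def I_def by (rule nn_integral_eq_integral) (use tf_integrable[OF tf_NN[OF f]] in auto)
  also have "\<dots> \<le> ennreal (A powr 2)" using A by (intro ennreal_leI) (simp add: powr_numeral)
  finally show ?thesis using rbd_iff[OF f, of 2] by simp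
qed

text \<open>Because n/q' = n/q - 1, the change of density between the exponents q and q' is one
  power of r, exactly the one that accompanies a derivative. The Euclidean inequality for r^(-n/q')
  times the weighted function is therefore the dilation-invariant one. The sharper bound A/\<Lambda>
  on f pays for the derivative of the weight.\<close>

lemma rbd_gns:
  fixes q :: real
  assumes R: "R \<le> exp (- 1)" and q: "1 \<le> q" "q < real CARD('n)"
  defines "q' \<equiv> real CARD('n) * q / (real CARD('n) - q)"
  shows "\<exists>C>0. \<forall>f c b \<Lambda> A. tf R f \<longrightarrow> A > 0 \<longrightarrow> \<bar>c - real CARD('n) / q'\<bar> + \<bar>b\<bar> \<le> \<Lambda> \<longrightarrow> \<Lambda> > 0 \<longrightarrow>
      (\<forall>i. rbd q (\<lambda>x. wt (c + 1) b x * partial_deriv i f x) A) \<longrightarrow> rbd q (\<lambda>x. wt c b x * f x) (A / \<Lambda>) \<longrightarrow>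
      rbd q' (\<lambda>x. wt c b x * f x) (C * A)"
proof -
  define n where "n = real CARD('n)"
  define \<theta> where "\<theta> = n / (n - q)"
  have nq: "n > 0" "n - q > 0" "q > 0" "\<theta> > 0" "q' > 0" using q unfolding n_def \<theta>_def q'_def by auto
  have q't: "q' = q * \<theta>" unfolding q'_def \<theta>_def n_def by simp
  have nq': "n / q' = n / q - 1" unfolding q'_def n_def[symmetric] using nq by (simp add: field_simps)
  obtain C0 where C0: "C0 > 0" "\<And>(f :: real ^ 'n \<Rightarrow> real) g r B. grad_bound f g \<Longrightarrow> (\<And>x. norm x > r \<Longrightarrow> f x = 0) \<Longrightarrow> B > 0 \<Longrightarrow>
      (\<integral>\<^sup>+x. ennreal (g x powr q) \<partial>lborel) \<le> ennreal B \<Longrightarrow>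
      (\<integral>\<^sup>+x. ennreal (\<bar>f x\<bar> powr q') \<partial>lborel) \<le> ennreal (C0 * B powr \<theta>)"
    using gagliardo_nirenberg_sobolev[OF q] unfolding q't \<theta>_def n_def by metis
  define K where "K = n powr q * 2 powr q * (2 * n)"
  have K: "K > 0" unfolding K_def using nq by simp
  define C where "C = (C0 * K powr \<theta>) powr (1 / q')"
  show ?thesis
  proof (intro exI[of _ C] conjI allI impI)
    show "C > 0" unfolding C_def using C0 K by simp
    fix f c b \<Lambda> A
    assume f: "tf R f" and A: "A > 0" and L: "\<bar>c - real CARD('n) / q'\<bar> + \<bar>b\<bar> \<le> \<Lambda>" "\<Lambda> > 0"
      and b1: "\<forall>i. rbd q (\<lambda>x. wt (c + 1) b x * partial_deriv i f x) A" and b0: "rbd q (\<lambda>x. wt c b x * f x) (A / \<Lambda>)"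
    define h where "h = (\<lambda>x. wt (c - n / q') b x * f x)"
    have h: "tf R h" unfolding h_def using f by (intro tf_smooth_mult smooth_on_wt')
    define X where "X = (\<lambda>i x. \<bar>wt (c + 1 - n / q) b x * partial_deriv i f x\<bar>)"
    define Y where "Y = (\<lambda>x. \<bar>wt (c - n / q) b x * f x\<bar>)"
    note [measurable] = tf_measurable[OF f] tf_measurable[OF tf_partial_deriv[OF f]]
    have [measurable]: "X i \<in> borel_measurable borel" "Y \<in> borel_measurable borel" for i
      unfolding X_def Y_def by measurable
    have XY: "(\<integral>\<^sup>+x. ennreal (X i x powr q) \<partial>lborel) \<le> ennreal (A powr q)"
      "(\<integral>\<^sup>+x. ennreal (Y x powr q) \<partial>lborel) \<le> ennreal ((A / \<Lambda>) powr q)" for i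
      using b1[rule_format, of i] b0 unfolding rbd_iff[OF tf_partial_deriv[OF f] nq(3)] rbd_iff[OF f nq(3)] X_def Y_def n_def by auto
    \<comment> \<open>Each partial derivative of h splits into a derivative of f and
      \<open>\<Lambda>\<close> times f with one power of r less; both then sit in the density of
      exponent q.\<close>
    have gle: "(\<Sum>i\<in>UNIV. \<bar>partial_deriv i h x\<bar>) powr q \<le> n powr q * 2 powr q * (\<Sum>i\<in>UNIV. X i x powr q + (\<Lambda> * Y x) powr q)" for x
    proof -
      have "\<bar>partial_deriv i h x\<bar> \<le> X i x + \<Lambda> * Y x" for i
      proof -
        have "\<bar>partial_deriv i h x\<bar> \<le> \<bar>wt (c - n / q') b x * partial_deriv i f x\<bar> + \<Lambda> * \<bar>wt (c - n / q' - 1) b x * f x\<bar>"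
          unfolding h_def by (rule partial_deriv_wt_mult_le[OF R f]) (use L in \<open>simp add: n_def\<close>)
        thus ?thesis unfolding X_def Y_def nq' by (simp add: algebra_simps)
      qed
      moreover have nn: "0 \<le> X i x" "0 \<le> \<Lambda> * Y x" for i unfolding X_def Y_def using L by auto
      ultimately have "(\<Sum>i\<in>UNIV. \<bar>partial_deriv i h x\<bar>) powr q \<le> (\<Sum>i\<in>UNIV. X i x + \<Lambda> * Y x) powr q"
        using nq by (intro powr_mono2 sum_mono sum_nonneg) auto
      also have "\<dots> \<le> n powr q * (\<Sum>i\<in>UNIV. (X i x + \<Lambda> * Y x) powr q)"
        unfolding n_def using nn nq by (intro sum_powr_le add_nonneg_nonneg) auto
      also have "\<dots> \<le> n powr q * (\<Sum>i\<in>UNIV. 2 powr q * (X i x powr q + (\<Lambda> * Y x) powr q))"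
        using nn nq by (intro mult_left_mono sum_mono powr_add_le) auto
      finally show ?thesis by (simp add: sum_distrib_left mult.assoc)
    qed
    have "(\<integral>\<^sup>+x. ennreal ((\<Sum>i\<in>UNIV. \<bar>partial_deriv i h x\<bar>) powr q) \<partial>lborel)
      \<le> (\<integral>\<^sup>+x. ennreal (n powr q * 2 powr q) * (\<Sum>i\<in>UNIV. ennreal (X i x powr q) + ennreal (\<Lambda> powr q) * ennreal (Y x powr q)) \<partial>lborel)"
    proof (rule nn_integral_mono)
      fix x
      have "ennreal ((\<Sum>i\<in>UNIV. \<bar>partial_deriv i h x\<bar>) powr q) \<le> ennreal (n powr q * 2 powr q * (\<Sum>i\<in>UNIV. X i x powr q + (\<Lambda> * Y x) powr q))"
        by (rule ennreal_leI[OF gle])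
      also have "\<dots> = ennreal (n powr q * 2 powr q) * (\<Sum>i\<in>UNIV. ennreal (X i x powr q) + ennreal (\<Lambda> powr q) * ennreal (Y x powr q))"
      proof -
        have "(\<Lambda> * Y x) powr q = \<Lambda> powr q * Y x powr q" using L by (intro powr_mult)
        thus ?thesis by (simp add: ennreal_mult sum_nonneg ennreal_plus flip: sum_ennreal)
      qed
      finally show "ennreal ((\<Sum>i\<in>UNIV. \<bar>partial_deriv i h x\<bar>) powr q)
        \<le> ennreal (n powr q * 2 powr q) * (\<Sum>i\<in>UNIV. ennreal (X i x powr q) + ennreal (\<Lambda> powr q) * ennreal (Y x powr q))" .
    qed
    also have "\<dots> = ennreal (n powr q * 2 powr q) * (\<Sum>i\<in>UNIV. (\<integral>\<^sup>+x. ennreal (X i x powr q) \<partial>lborel) + ennreal (\<Lambda> powr q) * (\<integral>\<^sup>+x. ennreal (Y x powr q) \<partial>lborel))"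
      by (simp add: nn_integral_cmult nn_integral_sum nn_integral_add)
    also have "\<dots> \<le> ennreal (n powr q * 2 powr q) * (\<Sum>i\<in>(UNIV :: 'n set). ennreal (A powr q) + ennreal (\<Lambda> powr q) * ennreal ((A / \<Lambda>) powr q))"
      by (intro mult_left_mono sum_mono add_mono XY) auto
    also have "\<dots> = ennreal (K * A powr q)"
    proof -
      have "ennreal (\<Lambda> powr q) * ennreal ((A / \<Lambda>) powr q) = ennreal (A powr q)"
        using L A by (simp flip: ennreal_mult powr_mult)
      moreover have "(\<Sum>i\<in>(UNIV :: 'n set). ennreal (A powr q) + ennreal (A powr q)) = ennreal (2 * n * A powr q)"
      proof -
        have "(\<Sum>i\<in>(UNIV :: 'n set). ennreal (A powr q) + ennreal (A powr q)) = (\<Sum>i\<in>(UNIV :: 'n set). ennreal (2 * A powr q))"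
          by (intro sum.cong refl) (simp flip: ennreal_plus)
        also have "\<dots> = ennreal (\<Sum>i\<in>(UNIV :: 'n set). 2 * A powr q)" by (rule sum_ennreal) simp
        finally show ?thesis by (simp add: n_def mult_ac)
      qed
      ultimately show ?thesis unfolding K_def using nq by (simp add: mult.assoc flip: ennreal_mult)
    qed
    finally have "(\<integral>\<^sup>+x. ennreal (\<bar>h x\<bar> powr q') \<partial>lborel) \<le> ennreal (C0 * (K * A powr q) powr \<theta>)"
      by (intro C0(2)[OF grad_bound_tf[OF h] tf_bounded_support[OF h]]) (use K A in auto)
    also have "C0 * (K * A powr q) powr \<theta> = (C * A) powr q'"
    proof -
      have "(C * A) powr q' = C powr q' * A powr q'" using A by (simp add: powr_mult C_def)
      also have "C powr q' = C0 * K powr \<theta>" unfolding C_def using C0 K nq by (simp add: powr_powr)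
      finally show ?thesis using K A by (simp add: powr_mult powr_powr q't)
    qed
    finally show "rbd q' (\<lambda>x. wt c b x * f x) (C * A)"
      unfolding rbd_iff[OF f nq(5)] h_def n_def .
  qed
qed

text \<open>Where |f| <= T the power |f|^q is compared with |f|^q0, elsewhere with |f|^q1. The level
  T is left free so that each application can balance the two terms.\<close>

lemma rbd_interpolate:
  assumes f: "f \<in> borel_measurable borel" and q: "q0 \<le> q" "q \<le> q1" and T: "T > 0" "A0 \<ge> 0" "A1 \<ge> 0"
    and b: "rbd q0 f A0" "rbd q1 f A1"
  shows "(\<integral>\<^sup>+x. ennreal (wt (- real CARD('n)) 0 x * \<bar>f x\<bar> powr q) \<partial>lborel)
    \<le> ennreal (T powr (q - q0) * A0 powr q0 + T powr (q - q1) * A1 powr q1)"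
proof -
  note [measurable] = f
  let ?w = "wt (- real CARD('n)) 0"
  have "(\<integral>\<^sup>+x. ennreal (?w x * \<bar>f x\<bar> powr q) \<partial>lborel)
    \<le> (\<integral>\<^sup>+x. ennreal (T powr (q - q0)) * ennreal (?w x * \<bar>f x\<bar> powr q0) + ennreal (T powr (q - q1)) * ennreal (?w x * \<bar>f x\<bar> powr q1) \<partial>lborel)"
  proof (rule nn_integral_mono)
    fix x
    have "\<bar>f x\<bar> powr q \<le> T powr (q - q0) * \<bar>f x\<bar> powr q0 + T powr (q - q1) * \<bar>f x\<bar> powr q1"
    proof (cases "\<bar>f x\<bar> \<le> T")
      case True
      have "\<bar>f x\<bar> powr q = \<bar>f x\<bar> powr (q - q0) * \<bar>f x\<bar> powr q0" by (simp flip: powr_add)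
      also have "\<dots> \<le> T powr (q - q0) * \<bar>f x\<bar> powr q0" using True q by (intro mult_right_mono powr_mono2) auto
      finally show ?thesis by (simp add: add_increasing2)
    next
      case False
      have "\<bar>f x\<bar> powr q = \<bar>f x\<bar> powr (q - q1) * \<bar>f x\<bar> powr q1" by (simp flip: powr_add)
      also have "\<dots> \<le> T powr (q - q1) * \<bar>f x\<bar> powr q1" using False q T by (intro mult_right_mono powr_mono2') auto
      finally show ?thesis by (simp add: add_increasing)
    qed
    hence "?w x * \<bar>f x\<bar> powr q \<le> ?w x * (T powr (q - q0) * \<bar>f x\<bar> powr q0 + T powr (q - q1) * \<bar>f x\<bar> powr q1)"
      by (rule mult_left_mono) (rule wt_nonneg)
    hence "ennreal (?w x * \<bar>f x\<bar> powr q) \<le> ennreal (T powr (q - q0) * (?w x * \<bar>f x\<bar> powr q0) + T powr (q - q1) * (?w x * \<bar>f x\<bar> powr q1))"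
      by (intro ennreal_leI) (simp add: algebra_simps)
    also have "\<dots> = ennreal (T powr (q - q0)) * ennreal (?w x * \<bar>f x\<bar> powr q0) + ennreal (T powr (q - q1)) * ennreal (?w x * \<bar>f x\<bar> powr q1)"
      by (simp add: ennreal_plus ennreal_mult wt_nonneg)
    finally show "ennreal (?w x * \<bar>f x\<bar> powr q) \<le> ennreal (T powr (q - q0)) * ennreal (?w x * \<bar>f x\<bar> powr q0) + ennreal (T powr (q - q1)) * ennreal (?w x * \<bar>f x\<bar> powr q1)" .
  qed
  also have "\<dots> = ennreal (T powr (q - q0)) * (\<integral>\<^sup>+x. ennreal (?w x * \<bar>f x\<bar> powr q0) \<partial>lborel) + ennreal (T powr (q - q1)) * (\<integral>\<^sup>+x. ennreal (?w x * \<bar>f x\<bar> powr q1) \<partial>lborel)"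
    by (simp add: nn_integral_add nn_integral_cmult)
  also have "\<dots> \<le> ennreal (T powr (q - q0)) * ennreal (A0 powr q0) + ennreal (T powr (q - q1)) * ennreal (A1 powr q1)"
    using b unfolding rbd_def by (intro add_mono mult_left_mono) auto
  also have "\<dots> = ennreal (T powr (q - q0) * A0 powr q0 + T powr (q - q1) * A1 powr q1)"
    by (simp add: ennreal_plus ennreal_mult)
  finally show ?thesis .
qed

text \<open>\<open>L2_bounds m R \<tau> u A\<close> is what the \<open>L\<^sup>2\<close> Carleman estimate provides, and \<open>sob m R q k\<close> says that it
  controls the \<open>L\<^sup>q\<close> norms at the price of \<open>k\<close> derivatives, each of which costs a factor \<open>\<tau>\<close>.\<close>

definition L2_bounds :: "nat \<Rightarrow> real \<Rightarrow> real \<Rightarrow> (real ^ 'n \<Rightarrow> real) \<Rightarrow> real \<Rightarrow> bool"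
  where "L2_bounds m R \<tau> u A \<longleftrightarrow> \<tau> > 1 \<and> tf R u \<and> A > 0 \<and> (\<forall>w. length w \<le> 2 * m \<longrightarrow>
    rbd 2 (\<lambda>x. wt (- \<tau> + real (length w)) (- (2 * \<tau> + real m)) x * pdw w u x) (\<tau> ^ length w * A))"

definition sob :: "nat \<Rightarrow> real \<Rightarrow> real \<Rightarrow> nat \<Rightarrow> bool"
  where "sob m R q k \<longleftrightarrow> (\<exists>C>0. \<forall>\<tau> u A. L2_bounds m R \<tau> u A \<longrightarrow> (\<forall>w. length w + k \<le> 2 * m \<longrightarrow>
    rbd q (\<lambda>x. wt (- \<tau> + real (length w)) (- (2 * \<tau> + real m)) x * pdw w u x) (C * \<tau> ^ (length w + k) * A)))"

lemma sob_0: "sob m R 2 0"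
  unfolding sob_def L2_bounds_def by (intro exI[of _ 1]) auto

lemma sob_mono:
  assumes s: "sob m R q k" and k: "k \<le> l" and q: "q \<ge> 0"
  shows "sob m R q l"
proof -
  obtain C where C: "C > 0" "\<And>\<tau> u A w. L2_bounds m R \<tau> u A \<Longrightarrow> length w + k \<le> 2 * m \<Longrightarrow>
    rbd q (\<lambda>x. wt (- \<tau> + real (length w)) (- (2 * \<tau> + real m)) x * pdw w u x) (C * \<tau> ^ (length w + k) * A)"
    using s unfolding sob_def by blast
  have "rbd q (\<lambda>x. wt (- \<tau> + real (length w)) (- (2 * \<tau> + real m)) x * pdw w u x) (C * \<tau> ^ (length w + l) * A)"
    if L: "L2_bounds m R \<tau> u A" and w: "length w + l \<le> 2 * m" for \<tau> u A w
  proof (rule rbd_mono)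
    have t: "\<tau> > 1" "A > 0" using L unfolding L2_bounds_def by auto
    show "rbd q (\<lambda>x. wt (- \<tau> + real (length w)) (- (2 * \<tau> + real m)) x * pdw w u x) (C * \<tau> ^ (length w + k) * A)"
      by (rule C(2)[OF L]) (use w k in simp)
    show "0 \<le> C * \<tau> ^ (length w + k) * A" using C t by simp
    have "\<tau> ^ (length w + k) \<le> \<tau> ^ (length w + l)" using t k by (intro power_increasing) auto
    thus "C * \<tau> ^ (length w + k) * A \<le> C * \<tau> ^ (length w + l) * A" using C t by simp
  qed (use q in simp)
  thus ?thesis unfolding sob_def using C(1) by blast
qed

text \<open>Differentiating once costs a factor \<tau>, and so does differentiating the weight. In
  \<open>rbd_gns\<close> with \<Lambda> = K \<tau> the bounds for the derivative and for the
  function therefore match.\<close>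

lemma sob_step:
  fixes q :: real
  assumes R: "R \<le> exp (- 1)" and q: "1 \<le> q" "q < real CARD('n)" and s: "sob m R q k"
  shows "sob m R (real CARD('n) * q / (real CARD('n) - q)) (Suc k)"
proof -
  define n where "n = real CARD('n)"
  define q' where "q' = n * q / (n - q)"
  have nq: "n > 0" "n - q > 0" "q > 0" using q unfolding n_def by auto
  have q': "q' \<ge> 1"
  proof -
    have "n - q \<le> n * 1" using nq by simp
    also have "\<dots> \<le> n * q" using nq q by (intro mult_left_mono) auto
    finally show ?thesis unfolding q'_def using nq by (simp add: field_simps)
  qed
  obtain C where C: "C > 0" "\<And>\<tau> u A w. L2_bounds m R \<tau> u A \<Longrightarrow> length w + k \<le> 2 * m \<Longrightarrow>
    rbd q (\<lambda>x. wt (- \<tau> + real (length w)) (- (2 * \<tau> + real m)) x * pdw w u x) (C * \<tau> ^ (length w + k) * A)"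
    using s unfolding sob_def by blast
  obtain C0 where C0: "C0 > 0" "\<And>f c b \<Lambda> A. tf R f \<Longrightarrow> A > 0 \<Longrightarrow> \<bar>c - n / q'\<bar> + \<bar>b\<bar> \<le> \<Lambda> \<Longrightarrow> \<Lambda> > 0 \<Longrightarrow>
      (\<And>i. rbd q (\<lambda>x. wt (c + 1) b x * partial_deriv i f x) A) \<Longrightarrow> rbd q (\<lambda>x. wt c b x * f x) (A / \<Lambda>) \<Longrightarrow>
      rbd q' (\<lambda>x. wt c b x * f x) (C0 * A)"
    using rbd_gns[OF R q] unfolding q'_def n_def by blast
  \<comment> \<open>3 \<tau> comes from the two exponents, 3 m from the length of the word together
    with the m logarithms, and n from n/q'.\<close>
  define K where "K = 3 + 3 * real m + n"
  have K: "K \<ge> 1" unfolding K_def using nq by simp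
  have "rbd q' (\<lambda>x. wt (- \<tau> + real (length w)) (- (2 * \<tau> + real m)) x * pdw w u x) (C0 * C * K * \<tau> ^ (length w + Suc k) * A)"
    if L: "L2_bounds m R \<tau> u A" and w: "length w + Suc k \<le> 2 * m" for \<tau> u A w
  proof -
    have t: "\<tau> > 1" "A > 0" "tf R u" using L unfolding L2_bounds_def by auto
    define A' where "A' = C * K * \<tau> ^ (length w + Suc k) * A"
    have "rbd q' (\<lambda>x. wt (- \<tau> + real (length w)) (- (2 * \<tau> + real m)) x * pdw w u x) (C0 * A')"
    proof (rule C0(2)[where \<Lambda> = "K * \<tau>"])
      show "tf R (pdw w u)" using t by auto
      show "A' > 0" unfolding A'_def using C K t by simp
      show "K * \<tau> > 0" using K t by simp
      show "\<bar>- \<tau> + real (length w) - n / q'\<bar> + \<bar>- (2 * \<tau> + real m)\<bar> \<le> K * \<tau>"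
      proof -
        have "n / q' \<le> n" "n / q' \<ge> 0" using q' nq by (auto simp: field_simps)
        moreover have "real (length w) \<le> 2 * real m" using w by simp
        moreover have "real m * 1 \<le> real m * \<tau>" "n * 1 \<le> n * \<tau>" using t nq by (intro mult_left_mono; simp)+
        moreover have "K * \<tau> = 3 * \<tau> + 3 * (real m * \<tau>) + n * \<tau>" unfolding K_def by (simp add: algebra_simps)
        moreover have "real m \<ge> 0" "real (length w) \<ge> 0" by auto
        ultimately show ?thesis using t by linarith
      qed
      show "rbd q (\<lambda>x. wt (- \<tau> + real (length w) + 1) (- (2 * \<tau> + real m)) x * partial_deriv i (pdw w u) x) A'" for i
      proof (rule rbd_mono)
        show "rbd q (\<lambda>x. wt (- \<tau> + real (length w) + 1) (- (2 * \<tau> + real m)) x * partial_deriv i (pdw w u) x) (C * \<tau> ^ (length w + Suc k) * A)"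
          using C(2)[OF L, of "i # w"] w by (simp add: add_ac)
        show "0 \<le> C * \<tau> ^ (length w + Suc k) * A" using C t by simp
        have "1 * (C * \<tau> ^ (length w + Suc k) * A) \<le> K * (C * \<tau> ^ (length w + Suc k) * A)"
          using K C t by (intro mult_right_mono) auto
        thus "C * \<tau> ^ (length w + Suc k) * A \<le> A'" unfolding A'_def by (simp add: mult_ac)
      qed (use nq in simp)
      have "A' / (K * \<tau>) = C * \<tau> ^ (length w + k) * A" unfolding A'_def using K t by (simp add: field_simps)
      thus "rbd q (\<lambda>x. wt (- \<tau> + real (length w)) (- (2 * \<tau> + real m)) x * pdw w u x) (A' / (K * \<tau>))"
        using C(2)[OF L, of w] w by simp
    qed
    thus ?thesis unfolding A'_def by (simp add: mult.assoc)
  qed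
  moreover have "C0 * C * K > 0" using C0 C K by simp
  ultimately show ?thesis unfolding sob_def q'_def n_def by (intro exI[of _ "C0 * C * K"]) blast
qed

text \<open>Once both bounds are enlarged to a common D, the level T = D makes each of the two terms
  of \<open>rbd_interpolate\<close> equal to D^q.\<close>

lemma sob_interpolate:
  assumes q: "1 \<le> q0" "q0 \<le> q" "q \<le> q1" and s: "sob m R q0 k" "sob m R q1 k"
  shows "sob m R q k"
proof -
  obtain C0 where C0: "C0 > 0" "\<And>\<tau> u A w. L2_bounds m R \<tau> u A \<Longrightarrow> length w + k \<le> 2 * m \<Longrightarrow>
    rbd q0 (\<lambda>x. wt (- \<tau> + real (length w)) (- (2 * \<tau> + real m)) x * pdw w u x) (C0 * \<tau> ^ (length w + k) * A)"
    using s(1) unfolding sob_def by blast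
  obtain C1 where C1: "C1 > 0" "\<And>\<tau> u A w. L2_bounds m R \<tau> u A \<Longrightarrow> length w + k \<le> 2 * m \<Longrightarrow>
    rbd q1 (\<lambda>x. wt (- \<tau> + real (length w)) (- (2 * \<tau> + real m)) x * pdw w u x) (C1 * \<tau> ^ (length w + k) * A)"
    using s(2) unfolding sob_def by blast
  define C where "C = C0 + C1"
  have "rbd q (\<lambda>x. wt (- \<tau> + real (length w)) (- (2 * \<tau> + real m)) x * pdw w u x) (2 * C * \<tau> ^ (length w + k) * A)"
    if L: "L2_bounds m R \<tau> u A" and w: "length w + k \<le> 2 * m" for \<tau> u A w
  proof -
    have t: "\<tau> > 1" "A > 0" "tf R u" using L unfolding L2_bounds_def by auto
    define f where "f = (\<lambda>x. wt (- \<tau> + real (length w)) (- (2 * \<tau> + real m)) x * pdw w u x)"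
    have f: "f \<in> borel_measurable borel" unfolding f_def using tf_measurable[OF tf_pdw[OF t(3), of w]] by measurable
    define D where "D = C * \<tau> ^ (length w + k) * A"
    have D: "D > 0" unfolding D_def C_def using C0 C1 t by (simp add: add_pos_pos)
    have b0: "rbd q0 f D" unfolding f_def
      by (rule rbd_mono[OF C0(2)[OF L w]]) (use C0 C1 t q in \<open>auto simp: D_def C_def distrib_right\<close>)
    have b1: "rbd q1 f D" unfolding f_def
      by (rule rbd_mono[OF C1(2)[OF L w]]) (use C0 C1 t q in \<open>auto simp: D_def C_def distrib_right\<close>)
    have "(\<integral>\<^sup>+x. ennreal (wt (- real CARD('n)) 0 x * \<bar>f x\<bar> powr q) \<partial>lborel)
      \<le> ennreal (D powr (q - q0) * D powr q0 + D powr (q - q1) * D powr q1)"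
      by (rule rbd_interpolate[OF f q(2,3) D _ _ b0 b1]) (use D in auto)
    also have "D powr (q - q0) * D powr q0 + D powr (q - q1) * D powr q1 = 2 * D powr q" by (simp flip: powr_add)
    also have "ennreal (2 * D powr q) \<le> ennreal ((2 * D) powr q)"
    proof (rule ennreal_leI)
      have "2 * D powr q \<le> 2 powr q * D powr q" using q powr_mono[of 1 q 2] by (intro mult_right_mono) auto
      thus "2 * D powr q \<le> (2 * D) powr q" using D by (simp add: powr_mult)
    qed
    finally have "rbd q f (2 * D)" unfolding rbd_def .
    thus ?thesis unfolding f_def D_def by (simp add: mult.assoc)
  qed
  moreover have "2 * C > 0" unfolding C_def using C0 C1 by simp
  ultimately show ?thesis unfolding sob_def by (intro exI[of _ "2 * C"]) blast
qed

text \<open>Each Sobolev step lowers 1/q by 1/n, but a whole number of steps from 2 need not end at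
  q. The induction therefore goes backwards from q, and interpolation with exponent 2 fills the
  range below the first Sobolev exponent.\<close>

lemma sob_chain:
  assumes R: "R \<le> exp (- 1)" and n: "CARD('n) \<ge> 3" and q: "q \<ge> 2" "1 / q \<ge> 1/2 - real k / real CARD('n)"
  shows "sob m R q k"
  using q
proof (induction k arbitrary: q)
  case 0
  hence "q = 2" by (simp add: field_simps)
  thus ?case using sob_0 by simp
next
  case (Suc k)
  define n where "n = real CARD('n)"
  have n3: "n \<ge> 3" unfolding n_def using assms(2) by simp
  have q0: "q > 0" using Suc.prems by simp
  show ?case
  proof (cases "1 / q \<ge> 1/2 - real k / n")
    case True
    have "sob m R q k" by (rule Suc.IH) (use Suc.prems True in \<open>auto simp: n_def\<close>)
    thus ?thesis by (rule sob_mono) (use Suc.prems in auto)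
  next
    case False
    \<comment> \<open>The exponent from which a single Sobolev step arrives at q.\<close>
    define q' where "q' = n * q / (n + q)"
    have nq: "n + q > 0" "q' > 0" unfolding q'_def using q0 n3 by (auto intro!: divide_pos_pos mult_pos_pos)
    have iq: "1 / q' = 1 / q + 1 / n" unfolding q'_def using q0 n3 by (simp add: field_simps)
    show ?thesis
    proof (cases "q' \<ge> 2")
      case True
      have "sob m R q' k"
      proof (rule Suc.IH[OF True])
        have "1 / q \<ge> 1/2 - (real k + 1) / n" using Suc.prems unfolding n_def by (simp add: add.commute)
        also have "1/2 - (real k + 1) / n = 1/2 - real k / n - 1 / n" by (simp add: add_divide_distrib)
        finally show "1 / q' \<ge> 1/2 - real k / real CARD('n)" unfolding iq n_def[symmetric] by linarith
      qed
      hence "sob m R (n * q' / (n - q')) (Suc k)"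
        unfolding n_def
      proof (rule sob_step[OF R, rotated 2])
        show "1 \<le> q'" using True by simp
        have "q' < n" unfolding q'_def using q0 n3 by (simp add: field_simps)
        thus "q' < real CARD('n)" unfolding n_def .
      qed
      moreover have "n * q' / (n - q') = q"
      proof -
        have "n - q' = n * n / (n + q)" unfolding q'_def using nq by (simp add: field_simps)
        thus ?thesis unfolding q'_def using nq n3 by simp
      qed
      ultimately show ?thesis by simp
    next
      case False
      \<comment> \<open>The image of 2 under one step; q' < 2 means that q lies below it.\<close>
      define q1 where "q1 = n * 2 / (n - 2)"
      have "sob m R q1 (Suc 0)" unfolding q1_def n_def
        by (rule sob_step[OF R _ _ sob_0]) (use n3 in \<open>auto simp: n_def\<close>)
      hence s1: "sob m R q1 (Suc k)" by (rule sob_mono) (use n3 in \<open>auto simp: q1_def\<close>)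
      have s0: "sob m R 2 (Suc k)" by (rule sob_mono[OF sob_0]) auto
      have "q \<le> q1"
      proof -
        have "q' < 2" using False by simp
        hence "n * q < 2 * (n + q)" unfolding q'_def using nq(1) by (simp add: divide_less_eq)
        thus ?thesis unfolding q1_def using n3 by (simp add: field_simps)
      qed
      thus ?thesis using Suc.prems by (intro sob_interpolate[OF _ _ _ s0 s1]) auto
    qed
  qed
qed

text \<open>In the plane the exponent 2 is critical and \<open>sob_step\<close> cannot start there.
  Instead the inequality from exponent 1 to exponent 2 is applied to the square of the weighted
  function, as in Ladyzhenskaya's inequality; the gradient of the square is a product of two
  functions bounded in L^2.\<close>

lemma sob_dim2:
  assumes R: "R \<le> exp (- 1)" and n: "CARD('n) = 2"
  shows "sob m R 4 1"
proof -
  have n2: "real CARD('n) = 2" using n by simp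
  have q1: "(1::real) \<le> 1" "(1::real) < real CARD('n)" using n2 by auto
  obtain C0 where C0: "C0 > 0" "\<And>(f :: real ^ 'n \<Rightarrow> real) g r B. grad_bound f g \<Longrightarrow> (\<And>x. norm x > r \<Longrightarrow> f x = 0) \<Longrightarrow> B > 0 \<Longrightarrow>
      (\<integral>\<^sup>+x. ennreal (g x powr 1) \<partial>lborel) \<le> ennreal B \<Longrightarrow>
      (\<integral>\<^sup>+x. ennreal (\<bar>f x\<bar> powr (1 * (2 / (2 - 1)))) \<partial>lborel) \<le> ennreal (C0 * B powr (2 / (2 - 1)))"
    using gagliardo_nirenberg_sobolev[OF q1] unfolding n2 by metis
  define K where "K = 4 + 3 * real m"
  define C where "C = C0 powr (1/4) * (4 + 4 * K) powr (1/2)"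
  have K: "K > 0" unfolding K_def by simp
  have C: "C > 0" unfolding C_def using C0 K by simp
  have "rbd 4 (\<lambda>x. wt (- \<tau> + real (length w)) (- (2 * \<tau> + real m)) x * pdw w u x) (C * \<tau> ^ (length w + 1) * A)"
    if L: "L2_bounds m R \<tau> u A" and w: "length w + 1 \<le> 2 * m" for \<tau> u A w
  proof -
    have t: "\<tau> > 1" "A > 0" "tf R u" using L unfolding L2_bounds_def by auto
    define f where "f = pdw w u"
    have f: "tf R f" unfolding f_def using t by auto
    define c where "c = - \<tau> + real (length w)"
    define b where "b = - (2 * \<tau> + real m)"
    \<comment> \<open>The shift 1/2 is n/4, the density correction for exponent 4 in the
      plane.\<close>
    define F where "F = (\<lambda>x. wt (c - 1/2) b x * f x)"
    have F: "tf R F" unfolding F_def using f by (intro tf_smooth_mult smooth_on_wt')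
    have F2: "tf R (\<lambda>x. (F x)\<^sup>2)" using F by (auto intro: tf_power)
    define X where "X = (\<lambda>i x. wt c b x * partial_deriv i f x)"
    define Y where "Y = (\<lambda>x. wt (c - 1) b x * f x)"
    define l where "l = length w"
    have L2: "\<And>w. length w \<le> 2 * m \<Longrightarrow> rbd 2 (\<lambda>x. wt (- \<tau> + real (length w)) (- (2 * \<tau> + real m)) x * pdw w u x) (\<tau> ^ length w * A)"
      using L unfolding L2_bounds_def by blast
    have pw: "z powr 2 = z\<^sup>2" if "z \<ge> 0" for z :: real using that by (simp add: powr_numeral)
    have IX: "(\<integral>\<^sup>+x. ennreal ((X i x)\<^sup>2) \<partial>lborel) \<le> ennreal ((\<tau> ^ (l + 1) * A)\<^sup>2)" for i
    proof -
      have "rbd 2 (\<lambda>x. wt (c + 1) b x * partial_deriv i f x) (\<tau> ^ (l + 1) * A)"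
        using L2[of "i # w"] w unfolding c_def b_def f_def l_def by (simp add: add_ac)
      thus ?thesis using t unfolding rbd_iff[OF tf_partial_deriv[OF f], of 2, simplified] n2 X_def by (simp add: pw)
    qed
    have IY: "(\<integral>\<^sup>+x. ennreal ((Y x)\<^sup>2) \<partial>lborel) \<le> ennreal ((\<tau> ^ l * A)\<^sup>2)"
    proof -
      have "rbd 2 (\<lambda>x. wt c b x * f x) (\<tau> ^ l * A)"
        using L2[of w] w unfolding c_def b_def f_def l_def by simp
      thus ?thesis using t unfolding rbd_iff[OF f, of 2, simplified] n2 Y_def by (simp add: pw)
    qed
    \<comment> \<open>The gradient of the square is 2 |X Y| plus a weight term of size \<tau> times
      the square of Y. One spare factor \<tau> is available because Y is bounded with one power of
      \<tau> less than X.\<close>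
    have bound: "\<bar>partial_deriv i (\<lambda>x. (F x)\<^sup>2) x\<bar> \<le> (X i x)\<^sup>2 + (1 + 2 * K * \<tau>) * (Y x)\<^sup>2" for i x
    proof (cases "x \<in> pball")
      case True
      have h: "wt (c - 1/2) b x * f x * (wt (c - 1/2) b x * y) = Y x * (wt c b x * y)"
         "wt (c - 1/2) b x * f x * (wt (c - 1/2 - 1) b x * f x) = (Y x)\<^sup>2" for y
        unfolding Y_def power2_eq_square
        using wt_mult[OF True, of "c - 1/2" b "c - 1/2" b] wt_mult[OF True, of "c - 1" b c b]
          wt_mult[OF True, of "c - 1/2" b "c - 1/2 - 1" b] wt_mult[OF True, of "c - 1" b "c - 1" b]
        by (simp_all add: algebra_simps)
      have "partial_deriv i (\<lambda>x. (F x)\<^sup>2) x = 2 * F x * partial_deriv i F x"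
        unfolding power2_eq_square using partial_deriv_mult[OF tf_differentiable[OF F] tf_differentiable[OF F], of i x] by simp
      hence "\<bar>partial_deriv i (\<lambda>x. (F x)\<^sup>2) x\<bar> = 2 * \<bar>F x\<bar> * \<bar>partial_deriv i F x\<bar>" by (simp add: abs_mult)
      also have "\<dots> \<le> 2 * \<bar>F x\<bar> * (\<bar>wt (c - 1/2) b x * partial_deriv i f x\<bar> + (K * \<tau>) * \<bar>wt (c - 1/2 - 1) b x * f x\<bar>)"
        unfolding F_def
      proof (intro mult_left_mono partial_deriv_wt_mult_le[OF R f])
        have "real (length w) \<le> 2 * real m" using w by simp
        moreover have "real m * 1 \<le> real m * \<tau>" using t by (intro mult_left_mono) auto
        moreover have "K * \<tau> = 4 * \<tau> + 3 * (real m * \<tau>)" unfolding K_def by (simp add: algebra_simps)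
        moreover have "real m \<ge> 0" "real (length w) \<ge> 0" by auto
        ultimately show "\<bar>c - 1/2\<bar> + \<bar>b\<bar> \<le> K * \<tau>" unfolding c_def b_def using t by linarith
      qed auto
      also have "\<dots> = 2 * \<bar>Y x * X i x\<bar> + 2 * K * \<tau> * (Y x)\<^sup>2"
      proof -
        have e1: "\<bar>F x\<bar> * \<bar>wt (c - 1/2) b x * partial_deriv i f x\<bar> = \<bar>Y x * X i x\<bar>"
          unfolding abs_mult[symmetric] F_def X_def h(1) ..
        have e2: "\<bar>F x\<bar> * \<bar>wt (c - 1/2 - 1) b x * f x\<bar> = (Y x)\<^sup>2"
          unfolding abs_mult[symmetric] F_def h(2) by simp
        have "2 * \<bar>F x\<bar> * (P + (K * \<tau>) * Q) = 2 * (\<bar>F x\<bar> * P) + 2 * K * \<tau> * (\<bar>F x\<bar> * Q)" for P Q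
          by (simp add: algebra_simps)
        thus ?thesis unfolding e1[symmetric] e2[symmetric] .
      qed
      also have "2 * \<bar>Y x * X i x\<bar> \<le> (X i x)\<^sup>2 + (Y x)\<^sup>2"
        using zero_le_power2[of "\<bar>X i x\<bar> - \<bar>Y x\<bar>"] by (simp add: power2_eq_square algebra_simps abs_mult)
      finally show ?thesis by (simp add: algebra_simps)
    next
      case False
      thus ?thesis using tf_eq_0[OF tf_partial_deriv[OF F2]] K t by simp
    qed
    note [measurable] = tf_measurable[OF f] tf_measurable[OF tf_partial_deriv[OF f]]
    have [measurable]: "X i \<in> borel_measurable borel" "Y \<in> borel_measurable borel" for i
      unfolding X_def Y_def by measurable
    \<comment> \<open>Two coordinates, each costing at most 2 + 2 K times the square of \<tau>^(l+1)
      A.\<close>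
    define B where "B = (4 + 4 * K) * (\<tau> ^ (l + 1) * A)\<^sup>2"
    have B: "B > 0" unfolding B_def using K t by simp
    have "(\<integral>\<^sup>+x. ennreal ((\<Sum>i\<in>UNIV. \<bar>partial_deriv i (\<lambda>x. (F x)\<^sup>2) x\<bar>) powr 1) \<partial>lborel)
      \<le> (\<integral>\<^sup>+x. (\<Sum>i\<in>(UNIV::'n set). ennreal ((X i x)\<^sup>2) + ennreal (1 + 2 * K * \<tau>) * ennreal ((Y x)\<^sup>2)) \<partial>lborel)"
    proof (rule nn_integral_mono)
      fix x
      have "ennreal (\<Sum>i\<in>UNIV. \<bar>partial_deriv i (\<lambda>x. (F x)\<^sup>2) x\<bar>) \<le> ennreal (\<Sum>i\<in>(UNIV::'n set). (X i x)\<^sup>2 + (1 + 2 * K * \<tau>) * (Y x)\<^sup>2)"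
        by (intro ennreal_leI sum_mono bound)
      also have "\<dots> = (\<Sum>i\<in>(UNIV::'n set). ennreal ((X i x)\<^sup>2 + (1 + 2 * K * \<tau>) * (Y x)\<^sup>2))"
        by (rule sum_ennreal[symmetric]) (use K t in simp)
      also have "\<dots> = (\<Sum>i\<in>(UNIV::'n set). ennreal ((X i x)\<^sup>2) + ennreal (1 + 2 * K * \<tau>) * ennreal ((Y x)\<^sup>2))"
        using K t by (intro sum.cong refl) (simp add: ennreal_plus ennreal_mult del: ennreal_1)
      finally show "ennreal ((\<Sum>i\<in>UNIV. \<bar>partial_deriv i (\<lambda>x. (F x)\<^sup>2) x\<bar>) powr 1)
        \<le> (\<Sum>i\<in>(UNIV::'n set). ennreal ((X i x)\<^sup>2) + ennreal (1 + 2 * K * \<tau>) * ennreal ((Y x)\<^sup>2))"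
        by (simp add: sum_nonneg)
    qed
    also have "\<dots> = (\<Sum>i\<in>(UNIV::'n set). (\<integral>\<^sup>+x. ennreal ((X i x)\<^sup>2) \<partial>lborel) + ennreal (1 + 2 * K * \<tau>) * (\<integral>\<^sup>+x. ennreal ((Y x)\<^sup>2) \<partial>lborel))"
      by (simp add: nn_integral_sum nn_integral_add nn_integral_cmult)
    also have "\<dots> \<le> (\<Sum>i\<in>(UNIV::'n set). ennreal ((\<tau> ^ (l + 1) * A)\<^sup>2) + ennreal (1 + 2 * K * \<tau>) * ennreal ((\<tau> ^ l * A)\<^sup>2))"
      by (intro sum_mono add_mono mult_left_mono IX IY) auto
    also have "\<dots> = ennreal (\<Sum>i\<in>(UNIV::'n set). (\<tau> ^ (l + 1) * A)\<^sup>2 + (1 + 2 * K * \<tau>) * (\<tau> ^ l * A)\<^sup>2)"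
    proof -
      have "ennreal ((\<tau> ^ (l + 1) * A)\<^sup>2) + ennreal (1 + 2 * K * \<tau>) * ennreal ((\<tau> ^ l * A)\<^sup>2)
        = ennreal ((\<tau> ^ (l + 1) * A)\<^sup>2 + (1 + 2 * K * \<tau>) * (\<tau> ^ l * A)\<^sup>2)"
        using K t by (subst ennreal_plus) (auto simp: ennreal_mult simp del: ennreal_plus)
      thus ?thesis by (simp only:) (rule sum_ennreal, use K t in auto)
    qed
    also have "\<dots> \<le> ennreal B"
    proof (rule ennreal_leI)
      have 1: "(\<tau> ^ l * A)\<^sup>2 \<le> (\<tau> ^ (l + 1) * A)\<^sup>2"
        using t by (intro power_mono mult_right_mono power_increasing) auto
      have 2: "\<tau> * (\<tau> ^ l * A)\<^sup>2 \<le> (\<tau> ^ (l + 1) * A)\<^sup>2"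
      proof -
        have "\<tau> * (\<tau> ^ l * A)\<^sup>2 \<le> \<tau> * (\<tau> * (\<tau> ^ l * A)\<^sup>2)" using t by (intro mult_left_mono) (auto simp: mult_le_cancel_right1)
        thus ?thesis by (simp add: power2_eq_square mult_ac)
      qed
      have "2 * K * (\<tau> * (\<tau> ^ l * A)\<^sup>2) \<le> 2 * K * (\<tau> ^ (l + 1) * A)\<^sup>2" using 2 K by (intro mult_left_mono) auto
      moreover have "(1 + 2 * K * \<tau>) * (\<tau> ^ l * A)\<^sup>2 = (\<tau> ^ l * A)\<^sup>2 + 2 * K * (\<tau> * (\<tau> ^ l * A)\<^sup>2)" by (simp add: algebra_simps)
      moreover have "B = 2 * (2 * (\<tau> ^ (l + 1) * A)\<^sup>2 + 2 * K * (\<tau> ^ (l + 1) * A)\<^sup>2)" unfolding B_def by (simp add: algebra_simps)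
      ultimately show "(\<Sum>i\<in>(UNIV::'n set). (\<tau> ^ (l + 1) * A)\<^sup>2 + (1 + 2 * K * \<tau>) * (\<tau> ^ l * A)\<^sup>2) \<le> B"
        using 1 by (simp add: n)
    qed
    finally have I1: "(\<integral>\<^sup>+x. ennreal ((\<Sum>i\<in>UNIV. \<bar>partial_deriv i (\<lambda>x. (F x)\<^sup>2) x\<bar>) powr 1) \<partial>lborel) \<le> ennreal B" .
    have I2: "(\<integral>\<^sup>+x. ennreal (\<bar>(F x)\<^sup>2\<bar> powr (1 * (2 / (2 - 1)))) \<partial>lborel) \<le> ennreal (C0 * B powr (2 / (2 - 1)))"
      by (rule C0(2)[OF grad_bound_tf[OF F2], where r = "norm x0 + 1"])
        (use tf_bounded_support[OF F2] B I1 in blast)+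
    have e1: "\<bar>(F x)\<^sup>2\<bar> powr (1 * (2 / (2 - 1))) = \<bar>wt (c - real CARD('n) / 4) b x * f x\<bar> powr 4" for x
    proof -
      have "\<bar>(F x)\<^sup>2\<bar> powr 2 = \<bar>F x\<bar> ^ 4" by (simp add: powr_numeral flip: power_mult)
      also have "\<dots> = \<bar>F x\<bar> powr 4" by (simp add: powr_numeral)
      finally show ?thesis unfolding F_def n2 by simp
    qed
    have e2: "C0 * B powr (2 / (2 - 1)) = (C * \<tau> ^ (length w + 1) * A) powr 4"
    proof -
      have p: "\<tau> ^ (l + 1) * A > 0" using t by simp
      have "(C * \<tau> ^ (length w + 1) * A) powr 4 = C powr 4 * (\<tau> ^ (l + 1) * A) powr 4"
        unfolding l_def using C p by (simp add: powr_mult mult.assoc)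
      also have "C powr 4 = C0 * (4 + 4 * K)\<^sup>2" unfolding C_def using C0 K by (simp add: powr_mult powr_powr powr_numeral)
      also have "(\<tau> ^ (l + 1) * A) powr 4 = ((\<tau> ^ (l + 1) * A)\<^sup>2)\<^sup>2" using p by (simp add: powr_numeral flip: power_mult)
      finally show ?thesis unfolding B_def using B p K by (simp add: powr_numeral power_mult_distrib)
    qed
    have "rbd 4 (\<lambda>x. wt c b x * f x) (C * \<tau> ^ (length w + 1) * A)"
      using rbd_iff[OF f, of 4 c b] I2[unfolded e1 e2] by simp
    thus ?thesis unfolding f_def c_def b_def .
  qed
  thus ?thesis unfolding sob_def using C by blast
qed

end

subsection \<open>Pointwise bounds in low dimension\<close>

text \<open>Rays of length comparable to \<open>\<rho>\<close> keep the estimate local, so that it can be applied where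
  \<open>r \<approx> \<rho>\<close>.\<close>

lemma local_morrey:
  fixes q :: real
  assumes q: "q > real CARD('n)"
  shows "\<exists>C>0. \<forall>(f :: real ^ 'n \<Rightarrow> real) g G x x0 \<rho> D. grad_bound f g \<longrightarrow> continuous_on UNIV G \<longrightarrow> (\<forall>y. 0 \<le> G y) \<longrightarrow>
    \<rho> > 0 \<longrightarrow> D > 0 \<longrightarrow> norm (x - x0) = \<rho> \<longrightarrow>
    (\<forall>y. \<rho> / 2 \<le> norm (y - x0) \<longrightarrow> norm (y - x0) \<le> 3/2 * \<rho> \<longrightarrow> \<bar>f y\<bar> \<le> G y \<and> \<rho> * g y \<le> 2 * G y) \<longrightarrow>
    (\<integral>\<^sup>+y. ennreal (G y powr q) * indicator {y. \<rho> / 2 \<le> norm (y - x0) \<and> norm (y - x0) \<le> 3/2 * \<rho>} y \<partial>lborel)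
      \<le> ennreal (\<rho> powr real CARD('n) * D powr q) \<longrightarrow> \<bar>f x\<bar> \<le> C * D"
proof -
  define n where "n = real CARD('n)"
  define \<kappa> where "\<kappa> = ray_vol TYPE('n)"
  have k: "\<kappa> > 0" unfolding \<kappa>_def by (rule ray_vol(1))
  have n0: "n > 0" unfolding n_def using zero_less_card_finite[where 'a='n] by simp
  have nq: "q > 0" "n / q < 1" "n / q > 0" using q n0 unfolding n_def by auto
  have q1: "q \<ge> 1" using q zero_less_card_finite[where 'a='n] by linarith
  define p where "p = 1 - n / q"
  have p: "p > 0" unfolding p_def using nq by simp
  define C where "C = 12 * (\<kappa> + 1) / (\<kappa> * p * 6 powr p)"
  show ?thesis
  proof (intro exI[of _ C] conjI allI impI)
    show "C > 0" unfolding C_def using k p by (intro divide_pos_pos mult_pos_pos) auto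
    fix f :: "real ^ 'n \<Rightarrow> real" and g G x x0 \<rho> D
    assume fg: "grad_bound f g" and cG: "continuous_on UNIV G" and G0: "\<forall>y. 0 \<le> G y"
      and rho: "\<rho> > 0" and D: "D > 0" and x: "norm (x - x0) = \<rho>"
      and bd: "\<forall>y. \<rho> / 2 \<le> norm (y - x0) \<longrightarrow> norm (y - x0) \<le> 3/2 * \<rho> \<longrightarrow> \<bar>f y\<bar> \<le> G y \<and> \<rho> * g y \<le> 2 * G y"
      and int: "(\<integral>\<^sup>+y. ennreal (G y powr q) * indicator {y. \<rho> / 2 \<le> norm (y - x0) \<and> norm (y - x0) \<le> 3/2 * \<rho>} y \<partial>lborel)
      \<le> ennreal (\<rho> powr real CARD('n) * D powr q)"
    define B where "B = {y. \<rho> / 2 \<le> norm (y - x0) \<and> norm (y - x0) \<le> 3/2 * \<rho>}"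
    have [measurable]: "B \<in> sets borel" unfolding B_def by measurable
    have [measurable]: "G \<in> borel_measurable borel" using cG borel_measurable_continuous_onI by blast
    \<comment> \<open>Since |\<omega>| <= 3, a ray of parameter length \<rho>/6 moves by at most
      \<rho>/2 and stays in the annulus.\<close>
    define s0 where "s0 = \<rho> / 6"
    have s0: "s0 > 0" unfolding s0_def using rho by simp
    define H where "H = (\<lambda>y. G y * indicator B y)"
    have H0: "0 \<le> H y" for y unfolding H_def using G0 by simp
    have [measurable]: "H \<in> borel_measurable borel" unfolding H_def by measurable
    have inB: "x + s *\<^sub>R \<omega> \<in> B" if "\<omega> \<in> ray_ball" "0 \<le> s" "s \<le> s0" for \<omega> s
    proof -
      have "norm (s *\<^sub>R \<omega>) \<le> s0 * 3" using that ray_ball_norm[OF that(1)] by (auto intro!: mult_mono)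
      hence "norm (s *\<^sub>R \<omega>) \<le> \<rho> / 2" unfolding s0_def by simp
      moreover have "norm (x + s *\<^sub>R \<omega> - x0) \<le> norm (x - x0) + norm (s *\<^sub>R \<omega>)"
        using norm_triangle_ineq[of "x - x0" "s *\<^sub>R \<omega>"] by (simp add: algebra_simps)
      moreover have "norm (x - x0) \<le> norm (x + s *\<^sub>R \<omega> - x0) + norm (s *\<^sub>R \<omega>)"
        using norm_triangle_ineq4[of "x + s *\<^sub>R \<omega> - x0" "s *\<^sub>R \<omega>"] by (simp add: algebra_simps)
      ultimately show ?thesis unfolding B_def using x by simp
    qed
    have ray: "ennreal \<bar>f x\<bar> \<le> ennreal (12 / \<rho>) * (\<integral>\<^sup>+s. ennreal (H (x + s *\<^sub>R \<omega>)) * indicator {0..s0} s \<partial>lborel)"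
      if w: "\<omega> \<in> ray_ball" for \<omega>
    proof -
      note wn = ray_ball_norm[OF w]
      have "\<forall>s. \<exists>d. ((\<lambda>s. f (x + s *\<^sub>R \<omega>)) has_real_derivative d) (at s) \<and> \<bar>d\<bar> \<le> g (x + s *\<^sub>R \<omega>) * norm \<omega>"
        using fg unfolding grad_bound_def by blast
      then obtain d where d: "\<And>s. ((\<lambda>s. f (x + s *\<^sub>R \<omega>)) has_real_derivative d s) (at s)"
        "\<And>s. \<bar>d s\<bar> \<le> g (x + s *\<^sub>R \<omega>) * norm \<omega>" by metis
      \<comment> \<open>The linear factor makes \<phi> vanish at the far end, so no boundary value
        of f enters. Its slope costs 1/s0 = 6/\<rho> and the gradient bound costs 3 times 2/\<rho>,
        in total 12/\<rho>.\<close>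
      define \<phi> where "\<phi> = (\<lambda>s. (1 - s / s0) * f (x + s *\<^sub>R \<omega>))"
      have "ennreal \<bar>\<phi> s0 - \<phi> 0\<bar> \<le> (\<integral>\<^sup>+s. ennreal (12 / \<rho> * G (x + s *\<^sub>R \<omega>)) * indicator {0..s0} s \<partial>lborel)"
      proof (rule nn_integral_bound_difference)
        show "0 \<le> s0" using s0 by simp
        show "continuous_on UNIV (\<lambda>s. 12 / \<rho> * G (x + s *\<^sub>R \<omega>))"
          by (intro continuous_intros continuous_on_compose2[OF cG]) auto
        show "0 \<le> 12 / \<rho> * G (x + s *\<^sub>R \<omega>)" for s using rho G0 by simp
        show "(\<phi> has_real_derivative (- (1 / s0)) * f (x + s *\<^sub>R \<omega>) + (1 - s / s0) * d s) (at s)" for s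
          unfolding \<phi>_def using d(1)[of s] s0 by (auto intro!: derivative_eq_intros simp: field_simps)
        fix s assume s: "0 < s" "s < s0"
        let ?y = "x + s *\<^sub>R \<omega>"
        have yB: "\<bar>f ?y\<bar> \<le> G ?y" "\<rho> * g ?y \<le> 2 * G ?y"
          using inB[OF w, of s] s bd unfolding B_def by auto
        have "\<bar>(1 - s / s0) * d s\<bar> \<le> 1 * (g ?y * 3)"
          unfolding abs_mult
        proof (rule mult_mono)
          show "\<bar>1 - s / s0\<bar> \<le> 1" using s s0 by (simp add: field_simps)
          have "g ?y * norm \<omega> \<le> g ?y * 3" using wn grad_bound_measurable(3)[OF fg] by (intro mult_left_mono) auto
          thus "\<bar>d s\<bar> \<le> g ?y * 3" using d(2)[of s] by linarith
        qed auto
        also have "g ?y \<le> 2 / \<rho> * G ?y" using yB(2) rho by (simp add: field_simps)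
        finally have 1: "\<bar>(1 - s / s0) * d s\<bar> \<le> 6 / \<rho> * G ?y" by simp
        have 2: "\<bar>(- (1 / s0)) * f ?y\<bar> \<le> 6 / \<rho> * G ?y"
          unfolding s0_def using yB(1) rho by (simp add: abs_mult field_simps)
        show "\<bar>(- (1 / s0)) * f ?y + (1 - s / s0) * d s\<bar> \<le> 12 / \<rho> * G ?y"
        proof -
          have e: "12 / \<rho> * G ?y = 6 / \<rho> * G ?y + 6 / \<rho> * G ?y" by (simp add: field_simps)
          show ?thesis unfolding e by (rule order_trans[OF abs_triangle_ineq add_mono[OF 2 1]])
        qed
      qed
      also have "\<dots> = (\<integral>\<^sup>+s. ennreal (12 / \<rho>) * (ennreal (H (x + s *\<^sub>R \<omega>)) * indicator {0..s0} s) \<partial>lborel)"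
      proof (rule nn_integral_cong)
        fix s
        show "ennreal (12 / \<rho> * G (x + s *\<^sub>R \<omega>)) * indicator {0..s0} s = ennreal (12 / \<rho>) * (ennreal (H (x + s *\<^sub>R \<omega>)) * indicator {0..s0} s)"
          using inB[OF w, of s] rho G0 by (auto simp: indicator_def H_def simp flip: ennreal_mult)
      qed
      also have "\<dots> = ennreal (12 / \<rho>) * (\<integral>\<^sup>+s. ennreal (H (x + s *\<^sub>R \<omega>)) * indicator {0..s0} s \<partial>lborel)"
        by (rule nn_integral_cmult) measurable
      finally show ?thesis using s0 unfolding \<phi>_def by simp
    qed
    have "ennreal (\<kappa> * \<bar>f x\<bar>) = (\<integral>\<^sup>+\<omega>. ennreal \<bar>f x\<bar> * indicator (ray_ball :: (real ^ 'n) set) \<omega> \<partial>lborel)"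
      unfolding \<kappa>_def using ray_vol(1)[where 'n='n] by (subst nn_integral_cmult_indicator) (auto simp: ray_vol(2) ennreal_mult mult.commute)
    also have "\<dots> \<le> (\<integral>\<^sup>+\<omega>. ennreal (12 / \<rho>) * (\<integral>\<^sup>+s. ennreal (H (x + s *\<^sub>R \<omega>)) * indicator {0..s0} s \<partial>lborel) * indicator ray_ball \<omega> \<partial>lborel)"
      using ray by (intro nn_integral_mono) (auto simp: indicator_def)
    also have "\<dots> = ennreal (12 / \<rho>) * (\<integral>\<^sup>+\<omega>. (\<integral>\<^sup>+s. ennreal (H (x + s *\<^sub>R \<omega>)) * indicator {0..s0} s * indicator ray_ball \<omega> \<partial>lborel) \<partial>lborel)"
    proof -
      have "ennreal (12 / \<rho>) * (\<integral>\<^sup>+s. ennreal (H (x + s *\<^sub>R \<omega>)) * indicator {0..s0} s \<partial>lborel) * indicator ray_ball \<omega>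
        = ennreal (12 / \<rho>) * (\<integral>\<^sup>+s. ennreal (H (x + s *\<^sub>R \<omega>)) * indicator {0..s0} s * indicator ray_ball \<omega> \<partial>lborel)" for \<omega>
        by (subst nn_integral_multc) (auto simp: mult.assoc)
      thus ?thesis by (simp only:) (rule nn_integral_cmult, measurable)
    qed
    also have "(\<integral>\<^sup>+\<omega>. (\<integral>\<^sup>+s. ennreal (H (x + s *\<^sub>R \<omega>)) * indicator {0..s0} s * indicator ray_ball \<omega> \<partial>lborel) \<partial>lborel)
      = (\<integral>\<^sup>+s. (\<integral>\<^sup>+\<omega>. ennreal (H (x + s *\<^sub>R \<omega>)) * indicator {0..s0} s * indicator ray_ball \<omega> \<partial>lborel) \<partial>lborel)"
      by (rule lborel_pair.Fubini') measurable
    also have "\<dots> = (\<integral>\<^sup>+s. ray_mean (\<lambda>x. ennreal (H x)) s x * indicator {0..s0} s \<partial>lborel)"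
      unfolding ray_mean_def by (rule nn_integral_cong, subst nn_integral_multc[symmetric]) (auto simp: mult_ac)
    also have "\<dots> \<le> (\<integral>\<^sup>+s. ennreal ((\<kappa> + 1) * D * \<rho> powr (n / q)) * (ennreal (s powr (- (n / q))) * indicator {0..s0} s) \<partial>lborel)"
    \<comment> \<open>At s = 0 the real power on the right is 0 by convention, so this single point
      is discarded.\<close>
    proof (rule nn_integral_mono_AE, rule AE_mp[OF AE_lborel_singleton[of 0]], rule AE_I2, rule impI)
      fix s :: real assume "s \<noteq> 0"
      show "ray_mean (\<lambda>x. ennreal (H x)) s x * indicator {0..s0} s
        \<le> ennreal ((\<kappa> + 1) * D * \<rho> powr (n / q)) * (ennreal (s powr (- (n / q))) * indicator {0..s0} s)"
      proof (cases "s \<in> {0..s0}")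
        case True
        hence s: "s > 0" using \<open>s \<noteq> 0\<close> by simp
        \<comment> \<open>At this level the integral bound on G turns both threshold terms into
          multiples of T. Since q > n, the power s^(-n/q) is integrable at 0.\<close>
        define T where "T = D * \<rho> powr (n / q) * s powr (- (n / q))"
        have T: "T > 0" unfolding T_def using D rho s by simp
        have "ray_mean (\<lambda>x. ennreal (H x powr q)) s x \<le> ennreal (s powr (- n)) * (\<integral>\<^sup>+x. ennreal (H x powr q) \<partial>lborel)"
          unfolding n_def by (rule ray_mean_le) (use s in auto)
        also have "(\<integral>\<^sup>+x. ennreal (H x powr q) \<partial>lborel) \<le> ennreal (\<rho> powr n * D powr q)"
        proof -
          have "(\<integral>\<^sup>+x. ennreal (H x powr q) \<partial>lborel) = (\<integral>\<^sup>+y. ennreal (G y powr q) * indicator B y \<partial>lborel)"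
            unfolding H_def by (intro nn_integral_cong) (auto simp: indicator_def)
          thus ?thesis using int unfolding B_def n_def by simp
        qed
        finally have Q: "ray_mean (\<lambda>x. ennreal (H x powr q)) s x \<le> ennreal (s powr (- n)) * ennreal (\<rho> powr n * D powr q)"
          by (simp add: mult_left_mono)
        have "ray_mean (\<lambda>x. ennreal (H x)) s x \<le> ennreal (\<kappa> * T) + ennreal (T powr (1 - q)) * ray_mean (\<lambda>x. ennreal (H x powr q)) s x"
          unfolding \<kappa>_def by (rule ray_mean_threshold) (use H0 T q1 in auto)
        also have "\<dots> \<le> ennreal (\<kappa> * T) + ennreal (T powr (1 - q)) * (ennreal (s powr (- n)) * ennreal (\<rho> powr n * D powr q))"
          by (intro add_left_mono mult_left_mono Q) simp
        also have "\<dots> = ennreal (\<kappa> * T + T powr (1 - q) * (s powr (- n) * (\<rho> powr n * D powr q)))"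
          using k T by (simp add: ennreal_plus ennreal_mult)
        also have "s powr (- n) * (\<rho> powr n * D powr q) = T powr q"
        proof -
          have "(\<rho> powr (n / q)) powr q = \<rho> powr n" "(s powr (- (n / q))) powr q = s powr (- n)"
            using nq by (simp_all only: powr_powr) simp_all
          thus ?thesis unfolding T_def using D rho s by (simp add: powr_mult)
        qed
        also have "\<kappa> * T + T powr (1 - q) * T powr q = (\<kappa> + 1) * T" using T by (simp add: distrib_right flip: powr_add)
        finally have "ray_mean (\<lambda>x. ennreal (H x)) s x \<le> ennreal ((\<kappa> + 1) * T)" .
        also have "ennreal ((\<kappa> + 1) * T) = ennreal ((\<kappa> + 1) * D * \<rho> powr (n / q)) * ennreal (s powr (- (n / q)))"
          unfolding T_def using k D by (subst ennreal_mult[symmetric]) (auto simp: mult.assoc)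
        finally show ?thesis using True by simp
      qed simp
    qed
    also have "\<dots> = ennreal ((\<kappa> + 1) * D * \<rho> powr (n / q)) * (\<integral>\<^sup>+s. ennreal (s powr (- (n / q))) * indicator {0..s0} s \<partial>lborel)"
      by (rule nn_integral_cmult) measurable
    also have "(\<integral>\<^sup>+s. ennreal (s powr (- (n / q))) * indicator {0..s0} s \<partial>lborel) = ennreal (s0 powr p / p)"
    proof (rule nn_integral_has_integral_lebesgue')
      show "((\<lambda>s. s powr (- (n / q))) has_integral s0 powr p / p) {0..s0}"
        using has_integral_powr_from_0[of "- (n / q)" s0] nq s0 unfolding p_def by (simp add: add.commute)
    qed simp
    finally have "ennreal (\<kappa> * \<bar>f x\<bar>) \<le> ennreal (12 / \<rho>) * (ennreal ((\<kappa> + 1) * D * \<rho> powr (n / q)) * ennreal (s0 powr p / p))"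
      by (simp add: mult_left_mono)
    also have "\<dots> = ennreal (12 / \<rho> * ((\<kappa> + 1) * D * \<rho> powr (n / q) * (s0 powr p / p)))"
    proof -
      have "ennreal a * (ennreal b * ennreal c) = ennreal (a * (b * c))" if "a \<ge> 0" "b \<ge> 0" "c \<ge> 0" for a b c
        using that by (simp add: ennreal_mult)
      thus ?thesis using rho k D p by simp
    qed
    finally have "\<kappa> * \<bar>f x\<bar> \<le> 12 / \<rho> * ((\<kappa> + 1) * D * \<rho> powr (n / q) * (s0 powr p / p))"
      using rho k D p by (subst (asm) ennreal_le_iff) auto
    also have "\<dots> = \<kappa> * (C * D)"
    proof -
      have "s0 powr p = \<rho> powr p / 6 powr p" unfolding s0_def using rho by (simp add: powr_divide)
      moreover have "\<rho> powr (n / q) * \<rho> powr p = \<rho>" unfolding p_def using rho by (simp flip: powr_add)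
      ultimately have "\<rho> powr (n / q) * s0 powr p = \<rho> / 6 powr p" by simp
      hence "12 / \<rho> * ((\<kappa> + 1) * D * \<rho> powr (n / q) * (s0 powr p / p)) = 12 / \<rho> * (\<kappa> + 1) * D * (\<rho> / 6 powr p) / p"
        by (simp add: mult.assoc)
      also have "\<dots> = \<kappa> * (C * D)" unfolding C_def using rho k p by (simp add: field_simps)
      finally show ?thesis .
    qed
    finally show "\<bar>f x\<bar> \<le> C * D" using k by simp
  qed
qed

context punctured_space
begin

text \<open>On the annulus r is comparable to \<rho> = |x - x0|, so r^-n dx and \<rho>^-n dx agree
  up to constants, and r times the gradient of the weighted function is controlled by G.
  \<open>local_morrey\<close> then gives a bound independent of \<rho>, at the cost of one more
  derivative.\<close>

lemma sup_bound:
  fixes q :: real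
  assumes R: "R \<le> exp (- 1)" and q: "q > real CARD('n)" and s: "sob m R q k" and k: "Suc k \<le> 2 * m"
  shows "\<exists>C>0. \<forall>\<tau> u A x. L2_bounds m R \<tau> u A \<longrightarrow> \<bar>wt (- \<tau>) (- (2 * \<tau> + real m)) x * u x\<bar> \<le> C * \<tau> ^ Suc k * A"
proof -
  define n where "n = real CARD('n)"
  have n1: "n \<ge> 1" unfolding n_def using zero_less_card_finite[where 'a='n] by linarith
  have q1: "q \<ge> 1" using q n1 unfolding n_def by linarith
  obtain C0 where C0: "C0 > 0" "\<And>\<tau> u A w. L2_bounds m R \<tau> u A \<Longrightarrow> length w + k \<le> 2 * m \<Longrightarrow>
    rbd q (\<lambda>x. wt (- \<tau> + real (length w)) (- (2 * \<tau> + real m)) x * pdw w u x) (C0 * \<tau> ^ (length w + k) * A)"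
    using s unfolding sob_def by blast
  obtain C1 where C1: "C1 > 0" "\<And>(f :: real ^ 'n \<Rightarrow> real) g G x x0 \<rho> D. grad_bound f g \<Longrightarrow> continuous_on UNIV G \<Longrightarrow> \<forall>y. 0 \<le> G y \<Longrightarrow>
    \<rho> > 0 \<Longrightarrow> D > 0 \<Longrightarrow> norm (x - x0) = \<rho> \<Longrightarrow>
    \<forall>y. \<rho> / 2 \<le> norm (y - x0) \<longrightarrow> norm (y - x0) \<le> 3/2 * \<rho> \<longrightarrow> \<bar>f y\<bar> \<le> G y \<and> \<rho> * g y \<le> 2 * G y \<Longrightarrow>
    (\<integral>\<^sup>+y. ennreal (G y powr q) * indicator {y. \<rho> / 2 \<le> norm (y - x0) \<and> norm (y - x0) \<le> 3/2 * \<rho>} y \<partial>lborel)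
      \<le> ennreal (\<rho> powr real CARD('n) * D powr q) \<Longrightarrow> \<bar>f x\<bar> \<le> C1 * D"
    using local_morrey[OF q] by blast
  \<comment> \<open>There are n coordinates, and in each the weight exponents are bounded by (4 + m)
    \<tau>.\<close>
  define K where "K = n * (4 + real m)"
  have K: "K \<ge> 1" unfolding K_def using n1 mult_mono[of 1 n 1 "4 + real m"] by simp
  define c where "c = (2 powr n * 2 powr q * (n powr q * n + K powr q)) powr (1 / q)"
  have c0: "n powr q * n + K powr q > 0" using n1 K by (intro add_nonneg_pos) auto
  have c: "c > 0" unfolding c_def using n1 c0 by simp
  show ?thesis
  proof (intro exI[of _ "C1 * (c * C0)"] conjI allI impI)
    show "0 < C1 * (c * C0)" using C0 C1 c by simp
    fix \<tau> u A x
    assume L: "L2_bounds m R \<tau> u A"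
    have t: "\<tau> > 1" "A > 0" "tf R u" using L unfolding L2_bounds_def by auto
    define b where "b = - (2 * \<tau> + real m)"
    define f where "f = (\<lambda>x. wt (- \<tau>) b x * u x)"
    have f: "tf R f" unfolding f_def using t by (intro tf_smooth_mult smooth_on_wt')
    define X where "X = (\<lambda>i x. wt (- \<tau> + 1) b x * partial_deriv i u x)"
    have X: "tf R (X i)" for i unfolding X_def using t by (intro tf_smooth_mult smooth_on_wt' tf_partial_deriv)
    define G where "G = (\<lambda>x. (\<Sum>i\<in>UNIV. \<bar>X i x\<bar>) + K * \<tau> * \<bar>f x\<bar>)"
    define A1 where "A1 = C0 * \<tau> ^ Suc k * A"
    have A1: "A1 > 0" unfolding A1_def using C0 t by simp
    have IX: "rbd q (X i) A1" for i
      using C0(2)[OF L, of "[i]"] k unfolding X_def b_def A1_def by simp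
    have If: "rbd q f (A1 / \<tau>)"
      using C0(2)[OF L, of "[]"] k t unfolding f_def b_def A1_def by (simp add: mult.assoc)
    have Gx: "\<bar>f y\<bar> \<le> G y" "norm (y - x0) * (\<Sum>i\<in>UNIV. \<bar>partial_deriv i f y\<bar>) \<le> G y" for y
    proof -
      have "1 * \<bar>f y\<bar> \<le> K * \<tau> * \<bar>f y\<bar>" using K t mult_mono[of 1 K 1 \<tau>] by (intro mult_right_mono) auto
      moreover have "0 \<le> (\<Sum>i\<in>UNIV. \<bar>X i y\<bar>)" by (intro sum_nonneg) auto
      ultimately show "\<bar>f y\<bar> \<le> G y" unfolding G_def by linarith
      show "norm (y - x0) * (\<Sum>i\<in>UNIV. \<bar>partial_deriv i f y\<bar>) \<le> G y"
      proof (cases "y \<in> pball")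
        case True
        define L where "L = (4 + real m) * \<tau>"
        have L: "\<bar>- \<tau>\<bar> + \<bar>b\<bar> \<le> L"
        proof -
          have "real m * 1 \<le> real m * \<tau>" using t by (intro mult_left_mono) auto
          thus ?thesis unfolding b_def L_def using t by (simp add: algebra_simps)
        qed
        have w: "wt (- \<tau> + 1) b y = norm (y - x0) * wt (- \<tau>) b y" "wt (- \<tau>) b y = norm (y - x0) * wt (- \<tau> - 1) b y"
          using wt_norm1[OF True, of "- \<tau>" b] wt_norm1[OF True, of "- \<tau> - 1" b] by (simp_all add: mult.commute)
        have "norm (y - x0) * (\<Sum>i\<in>UNIV. \<bar>partial_deriv i f y\<bar>)
          \<le> norm (y - x0) * (\<Sum>i\<in>UNIV. \<bar>wt (- \<tau>) b y * partial_deriv i u y\<bar> + L * \<bar>wt (- \<tau> - 1) b y * u y\<bar>)"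
          unfolding f_def by (intro mult_left_mono sum_mono partial_deriv_wt_mult_le[OF R t(3) L]) auto
        also have "\<dots> = (\<Sum>i\<in>UNIV. \<bar>X i y\<bar> + L * \<bar>f y\<bar>)"
          unfolding sum_distrib_left X_def f_def w(1)
          by (intro sum.cong refl) (subst (3) w(2), simp add: abs_mult algebra_simps)
        also have "\<dots> = G y" unfolding G_def K_def L_def n_def by (simp add: sum.distrib mult_ac)
        finally show ?thesis .
      next
        case False
        hence "(\<Sum>i\<in>UNIV. \<bar>partial_deriv i f y\<bar>) = 0" using tf_eq_0[OF tf_partial_deriv[OF f] False] by simp
        moreover have "0 \<le> G y" unfolding G_def using K t by (intro add_nonneg_nonneg sum_nonneg) auto
        ultimately show ?thesis by simp
      qed
    qed
    have G0: "0 \<le> G y" for y using Gx(1)[of y] by linarith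
    show "\<bar>wt (- \<tau>) (- (2 * \<tau> + real m)) x * u x\<bar> \<le> C1 * (c * C0) * \<tau> ^ Suc k * A"
    proof (cases "x \<in> pball")
      case True
      define \<rho> where "\<rho> = norm (x - x0)"
      have rho: "\<rho> > 0" unfolding \<rho>_def using pball_norm[OF True] by simp
      have "\<bar>f x\<bar> \<le> C1 * (c * A1)"
      proof (rule C1(2)[of f "\<lambda>y. \<Sum>i\<in>UNIV. \<bar>partial_deriv i f y\<bar>" G \<rho> "c * A1" x x0])
        show "grad_bound f (\<lambda>y. \<Sum>i\<in>UNIV. \<bar>partial_deriv i f y\<bar>)" by (rule grad_bound_tf[OF f])
        show "continuous_on UNIV G" unfolding G_def
          by (intro continuous_intros tf_continuous[OF X] tf_continuous[OF f])
        show "\<forall>y. 0 \<le> G y" using G0 by blast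
        show "\<rho> > 0" "norm (x - x0) = \<rho>" "c * A1 > 0" using rho \<rho>_def c A1 by auto
        show "\<forall>y. \<rho> / 2 \<le> norm (y - x0) \<longrightarrow> norm (y - x0) \<le> 3/2 * \<rho> \<longrightarrow> \<bar>f y\<bar> \<le> G y \<and> \<rho> * (\<Sum>i\<in>UNIV. \<bar>partial_deriv i f y\<bar>) \<le> 2 * G y"
        proof (intro allI impI conjI)
          fix y assume y: "\<rho> / 2 \<le> norm (y - x0)"
          show "\<bar>f y\<bar> \<le> G y" by (rule Gx(1))
          have "\<rho> * (\<Sum>i\<in>UNIV. \<bar>partial_deriv i f y\<bar>) \<le> (2 * norm (y - x0)) * (\<Sum>i\<in>UNIV. \<bar>partial_deriv i f y\<bar>)"
            using y by (intro mult_right_mono sum_nonneg) auto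
          thus "\<rho> * (\<Sum>i\<in>UNIV. \<bar>partial_deriv i f y\<bar>) \<le> 2 * G y" using Gx(2)[of y] by simp
        qed
        note [measurable] = tf_measurable[OF f] tf_measurable[OF X]
        define w where "w = wt (- n) 0"
        have [measurable]: "w \<in> borel_measurable borel" unfolding w_def by measurable
        have w0: "w y \<ge> 0" for y unfolding w_def by (rule wt_nonneg)
        have "(\<integral>\<^sup>+y. ennreal (G y powr q) * indicator {y. \<rho> / 2 \<le> norm (y - x0) \<and> norm (y - x0) \<le> 3/2 * \<rho>} y \<partial>lborel)
          \<le> (\<integral>\<^sup>+y. ennreal ((2 * \<rho>) powr n * 2 powr q) * (ennreal (n powr q) * (\<Sum>i\<in>UNIV. ennreal (w y * \<bar>X i y\<bar> powr q)) + ennreal ((K * \<tau>) powr q) * ennreal (w y * \<bar>f y\<bar> powr q)) \<partial>lborel)"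
        proof (rule nn_integral_mono)
          fix y
          show "ennreal (G y powr q) * indicator {y. \<rho> / 2 \<le> norm (y - x0) \<and> norm (y - x0) \<le> 3/2 * \<rho>} y
            \<le> ennreal ((2 * \<rho>) powr n * 2 powr q) * (ennreal (n powr q) * (\<Sum>i\<in>UNIV. ennreal (w y * \<bar>X i y\<bar> powr q)) + ennreal ((K * \<tau>) powr q) * ennreal (w y * \<bar>f y\<bar> powr q))"
          proof (cases "norm (y - x0) \<le> 3/2 * \<rho> \<and> y \<in> pball")
            case True
            have yp: "norm (y - x0) > 0" "ln (norm (y - x0)) < 0" using pball_norm True by auto
            \<comment> \<open>The factor (2 \<rho>)^n inserts the density: r <= 3/2 \<rho> in the
              annulus, so (2 \<rho>)^n r^-n is at least 1.\<close>
            have w1: "1 \<le> (2 * \<rho>) powr n * w y"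
            proof -
              have "w y = norm (y - x0) powr (- n)" unfolding w_def wt_def using yp by simp
              hence "(norm (y - x0)) powr n * w y = 1" using yp by (simp flip: powr_add)
              moreover have "(norm (y - x0)) powr n \<le> (2 * \<rho>) powr n" using True n1 rho by (intro powr_mono2) auto
              ultimately show ?thesis using mult_right_mono[OF _ w0] by metis
            qed
            have "G y powr q \<le> 2 powr q * ((\<Sum>i\<in>UNIV. \<bar>X i y\<bar>) powr q + (K * \<tau> * \<bar>f y\<bar>) powr q)"
              unfolding G_def using K t q1 by (intro powr_add_le sum_nonneg) auto
            also have "\<dots> \<le> 2 powr q * (n powr q * (\<Sum>i\<in>UNIV. \<bar>X i y\<bar> powr q) + (K * \<tau>) powr q * \<bar>f y\<bar> powr q)"
              unfolding n_def using q1 K t by (intro mult_left_mono add_mono sum_powr_le) (auto simp: powr_mult)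
            also have "\<dots> = 1 * \<dots>" by simp
            also have "\<dots> \<le> (2 * \<rho>) powr n * w y * (2 powr q * (n powr q * (\<Sum>i\<in>UNIV. \<bar>X i y\<bar> powr q) + (K * \<tau>) powr q * \<bar>f y\<bar> powr q))"
              by (intro mult_right_mono w1 mult_nonneg_nonneg add_nonneg_nonneg sum_nonneg) auto
            also have "\<dots> = (2 * \<rho>) powr n * 2 powr q * (n powr q * (\<Sum>i\<in>UNIV. w y * \<bar>X i y\<bar> powr q) + (K * \<tau>) powr q * (w y * \<bar>f y\<bar> powr q))"
              by (simp add: sum_distrib_left algebra_simps)
            finally have "ennreal (G y powr q) \<le> ennreal \<dots>" by (rule ennreal_leI)
            also have "\<dots> = ennreal ((2 * \<rho>) powr n * 2 powr q) * (ennreal (n powr q) * (\<Sum>i\<in>UNIV. ennreal (w y * \<bar>X i y\<bar> powr q)) + ennreal ((K * \<tau>) powr q) * ennreal (w y * \<bar>f y\<bar> powr q))"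
              using w0[of y] by (simp add: ennreal_mult sum_nonneg ennreal_plus mult_nonneg_nonneg add_nonneg_nonneg flip: sum_ennreal)
            finally show ?thesis by (simp add: indicator_def)
          next
            case False
            have "y \<notin> pball \<Longrightarrow> G y = 0" unfolding G_def using tf_eq_0[OF X] tf_eq_0[OF f] by simp
            thus ?thesis using False by (auto simp: indicator_def)
          qed
        qed
        also have "\<dots> = ennreal ((2 * \<rho>) powr n * 2 powr q) * (ennreal (n powr q) * (\<Sum>i\<in>UNIV. (\<integral>\<^sup>+y. ennreal (w y * \<bar>X i y\<bar> powr q) \<partial>lborel)) + ennreal ((K * \<tau>) powr q) * (\<integral>\<^sup>+y. ennreal (w y * \<bar>f y\<bar> powr q) \<partial>lborel))"
          by (simp add: nn_integral_cmult nn_integral_sum nn_integral_add)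
        also have "\<dots> \<le> ennreal ((2 * \<rho>) powr n * 2 powr q) * (ennreal (n powr q) * (\<Sum>i\<in>(UNIV::'n set). ennreal (A1 powr q)) + ennreal ((K * \<tau>) powr q) * ennreal ((A1 / \<tau>) powr q))"
          using IX If unfolding rbd_def w_def n_def by (intro mult_left_mono add_mono sum_mono) auto
        also have "\<dots> = ennreal (\<rho> powr real CARD('n) * (c * A1) powr q)"
        proof -
          have e1: "(\<Sum>i\<in>(UNIV::'n set). ennreal (A1 powr q)) = ennreal (n * A1 powr q)"
            by (subst sum_ennreal) (auto simp: n_def)
          have e2: "ennreal ((K * \<tau>) powr q) * ennreal ((A1 / \<tau>) powr q) = ennreal (K powr q * A1 powr q)"
          proof -
            have "(K * \<tau>) powr q * (A1 / \<tau>) powr q = (K * \<tau> * (A1 / \<tau>)) powr q" using K t A1 by (simp only: powr_mult)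
            also have "K * \<tau> * (A1 / \<tau>) = K * A1" using t by simp
            finally have "(K * \<tau>) powr q * (A1 / \<tau>) powr q = K powr q * A1 powr q" using K A1 by (simp add: powr_mult)
            thus ?thesis by (simp flip: ennreal_mult)
          qed
          have "ennreal ((2 * \<rho>) powr n * 2 powr q) * (ennreal (n powr q) * ennreal (n * A1 powr q) + ennreal (K powr q * A1 powr q))
            = ennreal ((2 * \<rho>) powr n * 2 powr q * (n powr q * (n * A1 powr q) + K powr q * A1 powr q))"
            using n1 by (simp add: ennreal_mult ennreal_plus)
          also have "(2 * \<rho>) powr n * 2 powr q * (n powr q * (n * A1 powr q) + K powr q * A1 powr q)
             = \<rho> powr n * ((2 powr n * 2 powr q * (n powr q * n + K powr q)) * A1 powr q)"
            using rho by (simp add: powr_mult algebra_simps)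
          also have "2 powr n * 2 powr q * (n powr q * n + K powr q) = c powr q"
            unfolding c_def using q1 n1 K by (simp add: powr_powr add_nonneg_nonneg)
          finally show ?thesis unfolding e1 e2 using c A1 by (simp add: powr_mult n_def)
        qed
        finally show "(\<integral>\<^sup>+y. ennreal (G y powr q) * indicator {y. \<rho> / 2 \<le> norm (y - x0) \<and> norm (y - x0) \<le> 3/2 * \<rho>} y \<partial>lborel)
          \<le> ennreal (\<rho> powr real CARD('n) * (c * A1) powr q)" .
      qed
      thus ?thesis unfolding f_def b_def A1_def by (simp add: mult.assoc)
    next
      case False
      thus ?thesis using tf_eq_0[OF t(3) False] C0 C1 c t by simp
    qed
  qed
qed

section \<open>From the Carleman estimate to norms of the undifferentiated function\<close>

lemma L2_bounds_carleman:
  fixes m :: nat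
  assumes m: "m \<ge> 2"
  shows "\<exists>C>0. \<forall>\<tau> u \<Phi>. \<tau> > 1 \<longrightarrow> tf (exp (- 100 * real m)) u \<longrightarrow> \<Phi> > 0 \<longrightarrow>
    NN \<tau> 0 (\<lambda>x. norm (x - x0) ^ (2 * m) * (laplacian ^^ m) u x) \<le> \<Phi>\<^sup>2 \<longrightarrow>
    L2_bounds m (exp (- 100 * real m)) \<tau> u (C * \<tau> powr (- 3 * real m / 2) * \<Phi>)"
proof -
  obtain C where C: "C > 0" "\<And>\<tau> u w. \<tau> > 1 \<Longrightarrow> tf (exp (- 100 * real m)) u \<Longrightarrow> length w \<le> 2 * m \<Longrightarrow>
    \<tau> ^ (3 * m) * Sq (- \<tau> - real CARD('n) / 2 + real (length w)) (- (2 * \<tau> + real m)) (pdw w u)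
    \<le> C * \<tau> ^ (2 * length w) * NN \<tau> 0 (\<lambda>x. norm (x - x0) ^ (2 * m) * (laplacian ^^ m) u x)"
    using carleman_derivatives[OF m] by blast
  show ?thesis
  proof (intro exI[of _ "sqrt C"] conjI allI impI)
    show "sqrt C > 0" using C by simp
    fix \<tau> u \<Phi>
    assume t: "\<tau> > 1" and u: "tf (exp (- 100 * real m)) u" and Phi: "\<Phi> > 0"
      and F: "NN \<tau> 0 (\<lambda>x. norm (x - x0) ^ (2 * m) * (laplacian ^^ m) u x) \<le> \<Phi>\<^sup>2"
    define A where "A = sqrt C * \<tau> powr (- 3 * real m / 2) * \<Phi>"
    have A: "A > 0" unfolding A_def using C t Phi by simp
    \<comment> \<open>The gain \<tau>^(3m) of the squared estimate is stored in A as
      \<tau>^(-3m/2).\<close>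
    have tp: "(\<tau> powr (- 3 * real m / 2))\<^sup>2 * \<tau> ^ (3 * m) = 1"
    proof -
      have "(\<tau> powr (- 3 * real m / 2))\<^sup>2 = \<tau> powr (- real (3 * m))"
        using t by (simp add: power2_eq_square flip: powr_add)
      moreover have "\<tau> ^ (3 * m) = \<tau> powr real (3 * m)" using t by (simp only: powr_realpow)
      ultimately have "(\<tau> powr (- 3 * real m / 2))\<^sup>2 * \<tau> ^ (3 * m) = \<tau> powr (- real (3 * m) + real (3 * m))"
        by (simp only: powr_add)
      thus ?thesis using t by simp
    qed
    have "rbd 2 (\<lambda>x. wt (- \<tau> + real (length w)) (- (2 * \<tau> + real m)) x * pdw w u x) (\<tau> ^ length w * A)"
      if w: "length w \<le> 2 * m" for w
    proof (rule rbd_2)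
      show "tf (exp (- 100 * real m)) (pdw w u)" using u by auto
      show "0 \<le> \<tau> ^ length w * A" using A t by simp
      have "\<tau> ^ (3 * m) * Sq (- \<tau> + real (length w) - real CARD('n) / 2) (- (2 * \<tau> + real m)) (pdw w u)
        \<le> C * \<tau> ^ (2 * length w) * \<Phi>\<^sup>2"
      proof -
        have "\<tau> ^ (3 * m) * Sq (- \<tau> - real CARD('n) / 2 + real (length w)) (- (2 * \<tau> + real m)) (pdw w u)
          \<le> C * \<tau> ^ (2 * length w) * NN \<tau> 0 (\<lambda>x. norm (x - x0) ^ (2 * m) * (laplacian ^^ m) u x)"
          by (rule C(2)[OF t u w])
        also have "\<dots> \<le> C * \<tau> ^ (2 * length w) * \<Phi>\<^sup>2" using F C t by (intro mult_left_mono) auto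
        finally show ?thesis by (simp add: algebra_simps)
      qed
      also have "C * \<tau> ^ (2 * length w) * \<Phi>\<^sup>2 = \<tau> ^ (3 * m) * (\<tau> ^ length w * A)\<^sup>2"
      proof -
        have "(\<tau> ^ length w * A)\<^sup>2 = \<tau> ^ (2 * length w) * (C * (\<tau> powr (- 3 * real m / 2))\<^sup>2 * \<Phi>\<^sup>2)"
          unfolding A_def power_mult_distrib using C by (simp add: power_mult[symmetric] mult.commute)
        hence "\<tau> ^ (3 * m) * (\<tau> ^ length w * A)\<^sup>2 = \<tau> ^ (2 * length w) * C * ((\<tau> powr (- 3 * real m / 2))\<^sup>2 * \<tau> ^ (3 * m)) * \<Phi>\<^sup>2"
          by (simp only: mult_ac)
        thus ?thesis unfolding tp by simp
      qed
      finally show "Sq (- \<tau> + real (length w) - real CARD('n) / 2) (- (2 * \<tau> + real m)) (pdw w u) \<le> (\<tau> ^ length w * A)\<^sup>2"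
        by (rule mult_left_le_imp_le) (use t in simp)
    qed
    thus "L2_bounds m (exp (- 100 * real m)) \<tau> u (sqrt C * \<tau> powr (- 3 * real m / 2) * \<Phi>)"
      unfolding L2_bounds_def A_def[symmetric] using t u A by blast
  qed
qed

text \<open>The level A \<tau>^z is optimal when both terms of \<open>rbd_interpolate\<close> have
  the same power of \<tau>, that is, z (p - 2) = z (p - q) + k q. This gives z = k q/(q -
  2).\<close>

lemma rbd_between:
  fixes p q :: real
  assumes s: "sob m R q k" and k: "k \<le> 2 * m" and p: "2 \<le> p" "p \<le> q" and q: "q > 2"
  shows "\<exists>C>0. \<forall>\<tau> u A. L2_bounds m R \<tau> u A \<longrightarrow>
    rbd p (\<lambda>x. wt (- \<tau>) (- (2 * \<tau> + real m)) x * u x) (C * \<tau> powr (real k * q / (q - 2) * (p - 2) / p) * A)"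
proof -
  obtain C1 where C1: "C1 > 0" "\<And>\<tau> u A w. L2_bounds m R \<tau> u A \<Longrightarrow> length w + k \<le> 2 * m \<Longrightarrow>
    rbd q (\<lambda>x. wt (- \<tau> + real (length w)) (- (2 * \<tau> + real m)) x * pdw w u x) (C1 * \<tau> ^ (length w + k) * A)"
    using s unfolding sob_def by blast
  define z where "z = real k * q / (q - 2)"
  define C where "C = (1 + C1 powr q) powr (1 / p)"
  have C: "C > 0" unfolding C_def using add_pos_nonneg[of 1 "C1 powr q"] by auto
  show ?thesis
  proof (intro exI[of _ C] conjI allI impI C)
    fix \<tau> u A assume L: "L2_bounds m R \<tau> u A"
    have t: "\<tau> > 1" "A > 0" "tf R u" using L unfolding L2_bounds_def by auto
    define f where "f = (\<lambda>x. wt (- \<tau>) (- (2 * \<tau> + real m)) x * u x)"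
    have f: "f \<in> borel_measurable borel" unfolding f_def using tf_measurable[OF t(3)] by measurable
    have b0: "rbd 2 f A"
    proof -
      have "\<forall>w. length w \<le> 2 * m \<longrightarrow>
        rbd 2 (\<lambda>x. wt (- \<tau> + real (length w)) (- (2 * \<tau> + real m)) x * pdw w u x) (\<tau> ^ length w * A)"
        using L unfolding L2_bounds_def by blast
      from this[rule_format, of "[]"] show ?thesis unfolding f_def by simp
    qed
    have b1: "rbd q f (C1 * \<tau> ^ k * A)" using C1(2)[OF L, of "[]"] k unfolding f_def by simp
    define T where "T = A * \<tau> powr z"
    have T: "T > 0" unfolding T_def using t by simp
    have "(\<integral>\<^sup>+x. ennreal (wt (- real CARD('n)) 0 x * \<bar>f x\<bar> powr p) \<partial>lborel)
      \<le> ennreal (T powr (p - 2) * A powr 2 + T powr (p - q) * (C1 * \<tau> ^ k * A) powr q)"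
      by (rule rbd_interpolate[OF f p T _ _ b0 b1]) (use t C1 in auto)
    also have "T powr (p - 2) * A powr 2 = A powr p * \<tau> powr (z * (p - 2))"
    proof -
      have "T powr (p - 2) = A powr (p - 2) * \<tau> powr (z * (p - 2))"
        unfolding T_def using t by (simp add: powr_mult powr_powr)
      moreover have "A powr (p - 2) * A powr 2 = A powr p" by (subst powr_add[symmetric]) simp
      ultimately show ?thesis by (metis mult.commute mult.left_commute)
    qed
    also have "T powr (p - q) * (C1 * \<tau> ^ k * A) powr q = C1 powr q * (A powr p * \<tau> powr (z * (p - 2)))"
    proof -
      have "T powr (p - q) = A powr (p - q) * \<tau> powr (z * (p - q))"
        unfolding T_def using t by (simp add: powr_mult powr_powr)
      moreover have "(C1 * \<tau> ^ k * A) powr q = C1 powr q * \<tau> powr (real k * q) * A powr q"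
        using t C1 by (simp add: powr_mult powr_powr flip: powr_realpow)
      ultimately have "T powr (p - q) * (C1 * \<tau> ^ k * A) powr q
        = C1 powr q * ((A powr (p - q) * A powr q) * (\<tau> powr (z * (p - q)) * \<tau> powr (real k * q)))"
        by (simp only: mult_ac)
      also have "A powr (p - q) * A powr q = A powr p" by (subst powr_add[symmetric]) simp
      also have "\<tau> powr (z * (p - q)) * \<tau> powr (real k * q) = \<tau> powr (z * (p - 2))"
      proof -
        have "real k * q = z * (q - 2)" unfolding z_def using q by simp
        hence "z * (p - q) + real k * q = z * (p - 2)" by (simp add: algebra_simps)
        thus ?thesis by (simp flip: powr_add)
      qed
      finally show ?thesis .
    qed
    also have "A powr p * \<tau> powr (z * (p - 2)) + C1 powr q * (A powr p * \<tau> powr (z * (p - 2)))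
      = (C * \<tau> powr (z * (p - 2) / p) * A) powr p"
    proof -
      have "C powr p = 1 + C1 powr q" unfolding C_def using p by (simp add: powr_powr add_nonneg_nonneg)
      moreover have "(\<tau> powr (z * (p - 2) / p)) powr p = \<tau> powr (z * (p - 2))" using p by (simp add: powr_powr)
      moreover have "(C * \<tau> powr (z * (p - 2) / p) * A) powr p = C powr p * (\<tau> powr (z * (p - 2) / p)) powr p * A powr p"
        using C t by (simp add: powr_mult)
      ultimately show ?thesis by (simp add: algebra_simps)
    qed
    finally show "rbd p (\<lambda>x. wt (- \<tau>) (- (2 * \<tau> + real m)) x * u x) (C * \<tau> powr (real k * q / (q - 2) * (p - 2) / p) * A)"
      unfolding rbd_def f_def[symmetric] z_def .
  qed
qed

lemma rbd_below_sup:
  fixes p :: real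
  assumes f: "f \<in> borel_measurable borel" and p: "2 \<le> p" and S: "S > 0" "\<And>x. \<bar>f x\<bar> \<le> S" and A: "A > 0" "rbd 2 f A"
  shows "rbd p f (S powr ((p - 2) / p) * A powr (2 / p))"
proof -
  note [measurable] = f
  let ?w = "wt (- real CARD('n)) 0"
  have "(\<integral>\<^sup>+x. ennreal (?w x * \<bar>f x\<bar> powr p) \<partial>lborel) \<le> (\<integral>\<^sup>+x. ennreal (S powr (p - 2)) * ennreal (?w x * \<bar>f x\<bar> powr 2) \<partial>lborel)"
  proof (rule nn_integral_mono)
    fix x
    have "\<bar>f x\<bar> powr p = \<bar>f x\<bar> powr (p - 2) * \<bar>f x\<bar> powr 2" by (subst powr_add[symmetric]) simp
    also have "\<dots> \<le> S powr (p - 2) * \<bar>f x\<bar> powr 2" using S p by (intro mult_right_mono powr_mono2) auto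
    finally have "?w x * \<bar>f x\<bar> powr p \<le> ?w x * (S powr (p - 2) * \<bar>f x\<bar> powr 2)" by (rule mult_left_mono) (rule wt_nonneg)
    hence "ennreal (?w x * \<bar>f x\<bar> powr p) \<le> ennreal (S powr (p - 2) * (?w x * \<bar>f x\<bar> powr 2))"
      by (intro ennreal_leI) (simp only: mult_ac)
    also have "\<dots> = ennreal (S powr (p - 2)) * ennreal (?w x * \<bar>f x\<bar> powr 2)"
      by (rule ennreal_mult) (auto simp: wt_nonneg)
    finally show "ennreal (?w x * \<bar>f x\<bar> powr p) \<le> ennreal (S powr (p - 2)) * ennreal (?w x * \<bar>f x\<bar> powr 2)" .
  qed
  also have "\<dots> = ennreal (S powr (p - 2)) * (\<integral>\<^sup>+x. ennreal (?w x * \<bar>f x\<bar> powr 2) \<partial>lborel)"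
    by (rule nn_integral_cmult) measurable
  also have "\<dots> \<le> ennreal (S powr (p - 2)) * ennreal (A powr 2)"
    using A unfolding rbd_def by (intro mult_left_mono) auto
  also have "\<dots> = ennreal (S powr (p - 2) * A powr 2)" by (rule ennreal_mult[symmetric]) auto
  also have "S powr (p - 2) * A powr 2 = (S powr ((p - 2) / p) * A powr (2 / p)) powr p"
  proof -
    have "(S powr ((p - 2) / p)) powr p = S powr (p - 2)" "(A powr (2 / p)) powr p = A powr 2"
      using p by (simp_all only: powr_powr) simp_all
    thus ?thesis by (simp only: powr_mult)
  qed
  finally show ?thesis unfolding rbd_def .
qed

text \<open>An exponent above n has to be reached with at most 2 m - 2 derivatives, leaving one for
  \<open>sup_bound\<close>. Outside the plane this needs 1/2 - (2 m - 2)/n < 1/n, which is exactly n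
  < 4 m - 2; in the plane \<open>sob_dim2\<close> serves.\<close>

lemma sup_bound_low_dim:
  fixes m :: nat
  assumes R: "R \<le> exp (- 1)" and m: "m \<ge> 2" and n: "CARD('n) \<ge> 2" "CARD('n) < 4 * m - 2"
  shows "\<exists>C>0. \<forall>\<tau> u A x. L2_bounds m R \<tau> u A \<longrightarrow> \<bar>wt (- \<tau>) (- (2 * \<tau> + real m)) x * u x\<bar> \<le> C * \<tau> ^ (2 * m - 1) * A"
proof -
  obtain q k where q: "q > real CARD('n)" "sob m R q k" "Suc k \<le> 2 * m - 1"
  proof (cases "CARD('n) = 2")
    case True
    show ?thesis using sob_dim2[OF R True] True m by (intro that[of 4 1]) auto
  next
    case False
    define d where "d = 1/2 - real (2 * m - 2) / real CARD('n)"
    have n0: "real CARD('n) > 0" using n by simp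
    have d: "d < 1 / real CARD('n)"
    proof -
      have "real CARD('n) < 4 * real m - 2" using n(2) m by linarith
      moreover have "real (2 * m - 2) = 2 * real m - 2" using m by (simp add: of_nat_diff)
      moreover have "real CARD('n) * d = real CARD('n) / 2 - real (2 * m - 2)"
        unfolding d_def using n0 by (simp add: right_diff_distrib)
      ultimately have "real CARD('n) * d < 1" by argo
      thus ?thesis using n0 by (simp add: field_simps)
    qed
    \<comment> \<open>If d <= 0, the chain reaches every finite exponent, and n + 1 is one above
      n.\<close>
    define q where "q = (if d \<le> 0 then real CARD('n) + 1 else 1 / d)"
    have "q > real CARD('n)" unfolding q_def using d n0 by (auto simp: field_simps)
    moreover have "sob m R q (2 * m - 2)"
    proof (rule sob_chain[OF R])
      show "CARD('n) \<ge> 3" using n False by simp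
      show "q \<ge> 2" using \<open>q > real CARD('n)\<close> n(1) by linarith
      have "1 / q \<ge> d" unfolding q_def using n0 by (auto intro: order_trans[of _ 0])
      thus "1 / q \<ge> 1/2 - real (2 * m - 2) / real CARD('n)" unfolding d_def .
    qed
    ultimately show ?thesis using m by (intro that[of q "2 * m - 2"]) auto
  qed
  have "Suc k \<le> 2 * m" using q(3) by simp
  from sup_bound[OF R q(1,2) this] obtain C where C: "C > 0"
    "\<And>\<tau> u A x. L2_bounds m R \<tau> u A \<Longrightarrow> \<bar>wt (- \<tau>) (- (2 * \<tau> + real m)) x * u x\<bar> \<le> C * \<tau> ^ Suc k * A" by blast
  show ?thesis
  proof (intro exI[of _ C] conjI allI impI C(1))
    fix \<tau> u A x assume L: "L2_bounds m R \<tau> u A"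
    have t: "\<tau> > 1" "A > 0" using L unfolding L2_bounds_def by auto
    have "C * \<tau> ^ Suc k * A \<le> C * \<tau> ^ (2 * m - 1) * A"
      using C(1) t q(3) by (intro mult_right_mono mult_left_mono power_increasing) auto
    thus "\<bar>wt (- \<tau>) (- (2 * \<tau> + real m)) x * u x\<bar> \<le> C * \<tau> ^ (2 * m - 1) * A" using C(2)[OF L, of x] by linarith
  qed
qed

end

subsection \<open>Complex-valued test functions\<close>

lemma Lp_norm_le_iff:
  assumes p: "p > 0" and B: "B \<ge> 0"
  shows "Lp_norm M (ennreal p) f \<le> ennreal B \<longleftrightarrow> (\<integral>\<^sup>+x. ennreal (norm (f x) powr p) \<partial>M) \<le> ennreal (B powr p)"
proof -
  define X where "X = (\<integral>\<^sup>+x. ennreal (norm (f x) powr p) \<partial>M)"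
  have e: "enn2real (ennreal p) = p" "ennreal p \<noteq> \<infinity>" using p by auto
  have N: "Lp_norm M (ennreal p) f = (if X = \<infinity> then \<infinity> else ennreal (enn2real X powr (1 / p)))"
    unfolding Lp_norm_def X_def e(1) Let_def using e(2) by simp
  show ?thesis
  proof (cases X rule: ennreal_cases)
    case (real r)
    have "r powr (1 / p) \<le> B \<longleftrightarrow> r \<le> B powr p"
    proof
      assume "r powr (1 / p) \<le> B"
      hence "(r powr (1 / p)) powr p \<le> B powr p" using p by (intro powr_mono2) auto
      thus "r \<le> B powr p" using p real by (simp add: powr_powr)
    next
      assume "r \<le> B powr p"
      hence "r powr (1 / p) \<le> (B powr p) powr (1 / p)" using p real by (intro powr_mono2) auto
      thus "r powr (1 / p) \<le> B" using p B by (simp add: powr_powr)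
    qed
    thus ?thesis using N real B unfolding X_def by (simp add: ennreal_le_iff)
  next
    case top
    thus ?thesis using N unfolding X_def by (simp add: top_unique)
  qed
qed

lemma nn_integral_radial_lborel:
  fixes x0 :: "real ^ 'n"
  assumes "f \<in> borel_measurable borel"
  shows "(\<integral>\<^sup>+x. f x \<partial>radial_lborel x0) = (\<integral>\<^sup>+x. ennreal (inverse (norm (x - x0) ^ CARD('n))) * f x \<partial>lborel)"
  unfolding radial_lborel_def using assms
  by (subst nn_integral_density) (simp_all add: power_int_minus dist_norm)

lemma pdw_bounded_linear:
  fixes f :: "real ^ 'n \<Rightarrow> 'b::real_normed_vector" and L :: "'b \<Rightarrow> 'c::real_normed_vector"
  assumes L: "bounded_linear L" and f: "smooth_on UNIV f"
  shows "pdw w (\<lambda>x. L (f x)) = (\<lambda>x. L (pdw w f x))"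
  by (induction w) (use smooth_on_bounded_linear(2)[OF L open_UNIV smooth_on_pdw[OF f]] in auto)

lemma smooth_on_laplacian_pow:
  fixes f :: "real ^ 'n \<Rightarrow> 'b::real_normed_vector"
  assumes f: "smooth_on UNIV f"
  shows "smooth_on UNIV ((laplacian ^^ m) f)"
proof (induction m)
  case (Suc m)
  have "smooth_on UNIV (laplacian g)" if "smooth_on UNIV g" for g :: "real ^ 'n \<Rightarrow> 'b"
  proof -
    have "smooth_on UNIV (\<lambda>x. \<Sum>i\<in>UNIV. partial_deriv i (partial_deriv i g) x)"
      by (intro smooth_on_sum smooth_on_partial_deriv that open_UNIV)
    thus ?thesis unfolding laplacian_def[abs_def] .
  qed
  thus ?case using Suc by simp
qed (simp add: f)

lemma laplacian_pow_bounded_linear: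
  fixes f :: "real ^ 'n \<Rightarrow> 'b::real_normed_vector" and L :: "'b \<Rightarrow> 'c::real_normed_vector"
  assumes L: "bounded_linear L" and f: "smooth_on UNIV f"
  shows "(laplacian ^^ m) (\<lambda>x. L (f x)) = (\<lambda>x. L ((laplacian ^^ m) f x))"
proof (induction m)
  case (Suc m)
  define g where "g = (laplacian ^^ m) f"
  have g: "smooth_on UNIV g" unfolding g_def by (rule smooth_on_laplacian_pow[OF f])
  have "partial_deriv i (partial_deriv i (\<lambda>x. L (g x))) = (\<lambda>x. L (partial_deriv i (partial_deriv i g) x))" for i
    using pdw_bounded_linear[OF L g, of "[i, i]"] by simp
  hence "laplacian (\<lambda>x. L (g x)) = (\<lambda>x. L (laplacian g x))"
    unfolding laplacian_def[abs_def] by (simp add: linear_sum[OF bounded_linear.linear[OF L]])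
  thus ?case using Suc unfolding g_def by simp
qed simp

section \<open>Passage between real weighted bounds and norms of complex functions\<close>

context punctured_space
begin

lemma tf_test_functions:
  assumes L: "bounded_linear L" and u: "u \<in> test_functions (ball x0 R - {x0})" and R: "R \<le> 1"
  shows "tf R (\<lambda>x. L (u x))"
  unfolding tf_def
proof (intro conjI exI[of _ "closure (support_on UNIV u)"])
  show "smooth_on UNIV (\<lambda>x. L (u x))"
    by (rule smooth_on_bounded_linear(1)[OF L open_UNIV test_functions_smooth[OF u]])
  have S: "compact (closure (support_on UNIV u))" "closure (support_on UNIV u) \<subseteq> ball x0 R - {x0}"
    using u unfolding test_functions_def by auto
  show "compact (closure (support_on UNIV u))" by (rule S(1))
  show "closure (support_on UNIV u) \<subseteq> pball \<inter> ball x0 R" using S(2) R unfolding pball_def by auto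
  show "\<forall>x. x \<notin> closure (support_on UNIV u) \<longrightarrow> L (u x) = 0"
  proof (intro allI impI)
    fix x assume "x \<notin> closure (support_on UNIV u)"
    hence "x \<notin> support_on UNIV u" using closure_subset by blast
    thus "L (u x) = 0" using linear_0[OF bounded_linear.linear[OF L]] by (simp add: support_on_def)
  qed
qed

text \<open>For r < 1 one has log (log r)^2 = 2 log (-log r), so exp (-\<tau> \<phi>) is r^-\<tau>
  (-log r)^(-2 \<tau>). This is the origin of 2 \<tau> in the second exponent of all
  weights.\<close>

lemma carleman_weight:
  assumes x: "x \<in> pball"
  shows "exp (- \<tau> * carleman_phi (dist x x0)) = wt (- \<tau>) (- (2 * \<tau>)) x"
    and "\<bar>ln (dist x x0) powi (- int m)\<bar> = wt 0 (- real m) x"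
    and "dist x x0 ^ k = wt (real k) 0 x"
    and "inverse (norm (x - x0) ^ CARD('n)) = wt (- real CARD('n)) 0 x"
proof -
  have r: "norm (x - x0) > 0" "ln (norm (x - x0)) < 0" using pball_norm[OF x] by auto
  have "ln ((ln (norm (x - x0)))\<^sup>2) = 2 * ln (- ln (norm (x - x0)))"
    using ln_realpow[of "- ln (norm (x - x0))" 2] r by simp
  hence "- \<tau> * carleman_phi (dist x x0) = - \<tau> * ln (norm (x - x0)) + - (2 * \<tau>) * ln (- ln (norm (x - x0)))"
    unfolding carleman_phi_def dist_norm by (simp add: algebra_simps)
  thus "exp (- \<tau> * carleman_phi (dist x x0)) = wt (- \<tau>) (- (2 * \<tau>)) x"
    unfolding wt_def powr_def using r by (simp flip: exp_add)
  have "\<bar>ln (dist x x0) powi (- int m)\<bar> = inverse ((- ln (norm (x - x0))) ^ m)"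
    using r by (simp add: power_int_minus dist_norm power_abs)
  thus "\<bar>ln (dist x x0) powi (- int m)\<bar> = wt 0 (- real m) x"
    unfolding wt_def using r by (simp add: powr_minus powr_realpow)
  show "dist x x0 ^ k = wt (real k) 0 x" "inverse (norm (x - x0) ^ CARD('n)) = wt (- real CARD('n)) 0 x"
    unfolding wt_def dist_norm using r by (simp_all add: powr_minus powr_realpow)
qed

text \<open>f and g stand for the weighted real and imaginary parts. One factor 2 comes from
  \<open>powr_add_le\<close>, the other from adding two equal bounds. The unweighted norm is covered
  as well because r^-n >= 1 on the unit ball, where H is supported.\<close>

lemma rbd_Lp_norm:
  fixes H :: "real ^ 'n \<Rightarrow> 'b::{real_normed_vector,second_countable_topology}"
  assumes [measurable]: "f \<in> borel_measurable borel" "g \<in> borel_measurable borel" "H \<in> borel_measurable borel"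
    and H: "\<And>x. x \<in> pball \<Longrightarrow> norm (H x) \<le> \<bar>f x\<bar> + \<bar>g x\<bar>" "\<And>x. x \<notin> pball \<Longrightarrow> H x = 0"
    and b: "rbd p f B" "rbd p g B" and p: "p \<ge> 1" and B: "B > 0"
  shows "Lp_norm (radial_lborel x0) (ennreal p) H \<le> ennreal (4 * B)" "Lp_norm lborel (ennreal p) H \<le> ennreal (4 * B)"
proof -
  let ?w = "wt (- real CARD('n)) 0" and ?v = "\<lambda>x. inverse (norm (x - x0) ^ CARD('n))"
  have "(\<integral>\<^sup>+x. ennreal (?v x) * ennreal (norm (H x) powr p) \<partial>lborel)
    \<le> (\<integral>\<^sup>+x. ennreal (2 powr p) * (ennreal (?w x * \<bar>f x\<bar> powr p) + ennreal (?w x * \<bar>g x\<bar> powr p)) \<partial>lborel)"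
  proof (rule nn_integral_mono)
    fix x
    show "ennreal (?v x) * ennreal (norm (H x) powr p)
      \<le> ennreal (2 powr p) * (ennreal (?w x * \<bar>f x\<bar> powr p) + ennreal (?w x * \<bar>g x\<bar> powr p))"
    proof (cases "x \<in> pball")
      case True
      have "norm (H x) powr p \<le> (\<bar>f x\<bar> + \<bar>g x\<bar>) powr p" using H(1)[OF True] p by (intro powr_mono2) auto
      also have "\<dots> \<le> 2 powr p * (\<bar>f x\<bar> powr p + \<bar>g x\<bar> powr p)" using p by (intro powr_add_le) auto
      finally have "?w x * norm (H x) powr p \<le> ?w x * (2 powr p * (\<bar>f x\<bar> powr p + \<bar>g x\<bar> powr p))"
        by (rule mult_left_mono) (rule wt_nonneg)
      also have "\<dots> = 2 powr p * (?w x * \<bar>f x\<bar> powr p + ?w x * \<bar>g x\<bar> powr p)" by (simp add: algebra_simps)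
      finally have "ennreal (?w x * norm (H x) powr p) \<le> ennreal \<dots>" by (rule ennreal_leI)
      thus ?thesis unfolding carleman_weight(4)[OF True]
        by (simp add: ennreal_mult ennreal_plus wt_nonneg mult_nonneg_nonneg add_nonneg_nonneg)
    next
      case False
      thus ?thesis using H(2) p by simp
    qed
  qed
  also have "\<dots> = ennreal (2 powr p) * ((\<integral>\<^sup>+x. ennreal (?w x * \<bar>f x\<bar> powr p) \<partial>lborel) + (\<integral>\<^sup>+x. ennreal (?w x * \<bar>g x\<bar> powr p) \<partial>lborel))"
    by (simp add: nn_integral_cmult nn_integral_add)
  also have "\<dots> \<le> ennreal (2 powr p) * (ennreal (B powr p) + ennreal (B powr p))"
    using b unfolding rbd_def by (intro mult_left_mono add_mono) auto
  also have "\<dots> = ennreal (2 powr p * (2 * B powr p))"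
    by (simp add: ennreal_mult flip: ennreal_plus)
  also have "\<dots> \<le> ennreal ((4 * B) powr p)"
  proof (rule ennreal_leI)
    have "(2::real) powr 1 \<le> 2 powr p" using p by (intro powr_mono) auto
    hence "2 powr p * (2 * B powr p) \<le> 2 powr p * (2 powr p * B powr p)" by (intro mult_left_mono mult_right_mono) auto
    also have "\<dots> = (2 * 2 * B) powr p" using B by (simp only: powr_mult)
    finally show "2 powr p * (2 * B powr p) \<le> (4 * B) powr p" by simp
  qed
  finally have X: "(\<integral>\<^sup>+x. ennreal (?v x) * ennreal (norm (H x) powr p) \<partial>lborel) \<le> ennreal ((4 * B) powr p)" .
  have "(\<integral>\<^sup>+x. ennreal (norm (H x) powr p) \<partial>radial_lborel x0) \<le> ennreal ((4 * B) powr p)"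
    using X by (subst nn_integral_radial_lborel) auto
  thus "Lp_norm (radial_lborel x0) (ennreal p) H \<le> ennreal (4 * B)" using p B by (subst Lp_norm_le_iff) auto
  have "(\<integral>\<^sup>+x. ennreal (norm (H x) powr p) \<partial>lborel) \<le> (\<integral>\<^sup>+x. ennreal (?v x) * ennreal (norm (H x) powr p) \<partial>lborel)"
  proof (rule nn_integral_mono)
    fix x
    show "ennreal (norm (H x) powr p) \<le> ennreal (?v x) * ennreal (norm (H x) powr p)"
    proof (cases "x \<in> pball")
      case True
      have "norm (x - x0) ^ CARD('n) \<le> 1" using pball_norm[OF True] by (intro power_le_one) auto
      hence "1 \<le> ?v x" using pball_norm[OF True] by (intro one_le_inverse) auto
      hence "1 * norm (H x) powr p \<le> ?v x * norm (H x) powr p" by (intro mult_right_mono) auto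
      thus ?thesis by (simp flip: ennreal_mult add: ennreal_leI)
    next
      case False
      thus ?thesis using H(2) p by simp
    qed
  qed
  also note X
  finally show "Lp_norm lborel (ennreal p) H \<le> ennreal (4 * B)" using p B by (subst Lp_norm_le_iff) auto
qed

lemma tf_carleman_rhs:
  assumes y: "tf R y"
  shows "tf R (\<lambda>x. norm (x - x0) ^ k * y x)"
  by (rule tf_cong[of R "\<lambda>x. wt (real k) 0 x * y x"])
    (use y tf_eq_0[OF y] in \<open>auto simp: carleman_weight(3)[unfolded dist_norm]\<close>)

text \<open>Links the right-hand side with the real theory: y is the real or imaginary part of Y and
  is dominated by its modulus, so both parts inherit the same bound.\<close>

lemma NN_le_Lp_norm:
  fixes Y :: "real ^ 'n \<Rightarrow> complex"
  assumes y: "tf R y" and Y: "\<And>x. \<bar>y x\<bar> \<le> norm (Y x)" "Y \<in> borel_measurable borel" and Phi: "\<Phi> > 0"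
    and le: "Lp_norm (radial_lborel x0) 2 (\<lambda>x. let r = dist x x0 in (exp (- \<tau> * carleman_phi r) * r ^ k) *\<^sub>R Y x) \<le> ennreal \<Phi>"
  shows "NN \<tau> 0 (\<lambda>x. norm (x - x0) ^ k * y x) \<le> \<Phi>\<^sup>2"
proof -
  note [measurable] = Y(2)
  define H where "H = (\<lambda>x. (exp (- \<tau> * carleman_phi (dist x x0)) * dist x x0 ^ k) *\<^sub>R Y x)"
  have [measurable]: "H \<in> borel_measurable borel" unfolding H_def carleman_phi_def by measurable
  define g where "g = (\<lambda>x. norm (x - x0) ^ k * y x)"
  have g: "tf R g" unfolding g_def by (rule tf_carleman_rhs[OF y])
  let ?f = "\<lambda>x. (wt (- \<tau>) (- (2 * \<tau> + 0)) x * g x)\<^sup>2"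
  have f: "tf R ?f" by (rule tf_NN[OF g])
  have "ennreal (NN \<tau> 0 g) = (\<integral>\<^sup>+x. ennreal (wt (- real CARD('n)) 0 x * ?f x) \<partial>lborel)"
    unfolding NN_def J_def by (rule nn_integral_eq_integral[OF J_integrable[OF f], symmetric]) (simp add: wt_nonneg)
  also have "\<dots> \<le> (\<integral>\<^sup>+x. ennreal (inverse (norm (x - x0) ^ CARD('n))) * ennreal (norm (H x) powr 2) \<partial>lborel)"
  proof (rule nn_integral_mono)
    fix x
    show "ennreal (wt (- real CARD('n)) 0 x * ?f x) \<le> ennreal (inverse (norm (x - x0) ^ CARD('n))) * ennreal (norm (H x) powr 2)"
    proof (cases "x \<in> pball")
      case True
      have "\<bar>wt (- \<tau>) (- (2 * \<tau> + 0)) x * g x\<bar> = wt (- \<tau>) (- (2 * \<tau>)) x * norm (x - x0) ^ k * \<bar>y x\<bar>"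
        unfolding g_def by (simp add: abs_mult wt_nonneg)
      also have "\<dots> \<le> wt (- \<tau>) (- (2 * \<tau>)) x * norm (x - x0) ^ k * norm (Y x)"
        by (intro mult_left_mono Y mult_nonneg_nonneg wt_nonneg) auto
      also have "\<dots> = norm (H x)" unfolding H_def carleman_weight(1)[OF True] by (simp add: abs_mult wt_nonneg dist_norm)
      finally have "?f x \<le> (norm (H x))\<^sup>2" by (simp add: abs_le_square_iff[symmetric])
      hence "wt (- real CARD('n)) 0 x * ?f x \<le> wt (- real CARD('n)) 0 x * (norm (H x))\<^sup>2" by (rule mult_left_mono) (rule wt_nonneg)
      thus ?thesis unfolding carleman_weight(4)[OF True]
        by (simp add: wt_nonneg powr_numeral ennreal_leI flip: ennreal_mult)
    next
      case False
      thus ?thesis using tf_eq_0[OF g False] by simp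
    qed
  qed
  also have "\<dots> = (\<integral>\<^sup>+x. ennreal (norm (H x) powr 2) \<partial>radial_lborel x0)" by (subst nn_integral_radial_lborel) auto
  also have "\<dots> \<le> ennreal (\<Phi> powr 2)"
    using le Phi Lp_norm_le_iff[of 2 \<Phi> "radial_lborel x0" H] unfolding Let_def H_def by simp
  finally show ?thesis unfolding g_def using Phi by (simp add: powr_numeral)
qed

definition carleman_lhs :: "real \<Rightarrow> nat \<Rightarrow> nat \<Rightarrow> (real ^ 'n \<Rightarrow> complex) \<Rightarrow> real ^ 'n \<Rightarrow> complex"
  where "carleman_lhs \<tau> m k u = (\<lambda>x. (exp (- \<tau> * carleman_phi (dist x x0)) * ln (dist x x0) powi (- int m) * dist x x0 ^ k) *\<^sub>R u x)"

lemma norm_carleman_lhs: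
  assumes "x \<in> pball"
  shows "norm (carleman_lhs \<tau> m k u x)
    \<le> \<bar>wt (- \<tau> + real k) (- (2 * \<tau> + real m)) x * Re (u x)\<bar> + \<bar>wt (- \<tau> + real k) (- (2 * \<tau> + real m)) x * Im (u x)\<bar>"
proof -
  have "norm (carleman_lhs \<tau> m k u x) = wt (- \<tau> + real k) (- (2 * \<tau> + real m)) x * norm (u x)"
    unfolding carleman_lhs_def norm_scaleR abs_mult carleman_weight[OF assms]
    using wt_mult[OF assms] by (simp add: wt_nonneg algebra_simps)
  also have "\<dots> \<le> wt (- \<tau> + real k) (- (2 * \<tau> + real m)) x * (\<bar>Re (u x)\<bar> + \<bar>Im (u x)\<bar>)"
    by (intro mult_left_mono cmod_le wt_nonneg)
  finally show ?thesis by (simp add: abs_mult wt_nonneg algebra_simps)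
qed

lemma carleman_lhs_measurable:
  assumes "u \<in> borel_measurable borel"
  shows "carleman_lhs \<tau> m k u \<in> borel_measurable borel"
proof -
  note [measurable] = assms
  have "carleman_lhs \<tau> m k u = (\<lambda>x. (exp (- \<tau> * carleman_phi (dist x x0)) * inverse (ln (dist x x0) ^ m) * dist x x0 ^ k) *\<^sub>R u x)"
    unfolding carleman_lhs_def by (simp add: power_int_minus)
  thus ?thesis unfolding carleman_phi_def by simp
qed

text \<open>\<open>N\<close> stands for the undifferentiated term on the left.\<close>

theorem carleman_complex:
  fixes m :: nat and N :: "real \<Rightarrow> (real ^ 'n \<Rightarrow> complex) \<Rightarrow> ennreal"
  assumes m: "m \<ge> 2" and se: "s + e \<le> 3 * real m / 2" and C0: "C0 > 0"
    and N: "\<And>\<tau> u A. u \<in> borel_measurable borel \<Longrightarrow> L2_bounds m (exp (- 100 * real m)) \<tau> (\<lambda>x. Re (u x)) A \<Longrightarrow>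
      L2_bounds m (exp (- 100 * real m)) \<tau> (\<lambda>x. Im (u x)) A \<Longrightarrow> N \<tau> u \<le> ennreal (C0 * \<tau> powr e * A)"
  shows "\<exists>C R0. 0 < C \<and> 0 < R0 \<and> R0 < 1 \<and>
        (\<forall>u :: real ^ 'n \<Rightarrow> complex. \<forall>\<tau>. u \<in> test_functions (ball x0 R0 - {x0}) \<and> \<tau> > 1 \<longrightarrow>
          ennreal (\<tau> powr s) * N \<tau> u
          + (\<Sum>\<alpha> | a \<le> multi_deg \<alpha> \<and> multi_deg \<alpha> \<le> 2 * m - 1.
              ennreal (\<tau> powr beta m (multi_deg \<alpha>))
              * Lp_norm (radial_lborel x0) 2
                  (\<lambda>x. let r = dist x x0 in
                    (exp (- \<tau> * carleman_phi r) * ln r powi (- int m) * r ^ multi_deg \<alpha>)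
                      *\<^sub>R multi_deriv \<alpha> u x))
          \<le> ennreal C * Lp_norm (radial_lborel x0) 2
              (\<lambda>x. let r = dist x x0 in
                (exp (- \<tau> * carleman_phi r) * r ^ (2 * m)) *\<^sub>R (laplacian ^^ m) u x))"
proof -
  define R where "R = exp (- 100 * real m)"
  have R: "0 < R" "R < 1" unfolding R_def using m by auto
  obtain C1 where C1: "C1 > 0" "\<And>\<tau> u \<Phi>. \<tau> > 1 \<Longrightarrow> tf R u \<Longrightarrow> \<Phi> > 0 \<Longrightarrow>
    NN \<tau> 0 (\<lambda>x. norm (x - x0) ^ (2 * m) * (laplacian ^^ m) u x) \<le> \<Phi>\<^sup>2 \<Longrightarrow>
    L2_bounds m R \<tau> u (C1 * \<tau> powr (- 3 * real m / 2) * \<Phi>)"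
    using L2_bounds_carleman[OF m] unfolding R_def by blast
  define \<A> where "\<A> = {\<alpha> :: 'n \<Rightarrow> nat. a \<le> multi_deg \<alpha> \<and> multi_deg \<alpha> \<le> 2 * m - 1}"
  define C where "C = C0 * C1 + real (card \<A>) * (4 * C1)"
  have C: "C > 0" unfolding C_def using C0 C1 by (intro add_pos_nonneg) auto
  show ?thesis
    unfolding \<A>_def[symmetric]
  proof (rule exI[of _ C], rule exI[of _ R], intro conjI allI impI C R)
    fix u :: "real ^ 'n \<Rightarrow> complex" and \<tau> :: real
    assume "u \<in> test_functions (ball x0 R - {x0}) \<and> \<tau> > 1"
    hence u: "u \<in> test_functions (ball x0 R - {x0})" and t: "\<tau> > 1" by auto
    define S where "S = ennreal (\<tau> powr s) * N \<tau> u + (\<Sum>\<alpha>\<in>\<A>. ennreal (\<tau> powr beta m (multi_deg \<alpha>))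
              * Lp_norm (radial_lborel x0) 2
                  (\<lambda>x. let r = dist x x0 in
                    (exp (- \<tau> * carleman_phi r) * ln r powi (- int m) * r ^ multi_deg \<alpha>)
                      *\<^sub>R multi_deriv \<alpha> u x))"
    define F where "F = Lp_norm (radial_lborel x0) 2
              (\<lambda>x. let r = dist x x0 in
                (exp (- \<tau> * carleman_phi r) * r ^ (2 * m)) *\<^sub>R (laplacian ^^ m) u x)"
    have us: "smooth_on UNIV u" by (rule test_functions_smooth[OF u])
    have um: "pdw w u \<in> borel_measurable borel" for w
      by (intro borel_measurable_continuous_onI smooth_on_continuous smooth_on_pdw us)
    have lm: "(laplacian ^^ m) u \<in> borel_measurable borel"
      by (intro borel_measurable_continuous_onI smooth_on_continuous smooth_on_laplacian_pow us)
    have tfu: "tf R (\<lambda>x. Re (u x))" "tf R (\<lambda>x. Im (u x))"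
      using tf_test_functions[OF bounded_linear_Re u] tf_test_functions[OF bounded_linear_Im u] R by auto
    have pd: "pdw w (\<lambda>x. Re (u x)) = (\<lambda>x. Re (pdw w u x))" "pdw w (\<lambda>x. Im (u x)) = (\<lambda>x. Im (pdw w u x))" for w
      by (rule pdw_bounded_linear[OF bounded_linear_Re us] pdw_bounded_linear[OF bounded_linear_Im us])+
    have lap: "(laplacian ^^ m) (\<lambda>x. Re (u x)) = (\<lambda>x. Re ((laplacian ^^ m) u x))"
      "(laplacian ^^ m) (\<lambda>x. Im (u x)) = (\<lambda>x. Im ((laplacian ^^ m) u x))"
      by (rule laplacian_pow_bounded_linear[OF bounded_linear_Re us] laplacian_pow_bounded_linear[OF bounded_linear_Im us])+
    \<comment> \<open>\<open>L2_bounds\<close> needs a positive A, so the estimate is proved for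
      every positive upper bound of F. A vanishing F is reached at the end by adding \<epsilon>/C,
      and an infinite F is trivial.\<close>
    have main: "S \<le> ennreal (C * \<Phi>)" if Phi: "\<Phi> > 0" "F \<le> ennreal \<Phi>" for \<Phi>
    proof -
      define A where "A = C1 * \<tau> powr (- 3 * real m / 2) * \<Phi>"
      have A: "A > 0" unfolding A_def using C1 t Phi by simp
      have L: "L2_bounds m R \<tau> (\<lambda>x. Re (u x)) A" "L2_bounds m R \<tau> (\<lambda>x. Im (u x)) A"
        unfolding A_def
      proof (rule C1(2)[OF t tfu(1) Phi(1)], goal_cases)
        case 1
        show ?case
          by (rule NN_le_Lp_norm[OF tf_laplacian_power[OF tfu(1)] _ lm Phi(1) Phi(2)[unfolded F_def]])
            (simp add: lap abs_Re_le_cmod)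
      next
        case 2
        show ?case
        proof (rule C1(2)[OF t tfu(2) Phi(1)])
          show "NN \<tau> 0 (\<lambda>x. norm (x - x0) ^ (2 * m) * (laplacian ^^ m) (\<lambda>x. Im (u x)) x) \<le> \<Phi>\<^sup>2"
            by (rule NN_le_Lp_norm[OF tf_laplacian_power[OF tfu(2)] _ lm Phi(1) Phi(2)[unfolded F_def]])
              (simp add: lap abs_Im_le_cmod)
        qed
      qed
      have 1: "ennreal (\<tau> powr s) * N \<tau> u \<le> ennreal (C0 * C1 * \<Phi>)"
      proof -
        have "ennreal (\<tau> powr s) * N \<tau> u \<le> ennreal (\<tau> powr s) * ennreal (C0 * \<tau> powr e * A)"
          using um[of "[]"] by (intro mult_left_mono N L[unfolded R_def]) auto
        also have "\<dots> = ennreal (\<tau> powr s * (C0 * \<tau> powr e * A))" using C0 A by (simp add: ennreal_mult)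
        also have "\<dots> \<le> ennreal (C0 * C1 * \<Phi>)"
        proof (rule ennreal_leI)
          have "\<tau> powr s * (C0 * \<tau> powr e * A) = C0 * C1 * \<Phi> * (\<tau> powr s * \<tau> powr e * \<tau> powr (- 3 * real m / 2))"
            unfolding A_def by (simp only: mult_ac)
          also have "\<tau> powr s * \<tau> powr e * \<tau> powr (- 3 * real m / 2) = \<tau> powr (s + e - 3 * real m / 2)"
            by (simp flip: powr_add)
          \<comment> \<open>The powers are the s on the left, the cost e of the norm, and the
            Carleman gain. Their sum is at most 0 by \<open>se\<close>, and \<tau> > 1.\<close>
          also have "C0 * C1 * \<Phi> * \<tau> powr (s + e - 3 * real m / 2) \<le> C0 * C1 * \<Phi> * \<tau> powr 0"
            using t se C0 C1 Phi by (intro mult_left_mono powr_mono) auto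
          finally show "\<tau> powr s * (C0 * \<tau> powr e * A) \<le> C0 * C1 * \<Phi>" using t by simp
        qed
        finally show ?thesis .
      qed
      have 2: "ennreal (\<tau> powr beta m (multi_deg \<alpha>))
              * Lp_norm (radial_lborel x0) 2
                  (\<lambda>x. let r = dist x x0 in
                    (exp (- \<tau> * carleman_phi r) * ln r powi (- int m) * r ^ multi_deg \<alpha>)
                      *\<^sub>R multi_deriv \<alpha> u x) \<le> ennreal (4 * C1 * \<Phi>)" if al: "\<alpha> \<in> \<A>" for \<alpha>
      proof -
        obtain w where w: "length w = multi_deg \<alpha>" "\<And>f :: real ^ 'n \<Rightarrow> complex. multi_deriv \<alpha> f = pdw w f"
          using multi_deriv_eq_pdw by blast
        have L2w: "rbd 2 (\<lambda>x. wt (- \<tau> + real (length w)) (- (2 * \<tau> + real m)) x * pdw w v x) (\<tau> ^ length w * A)"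
          if "L2_bounds m R \<tau> v A" "length w \<le> 2 * m" for v and w :: "'n list"
          using that unfolding L2_bounds_def by blast
        have lw: "length w \<le> 2 * m" using al w(1) unfolding \<A>_def by auto
        define k where "k = length w"
        have "Lp_norm (radial_lborel x0) (ennreal 2) (carleman_lhs \<tau> m k (pdw w u)) \<le> ennreal (4 * (\<tau> ^ k * A))"
        proof (rule rbd_Lp_norm(1)[where f="\<lambda>x. wt (- \<tau> + real k) (- (2 * \<tau> + real m)) x * Re (pdw w u x)"
              and g="\<lambda>x. wt (- \<tau> + real k) (- (2 * \<tau> + real m)) x * Im (pdw w u x)"])
          note [measurable] = um[of w]
          show "(\<lambda>x. wt (- \<tau> + real k) (- (2 * \<tau> + real m)) x * Re (pdw w u x)) \<in> borel_measurable borel"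
            "(\<lambda>x. wt (- \<tau> + real k) (- (2 * \<tau> + real m)) x * Im (pdw w u x)) \<in> borel_measurable borel"
            by measurable
          show "carleman_lhs \<tau> m k (pdw w u) \<in> borel_measurable borel" by (rule carleman_lhs_measurable[OF um])
          show "norm (carleman_lhs \<tau> m k (pdw w u) x) \<le> \<bar>wt (- \<tau> + real k) (- (2 * \<tau> + real m)) x * Re (pdw w u x)\<bar> +
              \<bar>wt (- \<tau> + real k) (- (2 * \<tau> + real m)) x * Im (pdw w u x)\<bar>" if "x \<in> pball" for x
            by (rule norm_carleman_lhs[OF that])
          show "carleman_lhs \<tau> m k (pdw w u) x = 0" if "x \<notin> pball" for x
          proof -
            have "Re (pdw w u x) = 0" "Im (pdw w u x) = 0"
              using tf_eq_0[OF tf_pdw[OF tfu(1)] that, of w] tf_eq_0[OF tf_pdw[OF tfu(2)] that, of w] unfolding pd by auto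
            hence "pdw w u x = 0" by (simp add: complex_eq_iff)
            thus ?thesis unfolding carleman_lhs_def by simp
          qed
          show "rbd 2 (\<lambda>x. wt (- \<tau> + real k) (- (2 * \<tau> + real m)) x * Re (pdw w u x)) (\<tau> ^ k * A)"
            "rbd 2 (\<lambda>x. wt (- \<tau> + real k) (- (2 * \<tau> + real m)) x * Im (pdw w u x)) (\<tau> ^ k * A)"
            using L2w[OF L(1) lw] L2w[OF L(2) lw] unfolding k_def pd by auto
        qed (use A t in auto)
        hence "ennreal (\<tau> powr beta m k) * Lp_norm (radial_lborel x0) 2 (carleman_lhs \<tau> m k (pdw w u))
          \<le> ennreal (\<tau> powr beta m k) * ennreal (4 * (\<tau> ^ k * A))" by (intro mult_left_mono) auto
        also have "\<dots> = ennreal (\<tau> powr beta m k * (4 * (\<tau> ^ k * A)))" using A t by (simp add: ennreal_mult)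
        \<comment> \<open>\<open>beta m k\<close> is exactly what the gain 3 m/2 leaves after k
          derivatives, so all powers of \<tau> cancel.\<close>
        also have "\<tau> powr beta m k * (4 * (\<tau> ^ k * A)) = 4 * C1 * \<Phi>"
        proof -
          have "\<tau> powr beta m k * (4 * (\<tau> ^ k * A)) = 4 * C1 * \<Phi> * (\<tau> powr beta m k * \<tau> powr real k * \<tau> powr (- 3 * real m / 2))"
            unfolding A_def using t by (simp add: powr_realpow)
          also have "\<tau> powr beta m k * \<tau> powr real k * \<tau> powr (- 3 * real m / 2) = \<tau> powr (beta m k + real k + - 3 * real m / 2)"
            by (simp only: powr_add)
          also have "beta m k + real k + - 3 * real m / 2 = 0" unfolding beta_def by (simp add: field_simps)
          finally show ?thesis using t by simp
        qed
        finally show ?thesis unfolding k_def w carleman_lhs_def Let_def .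
      qed
      have "S \<le> ennreal (C0 * C1 * \<Phi>) + (\<Sum>\<alpha>\<in>\<A>. ennreal (4 * C1 * \<Phi>))"
        unfolding S_def by (intro add_mono 1 sum_mono 2)
      also have "(\<Sum>\<alpha>\<in>\<A>. ennreal (4 * C1 * \<Phi>)) = ennreal (real (card \<A>) * (4 * C1 * \<Phi>))"
        using C1 Phi by (subst sum_ennreal) auto
      also have "ennreal (C0 * C1 * \<Phi>) + \<dots> = ennreal (C * \<Phi>)"
        unfolding C_def using C0 C1 Phi by (subst ennreal_plus[symmetric]) (auto simp: algebra_simps)
      finally show ?thesis .
    qed
    have "S \<le> ennreal C * F"
    proof (cases F rule: ennreal_cases)
      case (real \<Phi>)
      show ?thesis
      proof (rule ennreal_le_epsilon)
        fix \<epsilon> :: real assume "\<epsilon> > 0"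
        have "S \<le> ennreal (C * (\<Phi> + \<epsilon> / C))"
          by (rule main) (use real \<open>\<epsilon> > 0\<close> C in \<open>auto intro!: add_nonneg_pos ennreal_leI\<close>)
        also have "C * (\<Phi> + \<epsilon> / C) = C * \<Phi> + \<epsilon>" using C by (simp add: distrib_left)
        also have "ennreal (C * \<Phi> + \<epsilon>) = ennreal C * F + ennreal \<epsilon>" using C real \<open>\<epsilon> > 0\<close> by (simp add: ennreal_mult ennreal_plus)
        finally show "S \<le> ennreal C * F + ennreal \<epsilon>" .
      qed
    next
      case top
      thus ?thesis using C by (simp add: ennreal_mult_top)
    qed
    thus "ennreal (\<tau> powr s) * N \<tau> u + (\<Sum>\<alpha>\<in>\<A>. ennreal (\<tau> powr beta m (multi_deg \<alpha>))
              * Lp_norm (radial_lborel x0) 2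
                  (\<lambda>x. let r = dist x x0 in
                    (exp (- \<tau> * carleman_phi r) * ln r powi (- int m) * r ^ multi_deg \<alpha>)
                      *\<^sub>R multi_deriv \<alpha> u x))
      \<le> ennreal C * Lp_norm (radial_lborel x0) 2
              (\<lambda>x. let r = dist x x0 in
                (exp (- \<tau> * carleman_phi r) * r ^ (2 * m)) *\<^sub>R (laplacian ^^ m) u x)"
      unfolding S_def F_def .
  qed
qed

section \<open>The undifferentiated term in the three ranges of the dimension\<close>

lemma Lp_norm_from_rbd:
  assumes C: "C > 0" and p: "p \<ge> 1"
    and b: "\<And>\<tau> u A. L2_bounds m R \<tau> u A \<Longrightarrow> rbd p (\<lambda>x. wt (- \<tau>) (- (2 * \<tau> + real m)) x * u x) (C * \<tau> powr e * A)"
    and u: "u \<in> borel_measurable borel" "L2_bounds m R \<tau> (\<lambda>x. Re (u x)) A" "L2_bounds m R \<tau> (\<lambda>x. Im (u x)) A"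
  shows "Lp_norm (radial_lborel x0) (ennreal p) (carleman_lhs \<tau> m 0 u) \<le> ennreal (4 * C * \<tau> powr e * A)"
    "Lp_norm lborel (ennreal p) (carleman_lhs \<tau> m 0 u) \<le> ennreal (4 * C * \<tau> powr e * A)"
proof -
  note [measurable] = u(1)
  have t: "\<tau> > 1" "A > 0" "tf R (\<lambda>x. Re (u x))" "tf R (\<lambda>x. Im (u x))" using u unfolding L2_bounds_def by auto
  let ?f = "\<lambda>x. wt (- \<tau>) (- (2 * \<tau> + real m)) x * Re (u x)" and ?g = "\<lambda>x. wt (- \<tau>) (- (2 * \<tau> + real m)) x * Im (u x)"
  have fg: "?f \<in> borel_measurable borel" "?g \<in> borel_measurable borel" by measurable
  have le: "norm (carleman_lhs \<tau> m 0 u x) \<le> \<bar>?f x\<bar> + \<bar>?g x\<bar>" if "x \<in> pball" for x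
    using norm_carleman_lhs[OF that, of \<tau> m 0 u] by simp
  have z: "carleman_lhs \<tau> m 0 u x = 0" if "x \<notin> pball" for x
    using tf_eq_0[OF t(3) that] tf_eq_0[OF t(4) that] unfolding carleman_lhs_def by (simp add: complex_eq_iff)
  have B: "C * \<tau> powr e * A > 0" using C t by simp
  show "Lp_norm (radial_lborel x0) (ennreal p) (carleman_lhs \<tau> m 0 u) \<le> ennreal (4 * C * \<tau> powr e * A)"
    "Lp_norm lborel (ennreal p) (carleman_lhs \<tau> m 0 u) \<le> ennreal (4 * C * \<tau> powr e * A)"
    using rbd_Lp_norm[OF fg carleman_lhs_measurable[OF u(1)] le z b[OF u(2)] b[OF u(3)] p B] by (simp_all add: mult.assoc)
qed

lemma Lp_norm_infinity_from_sup:
  assumes b: "\<And>\<tau> u A x. L2_bounds m R \<tau> u A \<Longrightarrow> \<bar>wt (- \<tau>) (- (2 * \<tau> + real m)) x * u x\<bar> \<le> C * \<tau> ^ k * A"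
    and u: "u \<in> borel_measurable borel" "L2_bounds m R \<tau> (\<lambda>x. Re (u x)) A" "L2_bounds m R \<tau> (\<lambda>x. Im (u x)) A"
  shows "Lp_norm lborel \<infinity> (carleman_lhs \<tau> m 0 u) \<le> ennreal (2 * C * \<tau> powr real k * A)"
proof -
  have t: "\<tau> > 1" "A > 0" "tf R (\<lambda>x. Re (u x))" "tf R (\<lambda>x. Im (u x))" using u unfolding L2_bounds_def by auto
  have "norm (carleman_lhs \<tau> m 0 u x) \<le> 2 * C * \<tau> powr real k * A" for x
  proof (cases "x \<in> pball")
    case True
    show ?thesis using norm_carleman_lhs[OF True, of \<tau> m 0 u] b[OF u(2), of x] b[OF u(3), of x] t
      by (simp add: powr_realpow)
  next
    case False
    have "0 \<le> C * \<tau> ^ k * A" using b[OF u(2), of x] abs_ge_zero order_trans by blast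
    moreover have "u x = 0" using tf_eq_0[OF t(3) False] tf_eq_0[OF t(4) False] by (simp add: complex_eq_iff)
    ultimately show ?thesis using t unfolding carleman_lhs_def by (simp add: powr_realpow mult_ac)
  qed
  moreover have "carleman_lhs \<tau> m 0 u \<in> borel_measurable borel" by (rule carleman_lhs_measurable[OF u(1)])
  ultimately show ?thesis unfolding Lp_norm_def by (auto intro!: esssup_I ennreal_leI)
qed

text \<open>The upper end q = 2n/(n - 4m + 2) of the range of p is the Sobolev exponent after k = 2m
  - 1 steps. There k q/(q - 2) = n/2, so interpolating with exponent 2 costs \<tau> to the power n
  (p - 2)/(2 p).\<close>

lemma rbd_high_dim:
  fixes m :: nat and p :: real
  assumes R: "R \<le> exp (- 1)" and m: "m \<ge> 2" and n: "CARD('n) > 4 * m - 2"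
    and p: "2 \<le> p" "p \<le> 2 * real CARD('n) / (real CARD('n) - 4 * real m + 2)"
  shows "\<exists>C>0. \<forall>\<tau> u A. L2_bounds m R \<tau> u A \<longrightarrow>
    rbd p (\<lambda>x. wt (- \<tau>) (- (2 * \<tau> + real m)) x * u x) (C * \<tau> powr (real CARD('n) * (p - 2) / (2 * p)) * A)"
proof -
  define n where "n = real CARD('n)"
  define k where "k = real (2 * m - 1)"
  have k: "k = 2 * real m - 1" "k > 0" unfolding k_def using m by (auto simp: of_nat_diff)
  have "real (4 * m) < real (CARD('n) + 2)" using n m by (intro of_nat_less_iff[THEN iffD2]) linarith
  hence nk: "n > 2 * k" unfolding n_def k(1) by simp
  define q where "q = 2 * n / (n - 2 * k)"
  have pq: "p \<le> q" using p(2) unfolding q_def n_def[symmetric] k(1) by (simp add: algebra_simps)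
  have q2: "q - 2 = 4 * k / (n - 2 * k)" unfolding q_def using nk by (simp add: field_simps)
  hence "q - 2 > 0" using nk k by simp
  hence q: "q > 2" by simp
  have "sob m R q (2 * m - 1)"
  proof (rule sob_chain[OF R])
    show "CARD('n) \<ge> 3" using n m by linarith
    show "q \<ge> 2" using q by simp
    have "1 / q = 1/2 - k / n" unfolding q_def using nk k by (simp add: field_simps)
    thus "1 / q \<ge> 1/2 - real (2 * m - 1) / real CARD('n)" unfolding k_def n_def by simp
  qed
  hence "\<exists>C>0. \<forall>\<tau> u A. L2_bounds m R \<tau> u A \<longrightarrow>
    rbd p (\<lambda>x. wt (- \<tau>) (- (2 * \<tau> + real m)) x * u x) (C * \<tau> powr (k * q / (q - 2) * (p - 2) / p) * A)"
    unfolding k_def by (rule rbd_between) (use p(1) pq q in auto)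
  moreover have "k * q / (q - 2) = n / 2"
    unfolding q2 unfolding q_def using nk k by (simp add: field_simps)
  ultimately show ?thesis unfolding n_def by simp
qed

text \<open>With n = 2 (2m - 1) the chain reaches every finite exponent after 2m - 1 steps but not
  infinity. Interpolation towards q = 2 + p/\<epsilon> gives q/(q - 2) = 1 + 2 \<epsilon>/p, and the
  displayed power is the expansion of (2m - 1)(1 + 2 \<epsilon>/p)(1 - 2/p).\<close>

lemma rbd_critical_dim:
  fixes m :: nat and p \<epsilon> :: real
  assumes R: "R \<le> exp (- 1)" and m: "m \<ge> 2" and n: "CARD('n) = 4 * m - 2" and p: "2 \<le> p" and \<epsilon>: "0 < \<epsilon>" "\<epsilon> < 1"
  shows "\<exists>C>0. \<forall>\<tau> u A. L2_bounds m R \<tau> u A \<longrightarrow>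
    rbd p (\<lambda>x. wt (- \<tau>) (- (2 * \<tau> + real m)) x * u x)
      (C * \<tau> powr ((2 * real m - 1) * (1 - 2 / p + 2 * \<epsilon> / p - 4 * \<epsilon> / p\<^sup>2)) * A)"
proof -
  define k where "k = real (2 * m - 1)"
  have k: "k = 2 * real m - 1" "k > 0" unfolding k_def using m by (auto simp: of_nat_diff)
  have nk: "real CARD('n) = 2 * k" unfolding n k(1) using m by (simp add: of_nat_diff)
  define q where "q = 2 + p / \<epsilon>"
  have q: "q > 2" "p \<le> q"
  proof -
    have "p \<le> p / \<epsilon>" using p \<epsilon> by (simp add: field_simps)
    thus "q > 2" "p \<le> q" unfolding q_def using p by auto
  qed
  have "sob m R q (2 * m - 1)"
  proof (rule sob_chain[OF R])
    show "CARD('n) \<ge> 3" using n m by linarith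
    show "q \<ge> 2" using q by simp
    show "1 / q \<ge> 1/2 - real (2 * m - 1) / real CARD('n)" unfolding nk k_def[symmetric] using q k(2) by simp
  qed
  hence "\<exists>C>0. \<forall>\<tau> u A. L2_bounds m R \<tau> u A \<longrightarrow>
    rbd p (\<lambda>x. wt (- \<tau>) (- (2 * \<tau> + real m)) x * u x) (C * \<tau> powr (k * q / (q - 2) * (p - 2) / p) * A)"
    unfolding k_def by (rule rbd_between) (use p(1) q in auto)
  moreover have "k * q / (q - 2) * (p - 2) / p = k * (1 - 2 / p + 2 * \<epsilon> / p - 4 * \<epsilon> / p\<^sup>2)"
  proof -
    have "q / (q - 2) = (2 * \<epsilon> + p) / p" unfolding q_def using p \<epsilon> by (simp add: field_simps)
    moreover have "(2 * \<epsilon> + p) / p * ((p - 2) / p) = 1 - 2 / p + 2 * \<epsilon> / p - 4 * \<epsilon> / p\<^sup>2"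
      using p by (simp add: field_simps power2_eq_square)
    ultimately show ?thesis by (metis (no_types, lifting) mult.assoc times_divide_eq_right)
  qed
  ultimately show ?thesis unfolding k(1) by simp
qed

text \<open>The same interpolation with the endpoint infinity, available here from
  \<open>sup_bound_low_dim\<close>; the power of \<tau> is the cost 2m - 1 of the supremum times the
  share (p - 2)/p.\<close>

lemma rbd_low_dim:
  fixes m :: nat and p :: real
  assumes R: "R \<le> exp (- 1)" and m: "m \<ge> 2" and n: "CARD('n) \<ge> 2" "CARD('n) < 4 * m - 2" and p: "2 \<le> p"
  shows "\<exists>C>0. \<forall>\<tau> u A. L2_bounds m R \<tau> u A \<longrightarrow>
    rbd p (\<lambda>x. wt (- \<tau>) (- (2 * \<tau> + real m)) x * u x) (C * \<tau> powr ((2 * real m - 1) * (1 - 2 / p)) * A)"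
proof -
  define k where "k = 2 * m - 1"
  have k: "real k = 2 * real m - 1" unfolding k_def using m by (simp add: of_nat_diff)
  obtain C where C: "C > 0" "\<And>\<tau> u A x. L2_bounds m R \<tau> u A \<Longrightarrow>
      \<bar>wt (- \<tau>) (- (2 * \<tau> + real m)) x * u x\<bar> \<le> C * \<tau> ^ k * A"
    using sup_bound_low_dim[OF R m n] unfolding k_def by blast
  show ?thesis
  proof (intro exI[of _ "C powr ((p - 2) / p)"] conjI allI impI)
    show "0 < C powr ((p - 2) / p)" using C by simp
    fix \<tau> u A
    assume L: "L2_bounds m R \<tau> u A"
    have t: "\<tau> > 1" "A > 0" "tf R u" using L unfolding L2_bounds_def by auto
    note [measurable] = tf_measurable[OF t(3)]
    define f where "f = (\<lambda>x. wt (- \<tau>) (- (2 * \<tau> + real m)) x * u x)"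
    have b0: "rbd 2 f A"
    proof -
      have "\<forall>w. length w \<le> 2 * m \<longrightarrow>
        rbd 2 (\<lambda>x. wt (- \<tau> + real (length w)) (- (2 * \<tau> + real m)) x * pdw w u x) (\<tau> ^ length w * A)"
        using L unfolding L2_bounds_def by blast
      from this[rule_format, of "[]"] show ?thesis unfolding f_def by simp
    qed
    have "rbd p f ((C * \<tau> ^ k * A) powr ((p - 2) / p) * A powr (2 / p))"
    proof (rule rbd_below_sup[OF _ p])
      show "f \<in> borel_measurable borel" unfolding f_def by measurable
      show "\<bar>f x\<bar> \<le> C * \<tau> ^ k * A" for x unfolding f_def by (rule C(2)[OF L])
    qed (use C t b0 in auto)
    also have "(C * \<tau> ^ k * A) powr ((p - 2) / p) * A powr (2 / p)
      = C powr ((p - 2) / p) * (\<tau> ^ k) powr ((p - 2) / p) * (A powr ((p - 2) / p) * A powr (2 / p))"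
      by (simp only: powr_mult mult_ac)
    also have "A powr ((p - 2) / p) * A powr (2 / p) = A"
    proof -
      have "(p - 2) / p + 2 / p = 1" using p by (simp add: field_simps)
      thus ?thesis using t(2) by (simp flip: powr_add)
    qed
    also have "(\<tau> ^ k) powr ((p - 2) / p) = \<tau> powr ((2 * real m - 1) * (1 - 2 / p))"
    proof -
      have "(p - 2) / p = 1 - 2 / p" using p by (simp add: field_simps)
      moreover have "\<tau> ^ k = \<tau> powr real k" using t by (simp only: powr_realpow)
      ultimately show ?thesis by (simp only: powr_powr k)
    qed
    finally show "rbd p (\<lambda>x. wt (- \<tau>) (- (2 * \<tau> + real m)) x * u x)
        (C powr ((p - 2) / p) * \<tau> powr ((2 * real m - 1) * (1 - 2 / p)) * A)"
      unfolding f_def .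
  qed
qed

end

text \<open>In all three ranges the exponent of \<tau> before the undifferentiated term is what
  remains of 3 m/2 after the interpolation cost. The balance is exact in the first and third range;
  in the critical dimension it leaves the slack (2m - 1) 4 \<epsilon>/p^2.\<close>

theorem theorem3:
  fixes x0 :: "real ^ 'n" and m :: nat
  assumes "CARD('n) \<ge> 2" and "m \<ge> 2"
  shows
    "(CARD('n) > 4 * m - 2 \<longrightarrow>
      (\<forall>p::real. 2 \<le> p \<and> p \<le> 2 * real CARD('n) / (real CARD('n) - 4 * real m + 2) \<longrightarrow>
      (\<exists>C R0. 0 < C \<and> 0 < R0 \<and> R0 < 1 \<and>
        (\<forall>u :: real ^ 'n \<Rightarrow> complex. \<forall>\<tau>. u \<in> test_functions (ball x0 R0 - {x0}) \<and> \<tau> > 1 \<longrightarrow>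
          ennreal (\<tau> powr ((3 * real m * p - real CARD('n) * (p - 2)) / (2 * p)))
            * Lp_norm (radial_lborel x0) (ennreal p)
                (\<lambda>x. let r = dist x x0 in
                  (exp (- \<tau> * carleman_phi r) * ln r powi (- int m)) *\<^sub>R u x)
          + (\<Sum>\<alpha> | 1 \<le> multi_deg \<alpha> \<and> multi_deg \<alpha> \<le> 2 * m - 1.
              ennreal (\<tau> powr beta m (multi_deg \<alpha>))
              * Lp_norm (radial_lborel x0) 2
                  (\<lambda>x. let r = dist x x0 in
                    (exp (- \<tau> * carleman_phi r) * ln r powi (- int m) * r ^ multi_deg \<alpha>)
                      *\<^sub>R multi_deriv \<alpha> u x))
          \<le> ennreal C * Lp_norm (radial_lborel x0) 2
              (\<lambda>x. let r = dist x x0 in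
                (exp (- \<tau> * carleman_phi r) * r ^ (2 * m)) *\<^sub>R (laplacian ^^ m) u x)))))
    \<and>
    (CARD('n) = 4 * m - 2 \<longrightarrow>
      (\<forall>p::real. 2 \<le> p \<longrightarrow>
      (\<exists>\<epsilon>0. 0 < \<epsilon>0 \<and> \<epsilon>0 < 1 \<and> (\<forall>\<epsilon>. 0 < \<epsilon> \<and> \<epsilon> < \<epsilon>0 \<longrightarrow>
      (\<exists>C R0. 0 < C \<and> 0 < R0 \<and> R0 < 1 \<and>
        (\<forall>u :: real ^ 'n \<Rightarrow> complex. \<forall>\<tau>. u \<in> test_functions (ball x0 R0 - {x0}) \<and> \<tau> > 1 \<longrightarrow>
          ennreal (\<tau> powr ((4 * real m - 2) / p * (1 - \<epsilon>) - (real m - 2) / 2))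
            * Lp_norm lborel (ennreal p)
                (\<lambda>x. let r = dist x x0 in
                  (exp (- \<tau> * carleman_phi r) * ln r powi (- int m)) *\<^sub>R u x)
          + (\<Sum>\<alpha> | 0 \<le> multi_deg \<alpha> \<and> multi_deg \<alpha> \<le> 2 * m - 1.
              ennreal (\<tau> powr beta m (multi_deg \<alpha>))
              * Lp_norm (radial_lborel x0) 2
                  (\<lambda>x. let r = dist x x0 in
                    (exp (- \<tau> * carleman_phi r) * ln r powi (- int m) * r ^ multi_deg \<alpha>)
                      *\<^sub>R multi_deriv \<alpha> u x))
          \<le> ennreal C * Lp_norm (radial_lborel x0) 2
              (\<lambda>x. let r = dist x x0 in
                (exp (- \<tau> * carleman_phi r) * r ^ (2 * m)) *\<^sub>R (laplacian ^^ m) u x)))))))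
    \<and>
    (CARD('n) < 4 * m - 2 \<longrightarrow>
      (\<forall>p::ennreal. 2 \<le> p \<longrightarrow>
      (\<exists>C R0. 0 < C \<and> 0 < R0 \<and> R0 < 1 \<and>
        (\<forall>u :: real ^ 'n \<Rightarrow> complex. \<forall>\<tau>. u \<in> test_functions (ball x0 R0 - {x0}) \<and> \<tau> > 1 \<longrightarrow>
          ennreal (\<tau> powr ((4 * real m - 2) * enn2real (1 / p) - (real m - 2) / 2))
            * Lp_norm lborel p
                (\<lambda>x. let r = dist x x0 in
                  (exp (- \<tau> * carleman_phi r) * ln r powi (- int m)) *\<^sub>R u x)
          + (\<Sum>\<alpha> | 0 \<le> multi_deg \<alpha> \<and> multi_deg \<alpha> \<le> 2 * m - 1.
              ennreal (\<tau> powr beta m (multi_deg \<alpha>))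
              * Lp_norm (radial_lborel x0) 2
                  (\<lambda>x. let r = dist x x0 in
                    (exp (- \<tau> * carleman_phi r) * ln r powi (- int m) * r ^ multi_deg \<alpha>)
                      *\<^sub>R multi_deriv \<alpha> u x))
          \<le> ennreal C * Lp_norm (radial_lborel x0) 2
              (\<lambda>x. let r = dist x x0 in
                (exp (- \<tau> * carleman_phi r) * r ^ (2 * m)) *\<^sub>R (laplacian ^^ m) u x)))))"
proof -
  interpret punctured_space x0 .
  note n = assms(1) and m = assms(2)
  let ?R = "exp (- 100 * real m)"
  have R: "?R \<le> exp (- 1)" using m by simp
  have lhs: "carleman_lhs \<tau> m 0 u = (\<lambda>x. let r = dist x x0 in (exp (- \<tau> * carleman_phi r) * ln r powi (- int m)) *\<^sub>R u x)" for \<tau> u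
    unfolding carleman_lhs_def Let_def by simp
  show ?thesis
  proof (intro conjI impI allI, goal_cases)
    case (1 p)
    hence p: "2 \<le> p" "p \<le> 2 * real CARD('n) / (real CARD('n) - 4 * real m + 2)" by auto
    let ?e = "real CARD('n) * (p - 2) / (2 * p)"
    obtain C where C: "C > 0" "\<And>\<tau> u A. L2_bounds m ?R \<tau> u A \<Longrightarrow>
        rbd p (\<lambda>x. wt (- \<tau>) (- (2 * \<tau> + real m)) x * u x) (C * \<tau> powr ?e * A)"
      using rbd_high_dim[OF R m 1(1) p] by blast
    have N: "Lp_norm (radial_lborel x0) (ennreal p) (carleman_lhs \<tau> m 0 u) \<le> ennreal (4 * C * \<tau> powr ?e * A)"
      if "u \<in> borel_measurable borel" "L2_bounds m ?R \<tau> (\<lambda>x. Re (u x)) A" "L2_bounds m ?R \<tau> (\<lambda>x. Im (u x)) A" for \<tau> u A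
      using p(1) by (intro Lp_norm_from_rbd(1)[OF C(1) _ C(2) that]) auto
    have se: "(3 * real m * p - real CARD('n) * (p - 2)) / (2 * p) + ?e \<le> 3 * real m / 2"
      using p(1) by (simp add: field_simps)
    show ?case
      using carleman_complex[where a=1 and N="\<lambda>\<tau> u. Lp_norm (radial_lborel x0) (ennreal p) (carleman_lhs \<tau> m 0 u)", OF m se _ N] C(1)
      unfolding lhs by simp
  next
    case (2 p)
    show ?case
    \<comment> \<open>A concrete threshold below 1; \<open>rbd_critical_dim\<close> works for every
      \<epsilon> between 0 and 1.\<close>
    proof (rule exI[of _ "1/2"], intro conjI allI impI)
      fix \<epsilon> :: real
      assume "0 < \<epsilon> \<and> \<epsilon> < 1/2"
      hence \<epsilon>: "0 < \<epsilon>" "\<epsilon> < 1" by auto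
      let ?e = "(2 * real m - 1) * (1 - 2 / p + 2 * \<epsilon> / p - 4 * \<epsilon> / p\<^sup>2)"
      obtain C where C: "C > 0" "\<And>\<tau> u A. L2_bounds m ?R \<tau> u A \<Longrightarrow>
          rbd p (\<lambda>x. wt (- \<tau>) (- (2 * \<tau> + real m)) x * u x) (C * \<tau> powr ?e * A)"
        using rbd_critical_dim[OF R m 2 \<epsilon>] by blast
      have N: "Lp_norm lborel (ennreal p) (carleman_lhs \<tau> m 0 u) \<le> ennreal (4 * C * \<tau> powr ?e * A)"
        if "u \<in> borel_measurable borel" "L2_bounds m ?R \<tau> (\<lambda>x. Re (u x)) A" "L2_bounds m ?R \<tau> (\<lambda>x. Im (u x)) A" for \<tau> u A
        using 2(2) by (intro Lp_norm_from_rbd(2)[OF C(1) _ C(2) that]) auto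
      have se: "(4 * real m - 2) / p * (1 - \<epsilon>) - (real m - 2) / 2 + ?e \<le> 3 * real m / 2"
      proof -
        have "(4 * real m - 2) / p * (1 - \<epsilon>) - (real m - 2) / 2 + ?e = 3 * real m / 2 - (2 * real m - 1) * (4 * \<epsilon> / p\<^sup>2)"
          by (simp add: algebra_simps diff_divide_distrib add_divide_distrib)
        also have "\<dots> \<le> 3 * real m / 2"
          using mult_nonneg_nonneg[of "2 * real m - 1" "4 * \<epsilon> / p\<^sup>2"] m \<epsilon> by simp
        finally show ?thesis .
      qed
      show "\<exists>C R0. 0 < C \<and> 0 < R0 \<and> R0 < 1 \<and>
        (\<forall>u :: real ^ 'n \<Rightarrow> complex. \<forall>\<tau>. u \<in> test_functions (ball x0 R0 - {x0}) \<and> \<tau> > 1 \<longrightarrow>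
          ennreal (\<tau> powr ((4 * real m - 2) / p * (1 - \<epsilon>) - (real m - 2) / 2))
            * Lp_norm lborel (ennreal p)
                (\<lambda>x. let r = dist x x0 in
                  (exp (- \<tau> * carleman_phi r) * ln r powi (- int m)) *\<^sub>R u x)
          + (\<Sum>\<alpha> | 0 \<le> multi_deg \<alpha> \<and> multi_deg \<alpha> \<le> 2 * m - 1.
              ennreal (\<tau> powr beta m (multi_deg \<alpha>))
              * Lp_norm (radial_lborel x0) 2
                  (\<lambda>x. let r = dist x x0 in
                    (exp (- \<tau> * carleman_phi r) * ln r powi (- int m) * r ^ multi_deg \<alpha>)
                      *\<^sub>R multi_deriv \<alpha> u x))
          \<le> ennreal C * Lp_norm (radial_lborel x0) 2
              (\<lambda>x. let r = dist x x0 in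
                (exp (- \<tau> * carleman_phi r) * r ^ (2 * m)) *\<^sub>R (laplacian ^^ m) u x))"
        using carleman_complex[where a=0 and N="\<lambda>\<tau> u. Lp_norm lborel (ennreal p) (carleman_lhs \<tau> m 0 u)", OF m se _ N] C(1)
        unfolding lhs by simp
    qed auto
  next
    case (3 P)
    show ?case
    proof (cases P rule: ennreal_cases)
      case (real p)
      have p: "2 \<le> p"
      proof -
        have "ennreal 2 \<le> ennreal p" using 3(2) real by simp
        thus ?thesis using real(1) by (subst (asm) ennreal_le_iff) auto
      qed
      have P: "enn2real (1 / P) = 1 / p"
        unfolding real(2) using p divide_ennreal[of 1 p] by simp
      let ?e = "(2 * real m - 1) * (1 - 2 / p)"
      obtain C where C: "C > 0" "\<And>\<tau> u A. L2_bounds m ?R \<tau> u A \<Longrightarrow>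
          rbd p (\<lambda>x. wt (- \<tau>) (- (2 * \<tau> + real m)) x * u x) (C * \<tau> powr ?e * A)"
        using rbd_low_dim[OF R m n 3(1) p] by blast
      have N: "Lp_norm lborel P (carleman_lhs \<tau> m 0 u) \<le> ennreal (4 * C * \<tau> powr ?e * A)"
        if "u \<in> borel_measurable borel" "L2_bounds m ?R \<tau> (\<lambda>x. Re (u x)) A" "L2_bounds m ?R \<tau> (\<lambda>x. Im (u x)) A" for \<tau> u A
        unfolding real(2) using p by (intro Lp_norm_from_rbd(2)[OF C(1) _ C(2) that]) auto
      have se: "(4 * real m - 2) * enn2real (1 / P) - (real m - 2) / 2 + ?e \<le> 3 * real m / 2"
        unfolding P by (simp add: algebra_simps diff_divide_distrib add_divide_distrib)
      show ?thesis
        using carleman_complex[where a=0 and N="\<lambda>\<tau> u. Lp_norm lborel P (carleman_lhs \<tau> m 0 u)", OF m se _ N] C(1)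
        unfolding lhs by simp
    next
      case top
      obtain C where C: "C > 0" "\<And>\<tau> u A x. L2_bounds m ?R \<tau> u A \<Longrightarrow>
          \<bar>wt (- \<tau>) (- (2 * \<tau> + real m)) x * u x\<bar> \<le> C * \<tau> ^ (2 * m - 1) * A"
        using sup_bound_low_dim[OF R m n 3(1)] by blast
      let ?e = "real (2 * m - 1)"
      have N: "Lp_norm lborel P (carleman_lhs \<tau> m 0 u) \<le> ennreal (2 * C * \<tau> powr ?e * A)"
        if "u \<in> borel_measurable borel" "L2_bounds m ?R \<tau> (\<lambda>x. Re (u x)) A" "L2_bounds m ?R \<tau> (\<lambda>x. Im (u x)) A" for \<tau> u A
        unfolding top infinity_ennreal_def[symmetric] by (rule Lp_norm_infinity_from_sup[OF _ that]) (rule C(2))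
      \<comment> \<open>For infinite p the reciprocal is 0, and -(m - 2)/2 + 2m - 1 = 3m/2
        exactly.\<close>
      have se: "(4 * real m - 2) * enn2real (1 / P) - (real m - 2) / 2 + ?e \<le> 3 * real m / 2"
        unfolding top using m by (simp add: of_nat_diff field_simps)
      show ?thesis
        using carleman_complex[where a=0 and N="\<lambda>\<tau> u. Lp_norm lborel P (carleman_lhs \<tau> m 0 u)", OF m se _ N] C(1)
        unfolding lhs by simp
    qed
  qed
qed

end
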